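(* Let $N\ge3$ be an arbitrary integer, $\tau>0$, and suppose that the critical value $\mu_c=\mu_c(\tau)=(1+\tau^2)^{-1/2}$ is such that the dispersion equation $n^2+\tau^2m^2=\mu_c^{-2}n^4$ has, among pairs of positive integers in the disc $m^2+n^2\le N^2$, only the solution $(n,m)=(1,1)$. Then approximate 3-dimensional diamond waves are given by $$U^{(N)}_\varepsilon=(\psi,\eta)^{(N)}_\varepsilon=\sum_{1\le p\le N}\varepsilon^pU^{(p)}\in\mathbb H^k_{(S)}\ \text{ for any }k,$$ $$U^{(1)}=\Big(\sin x_1\cos\tau x_2,\ -\frac1{\mu_c}\cos x_1\cos\tau x_2\Big),\qquad \mu^{(N)}_\varepsilon=\mu_c+\tilde\mu,\quad \tilde\mu=\mu_1\varepsilon^2+O(\varepsilon^4),$$ where $$\mu_1=\frac1{4\mu_c^3}-\frac1{2\mu_c^2}-\frac3{4\mu_c}+2+\frac{\mu_c}{2}-\frac{9}{4(2-\mu_c)},$$ and where, for any $k$, $\mathcal F(U^{(N)}_\varepsilon,\mu^{(N)}_\varepsilon,\mathbf u_0)=\varepsilon^{N+1}Q_\varepsilon$ with $Q_\varepsilon$ uniformly bounded in $\mathbb H^k_{(S)}$ with respect to $\varepsilon$. Moreover there is one critical value $\tau_c$ of $\tau$ such that $\mu_1(\tau_c)=0$, and $\mu_1(\tau)<0$ for $\tau<\tau_c$, $\mu_1(\tau)>0$ for $\tau>\tau_c$.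
   Context: For $\tau>0$ let $\Gamma'\subset\mathbb R^2$ be the lattice generated by $(1,\tau)$ and $(1,-\tau)$ and $\Gamma$ the dual lattice of periods ($\lambda\cdot K\in2\pi\mathbb Z$ for $\lambda\in\Gamma$, $K\in\Gamma'$). $H^m(\mathbb R^2/\Gamma)$ is the Sobolev space of $\Gamma$-periodic functions of $X=(x_1,x_2)$, $H^m_0$ its subspace of zero-average functions, $\mathbb H^m=H^m_0\times H^m$. $\mathbb H^m_{(S)}$ is the set of $U=(\psi,\eta)\in\mathbb H^m$ with $\psi$ odd in $x_1$, even in $x_2$, and $\eta$ even in $x_1$ and in $x_2$. Dirichlet-Neumann operator: $\mathcal G_\eta\psi=\big(\partial_{x_3}\varphi-\nabla_X\eta\cdot\nabla_X\varphi\big)|_{x_3=\eta(X)}$, where $\varphi$ is $\Gamma$-periodic in $X$, harmonic in $x_3<\eta(X)$, $\varphi=\psi$ on $x_3=\eta(X)$, $\nabla\varphi\to0$ as $x_3\to-\infty$. $\mathcal F=(\mathcal F_1,\mathcal F_2)$ with $\mathcal F_1(U,\mu,\mathbf u)=\mathcal G_\eta(\psi)-\mathbf u\cdot\nabla_X\eta$ and $\mathcal F_2(U,\mu,\mathbf u)=\mathbf u\cdot\nabla_X\psi+\mu\eta+\frac{(\nabla_X\psi)^2}{2}-\frac{1}{2(1+(\nabla_X\eta)^2)}\{\nabla_X\eta\cdot(\nabla_X\psi+\mathbf u)\}^2$; $\mathbf u_0=(1,0)$. *)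

theory Defs
  imports "HOL-Analysis.Analysis" "HOL-Library.Landau_Symbols"
begin

type_synonym plane = "real \<times> real"

text \<open>The derivative is taken relative to \<open>S\<close>, so that for a closed domain with nonempty
  interior and smooth boundary this is the one-sided gradient at boundary points.\<close>

definition gradient_within :: "('a::euclidean_space \<Rightarrow> real) \<Rightarrow> 'a set \<Rightarrow> 'a \<Rightarrow> 'a" where
  "gradient_within f S x = (\<Sum>b\<in>Basis. frechet_derivative f (at x within S) b *\<^sub>R b)"

abbreviation gradient :: "('a::euclidean_space \<Rightarrow> real) \<Rightarrow> 'a \<Rightarrow> 'a" where
  "gradient f \<equiv> gradient_within f UNIV"

definition C1_on :: "('a::euclidean_space \<Rightarrow> real) \<Rightarrow> 'a set \<Rightarrow> bool" where
  "C1_on f S \<longleftrightarrow> f differentiable_on S \<and> continuous_on S (gradient_within f S)"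

definition partial :: "'a::euclidean_space \<Rightarrow> ('a \<Rightarrow> real) \<Rightarrow> 'a \<Rightarrow> real" where
  "partial b f x = gradient f x \<bullet> b"

text \<open>To be used for open \<open>S\<close>.\<close>

definition harmonic_on :: "('a::euclidean_space \<Rightarrow> real) \<Rightarrow> 'a set \<Rightarrow> bool" where
  "harmonic_on f S \<longleftrightarrow> C1_on f S \<and> (\<forall>b\<in>Basis. C1_on (partial b f) S) \<and>
     (\<forall>x\<in>S. (\<Sum>b\<in>Basis. partial b (partial b f) x) = 0)"

definition wave_lattice :: "real \<Rightarrow> plane set" where
  "wave_lattice \<tau> = {of_int a *\<^sub>R (1, \<tau>) + of_int b *\<^sub>R (1, - \<tau>) | a b :: int. True}"

definition period_lattice :: "real \<Rightarrow> plane set" where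
  "period_lattice \<tau> = {l. \<forall>K \<in> wave_lattice \<tau>. \<exists>j::int. l \<bullet> K = 2 * pi * of_int j}"

text \<open>The period lattice is generated by \<open>(\<pi>, \<pi>/\<tau>)\<close> and \<open>(2\<pi>, 0)\<close>, so this rectangle is
  (up to a null set) a fundamental domain for it; its area is \<open>2\<pi>\<^sup>2/\<tau>\<close>.\<close>

definition period_cell :: "real \<Rightarrow> plane set" where
  "period_cell \<tau> = {0..2 * pi} \<times> {0..pi / \<tau>}"

definition periodic :: "real \<Rightarrow> (plane \<Rightarrow> real) \<Rightarrow> bool" where
  "periodic \<tau> u \<longleftrightarrow> (\<forall>l \<in> period_lattice \<tau>. \<forall>X. u (X + l) = u X)"

definition fourier_coeff :: "real \<Rightarrow> (plane \<Rightarrow> real) \<Rightarrow> plane \<Rightarrow> complex" where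
  "fourier_coeff \<tau> u K =
     (LINT X : period_cell \<tau> | lebesgue. of_real (u X) * cis (- (K \<bullet> X))) /
       of_real (measure lebesgue (period_cell \<tau>))"

text \<open>Elements are genuine functions, not classes of functions modulo null sets.\<close>

definition sobolev :: "real \<Rightarrow> nat \<Rightarrow> (plane \<Rightarrow> real) set" where
  "sobolev \<tau> m = {u. periodic \<tau> u \<and> u \<in> borel_measurable lebesgue \<and>
     set_integrable lebesgue (period_cell \<tau>) (\<lambda>X. (u X)\<^sup>2) \<and>
     (\<lambda>K. (1 + (norm K)\<^sup>2) ^ m * (cmod (fourier_coeff \<tau> u K))\<^sup>2) summable_on wave_lattice \<tau>}"

definition sobolev_norm :: "real \<Rightarrow> nat \<Rightarrow> (plane \<Rightarrow> real) \<Rightarrow> real" where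
  "sobolev_norm \<tau> m u = sqrt
     (\<Sum>\<^sub>\<infinity>K\<in>wave_lattice \<tau>. (1 + (norm K)\<^sup>2) ^ m * (cmod (fourier_coeff \<tau> u K))\<^sup>2)"

definition sobolev0 :: "real \<Rightarrow> nat \<Rightarrow> (plane \<Rightarrow> real) set" where
  "sobolev0 \<tau> m = {u \<in> sobolev \<tau> m. (LINT X : period_cell \<tau> | lebesgue. u X) = 0}"

type_synonym wave = "(plane \<Rightarrow> real) \<times> (plane \<Rightarrow> real)"

definition HH :: "real \<Rightarrow> nat \<Rightarrow> wave set" where
  "HH \<tau> m = sobolev0 \<tau> m \<times> sobolev \<tau> m"

definition HH_S :: "real \<Rightarrow> nat \<Rightarrow> wave set" where
  "HH_S \<tau> m = {(\<psi>, \<eta>) \<in> HH \<tau> m. \<forall>x y.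
     \<psi> (- x, y) = - \<psi> (x, y) \<and> \<psi> (x, - y) = \<psi> (x, y) \<and>
     \<eta> (- x, y) = \<eta> (x, y) \<and> \<eta> (x, - y) = \<eta> (x, y)}"

definition HH_norm :: "real \<Rightarrow> nat \<Rightarrow> wave \<Rightarrow> real" where
  "HH_norm \<tau> m U = sqrt ((sobolev_norm \<tau> m (fst U))\<^sup>2 + (sobolev_norm \<tau> m (snd U))\<^sup>2)"

definition fluid :: "(plane \<Rightarrow> real) \<Rightarrow> (plane \<times> real) set" where
  "fluid \<eta> = {(X, z). z < \<eta> X}"

definition closed_fluid :: "(plane \<Rightarrow> real) \<Rightarrow> (plane \<times> real) set" where
  "closed_fluid \<eta> = {(X, z). z \<le> \<eta> X}"

text \<open>The potential is a classical solution, \<open>C\<^sup>1\<close> up to the surface so that its gradient has a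
  trace there; its values above the surface are irrelevant. The decay at infinite depth is uniform
  in the horizontal variable.\<close>

definition is_potential :: "real \<Rightarrow> (plane \<Rightarrow> real) \<Rightarrow> (plane \<Rightarrow> real) \<Rightarrow> (plane \<times> real \<Rightarrow> real) \<Rightarrow> bool"
  where
  "is_potential \<tau> \<eta> \<psi> \<phi> \<longleftrightarrow>
     (\<forall>l \<in> period_lattice \<tau>. \<forall>(X, z) \<in> closed_fluid \<eta>. \<phi> (X + l, z) = \<phi> (X, z)) \<and>
     C1_on \<phi> (closed_fluid \<eta>) \<and>
     harmonic_on \<phi> (fluid \<eta>) \<and>
     (\<forall>X. \<phi> (X, \<eta> X) = \<psi> X) \<and>
     uniform_limit UNIV (\<lambda>z X. gradient \<phi> (X, z)) (\<lambda>_. 0) at_bot"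

definition potential :: "real \<Rightarrow> (plane \<Rightarrow> real) \<Rightarrow> (plane \<Rightarrow> real) \<Rightarrow> plane \<times> real \<Rightarrow> real" where
  "potential \<tau> \<eta> \<psi> = (SOME \<phi>. is_potential \<tau> \<eta> \<psi> \<phi>)"

text \<open>The components \<open>fst\<close> and \<open>snd\<close> of the gradient of the potential are its horizontal gradient
  and its vertical derivative.\<close>

definition dirichlet_neumann :: "real \<Rightarrow> (plane \<Rightarrow> real) \<Rightarrow> (plane \<Rightarrow> real) \<Rightarrow> plane \<Rightarrow> real" where
  "dirichlet_neumann \<tau> \<eta> \<psi> X =
     (let g = gradient_within (potential \<tau> \<eta> \<psi>) (closed_fluid \<eta>) (X, \<eta> X)
      in snd g - gradient \<eta> X \<bullet> fst g)"

definition F1 :: "real \<Rightarrow> wave \<Rightarrow> real \<Rightarrow> plane \<Rightarrow> plane \<Rightarrow> real" where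
  "F1 \<tau> U \<mu> u X = (let (\<psi>, \<eta>) = U in dirichlet_neumann \<tau> \<eta> \<psi> X - u \<bullet> gradient \<eta> X)"

definition F2 :: "wave \<Rightarrow> real \<Rightarrow> plane \<Rightarrow> plane \<Rightarrow> real" where
  "F2 U \<mu> u X = (let (\<psi>, \<eta>) = U in
     u \<bullet> gradient \<psi> X + \<mu> * \<eta> X + (norm (gradient \<psi> X))\<^sup>2 / 2
     - 1 / (2 * (1 + (norm (gradient \<eta> X))\<^sup>2)) * (gradient \<eta> X \<bullet> (gradient \<psi> X + u))\<^sup>2)"

definition FF :: "real \<Rightarrow> wave \<Rightarrow> real \<Rightarrow> plane \<Rightarrow> wave" where
  "FF \<tau> U \<mu> u = (F1 \<tau> U \<mu> u, F2 U \<mu> u)"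

definition u0 :: plane where
  "u0 = (1, 0)"

definition mu_c :: "real \<Rightarrow> real" where
  "mu_c \<tau> = (1 + \<tau>\<^sup>2) powr (- 1 / 2)"

definition mu1 :: "real \<Rightarrow> real" where
  "mu1 \<tau> = (let \<mu> = mu_c \<tau> in
     1 / (4 * \<mu> ^ 3) - 1 / (2 * \<mu>\<^sup>2) - 3 / (4 * \<mu>) + 2 + \<mu> / 2 - 9 / (4 * (2 - \<mu>)))"

definition scale_wave :: "real \<Rightarrow> wave \<Rightarrow> wave" where
  "scale_wave c U = (\<lambda>X. c * fst U X, \<lambda>X. c * snd U X)"

definition expansion :: "nat \<Rightarrow> (nat \<Rightarrow> wave) \<Rightarrow> real \<Rightarrow> wave" where
  "expansion N U \<epsilon> =
     (\<lambda>X. \<Sum>p=1..N. \<epsilon> ^ p * fst (U p) X, \<lambda>X. \<Sum>p=1..N. \<epsilon> ^ p * snd (U p) X)"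

definition leading_wave :: "real \<Rightarrow> wave" where
  "leading_wave \<tau> =
     (\<lambda>(x1, x2). sin x1 * cos (\<tau> * x2),
      \<lambda>(x1, x2). - (1 / mu_c \<tau>) * (cos x1 * cos (\<tau> * x2)))"

end

theory Submission
  imports Defs "HOL-Library.Poly_Mapping" "HOL-Computational_Algebra.Formal_Power_Series"
begin

text \<open>All coefficients of the expansion in \<open>\<epsilon>\<close> are finite sums of functions
  \<open>exp (\<i> (n x\<^sub>1 + \<tau> m x\<^sub>2) + \<kappa> y)\<close>; the potential \<open>\<phi>\<close> rather than its trace \<open>\<psi>\<close> is
  expanded, and the conditions on the surface become \<open>E1 = E2 = 0\<close>. At order \<open>p\<close> the kernel of
  the linear part is spanned by the resonant modes. The mode (1,1) is balanced by \<open>\<mu>\<close>. The disc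
  hypothesis leaves a resonant mode \<open>(n, N)\<close> with \<open>n \<ge> 2\<close> possible, which enters at order
  \<open>N\<close>; it is removed by a multiple of its kernel wave added at order \<open>N - 2\<close>, whose
  response at order \<open>N\<close> is computed explicitly and does not vanish.

  The trace \<open>\<psi>\<close> is an exact polynomial in \<open>\<epsilon>\<close>, so \<open>\<phi>\<close> is continued beyond order \<open>N\<close>.
  The direct Taylor coefficients at the surface grow factorially; after flattening,
  \<open>v (X, y) = \<phi> (X, y + \<eta> X)\<close> satisfies \<open>\<Delta> v = 2 \<nabla>\<eta> \<cdot> \<nabla>v\<^sub>y + \<Delta>\<eta> v\<^sub>y - \<bar>\<nabla>\<eta>\<bar>\<^sup>2 v\<^sub>y\<^sub>y\<close>,
  and an elliptic estimate for the sums of the suprema of the Fourier coefficients gives geometric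
  bounds. The series is then the potential, unique by the maximum principle, and
  \<open>\<F>\<^sub>1 = E1\<close>, \<open>\<F>\<^sub>2 = E2 - E1\<^sup>2 / (2 (1 + \<bar>\<nabla>\<eta>\<bar>\<^sup>2))\<close> as convergent series that start
  at order \<open>N + 1\<close>. Their coefficients of order \<open>p\<close> have frequencies \<open>O(p)\<close>, so that geometric
  convergence absorbs every Sobolev weight.\<close>

text \<open>A resonant pair (n, m) with n \<ge> 2 has m > n^2, so m < N would give n^2 + m^2 < N^2
  and contradict the disc hypothesis. As coefficients of order p carry frequencies at most p, only m
  = N can obstruct, and only at order N. The order N - 2 of the correction is dictated by a cubic
  feedback: a wave inserted at order s couples with the wave of order one into the four sidebands (n
  \<plusminus> 1, N \<plusminus> 1) at order s + 1, and these are fed back into (n, N) at order s +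
  2. Since \<mu> is already spent on the mode (1, 1), the feedback coefficient itself must be
  nonzero. It contains the square roots of the sideband frequencies and \<open>mu1\<close>; after
  \<tau> and N are eliminated through the two dispersion relations it is bounded below for all real
  n \<ge> 2 and 0 < \<mu> < 1. Expanding \<phi> keeps everything explicit: harmonic modes are single
  exponentials, and the Dirichlet-Neumann operator is never expanded; it enters only at the end,
  through the convergent potential.\<close>

unbundle no vec_syntax
unbundle fps_syntax

abbreviation lk :: "('k \<Rightarrow>\<^sub>0 'b::zero) \<Rightarrow> 'k \<Rightarrow> 'b" where "lk \<equiv> Poly_Mapping.lookup"
abbreviation supp :: "('k \<Rightarrow>\<^sub>0 'b::zero) \<Rightarrow> 'k set" where "supp \<equiv> Poly_Mapping.keys"
abbreviation mon :: "'k \<Rightarrow> 'b \<Rightarrow> ('k \<Rightarrow>\<^sub>0 'b::zero)" where "mon \<equiv> Poly_Mapping.single"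

section \<open>Exponential polynomials\<close>

type_synonym key = "(int \<times> int) \<times> real"
type_synonym wpoly = "key \<Rightarrow>\<^sub>0 complex"

lemma poly_mapping_decompose:
 "t = (\<Sum>k\<in>supp t. mon k (lk t k))"
 by (rule poly_mapping_eqI)
   (simp add: lookup_sum lookup_single when_def in_keys_iff)

text \<open>Additive identities are reduced to single exponentials by this rule; for bilinear ones
  it is applied in both arguments.\<close>

lemma poly_mapping_induct [case_names single add]:
 assumes single: "\<And>k c. P (mon k c)"
  and add: "\<And>a b. P a \<Longrightarrow> P b \<Longrightarrow> P (a + b)"
 shows "P (t :: 'k \<Rightarrow>\<^sub>0 'b::comm_monoid_add)"
proof -
 have "P (\<Sum>k\<in>S. mon k (lk t k))" if "finite S" for S
  using that
 proof induction
  case empty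
  have "P (mon undefined 0)" by (rule single)
  then show ?case by simp
 qed (auto intro: add single)
 from this[of "supp t"] show ?thesis
  using poly_mapping_decompose[of t] by simp
qed

definition lsum :: "('k \<Rightarrow> 'b \<Rightarrow> 'c) \<Rightarrow> ('k \<Rightarrow>\<^sub>0 'b::zero) \<Rightarrow> 'c::comm_monoid_add" where
 "lsum f t = (\<Sum>k\<in>supp t. f k (lk t k))"

lemma lsum_superset:
 assumes "finite S" "supp t \<subseteq> S" "\<And>k. f k 0 = 0"
 shows "lsum f t = (\<Sum>k\<in>S. f k (lk t k))"
 unfolding lsum_def
 by (rule sum.mono_neutral_left) (use assms in \<open>auto simp: in_keys_iff\<close>)

lemma lsum_single [simp]: "f k 0 = 0 \<Longrightarrow> lsum f (mon k c) = f k c"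
 by (cases "c = 0") (auto simp: lsum_def)

lemma lsum_zero [simp]: "lsum f 0 = 0"
 by (simp add: lsum_def)

lemma lsum_add:
 assumes "\<And>k. f k 0 = 0" "\<And>k x y. f k (x + y) = f k x + f k y"
 shows "lsum f (a + b) = lsum f a + lsum f b"
proof -
 let ?S = "supp a \<union> supp b"
 have "lsum f (a + b) = (\<Sum>k\<in>?S. f k (lk (a + b) k))"
  by (rule lsum_superset) (auto simp: assms Poly_Mapping.keys_add)
 also have "\<dots> = (\<Sum>k\<in>?S. f k (lk a k)) + (\<Sum>k\<in>?S. f k (lk b k))"
  by (simp add: lookup_add assms sum.distrib)
 also have "\<dots> = lsum f a + lsum f b"
  using lsum_superset[of ?S a f] lsum_superset[of ?S b f] assms by simp
 finally show ?thesis .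
qed

text \<open>Relabelling of frequencies combined with a map of coefficients. Reflections, complex
  conjugation, the restriction to y = 0 and the harmonic extension are all of this form.\<close>

definition gpush :: "('k \<Rightarrow> 'k) \<Rightarrow> (complex \<Rightarrow> complex) \<Rightarrow> ('k \<Rightarrow>\<^sub>0 complex) \<Rightarrow> ('k \<Rightarrow>\<^sub>0 complex)" where
 "gpush h g = lsum (\<lambda>k c. mon (h k) (g c))"

lemma gpush_single [simp]: "g 0 = 0 \<Longrightarrow> gpush h g (mon k c) = mon (h k) (g c)"
 by (simp add: gpush_def)

lemma gpush_0 [simp]: "gpush h g 0 = 0"
 by (simp add: gpush_def)

lemma gpush_add:
 assumes "g 0 = 0" "\<And>x y. g (x + y) = g x + g y"
 shows "gpush h g (a + b) = gpush h g a + gpush h g b"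
 unfolding gpush_def by (rule lsum_add) (auto simp: assms single_add)

lemma gpush_mult:
 assumes "g 0 = 0" "\<And>x y. g (x + y) = g x + g y" "\<And>x y. g (x * y) = g x * g y"
  and "\<And>x y. h (x + y) = h x + h y"
 shows "gpush h g ((a :: ('k::comm_monoid_add) \<Rightarrow>\<^sub>0 complex) * b) = gpush h g a * gpush h g b"
proof (induction a rule: poly_mapping_induct)
 case (single k c)
 show ?case
 proof (induction b rule: poly_mapping_induct)
  case (single l d)
  then show ?case by (simp add: mult_single assms)
 next
  case (add a b)
  then show ?case by (simp add: gpush_add assms algebra_simps)
 qed
next
 case (add a b)
 then show ?case by (simp add: gpush_add assms algebra_simps)
qed

lemma lookup_gpush_invol:
 assumes "g 0 = 0" "\<And>x y. g (x + y) = g x + g y" "\<And>k. h (h k) = k"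
 shows "lk (gpush h g t) k = g (lk t (h k))"
proof (induction t rule: poly_mapping_induct)
 case (single l c)
 have "h l = k \<longleftrightarrow> l = h k" using assms(3) by metis
 then show ?case by (auto simp: lookup_single when_def assms)
qed (simp add: gpush_add assms lookup_add)

lemma keys_gpush: "supp (gpush h g t) \<subseteq> h ` supp t"
proof -
 have "supp (\<Sum>k\<in>S. mon (h k) (g (lk t k))) \<subseteq> h ` S" if "finite S" for S
  using that
 proof induction
  case (insert x F)
  then show ?case
   using Poly_Mapping.keys_add[of "mon (h x) (g (lk t x))"]
   by (fastforce split: if_splits)
 qed simp
 then show ?thesis by (simp add: gpush_def lsum_def)
qed

text \<open>Fourier multipliers with symbol \<open>w\<close>. All derivatives are of this form,
  hence commute and never enlarge the support.\<close>

lift_definition mlt :: "('k \<Rightarrow> complex) \<Rightarrow> ('k \<Rightarrow>\<^sub>0 complex) \<Rightarrow> ('k \<Rightarrow>\<^sub>0 complex)" is "\<lambda>w f k. w k * f k"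
 by (erule finite_subset[rotated]) auto

lemma lookup_mlt [simp]: "lk (mlt w t) k = w k * lk t k"
 by transfer simp

lemma mlt_add: "mlt w (a + b) = mlt w a + mlt w b"
 by (rule poly_mapping_eqI) (simp add: lookup_add algebra_simps)

lemma mlt_diff: "mlt w (a - b) = mlt w a - mlt w b"
 by (rule poly_mapping_eqI) (simp add: lookup_minus algebra_simps)

lemma mlt_0 [simp]: "mlt w 0 = 0"
 by (rule poly_mapping_eqI) simp

lemma mlt_single: "mlt w (mon k c) = mon k (w k * c)"
 by (rule poly_mapping_eqI) (simp add: lookup_single when_def)

lemma mlt_mlt: "mlt w (mlt v t) = mlt (\<lambda>k. w k * v k) t"
 by (rule poly_mapping_eqI) simp

lemma mlt_commute: "mlt w (mlt v t) = mlt v (mlt w t)"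
 by (simp add: mlt_mlt mult.commute)

lemma keys_mlt: "supp (mlt w t) \<subseteq> supp t"
 by (auto simp: in_keys_iff)

text \<open>Frequencies add under multiplication, so a multiplier with additive symbol is a
  derivation.\<close>

lemma mlt_mult:
 assumes "\<And>x y. w (x + y) = w x + w y"
 shows "mlt w ((a :: ('k::comm_monoid_add) \<Rightarrow>\<^sub>0 complex) * b) = mlt w a * b + a * mlt w b"
proof (induction a rule: poly_mapping_induct)
 case (single k c)
 show ?case
 proof (induction b rule: poly_mapping_induct)
  case (single l d)
  then show ?case by (simp add: mult_single mlt_single assms algebra_simps single_add)
 next
  case (add a b)
  then show ?case by (simp add: mlt_add algebra_simps)
 qed
next
 case (add a b)
 then show ?case by (simp add: mlt_add algebra_simps)
qed

section \<open>Evaluation by characters and the norm of the coefficients\<close>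

definition ev :: "('k \<Rightarrow> complex) \<Rightarrow> ('k \<Rightarrow>\<^sub>0 complex) \<Rightarrow> complex" where
 "ev ch = lsum (\<lambda>k c. c * ch k)"

lemma ev_single [simp]: "ev ch (mon k c) = c * ch k"
 by (simp add: ev_def)

lemma ev_0 [simp]: "ev ch 0 = 0"
 by (simp add: ev_def)

lemma ev_add: "ev ch (a + b) = ev ch a + ev ch b"
 unfolding ev_def by (rule lsum_add) (auto simp: algebra_simps)

lemma ev_mult:
 assumes "\<And>x y. ch (x + y) = ch x * ch y"
 shows "ev ch ((a :: ('k::comm_monoid_add) \<Rightarrow>\<^sub>0 complex) * b) = ev ch a * ev ch b"
proof (induction a rule: poly_mapping_induct)
 case (single k c)
 show ?case
 proof (induction b rule: poly_mapping_induct)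
  case (single l d)
  then show ?case by (simp add: mult_single assms)
 next
  case (add a b)
  then show ?case by (simp add: ev_add algebra_simps)
 qed
next
 case (add a b)
 then show ?case by (simp add: ev_add algebra_simps)
qed

lemma ev_uminus: "ev ch (- a) = - ev ch a"
proof -
 have "ev ch (- a) + ev ch a = ev ch 0" unfolding ev_add[symmetric] by simp
 then show ?thesis by (simp add: add_eq_0_iff)
qed

lemma ev_sum: "ev ch (\<Sum>i\<in>A. f i) = (\<Sum>i\<in>A. ev ch (f i))"
 by (induction A rule: infinite_finite_induct) (auto simp: ev_add)

text \<open>The norm of the Wiener algebra. It is submultiplicative (\<open>n1_mult\<close>), again
  because frequencies add under multiplication.\<close>

definition n1 :: "('k \<Rightarrow>\<^sub>0 complex) \<Rightarrow> real" where
 "n1 = lsum (\<lambda>k c. norm c)"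

lemma n1_nonneg [simp]: "0 \<le> n1 t"
 by (simp add: n1_def lsum_def sum_nonneg)

lemma n1_0 [simp]: "n1 0 = 0"
 by (simp add: n1_def)

lemma n1_single [simp]: "n1 (mon k c) = norm c"
 by (simp add: n1_def)

lemma n1_add: "n1 (a + b) \<le> n1 a + n1 b"
proof -
 let ?S = "supp a \<union> supp b"
 have "n1 (a + b) = (\<Sum>k\<in>?S. norm (lk (a + b) k))"
  unfolding n1_def by (rule lsum_superset) (auto simp: Poly_Mapping.keys_add)
 also have "\<dots> \<le> (\<Sum>k\<in>?S. norm (lk a k)) + (\<Sum>k\<in>?S. norm (lk b k))"
  by (auto simp: lookup_add sum.distrib[symmetric] intro!: sum_mono norm_triangle_ineq)
 also have "\<dots> = n1 a + n1 b"
  unfolding n1_def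
  using lsum_superset[of ?S a "\<lambda>k c. norm c"] lsum_superset[of ?S b "\<lambda>k c. norm c"] by simp
 finally show ?thesis .
qed

lemma n1_uminus [simp]: "n1 (- a) = n1 a"
 by (simp add: n1_def lsum_def keys_minus)

lemma n1_sum: "n1 (\<Sum>i\<in>A. f i) \<le> (\<Sum>i\<in>A. n1 (f i))"
 by (induction A rule: infinite_finite_induct) (auto intro: order_trans[OF n1_add])

lemma n1_mult_single: "n1 (mon (k::'k::comm_monoid_add) c * b) \<le> norm c * n1 b"
proof -
 have "mon k c * b = (\<Sum>l\<in>supp b. mon (k + l) (c * lk b l))"
  by (subst poly_mapping_decompose[of b]) (simp add: sum_distrib_left mult_single)
 also have "n1 \<dots> \<le> (\<Sum>l\<in>supp b. norm (c * lk b l))"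
  by (rule order_trans[OF n1_sum]) simp
 also have "\<dots> = norm c * n1 b"
  by (simp add: n1_def lsum_def norm_mult sum_distrib_left)
 finally show ?thesis .
qed

lemma n1_mult: "n1 ((a :: ('k::comm_monoid_add) \<Rightarrow>\<^sub>0 complex) * b) \<le> n1 a * n1 b"
proof -
 have "a * b = (\<Sum>k\<in>supp a. mon k (lk a k) * b)"
  by (subst poly_mapping_decompose[of a]) (simp add: sum_distrib_right)
 also have "n1 \<dots> \<le> (\<Sum>k\<in>supp a. norm (lk a k) * n1 b)"
  by (rule order_trans[OF n1_sum]) (intro sum_mono n1_mult_single)
 also have "\<dots> = n1 a * n1 b"
  by (simp add: n1_def lsum_def sum_distrib_right)
 finally show ?thesis .
qed

text \<open>The key \<open>((n, m), \<kappa>)\<close> stands for the function \<open>exp (\<i> (n x\<^sub>1 + \<tau> m x\<^sub>2) + \<kappa> y)\<close>.\<close>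

definition cf :: "int \<times> int \<Rightarrow> real \<Rightarrow> wpoly \<Rightarrow> complex" where
 "cf K y = lsum (\<lambda>k c. if fst k = K then c * of_real (exp (snd k * y)) else 0)"

lemma cf_single: "cf K y (mon k c) = (if fst k = K then c * of_real (exp (snd k * y)) else 0)"
 by (simp add: cf_def)

lemma cf_0 [simp]: "cf K y 0 = 0"
 by (simp add: cf_def)

lemma cf_add: "cf K y (a + b) = cf K y a + cf K y b"
 unfolding cf_def by (rule lsum_add) (auto simp: algebra_simps)

lemma cf_uminus: "cf K y (- a) = - cf K y a"
proof -
 have "cf K y (- a) + cf K y a = cf K y 0" unfolding cf_add[symmetric] by simp
 then show ?thesis by (simp add: add_eq_0_iff)
qed

lemma cf_mult_single: "cf K y (mon (J, l) c * t) = c * of_real (exp (l * y)) * cf (K - J) y t"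
proof (induction t rule: poly_mapping_induct)
 case (single k d)
 have "J + fst k = K \<longleftrightarrow> fst k = K - J" by (auto simp: algebra_simps)
 then show ?case
  by (cases k) (auto simp: mult_single cf_single distrib_right exp_add)
next
 case (add a b)
 then show ?case by (simp add: cf_add algebra_simps)
qed

lemma cf_mlt_fst: "cf K y (mlt (\<lambda>k. w (fst k)) t) = w K * cf K y t"
 by (induction t rule: poly_mapping_induct) (auto simp: mlt_single cf_single mlt_add cf_add algebra_simps)

lemma cf_eq_0: "K \<notin> fst ` supp t \<Longrightarrow> cf K y t = 0"
 unfolding cf_def lsum_def by (rule sum.neutral) auto

section \<open>Power series in the amplitude and the shift to the surface\<close>

text \<open>Orders of vanishing in \<epsilon> are treated as divisibility by powers of
  \<open>fps_X\<close>, which turns the handling of remainders into \<open>dvd\<close>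
  arguments.\<close>

lemma fps_X_power_dvd: "fps_X ^ M dvd (c :: 'a::comm_ring_1 fps) \<longleftrightarrow> (\<forall>q<M. c $ q = 0)"
proof
 assume "fps_X ^ M dvd c"
 then show "\<forall>q<M. c $ q = 0" by (auto simp: dvd_def fps_X_power_mult_nth)
next
 assume *: "\<forall>q<M. c $ q = 0"
 have "c = fps_X ^ M * fps_shift M c"
  by (rule fps_ext) (use * in \<open>auto simp: fps_X_power_mult_nth\<close>)
 then show "fps_X ^ M dvd c" by (metis dvd_triv_left)
qed

lemma fps_X_dvd: "fps_X dvd (c :: 'a::comm_ring_1 fps) \<longleftrightarrow> c $ 0 = 0"
 using fps_X_power_dvd[of 1 c] by simp

definition fcong :: "nat \<Rightarrow> 'a::comm_ring_1 fps \<Rightarrow> 'a fps \<Rightarrow> bool" where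
 "fcong M a b \<longleftrightarrow> fps_X ^ M dvd (a - b)"

lemma fcong_iff: "fcong M a b \<longleftrightarrow> (\<forall>q<M. a $ q = b $ q)"
 by (simp add: fcong_def fps_X_power_dvd)

lemma fcong_refl [simp]: "fcong M a a"
 by (simp add: fcong_iff)

lemma fcong_sym: "fcong M a b \<Longrightarrow> fcong M b a"
 by (simp add: fcong_iff)

lemma fcong_trans [trans]: "fcong M a b \<Longrightarrow> fcong M b c \<Longrightarrow> fcong M a c"
 by (simp add: fcong_iff)

lemma fcong_add: "fcong M a b \<Longrightarrow> fcong M c d \<Longrightarrow> fcong M (a + c) (b + d)"
 by (simp add: fcong_iff)

lemma fcong_diff: "fcong M a b \<Longrightarrow> fcong M c d \<Longrightarrow> fcong M (a - c) (b - d)"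
 by (simp add: fcong_iff)

lemma fcong_mult: "fcong M a b \<Longrightarrow> fcong M c d \<Longrightarrow> fcong M (a * c) (b * d)"
proof -
 assume "fcong M a b" "fcong M c d"
 then have "fps_X ^ M dvd (a - b) * c + b * (c - d)"
  unfolding fcong_def by (intro dvd_add dvd_mult2 dvd_mult)
 then show ?thesis unfolding fcong_def by (simp add: algebra_simps)
qed

lemma fcong_mono: "fcong M a b \<Longrightarrow> M' \<le> M \<Longrightarrow> fcong M' a b"
 by (simp add: fcong_iff)

lemma fcong_power: "fcong M a b \<Longrightarrow> fcong M (a ^ n) (b ^ n)"
 by (induction n) (auto intro: fcong_mult)

lemma fcong_sum: "(\<And>i. i \<in> A \<Longrightarrow> fcong M (f i) (g i)) \<Longrightarrow> fcong M (sum f A) (sum g A)"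
 by (induction A rule: infinite_finite_induct) (auto intro: fcong_add)

text \<open>Each further factor \<open>a\<close> or \<open>b\<close> contributes one order, because
  both vanish at \<epsilon> = 0.\<close>

lemma power_diff_dvd:
 assumes "fps_X dvd a" "fps_X dvd b" "fps_X ^ s dvd (a - b :: 'a::comm_ring_1 fps)"
 shows "fps_X ^ (s + j) dvd a ^ Suc j - b ^ Suc j"
proof (induction j)
 case 0
 then show ?case using assms by simp
next
 case (Suc j)
 have "a ^ Suc (Suc j) - b ^ Suc (Suc j) = a * (a ^ Suc j - b ^ Suc j) + (a - b) * b ^ Suc j"
  by (simp add: algebra_simps)
 moreover have "fps_X * fps_X ^ (s + j) dvd a * (a ^ Suc j - b ^ Suc j)"
  by (intro mult_dvd_mono assms Suc)
 moreover have "fps_X ^ s * fps_X ^ Suc j dvd (a - b) * b ^ Suc j"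
  by (intro mult_dvd_mono assms dvd_power_same)
 ultimately show ?case by (simp add: power_add mult.assoc mult.left_commute dvd_add)
qed

section \<open>Coefficientwise maps of power series\<close>

definition fm :: "('a \<Rightarrow> 'b) \<Rightarrow> 'a fps \<Rightarrow> 'b fps" where
 "fm f a = Abs_fps (\<lambda>n. f (a $ n))"

lemma fm_nth [simp]: "fm f a $ n = f (a $ n)"
 by (simp add: fm_def)

lemma fm_fm: "fm f (fm g a) = fm (\<lambda>x. f (g x)) a"
 by (rule fps_ext) simp

lemma fm_add: "(\<And>x y. f (x + y) = f x + f y) \<Longrightarrow> fm f (a + b) = fm f a + fm f b"
 by (rule fps_ext) simp

lemma fm_X_power_mult: "f 0 = 0 \<Longrightarrow> fm f (fps_X ^ p * a) = fps_X ^ p * fm f a"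
 for f :: "'a::comm_ring_1 \<Rightarrow> 'b::comm_ring_1"
 by (rule fps_ext) (simp add: fps_X_power_mult_nth)

lemma fm_dvd: "f 0 = 0 \<Longrightarrow> fps_X ^ p dvd a \<Longrightarrow> fps_X ^ p dvd fm f a"
 for f :: "'a::comm_ring_1 \<Rightarrow> 'b::comm_ring_1"
 by (simp add: fps_X_power_dvd)

lemma fcong_fm: "fcong M a b \<Longrightarrow> fcong M (fm f a) (fm f b)"
 by (simp add: fcong_iff)

lemma additive_sum:
 fixes f :: "'a::comm_monoid_add \<Rightarrow> 'b::comm_monoid_add"
 assumes "f 0 = 0" "\<And>x y. f (x + y) = f x + f y"
 shows "f (sum g A) = (\<Sum>i\<in>A. f (g i))"
 by (induction A rule: infinite_finite_induct) (auto simp: assms)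

lemma fm_mult_deriv:
 fixes f :: "'a::comm_ring_1 \<Rightarrow> 'a"
 assumes "f 0 = 0" "\<And>x y. f (x + y) = f x + f y" "\<And>x y. f (x * y) = f x * y + x * f y"
 shows "fm f (a * b) = fm f a * b + a * fm f b"
 by (rule fps_ext) (simp add: fps_mult_nth additive_sum[of f, OF assms(1,2)] assms sum.distrib)

abbreviation cst :: "complex \<Rightarrow> wpoly" where "cst \<equiv> mon 0"
abbreviation fcst :: "complex \<Rightarrow> wpoly fps" where "fcst c \<equiv> fps_const (cst c)"

lemma cst_mult: "cst a * cst b = cst (a * b)"
 by (simp add: mult_single)

lemma fcst_mult: "fcst a * fcst b = fcst (a * b)"
 by (simp add: cst_mult)

lemma fcst_of_nat: "fcst (of_nat n) = of_nat n"
 by (metis fps_of_nat single_of_nat)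

section \<open>Derivatives and the shift to the surface\<close>

definition dy :: "wpoly \<Rightarrow> wpoly" where "dy = mlt (\<lambda>k. of_real (snd k))"
definition dyn :: "nat \<Rightarrow> wpoly \<Rightarrow> wpoly" where "dyn j = mlt (\<lambda>k. of_real (snd k ^ j))"
definition d1 :: "wpoly \<Rightarrow> wpoly" where "d1 = mlt (\<lambda>k. \<i> * of_int (fst (fst k)))"
definition d2 :: "real \<Rightarrow> wpoly \<Rightarrow> wpoly" where "d2 \<tau> = mlt (\<lambda>k. \<i> * of_real \<tau> * of_int (snd (fst k)))"

lemma dyn_0 [simp]: "dyn 0 t = t" and dyn_Suc: "dyn (Suc j) t = dyn j (dy t)"
 by (auto simp: dyn_def dy_def mlt_mlt mult.commute intro!: poly_mapping_eqI)

lemma fm_dyn_0 [simp]: "fm (dyn 0) a = a"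
 by (rule fps_ext) simp

lemma dyn_1: "dyn (Suc 0) t = dy t"
 by (simp add: dyn_Suc)

lemma dyn_add: "dyn j (a + b) = dyn j a + dyn j b" by (simp add: dyn_def mlt_add)
lemma dy_add: "dy (a + b) = dy a + dy b" by (simp add: dy_def mlt_add)
lemma d1_add: "d1 (a + b) = d1 a + d1 b" by (simp add: d1_def mlt_add)
lemma d2_add: "d2 \<tau> (a + b) = d2 \<tau> a + d2 \<tau> b" by (simp add: d2_def mlt_add)
lemma d_0 [simp]: "dyn j 0 = 0" "dy 0 = 0" "d1 0 = 0" "d2 \<tau> 0 = 0"
 by (simp_all add: dyn_def dy_def d1_def d2_def)

lemma dy_mult: "dy (a * b) = dy a * b + a * dy b" unfolding dy_def by (rule mlt_mult) simp
lemma d1_mult: "d1 (a * b) = d1 a * b + a * d1 b" unfolding d1_def by (rule mlt_mult) (simp add: algebra_simps)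
lemma d2_mult: "d2 \<tau> (a * b) = d2 \<tau> a * b + a * d2 \<tau> b" unfolding d2_def by (rule mlt_mult) (simp add: algebra_simps)

lemma d_commute: "d1 (dy t) = dy (d1 t)" "d2 \<tau> (dy t) = dy (d2 \<tau> t)" "d1 (d2 \<tau> t) = d2 \<tau> (d1 t)"
 by (simp_all add: d1_def d2_def dy_def mlt_commute)

text \<open>For exponential sums the Taylor series in y is explicit: the j-th vertical derivative
  multiplies each term by the j-th power of its rate. This is the expansion stopped at j =
  M.\<close>

definition SubT :: "nat \<Rightarrow> wpoly fps \<Rightarrow> wpoly fps \<Rightarrow> wpoly fps" where
 "SubT M \<eta> \<phi> = (\<Sum>j\<le>M. fcst (1 / fact j) * \<eta> ^ j * fm (dyn j) \<phi>)"

text \<open>The formal Taylor expansion of \<open>\<phi> (X, y + \<eta> X)\<close> in powers of \<open>\<eta>\<close>.\<close>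

definition Sub :: "wpoly fps \<Rightarrow> wpoly fps \<Rightarrow> wpoly fps" where
 "Sub \<eta> \<phi> = Abs_fps (\<lambda>q. SubT q \<eta> \<phi> $ q)"

text \<open>The term with \<eta>^j starts at order j, so the coefficient of order q sees only j
  \<le> q. This legitimates the diagonal in \<open>Sub\<close>.\<close>

lemma SubT_nth_stable:
 assumes "\<eta> $ 0 = 0" "q \<le> M"
 shows "SubT M \<eta> \<phi> $ q = SubT q \<eta> \<phi> $ q"
proof -
 have "(fcst (1 / fact j) * \<eta> ^ j * fm (dyn j) \<phi>) $ q = 0" if "j > q" for j
 proof -
  have "fps_X ^ j dvd \<eta> ^ j" using assms(1) by (intro dvd_power_same) (simp add: fps_X_dvd)
  then have "fps_X ^ j dvd fcst (1 / fact j) * \<eta> ^ j * fm (dyn j) \<phi>"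
   by (intro dvd_mult2 dvd_mult)
  then show ?thesis using that by (simp add: fps_X_power_dvd)
 qed
 then show ?thesis
  unfolding SubT_def fps_sum_nth using assms(2)
  by (intro sum.mono_neutral_right) auto
qed

lemma fcong_Sub: "\<eta> $ 0 = 0 \<Longrightarrow> fcong (Suc M) (Sub \<eta> \<phi>) (SubT M \<eta> \<phi>)"
 by (auto simp: fcong_iff Sub_def intro!: SubT_nth_stable[symmetric])

lemma fcong_all_imp_eq: "(\<And>M. fcong (Suc M) a b) \<Longrightarrow> a = b"
 by (rule fps_ext) (auto simp: fcong_iff)

lemma SubT_add: "SubT M \<eta> (a + b) = SubT M \<eta> a + SubT M \<eta> b"
 by (simp add: SubT_def fm_add dyn_add algebra_simps sum.distrib)

lemma Sub_add: "Sub \<eta> (a + b) = Sub \<eta> a + Sub \<eta> b"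
 by (rule fps_ext) (simp add: Sub_def SubT_add)

lemma Sub_0 [simp]: "Sub \<eta> 0 = 0"
 using Sub_add[of \<eta> 0 0] by simp

lemma fm_deriv_power:
 fixes f :: "'a::comm_ring_1 \<Rightarrow> 'a"
 assumes "f 0 = 0" "\<And>x y. f (x + y) = f x + f y" "\<And>x y. f (x * y) = f x * y + x * f y"
 shows "fm f (a ^ Suc j) = of_nat (Suc j) * a ^ j * fm f a"
proof (induction j)
 case (Suc j)
 have "fm f (a ^ Suc (Suc j)) = fm f a * a ^ Suc j + a * fm f (a ^ Suc j)"
  by (simp only: power_Suc[of a "Suc j"] fm_mult_deriv[of f, OF assms])
 also have "\<dots> = of_nat (Suc (Suc j)) * a ^ Suc j * fm f a"
  unfolding Suc by (simp add: algebra_simps)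
 finally show ?case .
qed simp

text \<open>Chain rule for the truncated shift. Differentiating \<eta>^j lowers the power by one, so
  the second term is truncated one step earlier; the loss disappears in \<open>Sub_deriv\<close>,
  where the identity is compared modulo every power of \<epsilon>.\<close>

lemma SubT_deriv:
 assumes w: "\<And>x y. w (x + y) = w x + w y"
 shows "fm (mlt w) (SubT (Suc M) \<eta> \<phi>) =
   SubT (Suc M) \<eta> (fm (mlt w) \<phi>) + fm (mlt w) \<eta> * SubT M \<eta> (fm dy \<phi>)"
proof -
 let ?d = "fm (mlt w)"
 have w0: "w 0 = 0" using w[of 0 0] by simp
 have dc: "?d (fcst c * a) = fcst c * ?d a" for c a
 proof -
  have "?d (fcst c) = 0"
   by (rule fps_ext) (simp add: mlt_single w0)
  then show ?thesis
   using fm_mult_deriv[of "mlt w" "fcst c" a] by (simp add: mlt_add mlt_mult[OF w])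
 qed
 have dcm: "?d (fcst c * a * b) = fcst c * ?d a * b + fcst c * a * ?d b" for c a b
  using dc[of c "a * b"] fm_mult_deriv[of "mlt w" a b] by (simp add: mlt_add mlt_mult[OF w] algebra_simps)
 have dp: "?d (\<eta> ^ Suc j) = of_nat (Suc j) * \<eta> ^ j * ?d \<eta>" for j
  by (rule fm_deriv_power) (auto simp: mlt_add mlt_mult[OF w])
 have dd: "?d (fm (dyn j) \<phi>) = fm (dyn j) (?d \<phi>)" for j
  by (rule fps_ext) (simp add: dyn_def mlt_commute)
 have dsum: "?d (sum f A) = (\<Sum>i\<in>A. ?d (f i))" for f and A :: "nat set"
  by (induction A rule: infinite_finite_induct) (auto simp: fm_add mlt_add intro!: fps_ext)
 have fc: "fcst (1 / fact (Suc j)) * of_nat (Suc j) = fcst (1 / fact j)" for j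
  unfolding fcst_of_nat[symmetric] fcst_mult by (simp del: of_nat_Suc)
 have "?d (SubT (Suc M) \<eta> \<phi>) =
   (\<Sum>j\<le>Suc M. fcst (1 / fact j) * ?d (\<eta> ^ j) * fm (dyn j) \<phi>)
  + (\<Sum>j\<le>Suc M. fcst (1 / fact j) * \<eta> ^ j * fm (dyn j) (?d \<phi>))"
  unfolding SubT_def dsum dcm dd by (simp only: sum.distrib)
 also have "(\<Sum>j\<le>Suc M. fcst (1 / fact j) * ?d (\<eta> ^ j) * fm (dyn j) \<phi>)
   = (\<Sum>j\<le>M. fcst (1 / fact (Suc j)) * ?d (\<eta> ^ Suc j) * fm (dyn (Suc j)) \<phi>)"
 proof -
  have "?d (\<eta> ^ 0) = 0" by (rule fps_ext) (auto simp: mlt_single w0 simp flip: single_one)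
  then show ?thesis by (subst sum.atMost_Suc_shift) simp
 qed
 also have "\<dots> = fm (mlt w) \<eta> * SubT M \<eta> (fm dy \<phi>)"
 proof -
  have "fcst (1 / fact (Suc j)) * ?d (\<eta> ^ Suc j) * fm (dyn (Suc j)) \<phi>
   = ?d \<eta> * (fcst (1 / fact j) * \<eta> ^ j * fm (dyn j) (fm dy \<phi>))" for j
  proof -
   have "fm (dyn (Suc j)) \<phi> = fm (dyn j) (fm dy \<phi>)" by (rule fps_ext) (simp add: dyn_Suc)
   moreover have "fcst (1 / fact (Suc j)) * ?d (\<eta> ^ Suc j) = ?d \<eta> * (fcst (1 / fact j) * \<eta> ^ j)"
   proof -
    have "fcst (1 / fact (Suc j)) * ?d (\<eta> ^ Suc j)
     = (fcst (1 / fact (Suc j)) * of_nat (Suc j)) * (\<eta> ^ j * ?d \<eta>)"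
     unfolding dp by (simp only: ac_simps)
    then show ?thesis unfolding fc by (simp only: ac_simps)
   qed
   ultimately show ?thesis by (simp only: ac_simps)
  qed
  then show ?thesis by (simp only: SubT_def sum_distrib_left)
 qed
 finally show ?thesis by (simp add: SubT_def add.commute)
qed

lemma Sub_deriv:
 assumes w: "\<And>x y. w (x + y) = w x + w y" and \<eta>: "\<eta> $ 0 = 0"
 shows "fm (mlt w) (Sub \<eta> \<phi>) = Sub \<eta> (fm (mlt w) \<phi>) + fm (mlt w) \<eta> * Sub \<eta> (fm dy \<phi>)"
proof (rule fcong_all_imp_eq)
 fix M
 have "fcong (Suc M) (fm (mlt w) (Sub \<eta> \<phi>)) (fm (mlt w) (SubT (Suc M) \<eta> \<phi>))"
  by (intro fcong_fm) (rule fcong_mono[OF fcong_Sub[OF \<eta>]], simp)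
 also note SubT_deriv[OF w]
 also have "fcong (Suc M) (SubT (Suc M) \<eta> (fm (mlt w) \<phi>) + fm (mlt w) \<eta> * SubT M \<eta> (fm dy \<phi>))
   (Sub \<eta> (fm (mlt w) \<phi>) + fm (mlt w) \<eta> * Sub \<eta> (fm dy \<phi>))"
  by (intro fcong_add fcong_mult fcong_refl fcong_sym[OF fcong_Sub[OF \<eta>]]
    fcong_mono[OF fcong_sym[OF fcong_Sub[OF \<eta>]]]) simp
 finally show "fcong (Suc M) (fm (mlt w) (Sub \<eta> \<phi>)) \<dots>" .
qed

lemma Sub_d1: "\<eta> $ 0 = 0 \<Longrightarrow> fm d1 (Sub \<eta> \<phi>) = Sub \<eta> (fm d1 \<phi>) + fm d1 \<eta> * Sub \<eta> (fm dy \<phi>)"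
 unfolding d1_def by (rule Sub_deriv) (auto simp: algebra_simps)

lemma Sub_d2: "\<eta> $ 0 = 0 \<Longrightarrow> fm (d2 \<tau>) (Sub \<eta> \<phi>) = Sub \<eta> (fm (d2 \<tau>) \<phi>) + fm (d2 \<tau>) \<eta> * Sub \<eta> (fm dy \<phi>)"
 unfolding d2_def by (rule Sub_deriv) (auto simp: algebra_simps)

lemma Sub_dy: "\<eta> $ 0 = 0 \<Longrightarrow> fm dy \<eta> = 0 \<Longrightarrow> fm dy (Sub \<eta> \<phi>) = Sub \<eta> (fm dy \<phi>)"
 using Sub_deriv[of "\<lambda>k. of_real (snd k)" \<eta> \<phi>] by (simp add: dy_def[symmetric])

lemma SubT_diff:
 "SubT M \<eta>' (\<phi> + \<delta>) - SubT M \<eta> \<phi> =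
  (\<Sum>j\<le>M. fcst (1 / fact j) * (\<eta>' ^ j - \<eta> ^ j) * fm (dyn j) \<phi> + fcst (1 / fact j) * \<eta>' ^ j * fm (dyn j) \<delta>)"
 by (simp add: SubT_def fm_add dyn_add algebra_simps sum.distrib sum_subtractf)

text \<open>For j \<ge> 1 every term carries, besides the perturbation of order p, a further factor
  \<eta> or \<phi> of order at least one. Thus at order p only the unshifted \<alpha> appears, and
  the change of \<eta> shows one order later.\<close>

lemma Sub_perturb1:
 assumes "\<eta> $ 0 = 0" "\<phi> $ 0 = 0" "p \<ge> 1"
 shows "fcong (Suc p) (Sub (\<eta> + fps_X ^ p * \<beta>) (\<phi> + fps_X ^ p * \<alpha>)) (Sub \<eta> \<phi> + fps_X ^ p * \<alpha>)"
proof -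
 let ?\<eta> = "\<eta> + fps_X ^ p * \<beta>" and ?\<delta> = "fps_X ^ p * \<alpha>"
 have X: "fps_X dvd \<eta>" "fps_X dvd ?\<eta>" "fps_X dvd \<phi>" using assms by (auto simp: fps_X_dvd fps_X_power_mult_nth)
 have "fps_X ^ Suc p dvd SubT p ?\<eta> (\<phi> + ?\<delta>) - SubT p \<eta> \<phi> - ?\<delta>"
 proof -
  have "SubT p ?\<eta> (\<phi> + ?\<delta>) - SubT p \<eta> \<phi> - ?\<delta> = (\<Sum>j\<in>{1..p}. fcst (1 / fact j) * (?\<eta> ^ j - \<eta> ^ j) * fm (dyn j) \<phi> + fcst (1 / fact j) * ?\<eta> ^ j * fm (dyn j) ?\<delta>)"
   unfolding SubT_diff by (simp add: atMost_atLeast0 sum.atLeast_Suc_atMost)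
  moreover have "fps_X ^ Suc p dvd fcst (1 / fact j) * (?\<eta> ^ j - \<eta> ^ j) * fm (dyn j) \<phi> + fcst (1 / fact j) * ?\<eta> ^ j * fm (dyn j) ?\<delta>"
   if j: "j \<in> {1..p}" for j
  proof -
   obtain i where i: "j = Suc i" by (cases j) (use j in auto)
   have "fps_X ^ (p + i) dvd ?\<eta> ^ j - \<eta> ^ j"
    unfolding i by (rule power_diff_dvd) (use X in auto)
   then have "fps_X ^ p dvd ?\<eta> ^ j - \<eta> ^ j" by (rule dvd_trans[rotated]) (simp add: le_imp_power_dvd)
   moreover have "fps_X dvd fm (dyn j) \<phi>" using fm_dvd[of "dyn j" 1 \<phi>] X by simp
   ultimately have 1: "fps_X ^ p * fps_X dvd fcst (1 / fact j) * (?\<eta> ^ j - \<eta> ^ j) * fm (dyn j) \<phi>"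
    by (intro mult_dvd_mono dvd_mult)
   have "fps_X dvd ?\<eta> ^ j" using X(2) by (simp add: i)
   moreover have "fps_X ^ p dvd fm (dyn j) ?\<delta>" by (rule fm_dvd) auto
   ultimately have 2: "fps_X * fps_X ^ p dvd fcst (1 / fact j) * ?\<eta> ^ j * fm (dyn j) ?\<delta>"
    by (intro mult_dvd_mono dvd_mult)
   show ?thesis using 1 2 by (simp add: mult.commute dvd_add)
  qed
  ultimately show ?thesis by (simp only: dvd_sum)
 qed
 then have *: "fcong (Suc p) (SubT p ?\<eta> (\<phi> + ?\<delta>)) (SubT p \<eta> \<phi> + ?\<delta>)"
  by (simp add: fcong_def algebra_simps)
 have "fcong (Suc p) (Sub ?\<eta> (\<phi> + ?\<delta>)) (SubT p ?\<eta> (\<phi> + ?\<delta>))"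
  by (rule fcong_Sub) (use assms in \<open>simp add: fps_X_power_mult_nth\<close>)
 also note *
 also have "fcong (Suc p) (SubT p \<eta> \<phi> + ?\<delta>) (Sub \<eta> \<phi> + ?\<delta>)"
  by (intro fcong_add fcong_refl fcong_sym[OF fcong_Sub]) (use assms in simp)
 finally show ?thesis .
qed

text \<open>The same expansion carried two orders further. Terms with j \<ge> 3 start at order s +
  3, and terms quadratic in the perturbation at order 2s, which is at least s + 3 because s \<ge> 3;
  what remains is linear in (\<alpha>, \<beta>).\<close>

lemma Sub_perturb2:
 assumes "\<eta> $ 0 = 0" "\<phi> $ 0 = 0" "s \<ge> 3"
 shows "fcong (s + 3) (Sub (\<eta> + fps_X ^ s * \<beta>) (\<phi> + fps_X ^ s * \<alpha>))
   (Sub \<eta> \<phi> + fps_X ^ s * (\<alpha> + \<eta> * fm (dyn 1) \<alpha> + fcst (1/2) * \<eta>^2 * fm (dyn 2) \<alpha>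
    + \<beta> * fm (dyn 1) \<phi> + \<beta> * \<eta> * fm (dyn 2) \<phi>))"
proof -
 let ?\<eta> = "\<eta> + fps_X ^ s * \<beta>" and ?\<delta> = "fps_X ^ s * \<alpha>"
 let ?N = "s + 3"
 have X: "fps_X dvd \<eta>" "fps_X dvd ?\<eta>" "fps_X dvd \<phi>" using assms by (auto simp: fps_X_dvd fps_X_power_mult_nth)
 define D where "D j = fcst (1 / fact j) * (?\<eta> ^ j - \<eta> ^ j) * fm (dyn j) \<phi> + fcst (1 / fact j) * ?\<eta> ^ j * fm (dyn j) ?\<delta>" for j
 define R where "R = \<alpha> + \<eta> * fm (dyn 1) \<alpha> + fcst (1/2) * \<eta>^2 * fm (dyn 2) \<alpha>
    + \<beta> * fm (dyn 1) \<phi> + \<beta> * \<eta> * fm (dyn 2) \<phi>"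
 have fmd: "fm (dyn j) ?\<delta> = fps_X ^ s * fm (dyn j) \<alpha>" for j by (rule fm_X_power_mult) simp
 have big: "fps_X ^ ?N dvd D j" if "j \<ge> 3" for j
 proof -
  define i where "i = j - 3"
  have i: "j = Suc (i + 2)" using that by (simp add: i_def)
  have "fps_X ^ (s + (i + 2)) dvd ?\<eta> ^ j - \<eta> ^ j"
   unfolding i by (rule power_diff_dvd) (use X in auto)
  then have "fps_X ^ (s + 2) dvd ?\<eta> ^ j - \<eta> ^ j"
   by (rule dvd_trans[rotated]) (rule le_imp_power_dvd, simp)
  moreover have "fps_X dvd fm (dyn j) \<phi>" using fm_dvd[of "dyn j" 1 \<phi>] X by simp
  ultimately have 1: "fps_X ^ (s + 2) * fps_X dvd fcst (1 / fact j) * (?\<eta> ^ j - \<eta> ^ j) * fm (dyn j) \<phi>"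
   by (intro mult_dvd_mono dvd_mult)
  have "fps_X ^ 3 dvd ?\<eta> ^ 3" using X(2) by (rule dvd_power_same)
  then have "fps_X ^ 3 dvd ?\<eta> ^ j" by (rule dvd_trans) (simp add: le_imp_power_dvd that)
  moreover have "fps_X ^ s dvd fm (dyn j) ?\<delta>" by (rule fm_dvd) auto
  ultimately have 2: "fps_X ^ 3 * fps_X ^ s dvd fcst (1 / fact j) * ?\<eta> ^ j * fm (dyn j) ?\<delta>"
   by (intro mult_dvd_mono dvd_mult)
  have e: "fps_X ^ (s + 2) * fps_X = (fps_X ^ ?N :: wpoly fps)" "fps_X ^ 3 * fps_X ^ s = (fps_X ^ ?N :: wpoly fps)"
   by (simp_all add: numeral_eq_Suc power_add algebra_simps)
  show ?thesis unfolding D_def using 1 2 unfolding e by (rule dvd_add)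
 qed
 have ss: "fps_X ^ ?N dvd fps_X ^ s * (fps_X ^ s * c)" for c :: "wpoly fps"
 proof -
  have "fps_X ^ ?N dvd (fps_X ^ (s + s) :: wpoly fps)" using assms(3) by (intro le_imp_power_dvd) simp
  then have "fps_X ^ ?N dvd (fps_X ^ (s + s)) * c" by (rule dvd_mult2)
  then show ?thesis by (simp only: power_add mult.assoc)
 qed
 have "fps_X ^ ?N dvd D 0 + D 1 + D 2 - fps_X ^ s * R"
 proof -
  have h: "fcst (1/2) * 2 = (1 :: wpoly fps)"
  proof -
   have c: "cst (1/2) * 2 = 1" using cst_mult[of "1/2" 2] by simp
   show ?thesis unfolding fps_numeral_fps_const fps_const_mult c by simp
  qed
  have "D 0 = fps_X ^ s * \<alpha>" unfolding D_def fmd by simp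
  moreover have "D 1 = fps_X ^ s * (\<beta> * fm (dyn 1) \<phi> + \<eta> * fm (dyn 1) \<alpha>) + fps_X ^ s * (fps_X ^ s * (\<beta> * fm (dyn 1) \<alpha>))"
   unfolding D_def fmd by (simp add: algebra_simps)
  moreover have "D 2 = fps_X ^ s * (fcst (1/2) * 2 * (\<beta> * \<eta> * fm (dyn 2) \<phi>) + fcst (1/2) * \<eta>^2 * fm (dyn 2) \<alpha>)
    + fps_X ^ s * (fps_X ^ s * (fcst (1/2) * (\<beta>^2 * fm (dyn 2) \<phi> + 2 * \<eta> * \<beta> * fm (dyn 2) \<alpha> + fps_X ^ s * \<beta>^2 * fm (dyn 2) \<alpha>)))"
   unfolding D_def fmd by (simp add: algebra_simps power2_eq_square)
  ultimately have "D 0 + D 1 + D 2 - fps_X ^ s * R =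
    fps_X ^ s * (fps_X ^ s * (\<beta> * fm (dyn 1) \<alpha>)) + fps_X ^ s * (fps_X ^ s * (fcst (1/2) * (\<beta>^2 * fm (dyn 2) \<phi> + 2 * \<eta> * \<beta> * fm (dyn 2) \<alpha> + fps_X ^ s * \<beta>^2 * fm (dyn 2) \<alpha>)))"
   unfolding h by (simp add: R_def algebra_simps)
  then show ?thesis by (simp only: ss dvd_add)
 qed
 moreover have sumD: "(\<Sum>j\<le>s+2. D j) = D 0 + D 1 + D 2 + (\<Sum>j\<in>{3..s+2}. D j)"
 proof -
  have "{..s+2} = {0,1,2} \<union> {3..s+2}" by auto
  then show ?thesis by (simp add: sum.union_disjoint add.assoc)
 qed
 moreover have "fps_X ^ ?N dvd (\<Sum>j\<in>{3..s+2}. D j)"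
  by (rule dvd_sum) (use big in auto)
 ultimately have "fps_X ^ ?N dvd (D 0 + D 1 + D 2 - fps_X ^ s * R) + (\<Sum>j\<in>{3..s+2}. D j)"
  by (intro dvd_add)
 then have "fps_X ^ ?N dvd (\<Sum>j\<le>s+2. D j) - fps_X ^ s * R"
  unfolding sumD by (simp only: algebra_simps)
 then have *: "fcong ?N (SubT (s+2) ?\<eta> (\<phi> + ?\<delta>)) (SubT (s+2) \<eta> \<phi> + fps_X ^ s * R)"
  unfolding fcong_def D_def SubT_diff[symmetric] by (simp add: diff_diff_eq)
 have n: "?N = Suc (s + 2)" by simp
 have "fcong ?N (Sub ?\<eta> (\<phi> + ?\<delta>)) (SubT (s+2) ?\<eta> (\<phi> + ?\<delta>))"
  unfolding n by (rule fcong_Sub) (use assms in \<open>simp add: fps_X_power_mult_nth\<close>)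
 also note *
 also have "fcong ?N (SubT (s+2) \<eta> \<phi> + fps_X ^ s * R) (Sub \<eta> \<phi> + fps_X ^ s * R)"
  unfolding n by (intro fcong_add fcong_refl fcong_sym[OF fcong_Sub]) (use assms in simp)
 finally show ?thesis by (simp add: R_def)
qed

section \<open>Symmetry classes\<close>

text \<open>On functions, \<open>z0\<close> is the trace at y = 0, \<open>sg1\<close> and
  \<open>sg2\<close> are the reflections of x1 and x2, and \<open>rho\<close> is complex
  conjugation, so that the real functions are the fixed points of \<open>rho\<close>.\<close>

definition z0 :: "wpoly \<Rightarrow> wpoly" where "z0 = gpush (\<lambda>k. (fst k, 0)) (\<lambda>c. c)"
definition sg1 :: "wpoly \<Rightarrow> wpoly" where
 "sg1 = gpush (\<lambda>k. ((- fst (fst k), snd (fst k)), snd k)) (\<lambda>c. c)"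
definition sg2 :: "wpoly \<Rightarrow> wpoly" where
 "sg2 = gpush (\<lambda>k. ((fst (fst k), - snd (fst k)), snd k)) (\<lambda>c. c)"
definition rho :: "wpoly \<Rightarrow> wpoly" where
 "rho = gpush (\<lambda>k. ((- fst (fst k), - snd (fst k)), snd k)) cnj"
definition kn :: "real \<Rightarrow> int \<times> int \<Rightarrow> real" where
 "kn \<tau> K = sqrt ((real_of_int (fst K))^2 + \<tau>^2 * (real_of_int (snd K))^2)"
text \<open>The harmonic extension of a trace into the lower half-space: the mode (n, m) receives
  the rate \<open>kn\<close>, the length of its wave vector (n, \<tau> m).\<close>

definition hx :: "real \<Rightarrow> wpoly \<Rightarrow> wpoly" where
 "hx \<tau> = gpush (\<lambda>k. (fst k, kn \<tau> (fst k))) (\<lambda>c. c)"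

lemma gpush_gpush:
 assumes "g 0 = 0" "\<And>x y. g (x + y) = g x + g y" "g' 0 = 0" "\<And>x y. g' (x + y) = g' x + g' y"
 shows "gpush h g (gpush h' g' t) = gpush (\<lambda>k. h (h' k)) (\<lambda>c. g (g' c)) t"
proof (induction t rule: poly_mapping_induct)
 case (add a b)
 then show ?case
  using assms gpush_add[of "\<lambda>c. g (g' c)" "\<lambda>k. h (h' k)" a b] by (simp add: gpush_add)
qed (simp add: assms)

lemma gpush_mlt:
 assumes "g 0 = 0" "\<And>x y. g (x + y) = g x + g y" "\<And>x y. g (x * y) = g x * g y"
  and "\<And>k. g (w k) = w' (h k)"
 shows "gpush h g (mlt w t) = mlt w' (gpush h g t)"
 by (induction t rule: poly_mapping_induct) (auto simp: mlt_single gpush_add assms mlt_add)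

lemma lookup_mult_single:
 "lk (mon k c * t) l = c * lk t (l - k :: 'k::ab_group_add)"
 for c :: complex
proof (induction t rule: poly_mapping_induct)
 case (single j d)
 then show ?case by (auto simp: mult_single lookup_single when_def algebra_simps)
qed (simp add: lookup_add algebra_simps)

lemma lookup_cst_mult [simp]: "lk (cst c * t) k = c * lk t k"
 by (simp add: lookup_mult_single)

lemma lookup_of_int_mult: "lk (of_int s * t) k = of_int s * lk (t::wpoly) k"
 by (metis lookup_cst_mult single_of_int)

lemma z0_add: "z0 (a + b) = z0 a + z0 b" by (simp add: z0_def gpush_add)
lemma z0_mult: "z0 (a * b) = z0 a * z0 b" unfolding z0_def by (rule gpush_mult) auto
lemma z0_0 [simp]: "z0 0 = 0" by (simp add: z0_def)
lemma z0_single [simp]: "z0 (mon k c) = mon (fst k, 0) c" by (simp add: z0_def)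
lemma z0_uminus: "z0 (- a) = - z0 a"
 using z0_add[of a "- a"] by (simp add: eq_neg_iff_add_eq_0 add.commute)
lemma z0_diff: "z0 (a - b) = z0 a - z0 b" using z0_add[of a "- b"] by (simp add: z0_uminus)
lemma z0_mlt: "z0 (mlt (\<lambda>k. w (fst k)) t) = mlt (\<lambda>k. w (fst k)) (z0 t)"
 unfolding z0_def by (rule gpush_mlt) auto
lemma z0_d1: "z0 (d1 t) = d1 (z0 t)" unfolding d1_def by (rule z0_mlt)
lemma z0_d2: "z0 (d2 \<tau> t) = d2 \<tau> (z0 t)" unfolding d2_def by (rule z0_mlt)

lemma lookup_z0: "lk (z0 t) (K, 0) = cf K 0 t"
 by (induction t rule: poly_mapping_induct)
   (auto simp: lookup_single when_def cf_single z0_add lookup_add cf_add)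

definition flat :: "wpoly \<Rightarrow> bool" where "flat t \<longleftrightarrow> (\<forall>k\<in>supp t. snd k = 0)"

lemma flat_z0 [simp]: "flat (z0 t)"
 unfolding flat_def z0_def using keys_gpush by fastforce

lemma flat_z0_eq: "flat t \<Longrightarrow> z0 t = t"
proof -
 assume f: "flat t"
 have "z0 t = (\<Sum>k\<in>supp t. mon (fst k, 0) (lk t k))"
  by (simp add: z0_def gpush_def lsum_def)
 also have "\<dots> = (\<Sum>k\<in>supp t. mon k (lk t k))"
  by (rule sum.cong) (use f in \<open>auto simp: flat_def\<close>)
 also have "\<dots> = t" by (rule poly_mapping_decompose[symmetric])
 finally show ?thesis .
qed

lemma flat_iff_z0: "flat t \<longleftrightarrow> z0 t = t"
 using flat_z0 flat_z0_eq by metis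

lemma flat_0 [simp]: "flat 0" by (simp add: flat_def)
lemma flat_cst [simp]: "flat (cst c)" by (simp add: flat_def)
lemma flat_add: "flat a \<Longrightarrow> flat b \<Longrightarrow> flat (a + b)" by (simp add: flat_iff_z0 z0_add)
lemma flat_uminus: "flat a \<Longrightarrow> flat (- a)" by (simp add: flat_iff_z0 z0_uminus)
lemma flat_diff: "flat a \<Longrightarrow> flat b \<Longrightarrow> flat (a - b)" by (simp add: flat_iff_z0 z0_diff)
lemma flat_mult: "flat a \<Longrightarrow> flat b \<Longrightarrow> flat (a * b)" by (simp add: flat_iff_z0 z0_mult)
lemma flat_mlt: "flat a \<Longrightarrow> flat (mlt w a)" using keys_mlt by (fastforce simp: flat_def)
lemma flat_sum: "(\<And>i. i \<in> A \<Longrightarrow> flat (f i)) \<Longrightarrow> flat (sum f A)"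
 by (induction A rule: infinite_finite_induct) (auto intro: flat_add)
lemma flat_dy: "flat a \<Longrightarrow> dy a = 0"
 unfolding dy_def flat_def by (rule poly_mapping_eqI) (metis in_keys_iff lookup_mlt lookup_zero mult_eq_0_iff of_real_0)

lemma flat_eqI:
 assumes "flat a" "flat b" "\<And>K. lk a (K, 0) = lk b (K, 0)"
 shows "a = b"
proof (rule poly_mapping_eqI)
 fix k
 show "lk a k = lk b k"
 proof (cases "snd k = 0")
  case True
  then show ?thesis using assms(3)[of "fst k"] by (metis prod.collapse)
 next
  case False
  then show ?thesis using assms(1,2) by (metis flat_def in_keys_iff)
 qed
qed

definition harm :: "real \<Rightarrow> wpoly \<Rightarrow> bool" where
 "harm \<tau> t \<longleftrightarrow> (\<forall>k\<in>supp t. snd k = kn \<tau> (fst k))"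

lemma harm_hx [simp]: "harm \<tau> (hx \<tau> t)"
 unfolding harm_def hx_def using keys_gpush by fastforce

lemma z0_hx: "z0 (hx \<tau> t) = z0 t"
 unfolding z0_def hx_def by (subst gpush_gpush) auto

lemma harm_add: "harm \<tau> a \<Longrightarrow> harm \<tau> b \<Longrightarrow> harm \<tau> (a + b)"
 using Poly_Mapping.keys_add by (fastforce simp: harm_def)
lemma harm_0 [simp]: "harm \<tau> 0" by (simp add: harm_def)
lemma harm_mlt: "harm \<tau> a \<Longrightarrow> harm \<tau> (mlt w a)" using keys_mlt by (fastforce simp: harm_def)
lemma harm_uminus: "harm \<tau> a \<Longrightarrow> harm \<tau> (- a)" by (simp add: harm_def keys_minus)
lemma harm_cst_mult: "harm \<tau> a \<Longrightarrow> harm \<tau> (cst c * a)"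
 by (auto simp: harm_def in_keys_iff)

lemma kn_sq: "(kn \<tau> K)^2 = (real_of_int (fst K))^2 + \<tau>^2 * (real_of_int (snd K))^2"
 by (simp add: kn_def)

lemma kn_nonneg [simp]: "0 \<le> kn \<tau> K" by (simp add: kn_def)

text \<open>On harmonic modes the vertical derivative is a Fourier multiplier in X; at y = 0 its
  powers are those of the Dirichlet-Neumann operator of the flat surface.\<close>

lemma harm_dyn: "harm \<tau> t \<Longrightarrow> z0 (dyn j t) = mlt (\<lambda>k. of_real (kn \<tau> (fst k) ^ j)) (z0 t)"
proof -
 assume h: "harm \<tau> t"
 have "dyn j t = mlt (\<lambda>k. of_real (kn \<tau> (fst k) ^ j)) t"
 proof (rule poly_mapping_eqI)
  fix k
  show "lk (dyn j t) k = lk (mlt (\<lambda>k. of_real (kn \<tau> (fst k) ^ j)) t) k"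
   using h by (cases "k \<in> supp t") (simp_all add: harm_def dyn_def in_keys_iff)
 qed
 then show ?thesis by (simp only: z0_mlt[of "\<lambda>K. of_real (kn \<tau> K ^ j)"])
qed

lemma harm_laplace: "harm \<tau> t \<Longrightarrow> d1 (d1 t) + d2 \<tau> (d2 \<tau> t) + dy (dy t) = 0"
proof -
 assume h: "harm \<tau> t"
 show ?thesis
 proof (rule poly_mapping_eqI)
  fix k :: key
  have e: "complex_of_real ((kn \<tau> (fst k))^2) = (of_int (fst (fst k)))^2 + (of_real \<tau>)^2 * (of_int (snd (fst k)))^2"
   by (simp add: kn_sq)
  have "lk (d1 (d1 t) + d2 \<tau> (d2 \<tau> t) + dy (dy t)) k
   = of_real ((snd k)^2 - (kn \<tau> (fst k))^2) * lk t k"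
   unfolding of_real_diff e by (simp add: d1_def d2_def dy_def lookup_add power2_eq_square algebra_simps)
  also have "\<dots> = 0" using h by (auto simp: harm_def in_keys_iff)
  finally show "lk (d1 (d1 t) + d2 \<tau> (d2 \<tau> t) + dy (dy t)) k = lk 0 k" by simp
 qed
qed

text \<open>\<open>s1\<close>, \<open>s2\<close> are the parities in \<open>x\<^sub>1\<close>, \<open>x\<^sub>2\<close>, the condition on \<open>rho\<close> says that
 the function is real, and \<open>D * p\<close> bounds the frequencies occurring at order \<open>p\<close>.\<close>

definition wcls :: "nat \<Rightarrow> int \<Rightarrow> int \<Rightarrow> nat \<Rightarrow> wpoly \<Rightarrow> bool" where
 "wcls D s1 s2 p t \<longleftrightarrow> sg1 t = of_int s1 * t \<and> sg2 t = of_int s2 * t \<and> rho t = t \<and>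
   (\<forall>k\<in>supp t. \<bar>fst (fst k)\<bar> \<le> int (D * p) \<and> \<bar>snd (fst k)\<bar> \<le> int (D * p) \<and>
    even (fst (fst k) + int p) \<and> even (snd (fst k) + int p))"

lemma sg_mult: "sg1 (a * b) = sg1 a * sg1 b" "sg2 (a * b) = sg2 a * sg2 b" "rho (a * b) = rho a * rho b"
 unfolding sg1_def sg2_def rho_def by (rule gpush_mult; auto)+

lemma sg_add: "sg1 (a + b) = sg1 a + sg1 b" "sg2 (a + b) = sg2 a + sg2 b" "rho (a + b) = rho a + rho b"
 unfolding sg1_def sg2_def rho_def by (auto simp: gpush_add)

lemma sg_0 [simp]: "sg1 0 = 0" "sg2 0 = 0" "rho 0 = 0"
 unfolding sg1_def sg2_def rho_def by auto

lemma sg_uminus: "sg1 (- a) = - sg1 a" "sg2 (- a) = - sg2 a" "rho (- a) = - rho a"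
 using sg_add(1)[of a "- a"] sg_add(2)[of a "- a"] sg_add(3)[of a "- a"]
 by (simp_all add: eq_neg_iff_add_eq_0 add.commute)

lemma sg_cst: "sg1 (cst c) = cst c" "sg2 (cst c) = cst c" "rho (cst c) = cst (cnj c)"
 by (simp_all add: sg1_def sg2_def rho_def zero_prod_def)

lemma wcls_0 [simp]: "wcls D s1 s2 p 0"
 by (simp add: wcls_def)

lemma wcls_add: "wcls D s1 s2 p a \<Longrightarrow> wcls D s1 s2 p b \<Longrightarrow> wcls D s1 s2 p (a + b)"
 using Poly_Mapping.keys_add[of a b] by (fastforce simp: wcls_def sg_add algebra_simps)

lemma wcls_uminus: "wcls D s1 s2 p a \<Longrightarrow> wcls D s1 s2 p (- a)"
 by (simp add: wcls_def sg_uminus keys_minus)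

lemma wcls_diff: "wcls D s1 s2 p a \<Longrightarrow> wcls D s1 s2 p b \<Longrightarrow> wcls D s1 s2 p (a - b)"
 using wcls_add[of D s1 s2 p a "- b"] wcls_uminus by simp

lemma wcls_sum: "(\<And>i. i \<in> A \<Longrightarrow> wcls D s1 s2 p (f i)) \<Longrightarrow> wcls D s1 s2 p (sum f A)"
 by (induction A rule: infinite_finite_induct) (auto intro: wcls_add)

text \<open>The classes form a grading: parities multiply and orders add, and both the frequency
  bound D p and the congruence of the frequencies with p respect this.\<close>

lemma wcls_mult:
 assumes a: "wcls D s1 s2 p a" and b: "wcls D t1 t2 q b"
 shows "wcls D (s1 * t1) (s2 * t2) (p + q) (a * b)"
proof -
 have "\<bar>fst (fst k)\<bar> \<le> int (D * (p + q)) \<and> \<bar>snd (fst k)\<bar> \<le> int (D * (p + q)) \<and>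
    even (fst (fst k) + int (p + q)) \<and> even (snd (fst k) + int (p + q))" if k: "k \<in> supp (a * b)" for k
 proof -
  obtain i j where ij: "i \<in> supp a" "j \<in> supp b" "k = i + j"
   using k Poly_Mapping.keys_mult[of a b] by blast
  from a ij(1) have "\<bar>fst (fst i)\<bar> \<le> int (D * p)" "\<bar>snd (fst i)\<bar> \<le> int (D * p)"
    "even (fst (fst i) + int p)" "even (snd (fst i) + int p)" by (auto simp: wcls_def)
  moreover from b ij(2) have "\<bar>fst (fst j)\<bar> \<le> int (D * q)" "\<bar>snd (fst j)\<bar> \<le> int (D * q)"
    "even (fst (fst j) + int q)" "even (snd (fst j) + int q)" by (auto simp: wcls_def)
  moreover have "int (D * (p + q)) = int (D * p) + int (D * q)" by (simp add: algebra_simps)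
  ultimately show ?thesis unfolding ij(3) fst_add snd_add of_nat_add[of p q]
   by (intro conjI) (linarith, linarith, simp_all)
 qed
 moreover have "sg1 (a * b) = of_int (s1 * t1) * (a * b)" "sg2 (a * b) = of_int (s2 * t2) * (a * b)"
   "rho (a * b) = a * b"
  using a b by (simp_all add: wcls_def sg_mult algebra_simps)
 ultimately show ?thesis unfolding wcls_def by blast
qed

lemma wcls_cst: "wcls D 1 1 0 (cst (of_real c))"
 by (auto simp: wcls_def sg_cst split: if_splits)

lemma wcls_cst_mult: "wcls D s1 s2 p t \<Longrightarrow> wcls D s1 s2 p (cst (of_real c) * t)"
 using wcls_mult[OF wcls_cst[of D c], of s1 s2 p t] by simp

lemma mlt_of_int_mult: "mlt w (of_int s * t) = of_int s * mlt w (t :: wpoly)"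
 by (rule poly_mapping_eqI) (simp add: lookup_of_int_mult)

text \<open>\<open>e1\<close> and \<open>e2\<close> are the parities of the symbol, which multiply
  those of the function; the condition with \<open>cnj\<close> keeps real functions real.\<close>

lemma wcls_mlt:
 assumes "wcls D s1 s2 p t"
  and "\<And>n m y. w ((- n, m), y) = of_int e1 * w ((n, m), y)"
  and "\<And>n m y. w ((n, - m), y) = of_int e2 * w ((n, m), y)"
  and "\<And>n m y. cnj (w ((- n, - m), y)) = w ((n, m), y)"
  and "e1 * e1 = 1" "e2 * e2 = 1"
 shows "wcls D (e1 * s1) (e2 * s2) p (mlt w t)"
proof -
 have ee: "of_int e1 * (of_int e1 * x) = x" "of_int e2 * (of_int e2 * x) = x" for x :: complex
  unfolding mult.assoc[symmetric] of_int_mult[symmetric] assms(5,6) by simp_all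
 have m: "mlt (\<lambda>k. of_int e * w k) t = of_int e * mlt w t" for e t
  by (rule poly_mapping_eqI) (simp add: lookup_of_int_mult)
 have 1: "sg1 (mlt w t) = of_int e1 * mlt w (sg1 t)"
  unfolding sg1_def m[symmetric] by (rule gpush_mlt) (auto simp: assms(2) ee)
 have 2: "sg2 (mlt w t) = of_int e2 * mlt w (sg2 t)"
  unfolding sg2_def m[symmetric] by (rule gpush_mlt) (auto simp: assms(3) ee)
 have 3: "rho (mlt w t) = mlt w (rho t)"
  unfolding rho_def
 proof (rule gpush_mlt)
  fix k
  show "cnj (w k) = w ((- fst (fst k), - snd (fst k)), snd k)"
   using assms(4)[of "- fst (fst k)" "- snd (fst k)" "snd k"] by simp
 qed auto
 show ?thesis
  using assms(1) keys_mlt[of w t]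
  by (auto simp: wcls_def 1 2 3 mlt_of_int_mult mult.assoc)
qed

lemma wcls_d1: "wcls D s1 s2 p t \<Longrightarrow> wcls D (- s1) s2 p (d1 t)"
 using wcls_mlt[of D s1 s2 p t "\<lambda>k. \<i> * of_int (fst (fst k))" "-1" 1] by (simp add: d1_def)
lemma wcls_d2: "wcls D s1 s2 p t \<Longrightarrow> wcls D s1 (- s2) p (d2 \<tau> t)"
 using wcls_mlt[of D s1 s2 p t "\<lambda>k. \<i> * of_real \<tau> * of_int (snd (fst k))" 1 "-1"] by (simp add: d2_def)
lemma wcls_dyn: "wcls D s1 s2 p t \<Longrightarrow> wcls D s1 s2 p (dyn j t)"
 using wcls_mlt[of D s1 s2 p t "\<lambda>k. of_real (snd k ^ j)" 1 1] by (simp add: dyn_def)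
lemma wcls_dy: "wcls D s1 s2 p t \<Longrightarrow> wcls D s1 s2 p (dy t)"
 using wcls_dyn[of D s1 s2 p t "Suc 0"] by (simp add: dyn_1)

lemma wcls_gpush_snd:
 assumes "wcls D s1 s2 p t" and "\<And>n m. f (- n, m) = f (n, m)" "\<And>n m. f (n, - m) = f (n, m)"
 shows "wcls D s1 s2 p (gpush (\<lambda>k. (fst k, f (fst k))) (\<lambda>c. c) t)"
proof -
 let ?g = "gpush (\<lambda>k. (fst k, f (fst k))) (\<lambda>c. c)"
 have 1: "sg1 (?g t) = ?g (sg1 t)" "sg2 (?g t) = ?g (sg2 t)" "rho (?g t) = ?g (rho t)"
  unfolding sg1_def sg2_def rho_def by (subst (1 2) gpush_gpush; simp add: assms(2,3))+
 have 2: "?g (of_int s * t) = of_int s * ?g t" for s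
 proof -
  have "?g (cst c * t) = cst c * ?g t" for c
  proof (induction t rule: poly_mapping_induct)
   case (single k d)
   then show ?case by (simp add: mult_single)
  qed (simp add: gpush_add algebra_simps)
  from this[of "of_int s"] show ?thesis by (simp only: single_of_int)
 qed
 show ?thesis using assms(1) keys_gpush[of "\<lambda>k. (fst k, f (fst k))" "\<lambda>c. c" t]
  by (fastforce simp: wcls_def 1 2)
qed

lemma wcls_z0: "wcls D s1 s2 p t \<Longrightarrow> wcls D s1 s2 p (z0 t)"
 unfolding z0_def by (rule wcls_gpush_snd) auto
lemma wcls_hx: "wcls D s1 s2 p t \<Longrightarrow> wcls D s1 s2 p (hx \<tau> t)"
 unfolding hx_def by (rule wcls_gpush_snd) (auto simp: kn_def)

lemma wcls_mono:
 assumes "wcls D s1 s2 p t" "D \<le> D'"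
 shows "wcls D' s1 s2 p t"
proof -
 have "int (D * p) \<le> int (D' * p)" using assms(2) by (simp only: of_nat_le_iff mult_le_mono1)
 then show ?thesis using assms(1) unfolding wcls_def by (meson order_trans)
qed

text \<open>Oddness in x1 makes the coefficients at n and -n opposite, so those at n = 0 vanish. For
  the potential this is a spectral gap: it yields the decay at depth and the uniform constant of the
  elliptic estimate.\<close>

lemma wcls_odd:
 assumes "wcls D (-1) s2 p t" "k \<in> supp t"
 shows "fst (fst k) \<noteq> 0"
proof
 assume 0: "fst (fst k) = 0"
 have "lk (sg1 t) k = lk t ((- fst (fst k), snd (fst k)), snd k)"
  unfolding sg1_def by (rule lookup_gpush_invol) auto
 also have "\<dots> = lk t k" using 0 by (metis minus_zero prod.collapse)
 finally have "lk t k = - lk t k"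
  using assms(1) by (simp add: wcls_def lookup_of_int_mult)
 then show False using assms(2) by (simp add: in_keys_iff eq_neg_iff_add_eq_0)
qed

lemma wcls_lookup_sg1:
 assumes "wcls D s1 s2 p t"
 shows "lk t ((- n, m), y) = of_int s1 * lk t ((n, m), y)"
proof -
 have "lk (sg1 t) ((n, m), y) = lk t ((- n, m), y)"
  unfolding sg1_def by (subst lookup_gpush_invol) auto
 then show ?thesis using assms by (simp add: wcls_def lookup_of_int_mult)
qed

lemma wcls_lookup_sg2:
 assumes "wcls D s1 s2 p t"
 shows "lk t ((n, - m), y) = of_int s2 * lk t ((n, m), y)"
proof -
 have "lk (sg2 t) ((n, m), y) = lk t ((n, - m), y)"
  unfolding sg2_def by (subst lookup_gpush_invol) auto
 then show ?thesis using assms by (simp add: wcls_def lookup_of_int_mult)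
qed

text \<open>Reflecting both variables leads to the opposite frequency, where reality prescribes the
  conjugate coefficient. Hence every coefficient is real or purely imaginary, according to the
  parities; this is why the amplitudes fitted later are real.\<close>

lemma wcls_lookup_rho:
 assumes "wcls D s1 s2 p t"
 shows "cnj (lk t ((n, m), y)) = of_int (s1 * s2) * lk t ((n, m), y)"
proof -
 have "lk (rho t) ((- n, - m), y) = cnj (lk t ((n, m), y))"
  unfolding rho_def by (subst lookup_gpush_invol) auto
 moreover have "rho t = t" using assms by (simp add: wcls_def)
 ultimately have "cnj (lk t ((n, m), y)) = lk t ((- n, - m), y)"
  by simp
 also have "\<dots> = of_int (s1 * s2) * lk t ((n, m), y)"
  by (simp only: wcls_lookup_sg1[OF assms] wcls_lookup_sg2[OF assms] of_int_mult ac_simps)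
 finally show ?thesis .
qed

definition wCl :: "nat \<Rightarrow> int \<Rightarrow> int \<Rightarrow> wpoly fps \<Rightarrow> bool" where
 "wCl D s1 s2 a \<longleftrightarrow> (\<forall>p. wcls D s1 s2 p (a $ p))"

lemma wCl_add: "wCl D s1 s2 a \<Longrightarrow> wCl D s1 s2 b \<Longrightarrow> wCl D s1 s2 (a + b)"
 by (simp add: wCl_def wcls_add)
lemma wCl_diff: "wCl D s1 s2 a \<Longrightarrow> wCl D s1 s2 b \<Longrightarrow> wCl D s1 s2 (a - b)"
 by (simp add: wCl_def wcls_diff)
lemma wCl_0 [simp]: "wCl D s1 s2 0"
 by (simp add: wCl_def)

lemma wCl_mult:
 assumes "wCl D s1 s2 a" "wCl D t1 t2 b" "r1 = s1 * t1" "r2 = s2 * t2"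
 shows "wCl D r1 r2 (a * b)"
proof -
 have "wcls D (s1 * t1) (s2 * t2) p (a $ i * b $ (p - i))" if "i \<in> {0..p}" for p i
  using wcls_mult[of D s1 s2 i "a $ i" t1 t2 "p - i" "b $ (p - i)"] assms that by (simp add: wCl_def)
 then show ?thesis using assms(3,4) by (auto simp: wCl_def fps_mult_nth intro: wcls_sum)
qed

lemma wCl_fcst: "wCl D 1 1 (fcst (of_real c))"
 by (simp add: wCl_def wcls_cst)

lemma wCl_fcst_mult: "wCl D s1 s2 a \<Longrightarrow> wCl D s1 s2 (fcst (of_real c) * a)"
 by (rule wCl_mult[OF wCl_fcst]) auto

lemma wCl_power: "wCl D 1 1 a \<Longrightarrow> wCl D 1 1 (a ^ n)"
proof (induction n)
 case 0
 have "(1 :: wpoly fps) = fcst (of_real 1)" by simp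
 then show ?case using wCl_fcst[of D 1] by simp
next
 case (Suc n)
 then show ?case by (auto intro: wCl_mult)
qed

lemma wCl_d1: "wCl D s1 s2 a \<Longrightarrow> wCl D (- s1) s2 (fm d1 a)" by (simp add: wCl_def wcls_d1)
lemma wCl_d2: "wCl D s1 s2 a \<Longrightarrow> wCl D s1 (- s2) (fm (d2 \<tau>) a)" by (simp add: wCl_def wcls_d2)
lemma wCl_dy: "wCl D s1 s2 a \<Longrightarrow> wCl D s1 s2 (fm dy a)" by (simp add: wCl_def wcls_dy)
lemma wCl_dyn: "wCl D s1 s2 a \<Longrightarrow> wCl D s1 s2 (fm (dyn j) a)" by (simp add: wCl_def wcls_dyn)
lemma wCl_z0: "wCl D s1 s2 a \<Longrightarrow> wCl D s1 s2 (fm z0 a)" by (simp add: wCl_def wcls_z0)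

lemma wCl_mono: "wCl D s1 s2 a \<Longrightarrow> D \<le> D' \<Longrightarrow> wCl D' s1 s2 a"
 by (auto simp: wCl_def intro: wcls_mono)

lemma wCl_Sub:
 assumes "wCl D 1 1 \<eta>" "wCl D s1 s2 \<phi>"
 shows "wCl D s1 s2 (Sub \<eta> \<phi>)"
proof -
 have "wCl D s1 s2 (fcst (1 / fact j) * \<eta> ^ j * fm (dyn j) \<phi>)" for j
  using wCl_mult[OF wCl_fcst_mult[OF wCl_power[OF assms(1)], of "1 / fact j" j] wCl_dyn[OF assms(2), of j]]
  by simp
 then have "wCl D s1 s2 (SubT M \<eta> \<phi>)" for M
  unfolding SubT_def wCl_def fps_sum_nth by (auto intro: wcls_sum)
 then show ?thesis by (simp add: wCl_def Sub_def)
qed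

section \<open>Velocity on the surface and the two boundary conditions\<close>

definition A1 :: "wpoly fps \<Rightarrow> wpoly fps \<Rightarrow> wpoly fps" where
 "A1 \<eta> \<phi> = fm z0 (Sub \<eta> (fm d1 \<phi>))"
definition A2 :: "real \<Rightarrow> wpoly fps \<Rightarrow> wpoly fps \<Rightarrow> wpoly fps" where
 "A2 \<tau> \<eta> \<phi> = fm z0 (Sub \<eta> (fm (d2 \<tau>) \<phi>))"
definition A3 :: "wpoly fps \<Rightarrow> wpoly fps \<Rightarrow> wpoly fps" where
 "A3 \<eta> \<phi> = fm z0 (Sub \<eta> (fm dy \<phi>))"

text \<open>The kinematic and the Bernoulli condition on the surface, in terms of the potential \<open>\<phi>\<close>
 rather than of its trace.\<close>

definition E1 :: "real \<Rightarrow> wpoly fps \<Rightarrow> wpoly fps \<Rightarrow> wpoly fps" where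
 "E1 \<tau> \<eta> \<phi> = A3 \<eta> \<phi> - fm d1 \<eta> * A1 \<eta> \<phi> - fm (d2 \<tau>) \<eta> * A2 \<tau> \<eta> \<phi> - fm d1 \<eta>"
definition E2 :: "real \<Rightarrow> wpoly fps \<Rightarrow> wpoly fps \<Rightarrow> wpoly fps \<Rightarrow> wpoly fps" where
 "E2 \<tau> \<mu> \<eta> \<phi> = A1 \<eta> \<phi> + fcst (1/2) * ((A1 \<eta> \<phi>)^2 + (A2 \<tau> \<eta> \<phi>)^2 + (A3 \<eta> \<phi>)^2) + \<mu> * \<eta>"

lemma wCl_A:
 assumes "wCl D 1 1 \<eta>" "wCl D (-1) 1 \<phi>"
 shows "wCl D 1 1 (A1 \<eta> \<phi>)" "wCl D (-1) (-1) (A2 \<tau> \<eta> \<phi>)" "wCl D (-1) 1 (A3 \<eta> \<phi>)"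
 using wCl_d1[OF assms(2)] wCl_d2[OF assms(2)] wCl_dy[OF assms(2)] assms(1)
 by (auto simp: A1_def A2_def A3_def intro!: wCl_z0 wCl_Sub)

lemma wCl_E1:
 assumes "wCl D 1 1 \<eta>" "wCl D (-1) 1 \<phi>"
 shows "wCl D (-1) 1 (E1 \<tau> \<eta> \<phi>)"
proof -
 have "wCl D (-1) 1 (fm d1 \<eta> * A1 \<eta> \<phi>)" "wCl D (-1) 1 (fm (d2 \<tau>) \<eta> * A2 \<tau> \<eta> \<phi>)"
  by (rule wCl_mult[OF wCl_d1[OF assms(1)] wCl_A(1)[OF assms]]; simp)
    (rule wCl_mult[OF wCl_d2[OF assms(1)] wCl_A(2)[OF assms]]; simp)
 then show ?thesis
  unfolding E1_def using wCl_A(3)[OF assms] wCl_d1[OF assms(1)] by (intro wCl_diff)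
qed

lemma wCl_E2:
 assumes "wCl D 1 1 \<eta>" "wCl D (-1) 1 \<phi>" "wCl D 1 1 \<mu>"
 shows "wCl D 1 1 (E2 \<tau> \<mu> \<eta> \<phi>)"
proof -
 have "wCl D 1 1 ((A1 \<eta> \<phi>)^2)"
  unfolding power2_eq_square by (rule wCl_mult[OF wCl_A(1)[OF assms(1,2)] wCl_A(1)[OF assms(1,2)]]) auto
 moreover have "wCl D 1 1 ((A2 \<tau> \<eta> \<phi>)^2)"
  unfolding power2_eq_square by (rule wCl_mult[OF wCl_A(2)[OF assms(1,2)] wCl_A(2)[OF assms(1,2)]]) auto
 moreover have "wCl D 1 1 ((A3 \<eta> \<phi>)^2)"
  unfolding power2_eq_square by (rule wCl_mult[OF wCl_A(3)[OF assms(1,2)] wCl_A(3)[OF assms(1,2)]]) auto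
 moreover have "wCl D 1 1 (\<mu> * \<eta>)"
  by (rule wCl_mult[OF assms(3,1)]) auto
 ultimately show ?thesis
  unfolding E2_def using wCl_A(1)[OF assms(1,2)] wCl_fcst_mult[of D 1 1 _ "1/2"]
  by (auto intro!: wCl_add)
qed

lemma flat_fm_mult: "(\<And>p. flat (a $ p)) \<Longrightarrow> (\<And>p. flat (b $ p)) \<Longrightarrow> flat ((a * b) $ p)"
 by (auto simp: fps_mult_nth intro: flat_sum flat_mult)

lemma flat_A: "flat (A1 \<eta> \<phi> $ p)" "flat (A2 \<tau> \<eta> \<phi> $ p)" "flat (A3 \<eta> \<phi> $ p)"
 by (simp_all add: A1_def A2_def A3_def)

lemma flat_d: "flat t \<Longrightarrow> flat (d1 t)" "flat t \<Longrightarrow> flat (d2 \<tau> t)"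
 by (simp_all add: d1_def d2_def flat_mlt)

lemma flat_E1: "(\<And>p. flat (\<eta> $ p)) \<Longrightarrow> flat (E1 \<tau> \<eta> \<phi> $ p)"
 unfolding E1_def fps_sub_nth by (intro flat_diff flat_A flat_fm_mult) (auto simp: flat_A flat_d)

lemma flat_fcst: "flat (fcst c $ p)"
 by (cases p) auto

lemma flat_E2: "(\<And>p. flat (\<eta> $ p)) \<Longrightarrow> (\<And>p. flat (\<mu> $ p)) \<Longrightarrow> flat (E2 \<tau> \<mu> \<eta> \<phi> $ p)"
 unfolding E2_def power2_eq_square fps_add_nth
 by (intro flat_add flat_A flat_fm_mult flat_fcst; (simp only: fps_add_nth)?)
   (intro flat_add flat_A flat_fm_mult; assumption)+

section \<open>Formal solution\<close>

lemma fm_perturb: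
 assumes "f 0 = 0" "\<And>x y. f (x + y) = f x + f y"
 shows "fm f (a + fps_X ^ p * fps_const c) = fm f a + fps_X ^ p * fps_const (f (c :: wpoly) :: wpoly)"
 by (rule fps_ext) (use assms in \<open>auto simp: fps_X_power_mult_nth\<close>)

lemma fcong_add_X_power: "fcong p (a + fps_X ^ p * c) a"
 by (simp add: fcong_iff fps_X_power_mult_nth)

lemma Sub_nth_0: "\<phi> $ 0 = 0 \<Longrightarrow> Sub \<eta> \<phi> $ 0 = 0"
 by (simp add: Sub_def SubT_def)

lemma A_nth_0: "\<phi> $ 0 = 0 \<Longrightarrow> A1 \<eta> \<phi> $ 0 = 0" "\<phi> $ 0 = 0 \<Longrightarrow> A2 \<tau> \<eta> \<phi> $ 0 = 0" "\<phi> $ 0 = 0 \<Longrightarrow> A3 \<eta> \<phi> $ 0 = 0"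
 by (simp_all add: A1_def A2_def A3_def Sub_nth_0)

lemma A_perturb:
 fixes a b :: wpoly
 assumes "\<eta> $ 0 = 0" "\<phi> $ 0 = 0" "p \<ge> 1"
 defines "\<eta>' \<equiv> \<eta> + fps_X ^ p * fps_const b" and "\<phi>' \<equiv> \<phi> + fps_X ^ p * fps_const a"
 shows "fcong (Suc p) (A1 \<eta>' \<phi>') (A1 \<eta> \<phi> + fps_X ^ p * fps_const (z0 (d1 a)))"
  "fcong (Suc p) (A2 \<tau> \<eta>' \<phi>') (A2 \<tau> \<eta> \<phi> + fps_X ^ p * fps_const (z0 (d2 \<tau> a)))"
  "fcong (Suc p) (A3 \<eta>' \<phi>') (A3 \<eta> \<phi> + fps_X ^ p * fps_const (z0 (dy a)))"
proof -
 have *: "fcong (Suc p) (fm z0 (Sub \<eta>' (fm f \<phi>'))) (fm z0 (Sub \<eta> (fm f \<phi>)) + fps_X ^ p * fps_const (z0 (f a)))"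
  if f: "f 0 = 0" "\<And>x y. f (x + y) = f x + f y" for f
 proof -
  have "fcong (Suc p) (Sub \<eta>' (fm f \<phi>')) (Sub \<eta> (fm f \<phi>) + fps_X ^ p * fps_const (f a))"
   unfolding \<eta>'_def \<phi>'_def fm_perturb[of f, OF f] by (rule Sub_perturb1) (use assms f in auto)
  from fcong_fm[OF this, of z0] show ?thesis
   by (simp add: fm_perturb z0_add)
 qed
 show "fcong (Suc p) (A1 \<eta>' \<phi>') (A1 \<eta> \<phi> + fps_X ^ p * fps_const (z0 (d1 a)))"
  "fcong (Suc p) (A2 \<tau> \<eta>' \<phi>') (A2 \<tau> \<eta> \<phi> + fps_X ^ p * fps_const (z0 (d2 \<tau> a)))"
  "fcong (Suc p) (A3 \<eta>' \<phi>') (A3 \<eta> \<phi> + fps_X ^ p * fps_const (z0 (dy a)))"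
  unfolding A1_def A2_def A3_def by (rule *; simp add: d1_add d2_add dy_add)+
qed

text \<open>At order p the linearisation at rest appears, with \<mu> frozen at its constant term.
  The products of velocities and slopes in \<open>E1\<close> and \<open>E2\<close> have two factors
  vanishing at \<epsilon> = 0 and therefore react only at order p + 1.\<close>

lemma E_perturb:
 fixes a b :: wpoly
 assumes "\<eta> $ 0 = 0" "\<phi> $ 0 = 0" "p \<ge> 1"
 defines "\<eta>' \<equiv> \<eta> + fps_X ^ p * fps_const b" and "\<phi>' \<equiv> \<phi> + fps_X ^ p * fps_const a"
 shows "fcong (Suc p) (E1 \<tau> \<eta>' \<phi>') (E1 \<tau> \<eta> \<phi> + fps_X ^ p * fps_const (z0 (dy a) - d1 b))" (is ?t1)
  "fcong (Suc p) (E2 \<tau> \<mu> \<eta>' \<phi>') (E2 \<tau> \<mu> \<eta> \<phi> + fps_X ^ p * fps_const (z0 (d1 a) + \<mu> $ 0 * b))" (is ?t2)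
proof -
 note A = A_perturb[OF assms(1-3), where a = a and b = b, folded \<eta>'_def \<phi>'_def]
 have phi0: "\<phi>' $ 0 = 0" using assms by (simp add: fps_X_power_mult_nth)
 have Ap: "fcong p (A1 \<eta>' \<phi>') (A1 \<eta> \<phi>)" "fcong p (A2 \<tau> \<eta>' \<phi>') (A2 \<tau> \<eta> \<phi>)" "fcong p (A3 \<eta>' \<phi>') (A3 \<eta> \<phi>)"
  using A by (auto simp: fcong_iff fps_X_power_mult_nth)
 have de: "fm d1 \<eta>' = fm d1 \<eta> + fps_X ^ p * fps_const (d1 b)" "fm (d2 \<tau>) \<eta>' = fm (d2 \<tau>) \<eta> + fps_X ^ p * fps_const (d2 \<tau> b)"
  unfolding \<eta>'_def by (simp_all add: fm_perturb d1_add d2_add)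
 \<comment> \<open>If both factors vanish at \<epsilon> = 0, a change of order p in either changes
   the product only at order p + 1.\<close>
 have m: "fcong (Suc p) (e' * B') (e * B)"
  if "fcong p e' e" "fcong p B' B" "e $ 0 = 0" "B' $ 0 = 0" for e e' B B' :: "wpoly fps"
 proof -
  have "fps_X ^ p * fps_X dvd (e' - e) * B'" "fps_X * fps_X ^ p dvd e * (B' - B)"
   using that by (intro mult_dvd_mono; auto simp: fcong_def fps_X_dvd)+
  then have "fps_X ^ Suc p dvd (e' - e) * B' + e * (B' - B)"
   by (simp add: mult.commute dvd_add)
  then show ?thesis by (simp add: fcong_def algebra_simps)
 qed
 have B1: "fcong (Suc p) (fm d1 \<eta>' * A1 \<eta>' \<phi>') (fm d1 \<eta> * A1 \<eta> \<phi>)"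
  and B2: "fcong (Suc p) (fm (d2 \<tau>) \<eta>' * A2 \<tau> \<eta>' \<phi>') (fm (d2 \<tau>) \<eta> * A2 \<tau> \<eta> \<phi>)"
  by (rule m; use Ap assms(1) phi0 de in \<open>auto simp: A_nth_0 fcong_add_X_power\<close>)+
 have "fcong (Suc p) (E1 \<tau> \<eta>' \<phi>') (A3 \<eta> \<phi> + fps_X ^ p * fps_const (z0 (dy a)) - fm d1 \<eta> * A1 \<eta> \<phi>
   - fm (d2 \<tau>) \<eta> * A2 \<tau> \<eta> \<phi> - (fm d1 \<eta> + fps_X ^ p * fps_const (d1 b)))"
  unfolding E1_def using A B1 B2 de by (intro fcong_diff) auto
 also have "\<dots> = E1 \<tau> \<eta> \<phi> + fps_X ^ p * fps_const (z0 (dy a) - d1 b)"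
  by (simp add: E1_def algebra_simps flip: fps_const_sub)
 finally show ?t1 .
 have sq: "fcong (Suc p) (B'\<^sup>2) (B^2)" if "fcong p B' B" "B $ 0 = 0" "B' $ 0 = 0" for B B' :: "wpoly fps"
  unfolding power2_eq_square by (rule m) (use that in auto)
 have S: "fcong (Suc p) ((A1 \<eta>' \<phi>')^2 + (A2 \<tau> \<eta>' \<phi>')^2 + (A3 \<eta>' \<phi>')^2) ((A1 \<eta> \<phi>)^2 + (A2 \<tau> \<eta> \<phi>)^2 + (A3 \<eta> \<phi>)^2)"
  by (intro fcong_add sq) (use Ap assms(2) phi0 in \<open>auto simp: A_nth_0\<close>)
 have M: "fcong (Suc p) (\<mu> * \<eta>') (\<mu> * \<eta> + fps_X ^ p * fps_const (\<mu> $ 0 * b))"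
 proof -
  have "fcong (Suc p) (\<mu> * (fps_X ^ p * fps_const b)) (fps_X ^ p * fps_const (\<mu> $ 0 * b))"
   by (auto simp: fcong_iff fps_X_power_mult_nth mult.left_commute[of \<mu>] less_Suc_eq)
  then show ?thesis unfolding \<eta>'_def distrib_left by (intro fcong_add) auto
 qed
 have "fcong (Suc p) (E2 \<tau> \<mu> \<eta>' \<phi>') (A1 \<eta> \<phi> + fps_X ^ p * fps_const (z0 (d1 a))
   + fcst (1/2) * ((A1 \<eta> \<phi>)^2 + (A2 \<tau> \<eta> \<phi>)^2 + (A3 \<eta> \<phi>)^2) + (\<mu> * \<eta> + fps_X ^ p * fps_const (\<mu> $ 0 * b)))"
  unfolding E2_def by (rule fcong_add[OF fcong_add[OF A(1) fcong_mult[OF fcong_refl S]] M])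
 also have "\<dots> = E2 \<tau> \<mu> \<eta> \<phi> + fps_X ^ p * fps_const (z0 (d1 a) + \<mu> $ 0 * b)"
  by (simp add: E2_def algebra_simps flip: fps_const_add)
 finally show ?t2 .
qed

lemma E2_perturb_mu: "E2 \<tau> (\<mu> + c) \<eta> \<phi> = E2 \<tau> \<mu> \<eta> \<phi> + c * \<eta>"
 by (simp add: E2_def algebra_simps)

lemma lookup_d1: "lk (d1 t) ((n, m), y) = \<i> * of_int n * lk t ((n, m), y)"
 and lookup_d2: "lk (d2 \<tau> t) ((n, m), y) = \<i> * of_real \<tau> * of_int m * lk t ((n, m), y)"
 by (simp_all add: d1_def d2_def)

lemma kn_sym [simp]: "kn \<tau> (- n, m) = kn \<tau> (n, m)" "kn \<tau> (n, - m) = kn \<tau> (n, m)"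
 by (simp_all add: kn_def)

text \<open>Each horizontal frequency gives a 2 x 2 system with determinant \<mu> |K| - n^2, where
  |K| = \<open>kn \<tau> K\<close>. Its zeros are the resonant modes, and \<open>res\<close> is the
  solvability condition there. The last conclusion records that no frequency is created, which
  confines the sidebands of the inserted wave.\<close>

lemma linear_solve_support:
 assumes \<mu>: "\<mu> \<noteq> 0"
  and R1: "wcls D (-1) 1 p R1" "flat R1" and R2: "wcls D 1 1 p R2" "flat R2"
  and res: "\<And>n m. n \<noteq> 0 \<Longrightarrow> \<mu> * kn \<tau> (n, m) = (of_int n)^2 \<Longrightarrow>
    of_real \<mu> * lk R1 ((n, m), 0) + \<i> * of_int n * lk R2 ((n, m), 0) = 0"
 obtains a b where "wcls D (-1) 1 p a" "harm \<tau> a" "wcls D 1 1 p b" "flat b"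
  "z0 (dy a) - d1 b = - R1" "z0 (d1 a) + cst (of_real \<mu>) * b = - R2"
  "\<And>K. lk R1 (K, 0) = 0 \<Longrightarrow> lk R2 (K, 0) = 0 \<Longrightarrow>
    lk (z0 a) (K, 0) = 0 \<and> lk b (K, 0) = 0"
proof -
 define det where "det K = \<mu> * kn \<tau> K - (of_int (fst K))^2" for K
 \<comment> \<open>Cramer's rule. On resonant modes \<open>det\<close> is 0, and division by zero
   returns 0, which selects the solution with vanishing potential there.\<close>
 define a0 where "a0 = mlt (\<lambda>k. of_real (- \<mu> / det (fst k))) R1 + mlt (\<lambda>k. of_real (- 1 / det (fst k))) (d1 R2)"
 define a where "a = hx \<tau> a0"
 define b where "b = cst (of_real (- 1 / \<mu>)) * (R2 + d1 a0)"
 have dets: "det (- n, m) = det (n, m)" "det (n, - m) = det (n, m)" for n m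
  by (simp_all add: det_def)
 have a0: "wcls D (-1) 1 p a0"
  unfolding a0_def
  using wcls_mlt[OF R1(1), of "\<lambda>k. of_real (- \<mu> / det (fst k))" 1 1]
   wcls_mlt[OF wcls_d1[OF R2(1)], of "\<lambda>k. of_real (- 1 / det (fst k))" 1 1]
  by (intro wcls_add) (auto simp: dets)
 have fa0: "flat a0" unfolding a0_def using R1 R2 by (intro flat_add flat_mlt flat_d)
 have b: "wcls D 1 1 p b"
  unfolding b_def using wcls_d1[OF a0] by (intro wcls_cst_mult wcls_add R2) auto
 have fb: "flat b" unfolding b_def using fa0 R2 by (intro flat_mult flat_cst flat_add flat_d)
 have z: "z0 a = a0" by (simp add: a_def z0_hx flat_z0_eq fa0)
 have za: "z0 (dy a) = mlt (\<lambda>k. of_real (kn \<tau> (fst k))) a0"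
  using harm_dyn[of \<tau> a 1] by (simp add: a_def dyn_1 z0_hx flat_z0_eq fa0)
 have eq: "of_real (kn \<tau> K) * lk a0 (K, 0) - lk (d1 b) (K, 0) = - lk R1 (K, 0)"
  "lk (d1 a0) (K, 0) + of_real \<mu> * lk b (K, 0) = - lk R2 (K, 0)" for K
 proof -
  obtain n m where K: "K = (n, m)" by (cases K)
  define r1 r2 where "r1 = lk R1 (K, 0)" "r2 = lk R2 (K, 0)"
  have la: "lk a0 (K, 0) = - (of_real \<mu> * r1 + \<i> * of_int n * r2) / of_real (det K)"
   by (simp add: a0_def lookup_add lookup_d1 K r1_r2_def add_divide_distrib diff_divide_distrib)
  have lb: "lk b (K, 0) = - (r2 + \<i> * of_int n * lk a0 (K, 0)) / of_real \<mu>"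
   by (simp add: b_def lookup_add lookup_d1 K r1_r2_def add_divide_distrib diff_divide_distrib)
  show "lk (d1 a0) (K, 0) + of_real \<mu> * lk b (K, 0) = - lk R2 (K, 0)"
   using \<mu> unfolding lb by (simp add: lookup_d1 K r1_r2_def field_simps)
  have "of_real (kn \<tau> K) * lk a0 (K, 0) - \<i> * of_int n * lk b (K, 0)
    = (of_real (det K) * lk a0 (K, 0) + \<i> * of_int n * r2) / of_real \<mu>"
   using \<mu> unfolding lb by (simp add: det_def K field_simps power2_eq_square)
  also have "\<dots> = - r1"
  proof (cases "det K = 0")
   case False
   then have "of_real (det K) * lk a0 (K, 0) = - (of_real \<mu> * r1 + \<i> * of_int n * r2)"
    unfolding la by simp
   then show ?thesis using \<mu> by simp
  next
   case True
   have "of_real \<mu> * r1 + \<i> * of_int n * r2 = 0"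
   \<comment> \<open>For n = 0 the hypothesis \<open>res\<close> says nothing, but then
     \<open>r1\<close> vanishes by oddness in x1 and the other term carries the factor n.\<close>
   proof (cases "n = 0")
    case True
    have "(K, 0) \<notin> supp R1" using wcls_odd[OF R1(1), of "(K, 0)"] True K by auto
    then show ?thesis using True by (simp add: in_keys_iff r1_r2_def)
   next
    case False
    then show ?thesis using res[of n m] True by (simp add: det_def K r1_r2_def)
   qed
   then show ?thesis using \<mu> True by (simp add: la field_simps eq_neg_iff_add_eq_0)
  qed
  finally show "of_real (kn \<tau> K) * lk a0 (K, 0) - lk (d1 b) (K, 0) = - lk R1 (K, 0)"
   by (simp add: K lookup_d1 r1_r2_def)
 qed
 show ?thesis
 proof (rule that[of a b])
  show "wcls D (-1) 1 p a" unfolding a_def by (rule wcls_hx[OF a0])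
  show "z0 (dy a) - d1 b = - R1"
   by (rule flat_eqI) (use R1 fb eq in \<open>auto simp: lookup_minus za intro!: flat_uminus flat_diff flat_d flat_mlt fa0\<close>)
  show "z0 (d1 a) + cst (of_real \<mu>) * b = - R2"
   by (rule flat_eqI) (use R2 fb eq in \<open>auto simp: lookup_add z0_d1 z intro!: flat_uminus flat_add flat_d flat_mult fa0\<close>)
  show "lk (z0 a) (K, 0) = 0 \<and> lk b (K, 0) = 0"
   if "lk R1 (K, 0) = 0" "lk R2 (K, 0) = 0" for K
   using that by (cases K) (simp add: z a0_def b_def lookup_add lookup_d1)
 qed (auto simp: a_def b fb)
qed

lemma linear_solve:
 assumes "\<mu> \<noteq> 0" "wcls D (-1) 1 p R1" "flat R1" "wcls D 1 1 p R2" "flat R2"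
  and "\<And>n m. n \<noteq> 0 \<Longrightarrow> \<mu> * kn \<tau> (n, m) = (of_int n)^2 \<Longrightarrow>
    of_real \<mu> * lk R1 ((n, m), 0) + \<i> * of_int n * lk R2 ((n, m), 0) = 0"
 obtains a b where "wcls D (-1) 1 p a" "harm \<tau> a" "wcls D 1 1 p b" "flat b"
  "z0 (dy a) - d1 b = - R1" "z0 (d1 a) + cst (of_real \<mu>) * b = - R2"
 by (rule linear_solve_support[where \<tau> = \<tau>, OF assms(1-5)]) (erule assms(6), assumption, rule that)

text \<open>Up to the factor exponential in depth this is 4 c cos(n x1) cos(\<tau> m x2) for s = 1
  and 4 \<i> c sin(n x1) cos(\<tau> m x2) for s = -1. If n or m is 0, keys coincide and their
  coefficients add up.\<close>

definition wv :: "int \<Rightarrow> int \<Rightarrow> int \<Rightarrow> real \<Rightarrow> complex \<Rightarrow> wpoly" where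
 "wv s n m y c = mon ((n, m), y) c + mon ((n, - m), y) c
   + mon ((- n, m), y) (of_int s * c) + mon ((- n, - m), y) (of_int s * c)"

lemma wcls_wv:
 assumes "cnj c = of_int s * c" "s * s = 1" "\<bar>n\<bar> \<le> int (D * p)" "\<bar>m\<bar> \<le> int (D * p)" "even (n + int p)" "even (m + int p)"
 shows "wcls D s 1 p (wv s n m y c)"
proof -
 have ss: "of_int s * (of_int s * x) = x" for x :: complex
  unfolding mult.assoc[symmetric] of_int_mult[symmetric] assms(2) by simp
 have ss0: "complex_of_int s * of_int s = 1" using ss[of 1] by simp
 have m: "of_int s * mon k x = (mon k (of_int s * x) :: wpoly)" for k x
  by (rule poly_mapping_eqI) (simp add: lookup_of_int_mult lookup_single when_def)
 have ck: "cnj (of_int s * c) = c" using ss[of c] by (simp add: assms(1))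
 have "\<bar>fst (fst k)\<bar> \<le> int (D * p) \<and> \<bar>snd (fst k)\<bar> \<le> int (D * p) \<and>
    even (fst (fst k) + int p) \<and> even (snd (fst k) + int p)" if k: "k \<in> supp (wv s n m y c)" for k
 proof -
  have "supp (wv s n m y c) \<subseteq> {((n, m), y), ((n, - m), y), ((- n, m), y), ((- n, - m), y)}"
  proof
   fix x assume "x \<in> supp (wv s n m y c)"
   then show "x \<in> {((n, m), y), ((n, - m), y), ((- n, m), y), ((- n, - m), y)}"
    by (auto simp: wv_def in_keys_iff lookup_add lookup_single when_def split: if_splits)
  qed
  then show ?thesis using k assms(3-6) by auto
 qed
 moreover have "sg1 (wv s n m y c) = of_int s * wv s n m y c" "sg2 (wv s n m y c) = of_int 1 * wv s n m y c"
  by (simp_all add: wv_def sg1_def sg2_def gpush_add distrib_left m ss ss0 ac_simps)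
 moreover have "rho (wv s n m y c) = wv s n m y c"
  by (simp add: wv_def rho_def gpush_add ck assms(1) ss ss0 ac_simps)
 ultimately show ?thesis unfolding wcls_def by blast
qed

lemma harm_wv: "harm \<tau> (wv s n m (kn \<tau> (n, m)) c)"
 unfolding wv_def by (intro harm_add) (auto simp: harm_def kn_def split: if_splits)

lemma flat_wv: "flat (wv s n m 0 c)"
 unfolding wv_def by (intro flat_add) (auto simp: flat_def)

lemma mlt_wv: "(\<And>n m. w (- n, m) = w (n, m)) \<Longrightarrow> (\<And>n m. w (n, - m) = w (n, m)) \<Longrightarrow>
  mlt (\<lambda>k. w (fst k)) (wv s n m y c) = wv s n m y (w (n, m) * c)"
 by (simp add: wv_def mlt_add mlt_single algebra_simps)

lemma d1_wv: "d1 (wv s n m y c) = wv (- s) n m y (\<i> * of_int n * c)"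
 by (simp add: wv_def d1_def mlt_add mlt_single algebra_simps)

lemma z0_wv: "z0 (wv s n m y c) = wv s n m 0 c"
 by (simp add: wv_def z0_add)

lemma dy_wv: "dy (wv s n m y c) = wv s n m y (of_real y * c)"
 by (simp add: wv_def dy_def mlt_add mlt_single algebra_simps)

lemma cst_wv: "cst d * wv s n m y c = wv s n m y (d * c)"
 by (simp add: wv_def distrib_left mult_single algebra_simps)

lemma wv_add: "wv s n m y c + wv s n m y d = wv s n m y (c + d)"
 by (simp add: wv_def single_add algebra_simps)

lemma lookup_wv: "n > 0 \<Longrightarrow> m > 0 \<Longrightarrow> lk (wv s n m y c) ((n, m), y) = c"
 by (simp add: wv_def lookup_add lookup_single when_def)

lemma mu_c_pos: "mu_c \<tau> > 0"
 by (simp add: mu_c_def add_nonneg_eq_0_iff)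

lemma mu_c_sq: "(mu_c \<tau>)^2 * (1 + \<tau>^2) = 1"
proof -
 have p: "1 + \<tau>^2 > 0" by (smt (verit) zero_le_power2)
 have "(mu_c \<tau>)^2 = (1 + \<tau>^2) powr (- 1)"
  by (simp add: mu_c_def power2_eq_square flip: powr_add)
 then show ?thesis using p by (simp add: powr_minus)
qed

lemma mu_c_lt_1: "\<tau> > 0 \<Longrightarrow> mu_c \<tau> < 1"
proof (rule ccontr)
 assume t: "\<tau> > 0" and "\<not> mu_c \<tau> < 1"
 then have "(mu_c \<tau>)^2 \<ge> 1" by simp
 moreover have "1 + \<tau>^2 > 1" using t by simp
 ultimately have "(mu_c \<tau>)^2 * (1 + \<tau>^2) > 1" by (smt (verit) mult_le_cancel_right1)
 then show False using mu_c_sq[of \<tau>] by simp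
qed

lemma kn_1_1: "mu_c \<tau> * kn \<tau> (1, 1) = 1"
proof -
 have "(mu_c \<tau> * kn \<tau> (1, 1))^2 = 1" unfolding power_mult_distrib kn_sq using mu_c_sq[of \<tau>] by simp
 then show ?thesis using mu_c_pos[of \<tau>] kn_nonneg[of \<tau> "(1,1)"]
  by (metis abs_of_nonneg less_eq_real_def mult_nonneg_nonneg power2_eq_1_iff abs_minus_cancel abs_1)
qed

abbreviation cfm :: "real fps \<Rightarrow> wpoly fps" where "cfm \<equiv> fm (\<lambda>x. cst (of_real x))"

text \<open>The quarters compensate the four exponentials of \<open>wv\<close>, and -\<i>/4 turns
  the odd wave into sin x1 cos(\<tau> x2); see \<open>rt_leading\<close>.\<close>

definition eta1 :: "real \<Rightarrow> wpoly" where "eta1 \<tau> = wv 1 1 1 0 (of_real (- 1 / (4 * mu_c \<tau>)))"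
definition phi1 :: "real \<Rightarrow> wpoly" where "phi1 \<tau> = wv (-1) 1 1 (kn \<tau> (1, 1)) (- \<i> / 4)"

text \<open>A polynomial solution of both surface conditions modulo \<epsilon>^M. That
  \<open>m\<close> is even matches the congruence of frequencies with the order: translation by
  \<pi> in x1 amounts to replacing \<epsilon> by -\<epsilon>.\<close>

definition fsol :: "real \<Rightarrow> nat \<Rightarrow> nat \<Rightarrow> wpoly fps \<Rightarrow> wpoly fps \<Rightarrow> real fps \<Rightarrow> bool" where
 "fsol \<tau> D M \<eta> \<phi> m \<longleftrightarrow> wCl D 1 1 \<eta> \<and> wCl D (-1) 1 \<phi> \<and> (\<forall>p. flat (\<eta> $ p)) \<and> (\<forall>p. harm \<tau> (\<phi> $ p)) \<and>
   \<eta> $ 0 = 0 \<and> \<phi> $ 0 = 0 \<and> \<eta> $ 1 = eta1 \<tau> \<and> \<phi> $ 1 = phi1 \<tau> \<and>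
   (\<forall>p\<ge>M. \<eta> $ p = 0 \<and> \<phi> $ p = 0) \<and>
   m $ 0 = mu_c \<tau> \<and> (\<forall>p. odd p \<longrightarrow> m $ p = 0) \<and> (\<forall>p\<ge>M. m $ p = 0) \<and>
   (\<forall>q<M. E1 \<tau> \<eta> \<phi> $ q = 0 \<and> E2 \<tau> (cfm m) \<eta> \<phi> $ q = 0)"

lemma wCl_cfm: "(\<And>p. odd p \<Longrightarrow> m $ p = 0) \<Longrightarrow> wCl D 1 1 (cfm m)"
 unfolding wCl_def
proof
 fix p assume o: "\<And>p. odd p \<Longrightarrow> m $ p = 0"
 show "wcls D 1 1 p (cfm m $ p)"
 proof (cases "even p")
  case True
  then show ?thesis by (auto simp: wcls_def sg_cst split: if_splits)
 next
  case False
  then show ?thesis using o by simp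
 qed
qed

lemma E_0: "E1 \<tau> 0 0 = 0" "E2 \<tau> \<mu> 0 0 = 0"
proof -
 have z: "fm f 0 = (0 :: wpoly fps)" if "f 0 = (0::wpoly)" for f :: "wpoly \<Rightarrow> wpoly"
  by (rule fps_ext) (use that in simp)
 show "E1 \<tau> 0 0 = 0" "E2 \<tau> \<mu> 0 0 = 0" by (simp_all add: E1_def E2_def A1_def A2_def A3_def z)
qed

lemma wv_0 [simp]: "wv s n m y 0 = 0"
 by (simp add: wv_def)

lemma fsol_start: "fsol \<tau> 1 2 (fps_X * fps_const (eta1 \<tau>)) (fps_X * fps_const (phi1 \<tau>)) (fps_const (mu_c \<tau>))"
proof -
 let ?\<mu> = "mu_c \<tau>"
 have \<mu>: "?\<mu> \<noteq> 0" using mu_c_pos[of \<tau>] by simp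
 have k: "complex_of_real (kn \<tau> (1,1)) = of_real (1 / ?\<mu>)"
 proof -
  have "kn \<tau> (1,1) = 1 / ?\<mu>" using kn_1_1[of \<tau>] \<mu> by (simp add: field_simps)
  then show ?thesis by simp
 qed
 have "z0 (dy (phi1 \<tau>)) - d1 (eta1 \<tau>) = wv (-1) 1 1 0 (of_real (kn \<tau> (1,1)) * (- \<i> / 4)) + cst (-1) * wv (-1) 1 1 0 (\<i> * of_real (- 1 / (4 * ?\<mu>)))"
  by (simp add: phi1_def eta1_def dy_wv d1_wv z0_wv single_uminus)
 also have "\<dots> = 0" unfolding cst_wv wv_add k using \<mu> by simp
 finally have L1: "z0 (dy (phi1 \<tau>)) - d1 (eta1 \<tau>) = 0" .
 have "z0 (d1 (phi1 \<tau>)) + cst (of_real ?\<mu>) * eta1 \<tau> = wv 1 1 1 0 (\<i> * (- \<i> / 4) + of_real ?\<mu> * of_real (- 1 / (4 * ?\<mu>)))"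
  by (simp add: phi1_def eta1_def d1_wv z0_wv cst_wv wv_add)
 also have "\<dots> = 0" using \<mu> by simp
 finally have L2: "z0 (d1 (phi1 \<tau>)) + cst (of_real ?\<mu>) * eta1 \<tau> = 0" .
 have cm: "cfm (fps_const ?\<mu>) $ 0 = cst (of_real ?\<mu>)" by simp
 have E: "E1 \<tau> (fps_X * fps_const (eta1 \<tau>)) (fps_X * fps_const (phi1 \<tau>)) $ q = 0"
   "E2 \<tau> (cfm (fps_const ?\<mu>)) (fps_X * fps_const (eta1 \<tau>)) (fps_X * fps_const (phi1 \<tau>)) $ q = 0" if "q < 2" for q
  using E_perturb(1)[where \<eta> = 0 and \<phi> = 0 and p = 1 and \<tau> = \<tau> and b = "eta1 \<tau>" and a = "phi1 \<tau>"]
   E_perturb(2)[where \<eta> = 0 and \<phi> = 0 and p = 1 and \<tau> = \<tau> and b = "eta1 \<tau>" and a = "phi1 \<tau>" and \<mu> = "cfm (fps_const ?\<mu>)"] that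
  unfolding cm L1 L2 by (simp_all add: E_0 fcong_iff)
 have "wcls 1 1 1 1 (eta1 \<tau>)" "wcls 1 (-1) 1 1 (phi1 \<tau>)"
  unfolding eta1_def phi1_def by (rule wcls_wv; simp)+
 moreover have "flat (eta1 \<tau>)" "harm \<tau> (phi1 \<tau>)"
  unfolding eta1_def phi1_def by (rule flat_wv harm_wv)+
 ultimately show ?thesis
  unfolding fsol_def wCl_def using E
  by (auto simp: fps_X_mult_nth split: nat.splits)
qed

text \<open>A new coefficient c of \<mu> at order M - 1 multiplies \<open>eta1\<close> and so acts
  at order M; \<open>res\<close> is the solvability of the system of order M including this
  contribution. Requiring c = 0 for even M keeps \<mu> even.\<close>

lemma fsol_step:
 assumes F: "fsol \<tau> D M \<eta> \<phi> m" and M: "M \<ge> 2" and c: "even M \<Longrightarrow> c = 0"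
  and res: "\<And>a b. a \<noteq> 0 \<Longrightarrow> mu_c \<tau> * kn \<tau> (a, b) = (of_int a)^2 \<Longrightarrow>
    of_real (mu_c \<tau>) * lk (E1 \<tau> \<eta> \<phi> $ M) ((a, b), 0) + \<i> * of_int a *
    (lk (E2 \<tau> (cfm m) \<eta> \<phi> $ M) ((a, b), 0) + of_real c * lk (eta1 \<tau>) ((a, b), 0)) = 0"
 obtains a b where "fsol \<tau> D (Suc M) (\<eta> + fps_X ^ M * fps_const b) (\<phi> + fps_X ^ M * fps_const a) (m + fps_X ^ (M - 1) * fps_const c)"
proof -
 define R1 where "R1 = E1 \<tau> \<eta> \<phi> $ M"
 define R2 where "R2 = E2 \<tau> (cfm m) \<eta> \<phi> $ M + cst (of_real c) * eta1 \<tau>"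
 from F have cl: "wCl D 1 1 \<eta>" "wCl D (-1) 1 \<phi>" and fl: "\<And>p. flat (\<eta> $ p)" and ha: "\<And>p. harm \<tau> (\<phi> $ p)"
  and z: "\<eta> $ 0 = 0" "\<phi> $ 0 = 0" and one: "\<eta> $ 1 = eta1 \<tau>" "\<phi> $ 1 = phi1 \<tau>"
  and hi: "\<And>p. p \<ge> M \<Longrightarrow> \<eta> $ p = 0 \<and> \<phi> $ p = 0" "\<And>p. p \<ge> M \<Longrightarrow> m $ p = 0" and m0: "m $ 0 = mu_c \<tau>" and mo: "\<And>p. odd p \<Longrightarrow> m $ p = 0"
  and Z: "\<And>q. q < M \<Longrightarrow> E1 \<tau> \<eta> \<phi> $ q = 0" "\<And>q. q < M \<Longrightarrow> E2 \<tau> (cfm m) \<eta> \<phi> $ q = 0"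
  by (auto simp: fsol_def)
 have e1c: "wcls D 1 1 1 (eta1 \<tau>)" using cl(1) unfolding wCl_def one(1)[symmetric] by blast
 have cR: "wcls D 1 1 M (cst (of_real c) * eta1 \<tau>)"
 proof (cases "even M")
  case True
  then show ?thesis using c by simp
 next
  case False
  have "wcls D 1 1 (M - 1 + 1) (cst (of_real c) * eta1 \<tau>)"
  proof -
   have "wcls D 1 1 (M - 1) (cst (of_real c))"
    using False by (auto simp: wcls_def sg_cst split: if_splits)
   from wcls_mult[OF this e1c] show ?thesis by simp
  qed
  then show ?thesis using M by simp
 qed
 have c1: "wcls D (-1) 1 M R1" using wCl_E1[OF cl] by (simp add: wCl_def R1_def)
 have c2: "wcls D 1 1 M R2"
  unfolding R2_def using wCl_E2[OF cl wCl_cfm[OF mo]] cR by (intro wcls_add) (auto simp: wCl_def)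
 have f1: "flat R1" unfolding R1_def by (rule flat_E1[OF fl])
 have fe: "flat (eta1 \<tau>)" using fl[of 1] one by simp
 have f2: "flat R2" unfolding R2_def by (intro flat_add flat_E2 flat_mult flat_cst fe fl) simp
 obtain a b where ab: "wcls D (-1) 1 M a" "harm \<tau> a" "wcls D 1 1 M b" "flat b"
  "z0 (dy a) - d1 b = - R1" "z0 (d1 a) + cst (of_real (mu_c \<tau>)) * b = - R2"
 proof (rule linear_solve[of "mu_c \<tau>", OF _ c1 f1 c2 f2])
  show "mu_c \<tau> \<noteq> 0" using mu_c_pos[of \<tau>] by simp
 next
  fix x y :: int assume "x \<noteq> 0" "mu_c \<tau> * kn \<tau> (x, y) = (of_int x)^2"
  from res[OF this] show "of_real (mu_c \<tau>) * lk R1 ((x, y), 0) + \<i> * of_int x * lk R2 ((x, y), 0) = 0"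
   by (simp add: R1_def R2_def lookup_add)
 qed
 let ?\<eta> = "\<eta> + fps_X ^ M * fps_const b" and ?\<phi> = "\<phi> + fps_X ^ M * fps_const a"
 let ?m = "m + fps_X ^ (M - 1) * fps_const c"
 have M1: "1 \<le> M" using M by simp
 have cm: "cfm ?m = cfm m + fps_X ^ (M - 1) * fcst (of_real c)"
  by (rule fps_ext) (simp add: fps_X_power_mult_nth single_add)
 note P = E_perturb(1)[OF z M1, where \<tau> = \<tau> and a = a and b = b]
  E_perturb(2)[OF z M1, where \<tau> = \<tau> and a = a and b = b and \<mu> = "cfm m"]
 have Z1: "E1 \<tau> ?\<eta> ?\<phi> $ q = 0" if "q < Suc M" for q
  using P(1) that Z(1) ab(5) by (auto simp: fcong_iff fps_X_power_mult_nth R1_def less_Suc_eq)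
 have Z2: "E2 \<tau> (cfm ?m) ?\<eta> ?\<phi> $ q = 0" if q: "q < Suc M" for q
 proof -
  have "(fps_X ^ (M - 1) * (fcst (of_real c) * ?\<eta>)) $ q = (if q = M then cst (of_real c) * eta1 \<tau> else 0)"
   using q M z one by (auto simp: fps_X_power_mult_nth less_Suc_eq)
  moreover have "E2 \<tau> (cfm m) ?\<eta> ?\<phi> $ q = (if q = M then - (cst (of_real c) * eta1 \<tau>) else 0)"
   using P(2) q Z(2) ab(6) m0 by (auto simp: fcong_iff fps_X_power_mult_nth R2_def less_Suc_eq)
  ultimately show ?thesis
   unfolding cm E2_perturb_mu by (simp add: mult.assoc)
 qed
 have Mne: "(1::nat) \<noteq> M" using M by simp
 have "fsol \<tau> D (Suc M) ?\<eta> ?\<phi> ?m"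
  unfolding fsol_def
 proof (intro conjI allI impI)
  show "wCl D 1 1 ?\<eta>" "wCl D (-1) 1 ?\<phi>"
   using cl ab by (auto simp: wCl_def fps_X_power_mult_nth intro!: wcls_add)
  show "flat (?\<eta> $ p)" for p using fl ab by (auto simp: fps_X_power_mult_nth intro!: flat_add)
  show "harm \<tau> (?\<phi> $ p)" for p using ha ab by (auto simp: fps_X_power_mult_nth intro!: harm_add)
  show "?\<eta> $ 0 = 0" "?\<phi> $ 0 = 0" "?\<eta> $ 1 = eta1 \<tau>" "?\<phi> $ 1 = phi1 \<tau>"
   using z one M by (auto simp: fps_X_power_mult_nth)
  show "?m $ 0 = mu_c \<tau>" using m0 M by (auto simp: fps_X_power_mult_nth)
  show "?\<eta> $ p = 0" "?\<phi> $ p = 0" "?m $ p = 0" if "Suc M \<le> p" for p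
   using hi[of p] that by (auto simp: fps_X_power_mult_nth)
  show "?m $ p = 0" if "odd p" for p
   using mo[OF that] that c M by (auto simp: fps_X_power_mult_nth)
  show "E1 \<tau> ?\<eta> ?\<phi> $ q = 0" "E2 \<tau> (cfm ?m) ?\<eta> ?\<phi> $ q = 0" if "q < Suc M" for q
   using Z1[OF that] Z2[OF that] by auto
 qed
 then show ?thesis using that by blast
qed

text \<open>The resonance condition at the mode \<open>(1, 1)\<close> determines the next coefficient of \<open>\<mu>\<close>.\<close>

lemma fsol_mu:
 assumes F: "fsol \<tau> D M \<eta> \<phi> m"
 obtains c :: real where "even M \<Longrightarrow> c = 0"
  "\<And>a b. \<bar>a\<bar> = 1 \<Longrightarrow> \<bar>b\<bar> = 1 \<Longrightarrow> of_real (mu_c \<tau>) * lk (E1 \<tau> \<eta> \<phi> $ M) ((a, b), 0) + \<i> * of_int a *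
    (lk (E2 \<tau> (cfm m) \<eta> \<phi> $ M) ((a, b), 0) + of_real c * lk (eta1 \<tau>) ((a, b), 0)) = 0"
proof -
 from F have cl: "wCl D 1 1 \<eta>" "wCl D (-1) 1 \<phi>" and mo: "\<And>p. odd p \<Longrightarrow> m $ p = 0"
  by (auto simp: fsol_def)
 let ?e1 = "E1 \<tau> \<eta> \<phi> $ M" and ?e2 = "E2 \<tau> (cfm m) \<eta> \<phi> $ M"
 have c1: "wcls D (-1) 1 M ?e1" using wCl_E1[OF cl] by (simp add: wCl_def)
 have c2: "wcls D 1 1 M ?e2" using wCl_E2[OF cl wCl_cfm[OF mo]] by (simp add: wCl_def)
 have e1c: "wcls D 1 1 1 (eta1 \<tau>)" using cl(1) F unfolding wCl_def fsol_def by metis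
 define r1 where "r1 = lk ?e1 ((1,1),0)"
 define r2 where "r2 = lk ?e2 ((1,1),0)"
 define h where "h = - 1 / (4 * mu_c \<tau>)"
 have h: "lk (eta1 \<tau>) ((1,1),0) = of_real h" by (simp add: eta1_def lookup_wv h_def)
 have h0: "h \<noteq> 0" using mu_c_pos[of \<tau>] by (simp add: h_def)
 \<comment> \<open>The coefficient \<open>h\<close> of \<open>eta1\<close> at (1, 1) is nonzero, so
   the balance can be solved for c. As r1 is imaginary and r2 is real, the solution is real.\<close>
 define c where "c = - (mu_c \<tau> * Im r1 + Re r2) / h"
 have i1: "r1 = \<i> * of_real (Im r1)"
 proof -
  have "cnj r1 = - r1" unfolding r1_def using wcls_lookup_rho[OF c1, of 1 1 0] by simp
  then have "Re r1 = 0" by (simp add: complex_eq_iff)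
  then show ?thesis by (simp add: complex_eq_iff)
 qed
 have i2: "r2 = of_real (Re r2)"
 proof -
  have "cnj r2 = r2" unfolding r2_def using wcls_lookup_rho[OF c2, of 1 1 0] by simp
  then show ?thesis by (simp add: complex_eq_iff)
 qed
 have base: "of_real (mu_c \<tau>) * r1 + \<i> * (r2 + of_real c * of_real h) = 0"
  by (subst i1, subst i2) (use h0 in \<open>simp add: c_def field_simps\<close>)
 show ?thesis
 proof (rule that[of c])
  assume ev: "even M"
  \<comment> \<open>At even order all frequencies are even, so the mode (1, 1) is not
    forced.\<close>
  have "((1,1),0) \<notin> supp ?e1" "((1,1),0) \<notin> supp ?e2"
   using c1 c2 ev unfolding wcls_def by force+
  then show "c = 0" by (simp add: c_def r1_def r2_def in_keys_iff)
 next
  fix a b :: int assume "\<bar>a\<bar> = 1" "\<bar>b\<bar> = 1"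
  then have a: "a = 1 \<or> a = -1" and b: "b = 1 \<or> b = -1" by auto
  have l: "lk ?e1 ((a, b), 0) = of_int a * r1" "lk ?e2 ((a, b), 0) = r2"
   "lk (eta1 \<tau>) ((a, b), 0) = of_real h"
   using a b wcls_lookup_sg1[OF c1, of 1 1 0] wcls_lookup_sg2[OF c1, of 1 1 0] wcls_lookup_sg1[OF c1, of 1 "-1" 0]
    wcls_lookup_sg1[OF c2, of 1 1 0] wcls_lookup_sg2[OF c2, of 1 1 0] wcls_lookup_sg1[OF c2, of 1 "-1" 0]
    wcls_lookup_sg1[OF e1c, of 1 1 0] wcls_lookup_sg2[OF e1c, of 1 1 0] wcls_lookup_sg1[OF e1c, of 1 "-1" 0]
   by (auto simp: r1_def r2_def h)
  show "of_real (mu_c \<tau>) * lk ?e1 ((a, b), 0) + \<i> * of_int a *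
    (lk ?e2 ((a, b), 0) + of_real c * lk (eta1 \<tau>) ((a, b), 0)) = 0"
  proof -
   have "of_real (mu_c \<tau>) * (of_int a * r1) + \<i> * of_int a * (r2 + of_real c * of_real h)
    = of_int a * (of_real (mu_c \<tau>) * r1 + \<i> * (r2 + of_real c * of_real h))"
    by (simp add: algebra_simps)
   then show ?thesis unfolding l base by simp
  qed
 qed
qed

text \<open>With D = 1 the right-hand sides of order M are supported in |b| \<le> M, so each step
  meets only the resonances in that strip; there only the modes (\<plusminus>1, \<plusminus>1)
  occur, which \<mu> takes care of.\<close>

lemma fsol_exists:
 assumes "M \<ge> 2"
  and res: "\<And>a b. a \<noteq> 0 \<Longrightarrow> \<bar>b\<bar> < int M \<Longrightarrow> mu_c \<tau> * kn \<tau> (a, b) = (of_int a)^2 \<Longrightarrow> \<bar>a\<bar> = 1 \<and> \<bar>b\<bar> = 1"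
 shows "\<exists>\<eta> \<phi> m. fsol \<tau> 1 M \<eta> \<phi> m"
 using assms
proof (induction M rule: nat_induct_at_least)
 case base
 then show ?case using fsol_start by blast
next
 case (Suc M)
 then obtain \<eta> \<phi> m where F: "fsol \<tau> 1 M \<eta> \<phi> m" by force
 then have cl: "wCl 1 1 1 \<eta>" "wCl 1 (-1) 1 \<phi>" and mo: "\<And>p. odd p \<Longrightarrow> m $ p = 0"
  by (auto simp: fsol_def)
 have e1c: "wcls 1 1 1 1 (eta1 \<tau>)" using cl(1) F unfolding wCl_def fsol_def by metis
 have c1: "wcls 1 (-1) 1 M (E1 \<tau> \<eta> \<phi> $ M)" using wCl_E1[OF cl] by (simp add: wCl_def)
 have c2: "wcls 1 1 1 M (E2 \<tau> (cfm m) \<eta> \<phi> $ M)" using wCl_E2[OF cl wCl_cfm[OF mo]] by (simp add: wCl_def)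
 obtain c where c: "even M \<Longrightarrow> c = 0" and cr:
  "\<And>a b. \<bar>a\<bar> = 1 \<Longrightarrow> \<bar>b\<bar> = 1 \<Longrightarrow> of_real (mu_c \<tau>) * lk (E1 \<tau> \<eta> \<phi> $ M) ((a, b), 0) + \<i> * of_int a *
    (lk (E2 \<tau> (cfm m) \<eta> \<phi> $ M) ((a, b), 0) + of_real c * lk (eta1 \<tau>) ((a, b), 0)) = 0"
  using fsol_mu[OF F] by metis
 show ?case
 proof (rule fsol_step[OF F Suc.hyps, of c])
  fix a b :: int assume a: "a \<noteq> 0" "mu_c \<tau> * kn \<tau> (a, b) = (of_int a)^2"
  show "of_real (mu_c \<tau>) * lk (E1 \<tau> \<eta> \<phi> $ M) ((a, b), 0) + \<i> * of_int a *
    (lk (E2 \<tau> (cfm m) \<eta> \<phi> $ M) ((a, b), 0) + of_real c * lk (eta1 \<tau>) ((a, b), 0)) = 0"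
  proof (cases "\<bar>b\<bar> \<le> int M")
   case True
   then have "\<bar>a\<bar> = 1 \<and> \<bar>b\<bar> = 1" using Suc.prems[of a b] a by simp
   then show ?thesis using cr by blast
  next
   case False
   then have "((a, b), 0) \<notin> supp (E1 \<tau> \<eta> \<phi> $ M)" "((a, b), 0) \<notin> supp (E2 \<tau> (cfm m) \<eta> \<phi> $ M)"
    "((a, b), 0) \<notin> supp (eta1 \<tau>)"
    using c1 c2 e1c Suc.hyps unfolding wcls_def by force+
   then show ?thesis by (simp add: in_keys_iff)
  qed
 qed (use c in blast)+
qed

section \<open>Explicit coefficients up to order three\<close>

lemma Sub_nth_small:
 assumes "\<eta> $ 0 = 0" "w $ 0 = 0"
 shows "Sub \<eta> w $ 1 = w $ 1"
  "Sub \<eta> w $ 2 = w $ 2 + \<eta> $ 1 * dyn 1 (w $ 1)"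
  "Sub \<eta> w $ 3 = w $ 3 + \<eta> $ 1 * dyn 1 (w $ 2) + \<eta> $ 2 * dyn 1 (w $ 1) + cst (1/2) * (\<eta> $ 1)^2 * dyn 2 (w $ 1)"
proof -
 have p2: "(\<eta>^2) $ 0 = 0" "(\<eta>^2) $ 1 = 0" "(\<eta>^2) $ 2 = (\<eta> $ 1)^2"
  using assms by (simp_all add: power2_eq_square fps_mult_nth eval_nat_numeral sum.atLeast0_atMost_Suc)
 have d: "fm (dyn j) w $ 0 = 0" for j using assms by simp
 have p3: "(\<eta> ^ 3) $ 0 = 0" "(\<eta> ^ 3) $ Suc 0 = 0" "(\<eta> ^ 3) $ 2 = 0"
  using assms p2 by (simp_all add: power3_eq_cube fps_mult_nth eval_nat_numeral sum.atLeast0_atMost_Suc)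
 show "Sub \<eta> w $ 1 = w $ 1"
  using assms by (simp add: Sub_def SubT_def fps_mult_nth)
 show "Sub \<eta> w $ 2 = w $ 2 + \<eta> $ 1 * dyn 1 (w $ 1)"
  using assms p2 by (simp add: Sub_def SubT_def fps_mult_nth numeral_2_eq_2 sum.atLeast0_atMost_Suc)
 show "Sub \<eta> w $ 3 = w $ 3 + \<eta> $ 1 * dyn 1 (w $ 2) + \<eta> $ 2 * dyn 1 (w $ 1) + cst (1/2) * (\<eta> $ 1)^2 * dyn 2 (w $ 1)"
 proof -
  have "{..3::nat} = {0,1,2,3}" by auto
  moreover have "(\<eta> * fm (dyn 1) w) $ 3 = \<eta> $ 1 * dyn 1 (w $ 2) + \<eta> $ 2 * dyn 1 (w $ 1)"
   using assms
   by (simp add: fps_mult_nth numeral_3_eq_3 numeral_2_eq_2 sum.atLeast0_atMost_Suc)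
  moreover have "(fcst c * \<eta>^2 * fm (dyn 2) w) $ 3 = cst c * ((\<eta> $ 1)^2 * dyn 2 (w $ 1))" for c
   using assms p2 unfolding mult.assoc fps_mult_left_const_nth
   by (simp add: fps_mult_nth numeral_3_eq_3 numeral_2_eq_2 sum.atLeast0_atMost_Suc)
  moreover have "(fcst c * \<eta> ^ 3 * fm (dyn 3) w) $ 3 = 0" for c
   using assms p3 unfolding mult.assoc fps_mult_left_const_nth
   by (simp add: fps_mult_nth numeral_3_eq_3 numeral_2_eq_2 sum.atLeast0_atMost_Suc)
  ultimately show ?thesis
   by (simp add: Sub_def SubT_def fact_numeral add.assoc mult.assoc)
 qed
qed

text \<open>The Dirichlet-Neumann operator of the flat surface, which on harmonic functions replaces
  the vertical derivative (\<open>dy_harm\<close>).\<close>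

definition kk :: "real \<Rightarrow> wpoly \<Rightarrow> wpoly" where "kk \<tau> = mlt (\<lambda>k. of_real (kn \<tau> (fst k)))"

lemma kk_0 [simp]: "kk \<tau> 0 = 0" by (simp add: kk_def)

lemma lookup_kk: "lk (kk \<tau> t) (K, y) = of_real (kn \<tau> K) * lk t (K, y)"
 by (simp add: kk_def)

lemma dy_harm: "harm \<tau> t \<Longrightarrow> dy t = kk \<tau> t"
 by (rule poly_mapping_eqI) (auto simp: harm_def dy_def kk_def in_keys_iff)

lemma z0_dyn_harm: "harm \<tau> t \<Longrightarrow> z0 (dyn 1 (mlt (\<lambda>k. w (fst k)) t)) = mlt (\<lambda>k. w (fst k)) (kk \<tau> (z0 t))"
 "harm \<tau> t \<Longrightarrow> z0 (dyn 2 (mlt (\<lambda>k. w (fst k)) t)) = mlt (\<lambda>k. w (fst k)) (kk \<tau> (kk \<tau> (z0 t)))"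
 by (simp_all add: harm_dyn[OF harm_mlt] z0_mlt kk_def mlt_mlt power2_eq_square mult_ac)

lemma A_nth_gen:
 assumes "\<eta> $ 0 = 0" "\<phi> $ 0 = 0" "\<And>p. flat (\<eta> $ p)" "\<And>p. harm \<tau> (\<phi> $ p)"
  and f: "f = mlt (\<lambda>k. w (fst k))"
 defines "A \<equiv> fm z0 (Sub \<eta> (fm f \<phi>))" and "P \<equiv> \<lambda>p. z0 (\<phi> $ p)"
 shows "A $ 1 = f (P 1)" "A $ 2 = f (P 2) + \<eta> $ 1 * f (kk \<tau> (P 1))"
  "A $ 3 = f (P 3) + \<eta> $ 1 * f (kk \<tau> (P 2)) + \<eta> $ 2 * f (kk \<tau> (P 1)) + cst (1/2) * (\<eta> $ 1)^2 * f (kk \<tau> (kk \<tau> (P 1)))"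
proof -
 have w0: "fm f \<phi> $ 0 = 0" using assms(2) by (simp add: f)
 have fe: "z0 (\<eta> $ p) = \<eta> $ p" for p using assms(3) by (simp add: flat_z0_eq)
 have zf: "z0 (f t) = f (z0 t)" for t by (simp add: f z0_mlt)
 note z1 = z0_dyn_harm[of \<tau> _ w, folded f]
 show "A $ 1 = f (P 1)" "A $ 2 = f (P 2) + \<eta> $ 1 * f (kk \<tau> (P 1))"
  "A $ 3 = f (P 3) + \<eta> $ 1 * f (kk \<tau> (P 2)) + \<eta> $ 2 * f (kk \<tau> (P 1)) + cst (1/2) * (\<eta> $ 1)^2 * f (kk \<tau> (kk \<tau> (P 1)))"
  unfolding A_def P_def fm_nth Sub_nth_small[OF assms(1) w0]
  by (simp_all add: z0_add z0_mult fe zf z1 assms(4) power2_eq_square zero_prod_def[symmetric] del: One_nat_def)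
qed

lemma A3_harm: "(\<And>p. harm \<tau> (\<phi> $ p)) \<Longrightarrow> A3 \<eta> \<phi> = fm z0 (Sub \<eta> (fm (kk \<tau>) \<phi>))"
proof -
 assume "\<And>p. harm \<tau> (\<phi> $ p)"
 then have "fm dy \<phi> = fm (kk \<tau>) \<phi>" by (intro fps_ext) (simp add: dy_harm)
 then show ?thesis by (simp add: A3_def)
qed

lemma A_nth:
 assumes "\<eta> $ 0 = 0" "\<phi> $ 0 = 0" "\<And>p. flat (\<eta> $ p)" "\<And>p. harm \<tau> (\<phi> $ p)"
 defines "P \<equiv> \<lambda>p. z0 (\<phi> $ p)"
 shows "A1 \<eta> \<phi> $ 1 = d1 (P 1)" "A1 \<eta> \<phi> $ 2 = d1 (P 2) + \<eta> $ 1 * d1 (kk \<tau> (P 1))"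
  "A1 \<eta> \<phi> $ 3 = d1 (P 3) + \<eta> $ 1 * d1 (kk \<tau> (P 2)) + \<eta> $ 2 * d1 (kk \<tau> (P 1)) + cst (1/2) * (\<eta> $ 1)^2 * d1 (kk \<tau> (kk \<tau> (P 1)))"
  "A2 \<tau> \<eta> \<phi> $ 1 = d2 \<tau> (P 1)" "A2 \<tau> \<eta> \<phi> $ 2 = d2 \<tau> (P 2) + \<eta> $ 1 * d2 \<tau> (kk \<tau> (P 1))"
  "A3 \<eta> \<phi> $ 1 = kk \<tau> (P 1)" "A3 \<eta> \<phi> $ 2 = kk \<tau> (P 2) + \<eta> $ 1 * kk \<tau> (kk \<tau> (P 1))"
  "A3 \<eta> \<phi> $ 3 = kk \<tau> (P 3) + \<eta> $ 1 * kk \<tau> (kk \<tau> (P 2)) + \<eta> $ 2 * kk \<tau> (kk \<tau> (P 1)) + cst (1/2) * (\<eta> $ 1)^2 * kk \<tau> (kk \<tau> (kk \<tau> (P 1)))"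
 unfolding A3_harm[OF assms(4)] unfolding A1_def A2_def P_def
 by (rule A_nth_gen[OF assms(1-4)], simp add: d1_def d2_def kk_def)+

text \<open>Three orders suffice for \<open>mu1\<close>: by parity the mode (1, 1) is forced for the
  first time at order three.\<close>

lemma E_nth:
 assumes "\<eta> $ 0 = 0" "\<phi> $ 0 = 0" "\<And>p. flat (\<eta> $ p)" "\<And>p. harm \<tau> (\<phi> $ p)" and \<mu>: "\<mu> $ 1 = 0"
 defines "P \<equiv> \<lambda>p. z0 (\<phi> $ p)" and "h \<equiv> \<lambda>p. \<eta> $ p"
 shows "E1 \<tau> \<eta> \<phi> $ 2 = kk \<tau> (P 2) + h 1 * kk \<tau> (kk \<tau> (P 1)) - d1 (h 1) * d1 (P 1) - d2 \<tau> (h 1) * d2 \<tau> (P 1) - d1 (h 2)" (is ?a)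
  "E2 \<tau> \<mu> \<eta> \<phi> $ 2 = d1 (P 2) + h 1 * d1 (kk \<tau> (P 1)) + cst (1/2) * (d1 (P 1) * d1 (P 1) + d2 \<tau> (P 1) * d2 \<tau> (P 1) + kk \<tau> (P 1) * kk \<tau> (P 1)) + \<mu> $ 0 * h 2" (is ?b)
  "E1 \<tau> \<eta> \<phi> $ 3 = kk \<tau> (P 3) + h 1 * kk \<tau> (kk \<tau> (P 2)) + h 2 * kk \<tau> (kk \<tau> (P 1)) + cst (1/2) * (h 1 * (h 1 * kk \<tau> (kk \<tau> (kk \<tau> (P 1)))))
   - (d1 (h 1) * d1 (P 2) + d1 (h 1) * (h 1 * d1 (kk \<tau> (P 1))) + d1 (h 2) * d1 (P 1))
   - (d2 \<tau> (h 1) * d2 \<tau> (P 2) + d2 \<tau> (h 1) * (h 1 * d2 \<tau> (kk \<tau> (P 1))) + d2 \<tau> (h 2) * d2 \<tau> (P 1)) - d1 (h 3)" (is ?c)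
  "E2 \<tau> \<mu> \<eta> \<phi> $ 3 = d1 (P 3) + h 1 * d1 (kk \<tau> (P 2)) + h 2 * d1 (kk \<tau> (P 1)) + cst (1/2) * (h 1 * (h 1 * d1 (kk \<tau> (kk \<tau> (P 1)))))
   + (d1 (P 1) * d1 (P 2) + d1 (P 1) * (h 1 * d1 (kk \<tau> (P 1))) + d2 \<tau> (P 1) * d2 \<tau> (P 2) + d2 \<tau> (P 1) * (h 1 * d2 \<tau> (kk \<tau> (P 1)))
     + kk \<tau> (P 1) * kk \<tau> (P 2) + kk \<tau> (P 1) * (h 1 * kk \<tau> (kk \<tau> (P 1)))) + \<mu> $ 0 * h 3 + \<mu> $ 2 * h 1" (is ?d)
proof -
 note A = A_nth[OF assms(1-4)]
 have z: "A1 \<eta> \<phi> $ 0 = 0" "A2 \<tau> \<eta> \<phi> $ 0 = 0" "A3 \<eta> \<phi> $ 0 = 0" using A_nth_0[OF assms(2)] by auto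
 have m2: "(a * b) $ 2 = a $ 1 * b $ 1" if "a $ 0 = 0" "b $ 0 = 0" for a b :: "wpoly fps"
  using that by (simp add: fps_mult_nth numeral_2_eq_2 sum.atLeast0_atMost_Suc)
 have m3: "(a * b) $ 3 = a $ 1 * b $ 2 + a $ 2 * b $ 1" if "a $ 0 = 0" "b $ 0 = 0" for a b :: "wpoly fps"
  using that by (simp add: fps_mult_nth numeral_3_eq_3 numeral_2_eq_2 sum.atLeast0_atMost_Suc)
 have M2: "(\<mu> * \<eta>) $ 2 = \<mu> $ 0 * \<eta> $ 2" using assms(1) \<mu> by (simp add: fps_mult_nth numeral_2_eq_2 sum.atLeast0_atMost_Suc)
 have M3: "(\<mu> * \<eta>) $ 3 = \<mu> $ 0 * \<eta> $ 3 + \<mu> $ 2 * \<eta> $ 1" using assms(1) \<mu> by (simp add: fps_mult_nth numeral_3_eq_3 numeral_2_eq_2 sum.atLeast0_atMost_Suc)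
 have c: "cst (1/2) * (x + x) = x" for x
 proof -
  have "cst (1/2) * (x + x) = (cst (1/2) + cst (1/2)) * x" by (simp add: algebra_simps)
  also have "\<dots> = x" by (simp flip: single_add)
  finally show ?thesis .
 qed
 show ?a ?b
  unfolding E1_def E2_def fps_sub_nth fps_add_nth power2_eq_square fps_mult_left_const_nth M2 P_def h_def
  using assms(1) z by (simp_all add: m2 A del: One_nat_def)
 show ?c
  unfolding E1_def fps_sub_nth P_def h_def
  using assms(1) z by (simp add: m3 A algebra_simps power2_eq_square del: One_nat_def)
 have sq: "cst (1/2) * (a * b + b * a) = a * b" for a b using c[of "a * b"] by (simp add: mult.commute)
 have "E2 \<tau> \<mu> \<eta> \<phi> $ 3 = A1 \<eta> \<phi> $ 3 + (A1 \<eta> \<phi> $ 1 * A1 \<eta> \<phi> $ 2 + A2 \<tau> \<eta> \<phi> $ 1 * A2 \<tau> \<eta> \<phi> $ 2 + A3 \<eta> \<phi> $ 1 * A3 \<eta> \<phi> $ 2) + (\<mu> $ 0 * \<eta> $ 3 + \<mu> $ 2 * \<eta> $ 1)"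
  unfolding E2_def fps_add_nth power2_eq_square fps_mult_left_const_nth M3 m3[OF z(1) z(1)] m3[OF z(2) z(2)] m3[OF z(3) z(3)]
  by (simp only: distrib_left[of "cst (1/2)" "_ + _" "_ + _"] distrib_left[of "cst (1/2)" "_ + _ + _" "_ + _"] sq)
 then show ?d
  unfolding P_def h_def A by (simp add: algebra_simps power2_eq_square del: One_nat_def)
qed

lemma lookup_wv_mult:
 "lk (wv s n m 0 c * t) ((a, b), 0) = c * (lk t ((a - n, b - m), 0) + lk t ((a - n, b + m), 0)
   + of_int s * (lk t ((a + n, b - m), 0) + lk t ((a + n, b + m), 0)))"
 by (simp add: wv_def distrib_right lookup_add lookup_mult_single) (simp add: algebra_simps)

lemma lookup_wv_gen: "lk (wv s n m 0 c) ((a, b), 0) =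
  (if a = n \<and> b = m then c else 0) + (if a = n \<and> b = - m then c else 0)
  + (if a = - n \<and> b = m then of_int s * c else 0) + (if a = - n \<and> b = - m then of_int s * c else 0)"
 by (auto simp: wv_def lookup_add lookup_single when_def)

text \<open>The x2-derivative of \<open>wv\<close> (see \<open>d2_wv\<close>): odd in x2, it needs
  alternating signs.\<close>

definition dwv :: "int \<Rightarrow> int \<Rightarrow> int \<Rightarrow> complex \<Rightarrow> wpoly" where
 "dwv s n m c = mon ((n, m), 0) c + mon ((n, - m), 0) (- c)
   + mon ((- n, m), 0) (of_int s * c) + mon ((- n, - m), 0) (- of_int s * c)"

lemma d2_wv: "d2 \<tau> (wv s n m 0 c) = dwv s n m (\<i> * of_real \<tau> * of_int m * c)"
 by (simp add: wv_def dwv_def d2_def mlt_add mlt_single algebra_simps)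

lemma kk_wv: "kk \<tau> (wv s n m 0 c) = wv s n m 0 (of_real (kn \<tau> (n, m)) * c)"
 unfolding kk_def by (rule mlt_wv) auto

lemma lookup_dwv_mult:
 "lk (dwv s n m c * t) ((a, b), 0) = c * (lk t ((a - n, b - m), 0) - lk t ((a - n, b + m), 0)
   + of_int s * (lk t ((a + n, b - m), 0) - lk t ((a + n, b + m), 0)))"
 by (simp add: dwv_def distrib_right lookup_add lookup_mult_single) (simp add: algebra_simps)

lemma lookup_dwv_gen: "lk (dwv s n m c) ((a, b), 0) =
  (if a = n \<and> b = m then c else 0) - (if a = n \<and> b = - m then c else 0)
  + (if a = - n \<and> b = m then of_int s * c else 0) - (if a = - n \<and> b = - m then of_int s * c else 0)"
 by (auto simp: dwv_def lookup_add lookup_single when_def)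

section \<open>The coefficient of order two of the Bernoulli parameter\<close>

text \<open>Order two is solved at the modes (2, 2), (2, 0), (0, 2) and (0, 0); inserted into the
  solvability condition of order three at (1, 1), it determines the coefficient. The vanishing mean
  of \<eta> at order two is recorded for \<open>resonant_mode\<close>.\<close>

lemma fsol_mu2:
 assumes F: "fsol \<tau> D M \<eta> \<phi> m" and M: "M \<ge> 4" and \<tau>: "\<tau> > 0"
 shows "m $ 2 = mu1 \<tau>" and "lk (\<eta> $ 2) ((0, 0), 0) = 0"
proof -
 let ?l = "lk"
 define k where "k = 1 / mu_c \<tau>"
 define G where "G = complex_of_real k"
 define T where "T = complex_of_real \<tau>"
 define h where "h = - G / 4"
 have mu0: "mu_c \<tau> > 0" by (rule mu_c_pos)
 have k1: "k > 1" using mu_c_lt_1[OF \<tau>] mu0 by (simp add: k_def)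
 have k2: "k^2 = 1 + \<tau>^2" using mu_c_sq[of \<tau>] mu0 by (simp add: k_def field_simps power2_eq_square)
 \<comment> \<open>The dispersion relation of (1, 1): it eliminates \<tau>, so that everything below
   is rational in G = 1/\<mu>.\<close>
 have T2: "T^2 = G^2 - 1"
  using arg_cong[OF k2, of complex_of_real] by (simp add: T_def G_def)
 have G0: "G \<noteq> 0" using k1 by (simp add: G_def)
 have G1: "2 * G - 1 \<noteq> 0"
 proof -
  have "2 * G - 1 = of_real (2 * k - 1)" by (simp add: G_def)
  then show ?thesis using k1 by (simp only: of_real_eq_0_iff)
 qed
 have kn: "kn \<tau> (1,1) = k" using kn_1_1[of \<tau>] mu0 by (simp add: k_def field_simps)
 have kn22: "kn \<tau> (2,2) = 2 * k"
 proof -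
  have "kn \<tau> (2,2) = sqrt (4 * (1 + \<tau>^2))" by (simp add: kn_def)
  also have "\<dots> = 2 * k" using k1 by (simp add: k2[symmetric] real_sqrt_mult)
  finally show ?thesis .
 qed
 have kn20: "kn \<tau> (2,0) = 2" by (simp add: kn_def)
 have ii: "\<i> * \<i> = -1" by simp
 have G_mu: "complex_of_real (mu_c \<tau>) = 1 / G" by (simp add: G_def k_def)
 from F have cl: "wCl D 1 1 \<eta>" "wCl D (-1) 1 \<phi>" and fl: "\<And>p. flat (\<eta> $ p)" and ha: "\<And>p. harm \<tau> (\<phi> $ p)"
  and z: "\<eta> $ 0 = 0" "\<phi> $ 0 = 0" and one: "\<eta> $ 1 = eta1 \<tau>" "\<phi> $ 1 = phi1 \<tau>"
  and m0: "m $ 0 = mu_c \<tau>" and mo: "\<And>p. odd p \<Longrightarrow> m $ p = 0"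
  and Z: "\<And>q. q < M \<Longrightarrow> E1 \<tau> \<eta> \<phi> $ q = 0" "\<And>q. q < M \<Longrightarrow> E2 \<tau> (cfm m) \<eta> \<phi> $ q = 0"
  by (auto simp: fsol_def)
 have cm1: "cfm m $ 1 = 0" using mo[of 1] by simp
 define P2 where "P2 = z0 (\<phi> $ 2)"
 define H2 where "H2 = \<eta> $ 2"
 have P1: "z0 (phi1 \<tau>) = wv (-1) 1 1 0 (- \<i> / 4)" by (simp add: phi1_def z0_wv)
 have H1: "eta1 \<tau> = wv 1 1 1 0 h" by (simp add: eta1_def h_def G_def k_def mult.commute)
 have P2c: "wcls D (-1) 1 2 P2" using cl(2) by (simp add: wCl_def P2_def wcls_z0)
 have H2c: "wcls D 1 1 2 H2" using cl(1) by (simp add: wCl_def H2_def)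
 define p20 p22 e00 e02 e20 e22 where "p20 = ?l P2 ((2,0),0)" and "p22 = ?l P2 ((2,2),0)" and
  "e00 = ?l H2 ((0,0),0)" and "e02 = ?l H2 ((0,2),0)" and "e20 = ?l H2 ((2,0),0)" and "e22 = ?l H2 ((2,2),0)"
 have p0: "?l P2 ((0,b),0) = 0" for b
  using wcls_odd[OF P2c, of "((0,b),0)"] by (auto simp: in_keys_iff)
 note vals = p20_def[symmetric] p22_def[symmetric] e00_def[symmetric] e02_def[symmetric] e20_def[symmetric] e22_def[symmetric] p0
 note En = E_nth[OF z fl ha cm1]
 have lm: "2 < M" "3 < M" using M by auto
 note rules = lookup_add lookup_minus lookup_kk lookup_d1 lookup_wv_mult lookup_dwv_mult lookup_wv_gen lookup_dwv_gen
  kk_wv d1_wv d2_wv kn kn22 kn20 G_mu[symmetric]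
 have X2: "kk \<tau> P2 + wv 1 1 1 0 h * wv (-1) 1 1 0 (- \<i> * G^2 / 4) - wv (-1) 1 1 0 (\<i> * h) * wv 1 1 1 0 (1/4)
   - dwv 1 1 1 (\<i> * T * h) * dwv (-1) 1 1 (T / 4) - d1 H2 = 0"
  using En(1) Z(1)[OF lm(1)] unfolding one P1 H1 P2_def[symmetric] H2_def[symmetric]
  by (simp add: kk_wv d1_wv d2_wv kn G_def[symmetric] T_def[symmetric] power2_eq_square mult_ac)
 have Y2: "d1 P2 + wv 1 1 1 0 h * wv 1 1 1 0 (G / 4) + cst (1/2) * (wv 1 1 1 0 (1/4) * wv 1 1 1 0 (1/4)
   + dwv (-1) 1 1 (T / 4) * dwv (-1) 1 1 (T / 4) + wv (-1) 1 1 0 (- \<i> * G / 4) * wv (-1) 1 1 0 (- \<i> * G / 4)) + cst (1 / G) * H2 = 0"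
  using En(2) Z(2)[OF lm(1)] unfolding one P1 H1 P2_def[symmetric] H2_def[symmetric]
  by (simp add: kk_wv d1_wv d2_wv kn G_def[symmetric] T_def[symmetric] mult_ac m0 G_mu)
 have dv: "e22 / G = e22 * inverse G" "e20 / G = e20 * inverse G" "e02 / G = e02 * inverse G" "e00 / G = e00 * inverse G"
  by (simp_all add: field_simps)
 define iG where "iG = inverse G"
 note dv = dv[folded iG_def]
 note L2 = lookup_add lookup_minus lookup_kk lookup_d1 lookup_wv_mult lookup_dwv_mult lookup_wv_gen lookup_dwv_gen kn22 kn20 vals
 have a22: "2 * G * p22 - \<i> * h * G^2 / 2 - 2 * \<i> * e22 = 0"
  using arg_cong[OF X2, of "\<lambda>t. ?l t ((2,2),0)"] T2 ii
  by (simp add: L2 G_def[symmetric]) ((insert ii, algebra) | (simp add: field_simps; algebra))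
 have b22: "2 * \<i> * p22 + h * G / 4 + e22 / G = 0"
  using arg_cong[OF Y2, of "\<lambda>t. ?l t ((2,2),0)"] T2 ii
  by (simp add: L2 G_def[symmetric] power2_eq_square dv) ((insert ii, algebra) | (simp add: field_simps; algebra))
 have a20: "2 * p20 - \<i> * h - 2 * \<i> * e20 = 0"
  using arg_cong[OF X2, of "\<lambda>t. ?l t ((2,0),0)"] T2 ii
  by (simp add: L2 G_def[symmetric]) ((insert ii, algebra) | (simp add: field_simps; algebra))
 have b20: "2 * \<i> * p20 + h * G / 2 + (1 - G^2) / 8 + e20 / G = 0"
  using arg_cong[OF Y2, of "\<lambda>t. ?l t ((2,0),0)"] T2 ii
  by (simp add: L2 G_def[symmetric] power2_eq_square dv) ((insert ii, algebra) | (simp add: field_simps; algebra))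
 have b02: "h * G / 2 + 1 / 8 + e02 / G = 0"
  using arg_cong[OF Y2, of "\<lambda>t. ?l t ((0,2),0)"] T2 ii
  by (simp add: L2 G_def[symmetric] power2_eq_square dv) ((insert ii, algebra) | (simp add: field_simps; algebra))
 have b00: "h * G + G^2 / 4 + e00 / G = 0"
  using arg_cong[OF Y2, of "\<lambda>t. ?l t ((0,0),0)"] T2 ii
  by (simp add: L2 G_def[symmetric] power2_eq_square dv) ((insert ii, algebra) | (simp add: field_simps; algebra))
 \<comment> \<open>The potential has no second harmonic (2, 2), as for Stokes waves on deep
   water.\<close>
 have p22: "p22 = 0"
 proof -
  have "e22 = - G * (2 * \<i> * p22 + h * G / 4)" using b22 G0 by (simp add: field_simps eq_neg_iff_add_eq_0)
  with a22 have "2 * G * p22 - \<i> * h * G^2 / 2 - 2 * \<i> * (- G * (2 * \<i> * p22 + h * G / 4)) = 0" by simp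
  then have "- 2 * G * p22 = 0" by (simp add: algebra_simps power2_eq_square)
  then show ?thesis using G0 by simp
 qed
 have e22: "e22 = G ^ 3 / 16"
  using b22 G0 unfolding p22 h_def by (simp add: field_simps power3_eq_cube power2_eq_square)
 have e00: "e00 = 0"
  using b00 G0 unfolding h_def by (simp add: field_simps power2_eq_square)
 have e02: "e02 = G * (G^2 - 1) / 8"
  using b02 G0 unfolding h_def by (simp add: field_simps power2_eq_square)
 have p20': "p20 = \<i> * (e20 - G / 8)"
  using a20 unfolding h_def by (simp add: field_simps)
 \<comment> \<open>The mode (2, 0) has determinant 2\<mu> - 4, which is the origin of the
   denominator 2 - \<mu> in \<open>mu1\<close>; here it appears as 2G - 1.\<close>
 have e20: "e20 = G * (2 * G - 2 * G^2 + 1) / (8 * (2 * G - 1))"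
 proof -
  have "2 * \<i> * (\<i> * (e20 - G / 8)) + h * G / 2 + (1 - G^2) / 8 + e20 / G = 0" using b20 unfolding p20' .
  then have e: "e20 * (8 * (2 * G - 1)) = G * (2 * G - 2 * G^2 + 1)"
   using G0 unfolding h_def by (simp add: field_simps power2_eq_square) algebra
  then show ?thesis using G1 by (simp add: eq_divide_eq)
 qed
 define P3 where "P3 = z0 (\<phi> $ 3)"
 define H3 where "H3 = \<eta> $ 3"
 define p3 e3 where "p3 = ?l P3 ((1,1),0)" and "e3 = ?l H3 ((1,1),0)"
 have dv3: "e3 / G = e3 * iG" by (simp add: iG_def field_simps)
 have X3: "kk \<tau> P3 + wv 1 1 1 0 h * kk \<tau> (kk \<tau> P2) + wv (-1) 1 1 0 (- \<i> * G^2 / 4) * H2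
   + cst (1/2) * (wv 1 1 1 0 h * (wv 1 1 1 0 h * wv (-1) 1 1 0 (- \<i> * G ^ 3 / 4)))
   - (wv (-1) 1 1 0 (\<i> * h) * d1 P2 + wv (-1) 1 1 0 (\<i> * h) * (wv 1 1 1 0 h * wv 1 1 1 0 (G / 4)) + wv 1 1 1 0 (1/4) * d1 H2)
   - (dwv 1 1 1 (\<i> * T * h) * d2 \<tau> P2 + dwv 1 1 1 (\<i> * T * h) * (wv 1 1 1 0 h * dwv (-1) 1 1 (T * G / 4)) + dwv (-1) 1 1 (T / 4) * d2 \<tau> H2)
   - d1 H3 = 0"
  using En(3) Z(1)[OF lm(2)] unfolding one P1 H1 P2_def[symmetric] H2_def[symmetric] P3_def[symmetric] H3_def[symmetric]
  by (simp add: kk_wv d1_wv d2_wv kn G_def[symmetric] T_def[symmetric] power2_eq_square power3_eq_cube mult_ac)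
 have Y3: "d1 P3 + wv 1 1 1 0 h * d1 (kk \<tau> P2) + wv 1 1 1 0 (G / 4) * H2
   + cst (1/2) * (wv 1 1 1 0 h * (wv 1 1 1 0 h * wv 1 1 1 0 (G^2 / 4)))
   + (wv 1 1 1 0 (1/4) * d1 P2 + wv 1 1 1 0 (1/4) * (wv 1 1 1 0 h * wv 1 1 1 0 (G / 4))
     + dwv (-1) 1 1 (T / 4) * d2 \<tau> P2 + dwv (-1) 1 1 (T / 4) * (wv 1 1 1 0 h * dwv (-1) 1 1 (T * G / 4))
     + wv (-1) 1 1 0 (- \<i> * G / 4) * kk \<tau> P2 + wv (-1) 1 1 0 (- \<i> * G / 4) * (wv 1 1 1 0 h * wv (-1) 1 1 0 (- \<i> * G^2 / 4)))
   + cst (1 / G) * H3 + cst (of_real (m $ 2)) * wv 1 1 1 0 h = 0"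
  using En(4) Z(2)[OF lm(2)] unfolding one P1 H1 P2_def[symmetric] H2_def[symmetric] P3_def[symmetric] H3_def[symmetric]
  by (simp add: kk_wv d1_wv d2_wv kn G_def[symmetric] T_def[symmetric] power2_eq_square mult_ac m0 G_mu)
 note L3 = lookup_add lookup_minus lookup_kk lookup_d1 lookup_d2 lookup_wv_mult lookup_dwv_mult lookup_wv_gen lookup_dwv_gen
  kn kn22 kn20 vals p3_def[symmetric] e3_def[symmetric]
 have a3: "G * p3 - \<i> * e3 + (4 * h * p20 - \<i> * G^2 / 4 * (e02 - e20 - e22 + e00) - 3 * \<i> / 8 * h^2 * G ^ 3
   - (2 * h * p20 + 3 * \<i> / 4 * h^2 * G + \<i> / 2 * (e20 + e22)) - (- \<i> * T^2 * h^2 * G / 4 + \<i> * T^2 / 2 * (e22 - e02))) = 0"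
  using arg_cong[OF X3, of "\<lambda>t. ?l t ((1,1),0)"] p22 ii
  by (simp add: L3 G_def[symmetric] T_def[symmetric]) ((insert ii, algebra) | (simp add: field_simps; algebra))
 have b3: "\<i> * p3 + e3 / G + (4 * \<i> * h * p20 + G / 4 * (e00 + e02 + e20 + e22) + 9 / 8 * h^2 * G^2 + \<i> / 2 * p20
   + 9 / 16 * h * G + T^2 * h * G / 16 + \<i> * G / 2 * p20 + 3 / 16 * G ^ 3 * h) + of_real (m $ 2) * h = 0"
  using arg_cong[OF Y3, of "\<lambda>t. ?l t ((1,1),0)"] p22 ii
  by (simp add: L3 G_def[symmetric] T_def[symmetric] power2_eq_square power3_eq_cube dv3) ((insert ii, algebra) | (simp add: field_simps; algebra))
 define S where "S = 2 * G - 1"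
 have S0: "S \<noteq> 0" and GS: "2 * G = S + 1" using G1 by (auto simp: S_def)
 define q where "q = e20 - G / 8"
 have e20q: "e20 = q + G / 8" by (simp add: q_def)
 have p20q: "p20 = \<i> * q" unfolding p20' q_def ..
 have Sq: "S * q = - G * (G^2 - 1) / 4"
 proof -
  have "e20 * (8 * S) = G * (2 * G - 2 * G^2 + 1)" unfolding e20 S_def[symmetric] using S0 by simp
  moreover have "8 * (S * q) = e20 * (8 * S) - S * G" by (simp add: q_def algebra_simps)
  ultimately have "8 * (S * q) = G * (2 * G - 2 * G^2 + 1) - (2 * G - 1) * G" by (simp add: S_def)
  also have "\<dots> = 8 * (- G * (G^2 - 1) / 4)" by (simp add: algebra_simps power2_eq_square)
  finally show ?thesis by (simp only: mult_cancel_left) simp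
 qed
 \<comment> \<open>The mode (1, 1) is resonant, so this combination of the two equations annihilates
   the unknowns \<open>p3\<close> and \<open>e3\<close> of order three.\<close>
 have comb: "G * (\<i> * (\<i> * p3 + e3 / G)) + (G * p3 - \<i> * e3) = 0"
  using G0 by (simp add: algebra_simps)
 define u where "u = of_real (m $ 2) * h"
 define X where "X = 4 * h * p20 - \<i> * G^2 / 4 * (e02 - e20 - e22 + e00) - 3 * \<i> / 8 * h^2 * G ^ 3
   - (2 * h * p20 + 3 * \<i> / 4 * h^2 * G + \<i> / 2 * (e20 + e22)) - (- \<i> * T^2 * h^2 * G / 4 + \<i> * T^2 / 2 * (e22 - e02))"
 define Y where "Y = 4 * \<i> * h * p20 + G / 4 * (e00 + e02 + e20 + e22) + 9 / 8 * h^2 * G^2 + \<i> / 2 * p20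
   + 9 / 16 * h * G + T^2 * h * G / 16 + \<i> * G / 2 * p20 + 3 / 16 * G ^ 3 * h"
 have v1: "G * p3 - \<i> * e3 = - X" using a3 unfolding X_def[symmetric] by (simp add: eq_neg_iff_add_eq_0)
 have v2: "\<i> * p3 + e3 / G = - Y - u"
  using b3 unfolding Y_def[symmetric] u_def[symmetric] by (simp add: eq_neg_iff_add_eq_0 algebra_simps)
 have "G * (\<i> * (- Y - u)) + - X = 0" using comb unfolding v1 v2 .
 then have uu: "\<i> * G * u = - X - \<i> * G * Y"
  by (simp add: algebra_simps eq_neg_iff_add_eq_0)
 define a where "a = G^2 / 4 - G / 2 - 1 / 2"
 define c where "c = 3 * G / 4 - 1 / 2"
 define b where "b = G ^ 3 / 32 - G / 16 - G^2 / 4 * (G * (G^2 - 1) / 8 - G ^ 3 / 16) - 3 / 128 * G ^ 5 - 3 / 64 * G ^ 3 - G ^ 3 / 32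
   + (G^2 - 1) * G ^ 3 / 64 - (G^2 - 1) / 2 * (G ^ 3 / 16 - G * (G^2 - 1) / 8)"
 define d where "d = G / 4 * (G * (G^2 - 1) / 8 + G / 8 + G ^ 3 / 16) + 9 / 128 * G ^ 4 - 9 / 64 * G^2
   - (G^2 - 1) * G^2 / 64 - 3 / 64 * G ^ 4"
 have Xv: "X = \<i> * (q * a + b)"
  unfolding X_def e20q p20q e00 e02 e22 T2 h_def a_def b_def
  by (simp add: field_simps power2_eq_square power3_eq_cube eval_nat_numeral)
 have Yv: "Y = q * c + d"
  unfolding Y_def e20q p20q e00 e02 e22 T2 h_def c_def d_def
  by (simp add: field_simps power2_eq_square power3_eq_cube eval_nat_numeral)
 have "\<i> * (G * u) = \<i> * (- (q * a + b) - G * (q * c + d))"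
  using uu unfolding Xv Yv by (simp add: algebra_simps)
 then have gu: "G * u = - (q * a + b) - G * (q * c + d)" by simp
 define x where "x = complex_of_real (m $ 2)"
 have gu': "x * (G * G) = 4 * ((q * a + b) + G * (q * c + d))"
  using gu unfolding u_def h_def x_def[symmetric] by (simp add: field_simps; algebra)
 have "x * (G * G) * S = 4 * ((S * q) * (a + G * c) + S * (b + G * d))"
  unfolding gu' by (simp add: algebra_simps)
 also have "\<dots> = G * (G * S * (G ^ 3 / 4 - G^2 / 2 - 3 * G / 4 + 2) + S / 2 - 9 * G^2 / 4)"
  unfolding Sq unfolding S_def a_def b_def c_def d_def
  by (simp add: field_simps power2_eq_square power3_eq_cube eval_nat_numeral)
 finally have "G * (x * (G * S)) = G * (G * S * (G ^ 3 / 4 - G^2 / 2 - 3 * G / 4 + 2) + S / 2 - 9 * G^2 / 4)"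
  by (simp only: mult_ac)
 then have fin: "of_real (m $ 2) * (G * S) = G * S * (G ^ 3 / 4 - G^2 / 2 - 3 * G / 4 + 2) + S / 2 - 9 * G^2 / 4"
  using G0 unfolding x_def mult_cancel_left by simp
 have "of_real (m $ 2) = complex_of_real (k ^ 3 / 4 - k^2 / 2 - 3 * k / 4 + 2 + 1 / (2 * k) - 9 * k / (4 * (2 * k - 1)))"
 proof -
  have "of_real (m $ 2) = G ^ 3 / 4 - G^2 / 2 - 3 * G / 4 + 2 + 1 / (2 * G) - 9 * G / (4 * S)"
   using fin G0 S0 by (simp add: field_simps power2_eq_square)
  then show ?thesis by (simp add: G_def S_def)
 qed
 then have "m $ 2 = k ^ 3 / 4 - k^2 / 2 - 3 * k / 4 + 2 + 1 / (2 * k) - 9 * k / (4 * (2 * k - 1))"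
  by (simp only: of_real_eq_iff)
 also have "\<dots> = mu1 \<tau>"
 proof -
  have mk: "mu_c \<tau> = 1 / k" by (simp add: k_def)
  have "2 - 1 / k = (2 * k - 1) / k" using k1 by (simp add: field_simps)
  then have e9: "9 / (4 * (2 - 1 / k)) = 9 * k / (4 * (2 * k - 1))" by simp
  show ?thesis unfolding mu1_def Let_def mk e9 using k1 by (simp add: power_divide mult.commute)
 qed
 finally show "m $ 2 = mu1 \<tau>" .
 show "?l (\<eta> $ 2) ((0, 0), 0) = 0" using e00 by (simp add: e00_def H2_def)
qed

section \<open>The resonant mode\<close>

lemma mode_polynomial_nonneg:
 fixes v m :: real
 assumes "v \<ge> 0" "0 \<le> m" "m \<le> 1"
 shows "0 \<le> m * ((768 - 1632 * m + 4701/4 * m^2 - 210 * m ^ 3) + v * (832 - 1552 * m + 1877/2 * m^2 - 124 * m ^ 3)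
  + v^2 * (336 - 534 * m + 981/4 * m^2 - 18 * m ^ 3) + v ^ 3 * (60 - 78 * m + 21 * m^2) + v ^ 4 * (4 - 4 * m))"
proof -
 define w where "w = 1 - m"
 have w: "w \<ge> 0" using assms by (simp add: w_def)
 \<comment> \<open>Homogenised by w + m = 1, the coefficient of every power of v shows only
   nonnegative numbers.\<close>
 have h: "768 - 1632 * m + 4701/4 * m^2 - 210 * m ^ 3 = 768 * w ^ 3 + 672 * (w^2 * m) + 861/4 * (w * m^2) + 405/4 * m ^ 3"
  "832 - 1552 * m + 1877/2 * m^2 - 124 * m ^ 3 = 832 * w ^ 3 + 944 * (w^2 * m) + 661/2 * (w * m^2) + 189/2 * m ^ 3"
  "336 - 534 * m + 981/4 * m^2 - 18 * m ^ 3 = 336 * w ^ 3 + 474 * (w^2 * m) + 741/4 * (w * m^2) + 117/4 * m ^ 3"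
  "60 - 78 * m + 21 * m^2 = 60 * w^2 + 42 * (w * m) + 3 * m^2" "4 - 4 * m = 4 * w"
  by (simp_all add: w_def field_simps power2_eq_square power3_eq_cube)
 show ?thesis unfolding h using assms w by (intro mult_nonneg_nonneg add_nonneg_nonneg) auto
qed

text \<open>The polynomial is the numerator of the bound of \<open>mode_coefficient_pos\<close> expanded at
 \<open>n\<^sup>2 = 4 + v\<close>; all its coefficients in the Bernstein basis of \<open>m \<in> [0, 1]\<close> are nonnegative.\<close>

lemma mode_rational_bound:
 fixes n m :: real
 assumes n: "n \<ge> 2" and m: "0 \<le> m" "m \<le> 1"
 defines "P \<equiv> \<lambda>s. 4 * n ^ 4 + 4 * s * n ^ 3 - 3 * n^2 * m - 2 * s * n * m + m"
  and "U \<equiv> \<lambda>s. s * n ^ 5 * (8 - 4 * m) - 6 * n ^ 4 * m - 8 * s * n ^ 3 * m + 6 * s * n ^ 3 * m^2 + (2 * m + 4 * m^2) * n^2 - 2 * s * m^2 * n"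
 shows "P 1 > 0" "P (- 1) > 0"
  "(n + 1)^2 * (U 1 / P 1) + (n - 1)^2 * (U (- 1) / P (- 1)) \<ge> 4 * n^2 + 2 * m^2 + 15 / 4 * m - 5 * m * (n^2 + 1)"
proof -
 have p1: "n ^ 4 = n * n ^ 3" "n ^ 3 = n * n^2" by (simp_all add: eval_nat_numeral)
 have n3: "n ^ 3 \<ge> 2 * n^2" "n^2 \<ge> 2 * n" using n by (simp_all add: p1 power2_eq_square)
 have n4: "n ^ 4 \<ge> 2 * n ^ 3" using n by (simp add: p1)
 have mn: "n^2 * m \<le> n\<^sup>2" "n * m \<le> n" "n * m \<ge> 0" using m n by (simp_all add: mult_left_le)
 have n2: "n^2 > 0" using n by simp
 have "P 1 = 4 * n ^ 4 + 4 * n ^ 3 - 3 * (n^2 * m) - 2 * (n * m) + m"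
  "P (- 1) = 4 * n ^ 4 - 4 * n ^ 3 - 3 * (n^2 * m) + 2 * (n * m) + m" by (simp_all add: P_def)
 then show P: "P 1 > 0" "P (- 1) > 0" using n3 n4 mn m n2 n by linarith+
 define v where "v = n^2 - 4"
 have v: "v \<ge> 0" using power_mono[of 2 n 2] n by (simp add: v_def)
 have "(n + 1)^2 * (U 1 * P (- 1)) + (n - 1)^2 * (U (- 1) * P 1) - (4 * n^2 + 2 * m^2 + 15 / 4 * m - 5 * m * (n^2 + 1)) * (P 1 * P (- 1))
  = m * ((768 - 1632 * m + 4701/4 * m^2 - 210 * m ^ 3) + v * (832 - 1552 * m + 1877/2 * m^2 - 124 * m ^ 3)
  + v^2 * (336 - 534 * m + 981/4 * m^2 - 18 * m ^ 3) + v ^ 3 * (60 - 78 * m + 21 * m^2) + v ^ 4 * (4 - 4 * m))"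
  unfolding P_def U_def v_def by algebra
 also have "\<dots> \<ge> 0" using mode_polynomial_nonneg[OF v m] .
 finally have "(4 * n^2 + 2 * m^2 + 15 / 4 * m - 5 * m * (n^2 + 1)) * (P 1 * P (- 1))
   \<le> (n + 1)\<^sup>2 * (U 1 * P (- 1)) + (n - 1)^2 * (U (- 1) * P 1)" by simp
 also have "\<dots> = ((n + 1)^2 * (U 1 / P 1) + (n - 1)^2 * (U (- 1) / P (- 1))) * (P 1 * P (- 1))"
  using P by (simp add: field_simps)
 finally show "(n + 1)^2 * (U 1 / P 1) + (n - 1)^2 * (U (- 1) / P (- 1)) \<ge> 4 * n^2 + 2 * m^2 + 15 / 4 * m - 5 * m * (n^2 + 1)"
  using P by (simp add: mult_le_cancel_right)
qed

text \<open>In the application s n \<mu>^2 + t \<rho> is \<mu>^2 times the inner product of the wave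
  vectors (n, \<tau> N) and (s, \<tau> t), whose lengths times \<mu> are n^2 and 1; the bound is
  Cauchy-Schwarz. Here only \<rho>^2 is known, and the inequality follows from that of the
  arithmetic and geometric mean for the factors 1 - \<mu>^2 and n^2 - \<mu>^2.\<close>

lemma mode_D_le:
 fixes n \<mu> \<rho> :: real
 assumes n: "n \<ge> 2" and \<mu>: "0 < \<mu>" "\<mu> < 1" and \<rho>: "\<rho>^2 = n^2 * ((1 - \<mu>^2) * (n^2 - \<mu>^2))"
  and s: "s = 1 \<or> s = -1" and t: "t = 1 \<or> t = -1"
 shows "\<bar>s * n * \<mu>^2 + t * \<rho>\<bar> \<le> n\<^sup>2"
proof -
 have m: "\<mu>^2 < 1" "0 < \<mu>\<^sup>2" using \<mu> by (simp_all add: power_less_one_iff)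
 have "(\<bar>\<rho>\<bar> / n)^2 = (1 - \<mu>^2) * (n^2 - \<mu>^2)" using \<rho> n by (simp add: power_divide)
 also have "\<dots> \<le> ((1 - 2 * \<mu>^2 + n^2) / 2)\<^sup>2"
  using zero_le_power2[of "(1 - \<mu>^2) - (n^2 - \<mu>^2)"] by (simp add: field_simps power2_eq_square)
 finally have "\<bar>\<rho>\<bar> / n \<le> (1 - 2 * \<mu>^2 + n^2) / 2"
  by (rule power2_le_imp_le) (use m power_mono[of 2 n 2] n in simp)
 then have "\<bar>\<rho>\<bar> \<le> (1 - 2 * \<mu>^2 + n^2) / 2 * n" using n by (simp only: pos_divide_le_eq)
 then have "\<bar>\<rho>\<bar> * n \<le> (1 - 2 * \<mu>^2 + n^2) / 2 * n * n" using n by (intro mult_right_mono) auto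
 then have r: "\<bar>\<rho>\<bar> * n \<le> n\<^sup>2 * (1 - 2 * \<mu>^2 + n^2) / 2" by (simp add: power2_eq_square mult_ac)
 have "(s * n * \<mu>^2 + t * \<rho>)^2 = n^2 * \<mu>^2 * \<mu>^2 + \<rho>^2 + 2 * (s * t) * n * \<mu>^2 * \<rho>"
  using s t by (auto simp: power2_eq_square algebra_simps)
 also have "2 * (s * t) * n * \<mu>^2 * \<rho> \<le> 2 * \<mu>^2 * (\<bar>\<rho>\<bar> * n)"
 proof -
  have "(s * t) * \<rho> \<le> \<bar>\<rho>\<bar>" using s t by auto
  then have "(2 * n * \<mu>^2) * ((s * t) * \<rho>) \<le> (2 * n * \<mu>^2) * \<bar>\<rho>\<bar>" using n m by (intro mult_left_mono) auto
  then show ?thesis by (simp add: mult_ac)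
 qed
 also have "2 * \<mu>^2 * (\<bar>\<rho>\<bar> * n) \<le> 2 * \<mu>^2 * (n^2 * (1 - 2 * \<mu>^2 + n^2) / 2)" using r m by (intro mult_left_mono) auto
 also have "n^2 * \<mu>^2 * \<mu>^2 + \<rho>^2 + 2 * \<mu>^2 * (n^2 * (1 - 2 * \<mu>^2 + n^2) / 2) = (n^2)^2"
  unfolding \<rho> by (simp add: field_simps power2_eq_square)
 finally have "(s * n * \<mu>^2 + t * \<rho>)^2 \<le> (n^2)\<^sup>2" by simp
 then show ?thesis using abs_le_square_iff[of _ "n^2"] by simp
qed

text \<open>In the application q is \<mu> times the length of a sideband wave vector, hence a square
  root. As |D| \<le> n^2, it lies between n^2 + D/n^2 and n^2 + 1. This enclosure keeps q away from
  (n + s)^2, so the sideband is not resonant, and putting the lower end in place of q gives a bound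
  that is rational in \<rho>.\<close>

lemma mode_term_bound:
 fixes n \<mu> \<rho> q s t :: real
 assumes n: "n \<ge> 2" and \<mu>: "0 < \<mu>" "\<mu> < 1" and \<rho>: "\<rho>^2 = n^2 * ((1 - \<mu>^2) * (n^2 - \<mu>^2))"
  and s: "s = 1 \<or> s = -1" and t: "t = 1 \<or> t = -1"
  and q: "q \<ge> 0" "q^2 = n ^ 4 + 1 + 2 * (s * n * \<mu>^2 + t * \<rho>)"
 defines "D \<equiv> s * n * \<mu>^2 + t * \<rho>"
 shows "q - (n + s)^2 \<noteq> 0"
  "(n + s)^2 * (n^2 - D)^2 / (n^2 * ((n + s)^2 - q)) \<ge> n\<^sup>2 * (n + s)^2 * (1 - D / n^2)^2 / (1 - D / n^2 + 2 * s * n)"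
  "1 - D / n^2 + 2 * s * n \<noteq> 0"
proof -
 define d where "d = D / n^2"
 have D: "D = n^2 * d" using n by (simp add: d_def)
 have dl: "\<bar>d\<bar> \<le> 1"
  using mode_D_le[OF n \<mu> \<rho> s t] n by (simp add: d_def D_def abs_mult)
 have q2: "q^2 = n ^ 4 + 1 + 2 * (n^2 * d)" using q(2) D by (simp add: D_def)
 have n4: "n ^ 4 = (n^2)^2" by simp
 have lo: "n^2 + d \<le> q"
 proof (rule power2_le_imp_le)
  have "d^2 \<le> 1" using dl by (simp add: abs_square_le_1)
  then show "(n^2 + d)^2 \<le> q\<^sup>2" unfolding q2 n4 by (simp add: power2_eq_square algebra_simps)
 qed (rule q(1))
 have hi: "q \<le> n\<^sup>2 + 1"
 proof (rule power2_le_imp_le)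
  have "n^2 * d \<le> n\<^sup>2" using dl by (simp add: mult_left_le)
  then show "q^2 \<le> (n^2 + 1)\<^sup>2" unfolding q2 n4 by (simp add: power2_eq_square algebra_simps)
 qed simp
 have e: "(n + s)^2 = n^2 + 2 * s * n + 1" using s by (auto simp: power2_eq_square algebra_simps)
 have num: "(n + s)^2 * (n^2 - D)^2 / (n^2 * ((n + s)^2 - q)) = (n^2 * (n + s)^2 * (1 - d)^2) * (1 / ((n + s)^2 - q))"
 proof -
  have e: "(n^2 - n^2 * d)^2 = n^2 * (n^2 * (1 - d)^2)" by algebra
  have c: "x * (n^2 * w) / (n^2 * y) = x * w / y" for x w y :: real using n by simp
  show ?thesis unfolding D e c by (simp add: mult_ac)
 qed
 have pos: "n^2 * (n + s)^2 * (1 - d)^2 \<ge> 0" by simp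
 show "q - (n + s)^2 \<noteq> 0" unfolding e using s hi lo dl n by auto
 show "1 - D / n^2 + 2 * s * n \<noteq> 0" unfolding d_def[symmetric] using s dl n by auto
 \<comment> \<open>The reciprocal is decreasing on either side of 0, and both denominators have the
   sign of s.\<close>
 have "1 / ((n + s)^2 - q) \<ge> 1 / (1 - d + 2 * s * n)"
 proof (cases "s = 1")
  case True
  then show ?thesis unfolding e using lo hi dl n by (intro divide_left_mono mult_pos_pos) auto
 next
  case False
  then have s: "s = -1" using s by simp
  have "1 / (q - (n + s)^2) \<le> 1 / (- (1 - d + 2 * s * n))"
   unfolding e unfolding s using lo hi dl n by (intro divide_left_mono mult_pos_pos) auto
  then have "- (1 / (- (1 - d + 2 * s * n))) \<le> - (1 / (q - (n + s)^2))" by simp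
  then show ?thesis unfolding minus_divide_right minus_minus minus_diff_eq .
 qed
 from mult_left_mono[OF this pos]
 show "(n + s)^2 * (n^2 - D)^2 / (n^2 * ((n + s)^2 - q)) \<ge> n\<^sup>2 * (n + s)^2 * (1 - D / n^2)^2 / (1 - D / n^2 + 2 * s * n)"
  unfolding num d_def[symmetric] by simp
qed

text \<open>The two terms are exchanged by \<rho> \<mapsto> -\<rho>, so their sum contains only
  \<rho>^2, which the dispersion relation expresses by n and m = \<mu>^2. The last denominator is
  the product of the two original ones up to the factor n^2.\<close>

lemma mode_pair_sum:
 fixes n m \<rho> s :: real
 assumes n: "n \<ge> 2" and m: "0 \<le> m" "m \<le> 1" and \<rho>: "\<rho>^2 = n^2 * ((1 - m) * (n^2 - m))" and s: "s = 1 \<or> s = -1"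
  and x1: "x1 = 1 - (s * n * m + \<rho>) / n^2" and x2: "x2 = 1 - (s * n * m - \<rho>) / n^2"
  and nz: "x1 + 2 * s * n \<noteq> 0" "x2 + 2 * s * n \<noteq> 0"
 shows "n^2 * (n + s)^2 * x1^2 / (x1 + 2 * s * n) + n^2 * (n + s)^2 * x2^2 / (x2 + 2 * s * n)
  = (n + s)^2 * ((s * n ^ 5 * (8 - 4 * m) - 6 * n ^ 4 * m - 8 * s * n ^ 3 * m + 6 * s * n ^ 3 * m^2 + (2 * m + 4 * m^2) * n^2 - 2 * s * m^2 * n)
   / (4 * n ^ 4 + 4 * s * n ^ 3 - 3 * n^2 * m - 2 * s * n * m + m))"
proof -
 define P where "P = 4 * n ^ 4 + 4 * s * n ^ 3 - 3 * n^2 * m - 2 * s * n * m + m"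
 define U where "U = s * n ^ 5 * (8 - 4 * m) - 6 * n ^ 4 * m - 8 * s * n ^ 3 * m + 6 * s * n ^ 3 * m^2 + (2 * m + 4 * m^2) * n^2 - 2 * s * m^2 * n"
 have ss: "s * s = 1" using s by auto
 have P0: "P \<noteq> 0" using mode_rational_bound(1,2)[OF n m] s unfolding P_def by auto
 have n0: "n \<noteq> 0" using n by simp
 define y1 y2 where "y1 = n^2 * x1" and "y2 = n^2 * x2"
 have y: "y1 = n^2 - s * n * m - \<rho>" "y2 = n^2 - s * n * m + \<rho>"
  using n0 by (simp_all add: y1_def y2_def x1 x2 field_simps)
 define z1 z2 where "z1 = y1 + 2 * s * n ^ 3" and "z2 = y2 + 2 * s * n ^ 3"
 have z: "z1 = n^2 * (x1 + 2 * s * n)" "z2 = n^2 * (x2 + 2 * s * n)"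
  by (simp_all add: z1_def z2_def y1_def y2_def algebra_simps power2_eq_square power3_eq_cube)
 have z0: "z1 \<noteq> 0" "z2 \<noteq> 0" using z nz n0 by simp_all
 have zz: "z1 * z2 = n^2 * P"
 proof -
  have "z1 * z2 = (n^2 - s * n * m + 2 * s * n ^ 3)^2 - \<rho>^2" unfolding z1_def z2_def y by (simp add: algebra_simps power2_eq_square)
  also have "\<dots> = n^2 * P" unfolding \<rho> P_def using ss by algebra
  finally show ?thesis .
 qed
 have "x1^2 / (x1 + 2 * s * n) = y1^2 / (n^2 * z1)" "x2^2 / (x2 + 2 * s * n) = y2^2 / (n^2 * z2)"
  unfolding z y1_def y2_def using n0 by (simp_all add: power2_eq_square)
 then have "n^2 * (x1^2 / (x1 + 2 * s * n)) + n^2 * (x2^2 / (x2 + 2 * s * n)) = y1^2 / z1 + y2^2 / z2"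
  using n0 by simp
 also have "\<dots> = (y1^2 * z2 + y2^2 * z1) / (n^2 * P)"
  using z0 unfolding zz[symmetric] by (simp add: field_simps)
 also have "y1^2 * z2 + y2^2 * z1 = n^2 * U"
 proof -
  have "y1^2 * z2 + y2^2 * z1 = 2 * ((n^2 - s * n * m)^2 + \<rho>^2) * (n^2 - s * n * m + 2 * s * n ^ 3) - 4 * (n^2 - s * n * m) * \<rho>^2"
   unfolding z1_def z2_def y by algebra
  also have "\<dots> = n^2 * U" unfolding \<rho> U_def using ss by algebra
  finally show ?thesis .
 qed
 finally have "n^2 * (x1^2 / (x1 + 2 * s * n)) + n^2 * (x2^2 / (x2 + 2 * s * n)) = U / P"
  using n0 by simp
 then have "(n + s)^2 * (n^2 * (x1^2 / (x1 + 2 * s * n)) + n^2 * (x2^2 / (x2 + 2 * s * n))) = (n + s)^2 * (U / P)" by simp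
 then show ?thesis unfolding P_def[symmetric] U_def[symmetric] by (simp add: algebra_simps)
qed

text \<open>The four terms T are bounded by \<open>mode_term_bound\<close>, the pairs with equal s
  are summed by \<open>mode_pair_sum\<close>, and \<open>mode_rational_bound\<close> leaves a
  function of \<mu> alone.\<close>

lemma mode_coefficient_pos:
 fixes n \<mu> \<rho> :: real and q :: "real \<Rightarrow> real \<Rightarrow> real"
 assumes n: "n \<ge> 2" and \<mu>: "0 < \<mu>" "\<mu> < 1" and \<rho>: "\<rho>^2 = n^2 * ((1 - \<mu>^2) * (n^2 - \<mu>^2))"
  and q: "\<And>s t. s\<^sup>2 = 1 \<Longrightarrow> t\<^sup>2 = 1 \<Longrightarrow> q s t \<ge> 0 \<and> (q s t)\<^sup>2 = n ^ 4 + 1 + 2 * (s * n * \<mu>^2 + t * \<rho>)"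
 defines "T \<equiv> \<lambda>s t. (n + s)\<^sup>2 * (n^2 - (s * n * \<mu>^2 + t * \<rho>))^2 / (n^2 * ((n + s)^2 - q s t))"
 shows "5 * \<mu>^2 * (n^2 + 1) - 4 * n^2 - 2 * \<mu> ^ 4 + (T 1 1 + T 1 (-1) + T (-1) 1 + T (-1) (-1))
   + 4 * \<mu> ^ 3 * (1 / (4 * \<mu> ^ 3) - 1 / (2 * \<mu>^2) - 3 / (4 * \<mu>) + 2 + \<mu> / 2 - 9 / (4 * (2 - \<mu>))) > 0"
proof -
 let ?m = "\<mu>^2"
 have m: "0 \<le> ?m" "?m \<le> 1" using \<mu> by (simp_all add: power_le_one)
 define x where "x s t = 1 - (s * n * \<mu>^2 + t * \<rho>) / n^2" for s t
 define B where "B s t = n^2 * (n + s)^2 * (x s t)^2 / (x s t + 2 * s * n)" for s t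
 have TB: "T s t \<ge> B s t" "x s t + 2 * s * n \<noteq> 0" if "s = 1 \<or> s = -1" "t = 1 \<or> t = -1" for s t
  using mode_term_bound(2,3)[OF n \<mu> \<rho> that, of "q s t"] q[of s t] that unfolding T_def B_def x_def by auto
 have BS: "B s 1 + B s (-1) = (n + s)^2 * ((s * n ^ 5 * (8 - 4 * ?m) - 6 * n ^ 4 * ?m - 8 * s * n ^ 3 * ?m + 6 * s * n ^ 3 * ?m^2 + (2 * ?m + 4 * ?m^2) * n^2 - 2 * s * ?m^2 * n)
   / (4 * n ^ 4 + 4 * s * n ^ 3 - 3 * n^2 * ?m - 2 * s * n * ?m + ?m))" if s: "s = 1 \<or> s = -1" for s
  unfolding B_def
  by (rule mode_pair_sum[OF n m \<rho> s]) (use TB(2)[OF s, of 1] TB(2)[OF s, of "-1"] in \<open>auto simp: x_def\<close>)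
 have "T 1 1 + T 1 (-1) + T (-1) 1 + T (-1) (-1) \<ge> (B 1 1 + B 1 (-1)) + (B (-1) 1 + B (-1) (-1))"
  using TB(1)[of 1 1] TB(1)[of 1 "-1"] TB(1)[of "-1" 1] TB(1)[of "-1" "-1"] by simp
 also have "(B 1 1 + B 1 (-1)) + (B (-1) 1 + B (-1) (-1)) \<ge> 4 * n^2 + 2 * ?m^2 + 15 / 4 * ?m - 5 * ?m * (n^2 + 1)"
  using mode_rational_bound(3)[OF n m] BS[of 1] BS[of "-1"] by simp
 finally have low: "T 1 1 + T 1 (-1) + T (-1) 1 + T (-1) (-1) \<ge> 4 * n^2 + 2 * \<mu> ^ 4 + 15 / 4 * ?m - 5 * ?m * (n^2 + 1)"
  by simp
 \<comment> \<open>The surplus 15/4 \<mu>^2 granted by \<open>mode_rational_bound\<close> has to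
   outweigh the term with \<open>mu1\<close>, which is negative for small \<tau>.\<close>
 have "15 / 4 * ?m + 4 * \<mu> ^ 3 * (1 / (4 * \<mu> ^ 3) - 1 / (2 * \<mu>^2) - 3 / (4 * \<mu>) + 2 + \<mu> / 2 - 9 / (4 * (2 - \<mu>)))
   = ((2 - 5 * \<mu> + 7/2 * \<mu>^2) + \<mu> ^ 3 * (25/4 - 4 * \<mu> - 2 * \<mu>^2)) / (2 - \<mu>)"
  using \<mu> by (simp add: field_simps power2_eq_square power3_eq_cube eval_nat_numeral)
 also have "\<dots> > 0"
 proof (rule divide_pos_pos, rule add_pos_nonneg)
  have "2 - 5 * \<mu> + 7/2 * \<mu>^2 = 7/2 * (\<mu> - 5/7)^2 + 3/14" by (simp add: power2_eq_square algebra_simps)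
  also have "\<dots> > 0" by (rule add_nonneg_pos) auto
  finally show "0 < 2 - 5 * \<mu> + 7/2 * \<mu>^2" .
  have "0 \<le> 25/4 - 4 * \<mu> - 2 * \<mu>^2" using \<mu> m by simp
  then show "0 \<le> \<mu> ^ 3 * (25/4 - 4 * \<mu> - 2 * \<mu>^2)" using \<mu> by simp
 qed (use \<mu> in auto)
 finally show ?thesis using low by simp
qed

section \<open>Variation of the surface conditions\<close>

lemma mlt_cst_mult: "mlt w (cst c * t) = cst c * mlt w t"
 by (rule poly_mapping_eqI) simp

lemma fm_X_power_add:
 assumes "f 0 = 0" "\<And>x y. f (x + y) = f x + f y"
 shows "fm f (a + fps_X ^ s * b) = fm f a + fps_X ^ s * fm (f :: wpoly \<Rightarrow> wpoly) b"
 by (simp add: fm_add assms fm_X_power_mult)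

text \<open>First variation, in the direction (\<beta>, \<alpha>), of the trace on the surface of
  the derivative f of \<phi>, kept up to relative order two (\<open>A_perturb2\<close>).\<close>

definition Bf :: "(wpoly \<Rightarrow> wpoly) \<Rightarrow> wpoly fps \<Rightarrow> wpoly fps \<Rightarrow> wpoly fps \<Rightarrow> wpoly fps \<Rightarrow> wpoly fps" where
 "Bf f \<eta> \<phi> \<beta> \<alpha> = fm z0 (fm f \<alpha> + \<eta> * fm (dyn 1) (fm f \<alpha>) + fcst (1/2) * \<eta>^2 * fm (dyn 2) (fm f \<alpha>)
    + \<beta> * fm (dyn 1) (fm f \<phi>) + \<beta> * \<eta> * fm (dyn 2) (fm f \<phi>))"

lemma A_perturb2:
 assumes "\<eta> $ 0 = 0" "\<phi> $ 0 = 0" "s \<ge> 3" and f: "f 0 = 0" "\<And>x y. f (x + y) = f x + f y"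
 shows "fcong (s + 3) (fm z0 (Sub (\<eta> + fps_X ^ s * \<beta>) (fm f (\<phi> + fps_X ^ s * \<alpha>))))
   (fm z0 (Sub \<eta> (fm f \<phi>)) + fps_X ^ s * Bf f \<eta> \<phi> \<beta> \<alpha>)"
proof -
 have "fcong (s + 3) (Sub (\<eta> + fps_X ^ s * \<beta>) (fm f \<phi> + fps_X ^ s * fm f \<alpha>))
   (Sub \<eta> (fm f \<phi>) + fps_X ^ s * (fm f \<alpha> + \<eta> * fm (dyn 1) (fm f \<alpha>) + fcst (1/2) * \<eta>^2 * fm (dyn 2) (fm f \<alpha>)
    + \<beta> * fm (dyn 1) (fm f \<phi>) + \<beta> * \<eta> * fm (dyn 2) (fm f \<phi>)))"
  by (rule Sub_perturb2) (use assms in auto)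
 from fcong_fm[OF this, of z0] show ?thesis
  unfolding fm_X_power_add[of f, OF f] fm_X_power_add[of z0, OF z0_0 z0_add] Bf_def .
qed

text \<open>The variations of \<open>E1\<close> and \<open>E2\<close> by the product rule. They are
  linear in (\<beta>, \<alpha>), see \<open>Th_scale\<close>, so that the amplitude of the inserted
  wave can be fitted afterwards.\<close>

definition Th1 :: "real \<Rightarrow> wpoly fps \<Rightarrow> wpoly fps \<Rightarrow> wpoly fps \<Rightarrow> wpoly fps \<Rightarrow> wpoly fps" where
 "Th1 \<tau> \<eta> \<phi> \<beta> \<alpha> = Bf dy \<eta> \<phi> \<beta> \<alpha> - (fm d1 \<eta> * Bf d1 \<eta> \<phi> \<beta> \<alpha> + fm d1 \<beta> * A1 \<eta> \<phi>)
   - (fm (d2 \<tau>) \<eta> * Bf (d2 \<tau>) \<eta> \<phi> \<beta> \<alpha> + fm (d2 \<tau>) \<beta> * A2 \<tau> \<eta> \<phi>) - fm d1 \<beta>"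
definition Th2 :: "real \<Rightarrow> wpoly fps \<Rightarrow> wpoly fps \<Rightarrow> wpoly fps \<Rightarrow> wpoly fps \<Rightarrow> wpoly fps \<Rightarrow> wpoly fps" where
 "Th2 \<tau> \<mu> \<eta> \<phi> \<beta> \<alpha> = Bf d1 \<eta> \<phi> \<beta> \<alpha> + (A1 \<eta> \<phi> * Bf d1 \<eta> \<phi> \<beta> \<alpha> + A2 \<tau> \<eta> \<phi> * Bf (d2 \<tau>) \<eta> \<phi> \<beta> \<alpha>
   + A3 \<eta> \<phi> * Bf dy \<eta> \<phi> \<beta> \<alpha>) + \<mu> * \<beta>"

lemma E_perturb2:
 fixes \<alpha> \<beta> :: "wpoly fps"
 assumes z: "\<eta> $ 0 = 0" "\<phi> $ 0 = 0" and s: "s \<ge> 3"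
 defines "\<eta>' \<equiv> \<eta> + fps_X ^ s * \<beta>" and "\<phi>' \<equiv> \<phi> + fps_X ^ s * \<alpha>"
 shows "fcong (s + 3) (E1 \<tau> \<eta>' \<phi>') (E1 \<tau> \<eta> \<phi> + fps_X ^ s * Th1 \<tau> \<eta> \<phi> \<beta> \<alpha>)" (is ?t1)
  "fcong (s + 3) (E2 \<tau> \<mu> \<eta>' \<phi>') (E2 \<tau> \<mu> \<eta> \<phi> + fps_X ^ s * Th2 \<tau> \<mu> \<eta> \<phi> \<beta> \<alpha>)" (is ?t2)
proof -
 have ss: "fcong (s + 3) (fps_X ^ s * (fps_X ^ s * c)) 0" for c :: "wpoly fps"
  using s by (auto simp: fcong_iff fps_X_power_mult_nth)
 have A: "fcong (s + 3) (A1 \<eta>' \<phi>') (A1 \<eta> \<phi> + fps_X ^ s * Bf d1 \<eta> \<phi> \<beta> \<alpha>)"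
  "fcong (s + 3) (A2 \<tau> \<eta>' \<phi>') (A2 \<tau> \<eta> \<phi> + fps_X ^ s * Bf (d2 \<tau>) \<eta> \<phi> \<beta> \<alpha>)"
  "fcong (s + 3) (A3 \<eta>' \<phi>') (A3 \<eta> \<phi> + fps_X ^ s * Bf dy \<eta> \<phi> \<beta> \<alpha>)"
  unfolding A1_def A2_def A3_def \<eta>'_def \<phi>'_def
  by (rule A_perturb2[OF z s]; simp add: d1_add d2_add dy_add)+
 have m: "fcong (s + 3) (a' * b') (a * b + fps_X ^ s * (a * db + da * b))"
  if "fcong (s + 3) a' (a + fps_X ^ s * da)" "fcong (s + 3) b' (b + fps_X ^ s * db)" for a a' b b' da db :: "wpoly fps"
 proof -
  have "fcong (s + 3) (a' * b') ((a + fps_X ^ s * da) * (b + fps_X ^ s * db))"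
   by (rule fcong_mult[OF that])
  also have "(a + fps_X ^ s * da) * (b + fps_X ^ s * db) = a * b + fps_X ^ s * (a * db + da * b) + fps_X ^ s * (fps_X ^ s * (da * db))"
   by (simp add: algebra_simps)
  also have "fcong (s + 3) \<dots> (a * b + fps_X ^ s * (a * db + da * b) + 0)"
   by (rule fcong_add[OF fcong_refl ss])
  finally show ?thesis by simp
 qed
 have e: "fm d1 \<eta>' = fm d1 \<eta> + fps_X ^ s * fm d1 \<beta>" "fm (d2 \<tau>) \<eta>' = fm (d2 \<tau>) \<eta> + fps_X ^ s * fm (d2 \<tau>) \<beta>"
  unfolding \<eta>'_def by (simp_all add: fm_X_power_add d1_add d2_add)
 have e': "fcong (s + 3) (fm d1 \<eta>') (fm d1 \<eta> + fps_X ^ s * fm d1 \<beta>)" "fcong (s + 3) (fm (d2 \<tau>) \<eta>') (fm (d2 \<tau>) \<eta> + fps_X ^ s * fm (d2 \<tau>) \<beta>)"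
  by (simp_all add: e)
 have "fcong (s + 3) (E1 \<tau> \<eta>' \<phi>') ((A3 \<eta> \<phi> + fps_X ^ s * Bf dy \<eta> \<phi> \<beta> \<alpha>)
   - (fm d1 \<eta> * A1 \<eta> \<phi> + fps_X ^ s * (fm d1 \<eta> * Bf d1 \<eta> \<phi> \<beta> \<alpha> + fm d1 \<beta> * A1 \<eta> \<phi>))
   - (fm (d2 \<tau>) \<eta> * A2 \<tau> \<eta> \<phi> + fps_X ^ s * (fm (d2 \<tau>) \<eta> * Bf (d2 \<tau>) \<eta> \<phi> \<beta> \<alpha> + fm (d2 \<tau>) \<beta> * A2 \<tau> \<eta> \<phi>))
   - (fm d1 \<eta> + fps_X ^ s * fm d1 \<beta>))"
  unfolding E1_def by (intro fcong_diff m A e')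
 then show ?t1 by (simp add: E1_def Th1_def algebra_simps)
 have sq: "fcong (s + 3) (a'\<^sup>2) (a^2 + fps_X ^ s * (a * da + da * a))" if "fcong (s + 3) a' (a + fps_X ^ s * da)" for a a' da :: "wpoly fps"
  unfolding power2_eq_square by (rule m[OF that that])
 have "fcong (s + 3) (E2 \<tau> \<mu> \<eta>' \<phi>') ((A1 \<eta> \<phi> + fps_X ^ s * Bf d1 \<eta> \<phi> \<beta> \<alpha>)
   + fcst (1/2) * (((A1 \<eta> \<phi>)^2 + fps_X ^ s * (A1 \<eta> \<phi> * Bf d1 \<eta> \<phi> \<beta> \<alpha> + Bf d1 \<eta> \<phi> \<beta> \<alpha> * A1 \<eta> \<phi>))
    + ((A2 \<tau> \<eta> \<phi>)^2 + fps_X ^ s * (A2 \<tau> \<eta> \<phi> * Bf (d2 \<tau>) \<eta> \<phi> \<beta> \<alpha> + Bf (d2 \<tau>) \<eta> \<phi> \<beta> \<alpha> * A2 \<tau> \<eta> \<phi>))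
    + ((A3 \<eta> \<phi>)^2 + fps_X ^ s * (A3 \<eta> \<phi> * Bf dy \<eta> \<phi> \<beta> \<alpha> + Bf dy \<eta> \<phi> \<beta> \<alpha> * A3 \<eta> \<phi>)))
   + (\<mu> * \<eta> + fps_X ^ s * (\<mu> * \<beta>)))"
  unfolding E2_def by (intro fcong_add fcong_mult fcong_refl sq A) (simp add: \<eta>'_def algebra_simps)
 also have "\<dots> = E2 \<tau> \<mu> \<eta> \<phi> + fps_X ^ s * Th2 \<tau> \<mu> \<eta> \<phi> \<beta> \<alpha>"
 proof -
  have c: "cst (1/2) * 2 = 1" using cst_mult[of "1/2" 2] by simp
  have h: "fcst (1/2) * (x + x) = x" for x
  proof -
   have "fcst (1/2) * (x + x) = (fcst (1/2) * 2) * x" by (simp add: algebra_simps)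
   also have "fcst (1/2) * 2 = 1" unfolding fps_numeral_fps_const fps_const_mult c by simp
   finally show ?thesis by simp
  qed
  have r: "fcst (1/2) * (a + fps_X ^ s * (x * y + y * x)) = fcst (1/2) * a + fps_X ^ s * (x * y)" for a x y
  proof -
   have "x * y + y * x = x * y + x * y" by (simp add: mult.commute)
   then show ?thesis
    by (simp only: distrib_left[of "fcst (1/2)" a] mult.left_commute[of "fcst (1/2)" "fps_X ^ s"] h)
  qed
  have "fcst (1/2) * ((a1 + fps_X ^ s * (x1 * y1 + y1 * x1)) + (a2 + fps_X ^ s * (x2 * y2 + y2 * x2)) + (a3 + fps_X ^ s * (x3 * y3 + y3 * x3)))
    = fcst (1/2) * (a1 + a2 + a3) + fps_X ^ s * (x1 * y1 + x2 * y2 + x3 * y3)" for a1 a2 a3 x1 x2 x3 y1 y2 y3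
   by (simp only: distrib_left[of "fcst (1/2)" "_ + fps_X ^ s * _" "_ + fps_X ^ s * _"] distrib_left[of "fcst (1/2)" "_ + fps_X ^ s * _ + _" "_ + fps_X ^ s * _"] r)
     (simp add: distrib_left add_ac)
  then show ?thesis unfolding E2_def Th2_def by (simp only:) (simp only: distrib_left add_ac)
 qed
 finally show ?t2 .
qed

lemma Bf_nth_gen:
 assumes z: "\<eta> $ 0 = 0" "\<phi> $ 0 = 0" and fl: "\<And>p. flat (\<eta> $ p)" "\<And>p. flat (\<beta> $ p)" and ha: "\<And>p. harm \<tau> (\<phi> $ p)" "\<And>p. harm \<tau> (\<alpha> $ p)"
  and a2: "\<alpha> $ 2 = 0" and f: "f = mlt (\<lambda>k. w (fst k))"
 defines "P \<equiv> \<lambda>p. z0 (\<phi> $ p)" and "a \<equiv> \<lambda>p. z0 (\<alpha> $ p)" and "h \<equiv> \<lambda>p. \<eta> $ p" and "b \<equiv> \<lambda>p. \<beta> $ p"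
 shows "Bf f \<eta> \<phi> \<beta> \<alpha> $ 0 = f (a 0)"
  "Bf f \<eta> \<phi> \<beta> \<alpha> $ 1 = f (a 1) + h 1 * f (kk \<tau> (a 0)) + b 0 * f (kk \<tau> (P 1))"
  "Bf f \<eta> \<phi> \<beta> \<alpha> $ 2 = h 1 * f (kk \<tau> (a 1)) + h 2 * f (kk \<tau> (a 0)) + cst (1/2) * (h 1 * (h 1 * f (kk \<tau> (kk \<tau> (a 0)))))
    + b 1 * f (kk \<tau> (P 1)) + b 0 * f (kk \<tau> (P 2)) + b 0 * (h 1 * f (kk \<tau> (kk \<tau> (P 1))))"
proof -
 have fe: "z0 (\<eta> $ p) = \<eta> $ p" "z0 (\<beta> $ p) = \<beta> $ p" for p using fl by (simp_all add: flat_z0_eq)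
 have zf: "z0 (f t) = f (z0 t)" for t by (simp add: f z0_mlt)
 have f0: "f 0 = 0" by (simp add: f)
 note z1 = z0_dyn_harm[of \<tau> _ w, folded f]
 have p2: "(\<eta>^2) $ 0 = 0" "(\<eta>^2) $ 1 = 0" "(\<eta>^2) $ 2 = \<eta> $ 1 * \<eta> $ 1"
  using z by (simp_all add: power2_eq_square fps_mult_nth eval_nat_numeral sum.atLeast0_atMost_Suc)
 have n0: "(x * y) $ 0 = x $ 0 * y $ 0" for x y :: "wpoly fps" by simp
 have n1: "(x * y) $ 1 = x $ 0 * y $ 1 + x $ 1 * y $ 0" for x y :: "wpoly fps" by (simp add: fps_mult_nth)
 have n2: "(x * y) $ 2 = x $ 0 * y $ 2 + x $ 1 * y $ 1 + x $ 2 * y $ 0" for x y :: "wpoly fps"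
  by (simp add: fps_mult_nth numeral_2_eq_2 sum.atLeast0_atMost_Suc)
 have zc: "z0 (cst c) = cst c" for c by (rule flat_z0_eq[OF flat_cst])
 show "Bf f \<eta> \<phi> \<beta> \<alpha> $ 0 = f (a 0)"
  "Bf f \<eta> \<phi> \<beta> \<alpha> $ 1 = f (a 1) + h 1 * f (kk \<tau> (a 0)) + b 0 * f (kk \<tau> (P 1))"
  "Bf f \<eta> \<phi> \<beta> \<alpha> $ 2 = h 1 * f (kk \<tau> (a 1)) + h 2 * f (kk \<tau> (a 0)) + cst (1/2) * (h 1 * (h 1 * f (kk \<tau> (kk \<tau> (a 0)))))
    + b 1 * f (kk \<tau> (P 1)) + b 0 * f (kk \<tau> (P 2)) + b 0 * (h 1 * f (kk \<tau> (kk \<tau> (P 1))))"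
  unfolding Bf_def P_def a_def h_def b_def fm_nth fps_add_nth n0 n1 n2 mult.assoc fps_mult_left_const_nth
  using z p2 by (simp_all add: z0_add z0_mult fe zf z1 ha f0 a2 zero_prod_def[symmetric] mult.assoc del: One_nat_def)
qed

lemma Th_nth:
 assumes z: "\<eta> $ 0 = 0" "\<phi> $ 0 = 0" and fl: "\<And>p. flat (\<eta> $ p)" "\<And>p. flat (\<beta> $ p)" and ha: "\<And>p. harm \<tau> (\<phi> $ p)" "\<And>p. harm \<tau> (\<alpha> $ p)"
  and a2: "\<alpha> $ 2 = 0" and b2: "\<beta> $ 2 = 0" and \<mu>: "\<mu> $ 1 = 0"
 defines "P \<equiv> \<lambda>p. z0 (\<phi> $ p)" and "a \<equiv> \<lambda>p. z0 (\<alpha> $ p)" and "h \<equiv> \<lambda>p. \<eta> $ p" and "b \<equiv> \<lambda>p. \<beta> $ p"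
 defines "B1 \<equiv> \<lambda>f::wpoly \<Rightarrow> wpoly. f (a 1) + h 1 * f (kk \<tau> (a 0)) + b 0 * f (kk \<tau> (P 1))"
  and "B2 \<equiv> \<lambda>f::wpoly \<Rightarrow> wpoly. h 1 * f (kk \<tau> (a 1)) + h 2 * f (kk \<tau> (a 0)) + cst (1/2) * (h 1 * (h 1 * f (kk \<tau> (kk \<tau> (a 0)))))
    + b 1 * f (kk \<tau> (P 1)) + b 0 * f (kk \<tau> (P 2)) + b 0 * (h 1 * f (kk \<tau> (kk \<tau> (P 1))))"
 shows "Th1 \<tau> \<eta> \<phi> \<beta> \<alpha> $ 0 = kk \<tau> (a 0) - d1 (b 0)"
  "Th1 \<tau> \<eta> \<phi> \<beta> \<alpha> $ 1 = B1 (kk \<tau>) - (d1 (h 1) * d1 (a 0) + d1 (b 0) * d1 (P 1)) - (d2 \<tau> (h 1) * d2 \<tau> (a 0) + d2 \<tau> (b 0) * d2 \<tau> (P 1)) - d1 (b 1)"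
  "Th1 \<tau> \<eta> \<phi> \<beta> \<alpha> $ 2 = B2 (kk \<tau>)
   - (d1 (h 1) * B1 d1 + d1 (h 2) * d1 (a 0) + d1 (b 0) * (d1 (P 2) + h 1 * d1 (kk \<tau> (P 1))) + d1 (b 1) * d1 (P 1))
   - (d2 \<tau> (h 1) * B1 (d2 \<tau>) + d2 \<tau> (h 2) * d2 \<tau> (a 0) + d2 \<tau> (b 0) * (d2 \<tau> (P 2) + h 1 * d2 \<tau> (kk \<tau> (P 1))) + d2 \<tau> (b 1) * d2 \<tau> (P 1))"
  "Th2 \<tau> \<mu> \<eta> \<phi> \<beta> \<alpha> $ 0 = d1 (a 0) + \<mu> $ 0 * b 0"
  "Th2 \<tau> \<mu> \<eta> \<phi> \<beta> \<alpha> $ 1 = B1 d1 + (d1 (P 1) * d1 (a 0) + d2 \<tau> (P 1) * d2 \<tau> (a 0) + kk \<tau> (P 1) * kk \<tau> (a 0)) + \<mu> $ 0 * b 1"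
  "Th2 \<tau> \<mu> \<eta> \<phi> \<beta> \<alpha> $ 2 = B2 d1 + (d1 (P 1) * B1 d1 + (d1 (P 2) + h 1 * d1 (kk \<tau> (P 1))) * d1 (a 0)
    + (d2 \<tau> (P 1) * B1 (d2 \<tau>) + (d2 \<tau> (P 2) + h 1 * d2 \<tau> (kk \<tau> (P 1))) * d2 \<tau> (a 0))
    + (kk \<tau> (P 1) * B1 (kk \<tau>) + (kk \<tau> (P 2) + h 1 * kk \<tau> (kk \<tau> (P 1))) * kk \<tau> (a 0))) + \<mu> $ 2 * b 0"
proof -
 have dyk: "fm dy \<phi> = fm (kk \<tau>) \<phi>" "fm dy \<alpha> = fm (kk \<tau>) \<alpha>" by (rule fps_ext; simp add: dy_harm ha)+
 have Bdy: "Bf dy \<eta> \<phi> \<beta> \<alpha> = Bf (kk \<tau>) \<eta> \<phi> \<beta> \<alpha>" by (simp add: Bf_def dyk)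
 note gen = Bf_nth_gen[OF z fl ha a2]
 have B: "Bf d1 \<eta> \<phi> \<beta> \<alpha> $ 0 = d1 (a 0)" "Bf d1 \<eta> \<phi> \<beta> \<alpha> $ 1 = B1 d1" "Bf d1 \<eta> \<phi> \<beta> \<alpha> $ 2 = B2 d1"
  "Bf (d2 \<tau>) \<eta> \<phi> \<beta> \<alpha> $ 0 = d2 \<tau> (a 0)" "Bf (d2 \<tau>) \<eta> \<phi> \<beta> \<alpha> $ 1 = B1 (d2 \<tau>)" "Bf (d2 \<tau>) \<eta> \<phi> \<beta> \<alpha> $ 2 = B2 (d2 \<tau>)"
  "Bf dy \<eta> \<phi> \<beta> \<alpha> $ 0 = kk \<tau> (a 0)" "Bf dy \<eta> \<phi> \<beta> \<alpha> $ 1 = B1 (kk \<tau>)" "Bf dy \<eta> \<phi> \<beta> \<alpha> $ 2 = B2 (kk \<tau>)"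
  unfolding Bdy B1_def B2_def P_def a_def h_def b_def by (rule gen, simp add: d1_def d2_def kk_def)+
 note A = A_nth[OF z fl(1) ha(1)]
 have z': "A1 \<eta> \<phi> $ 0 = 0" "A2 \<tau> \<eta> \<phi> $ 0 = 0" "A3 \<eta> \<phi> $ 0 = 0" using A_nth_0[OF z(2)] by auto
 have n0: "(x * y) $ 0 = x $ 0 * y $ 0" for x y :: "wpoly fps" by simp
 have n1: "(x * y) $ 1 = x $ 0 * y $ 1 + x $ 1 * y $ 0" for x y :: "wpoly fps" by (simp add: fps_mult_nth)
 have n2: "(x * y) $ 2 = x $ 0 * y $ 2 + x $ 1 * y $ 1 + x $ 2 * y $ 0" for x y :: "wpoly fps"
  by (simp add: fps_mult_nth numeral_2_eq_2 sum.atLeast0_atMost_Suc)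
 have e: "fm d1 \<eta> $ 0 = 0" "fm (d2 \<tau>) \<eta> $ 0 = 0" "fm d1 \<eta> $ p = d1 (\<eta> $ p)" "fm (d2 \<tau>) \<eta> $ p = d2 \<tau> (\<eta> $ p)" "fm d1 \<beta> $ p = d1 (\<beta> $ p)" "fm (d2 \<tau>) \<beta> $ p = d2 \<tau> (\<beta> $ p)" for p
  using z by simp_all
 note b2' = b2
 show "Th1 \<tau> \<eta> \<phi> \<beta> \<alpha> $ 0 = kk \<tau> (a 0) - d1 (b 0)"
  "Th2 \<tau> \<mu> \<eta> \<phi> \<beta> \<alpha> $ 0 = d1 (a 0) + \<mu> $ 0 * b 0"
  unfolding Th1_def Th2_def fps_sub_nth fps_add_nth n0 e B z' P_def a_def h_def b_def using z by simp_all
 show "Th1 \<tau> \<eta> \<phi> \<beta> \<alpha> $ 1 = B1 (kk \<tau>) - (d1 (h 1) * d1 (a 0) + d1 (b 0) * d1 (P 1)) - (d2 \<tau> (h 1) * d2 \<tau> (a 0) + d2 \<tau> (b 0) * d2 \<tau> (P 1)) - d1 (b 1)"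
  unfolding Th1_def fps_sub_nth fps_add_nth n1 e(1,2) unfolding e B z' A P_def a_def h_def b_def using z by simp
 show "Th2 \<tau> \<mu> \<eta> \<phi> \<beta> \<alpha> $ 1 = B1 d1 + (d1 (P 1) * d1 (a 0) + d2 \<tau> (P 1) * d2 \<tau> (a 0) + kk \<tau> (P 1) * kk \<tau> (a 0)) + \<mu> $ 0 * b 1"
  unfolding Th2_def fps_sub_nth fps_add_nth n1 e B z' A \<mu> P_def a_def h_def b_def using z by simp
 show "Th1 \<tau> \<eta> \<phi> \<beta> \<alpha> $ 2 = B2 (kk \<tau>)
   - (d1 (h 1) * B1 d1 + d1 (h 2) * d1 (a 0) + d1 (b 0) * (d1 (P 2) + h 1 * d1 (kk \<tau> (P 1))) + d1 (b 1) * d1 (P 1))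
   - (d2 \<tau> (h 1) * B1 (d2 \<tau>) + d2 \<tau> (h 2) * d2 \<tau> (a 0) + d2 \<tau> (b 0) * (d2 \<tau> (P 2) + h 1 * d2 \<tau> (kk \<tau> (P 1))) + d2 \<tau> (b 1) * d2 \<tau> (P 1))"
  unfolding Th1_def fps_sub_nth fps_add_nth n2 e(1,2) unfolding e B z' A b2' P_def a_def h_def b_def using z by (simp add: add.assoc)
 show "Th2 \<tau> \<mu> \<eta> \<phi> \<beta> \<alpha> $ 2 = B2 d1 + (d1 (P 1) * B1 d1 + (d1 (P 2) + h 1 * d1 (kk \<tau> (P 1))) * d1 (a 0)
    + (d2 \<tau> (P 1) * B1 (d2 \<tau>) + (d2 \<tau> (P 2) + h 1 * d2 \<tau> (kk \<tau> (P 1))) * d2 \<tau> (a 0))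
    + (kk \<tau> (P 1) * B1 (kk \<tau>) + (kk \<tau> (P 2) + h 1 * kk \<tau> (kk \<tau> (P 1))) * kk \<tau> (a 0))) + \<mu> $ 2 * b 0"
  unfolding Th2_def fps_sub_nth fps_add_nth n2 e B z' A \<mu> b2' P_def a_def h_def b_def using z by simp
qed

text \<open>One sideband (n + s, N + t) with response (A, B) in potential and elevation.
  \<open>h1\<close> and \<open>h2\<close> are its equations; solved for the response and inserted
  into the solvability condition at (n, N), they give a closed expression. Here q G is the length of
  the sideband wave vector and D G^2 the inner product of (n, \<tau> N) and (s, \<tau> t).\<close>

lemma mode_contribution:
 fixes n s G h D q A B :: complex
 assumes s: "s * s = 1" and G: "G \<noteq> 0" and n: "n \<noteq> 0" and h: "h \<noteq> 0" and det: "q - (n + s)^2 \<noteq> 0"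
  and q: "q^2 = n ^ 4 + 1 + 2 * D"
  and h1: "q * G * A - \<i> * (n + s) * B + h * (\<i> / (G * n)) * (n ^ 4 * G^2 + D * G^2) + s * (\<i> * h / G) * (G^2 + D * G^2) = 0"
  and h2: "\<i> * (n + s) * A + B / G + h * (\<i> * n * (n^2 * G) * (\<i> / (G * n))) + \<i> * G * (\<i> * h / G)
    + s * (\<i> * h / G) * ((G * (n^2 * G) - D * G^2) * (\<i> / (G * n))) = 0"
 shows "(1 / G) * (h * ((q * G)^2 - (D * G^2 + G^2)) * A + s * (\<i> * h / G) * (D * G^2) * B)
   + \<i> * n * (\<i> * (n + s) * (q * G) * h * A + \<i> * G * (\<i> * h / G) * B - s * (\<i> * h / G) * (D * G^2 + G^2 + G * (q * G)) * A)
  = \<i> * n * h^2 * G * ((n ^ 4 + D + s * n + s * n * D) - (n ^ 3 + n + s * (n^2 - D))^2 / n^2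
    + 4 * ((n + s)^2 * (n^2 - D)^2 / (n^2 * ((n + s)^2 - q))))"
proof -
 \<comment> \<open>Normalised responses: in these variables the two equations are free of \<i>, h
   and G (\<open>e1\<close> and \<open>e2\<close>).\<close>
 define a where "a = A / (\<i> * h)"
 define b where "b = B / (h * G)"
 define X where "X = n ^ 4 + D + s * n + s * n * D"
 define Y where "Y = n ^ 3 + n + s * (n^2 - D)"
 define \<Delta> where "\<Delta> = q - (n + s)^2"
 have A: "A = \<i> * h * a" and B: "B = h * G * b" using h G by (simp_all add: a_def b_def)
 have "\<i> * h * G / n * (n * (q * a - (n + s) * b) + X) =
   q * G * A - \<i> * (n + s) * B + h * (\<i> / (G * n)) * (n ^ 4 * G^2 + D * G^2) + s * (\<i> * h / G) * (G^2 + D * G^2)"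
  using G n unfolding A B X_def by (simp add: field_simps power2_eq_square)
 then have "\<i> * h * G / n * (n * (q * a - (n + s) * b) + X) = 0" unfolding h1 .
 then have e1: "n * (q * a - (n + s) * b) = - X" using h G n by (simp add: eq_neg_iff_add_eq_0)
 have "h / n * (n * (b - (n + s) * a) - Y) = \<i> * (n + s) * A + B / G + h * (\<i> * n * (n^2 * G) * (\<i> / (G * n))) + \<i> * G * (\<i> * h / G)
    + s * (\<i> * h / G) * ((G * (n^2 * G) - D * G^2) * (\<i> / (G * n)))"
  using G n unfolding A B Y_def by (simp add: field_simps power2_eq_square power3_eq_cube)
 then have "h / n * (n * (b - (n + s) * a) - Y) = 0" unfolding h2 .
 then have e2: "n * (b - (n + s) * a) = Y" using h n by simp
 have D0: "\<Delta> \<noteq> 0" using det by (simp add: \<Delta>_def)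
 have aD: "n * (a * \<Delta>) = (n + s) * Y - X" using e1 e2 unfolding \<Delta>_def by algebra
 have XY: "X - (n + s) * Y = 2 * (1 + s * n) * (D - n^2)" unfolding X_def Y_def using s by algebra
 have XY2: "(X - (n + s) * Y)^2 = 4 * ((n + s)^2 * (n^2 - D)^2)" unfolding XY using s by algebra
 have b: "n * b = Y + n * (n + s) * a" using e2 by (simp add: algebra_simps)
 have key: "n * (a * (X - n^2 * q) + b * (s * D - n)) = n^2 * X - Y^2 + n * a * (X - (n + s) * Y)"
 proof -
  have "s * D - n = n^2 * (n + s) - Y" unfolding Y_def by (simp add: algebra_simps power2_eq_square power3_eq_cube)
  then have "n * (a * (X - n^2 * q) + b * (s * D - n)) = n * a * (X - n^2 * q) + (Y + n * (n + s) * a) * (n^2 * (n + s) - Y)"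
   using b by algebra
  also have "\<dots> = n * a * (X - (n + s) * Y) - n ^ 3 * a * \<Delta> + n^2 * (n + s) * Y - Y^2"
   unfolding \<Delta>_def by algebra
  also have "n ^ 3 * a * \<Delta> = n^2 * ((n + s) * Y - X)" using aD by algebra
  finally have "n * (a * (X - n^2 * q) + b * (s * D - n)) = n * a * (X - (n + s) * Y) + n^2 * X - Y^2" by (simp add: algebra_simps)
  then show ?thesis by simp
 qed
 define W where "W = X - (n + s) * Y"
 have "n * a = - W / \<Delta>" using aD D0 by (simp add: eq_divide_eq mult.assoc W_def)
 then have "n * a * W = - (W^2 / \<Delta>)" by (simp add: power2_eq_square)
 then have fin: "n * (a * (X - n^2 * q) + b * (s * D - n)) = n^2 * X - Y^2 - 4 * ((n + s)^2 * (n^2 - D)^2) / \<Delta>"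
  unfolding key XY2[symmetric] W_def[symmetric] by simp
 have "(1 / G) * (h * ((q * G)^2 - (D * G^2 + G^2)) * A + s * (\<i> * h / G) * (D * G^2) * B)
   + \<i> * n * (\<i> * (n + s) * (q * G) * h * A + \<i> * G * (\<i> * h / G) * B - s * (\<i> * h / G) * (D * G^2 + G^2 + G * (q * G)) * A)
  = \<i> * h^2 * G * ((q^2 - D - 1) * a + s * D * b - n * (n + s) * q * a - n * b + n * s * (D + 1 + q) * a)"
  unfolding A B using G by (simp add: field_simps power2_eq_square)
 also have "(q^2 - D - 1) * a + s * D * b - n * (n + s) * q * a - n * b + n * s * (D + 1 + q) * a
   = a * (X - n^2 * q) + b * (s * D - n)" unfolding q X_def by algebra
 also have "\<dots> = (n^2 * X - Y^2 - 4 * ((n + s)^2 * (n^2 - D)^2) / \<Delta>) / n"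
  unfolding fin[symmetric] using n by simp
 also have "\<dots> = n * (X - Y^2 / n^2 - 4 * ((n + s)^2 * (n^2 - D)^2) / (n^2 * \<Delta>))"
  using n D0 by (simp add: field_simps power2_eq_square)
 also have "4 * ((n + s)^2 * (n^2 - D)^2) / (n^2 * \<Delta>) = - (4 * ((n + s)^2 * (n^2 - D)^2 / (n^2 * ((n + s)^2 - q))))"
 proof -
  have "n^2 * ((n + s)^2 - q) = - (n^2 * \<Delta>)" by (simp add: \<Delta>_def algebra_simps)
  then show ?thesis by simp
 qed
 finally show ?thesis unfolding X_def[symmetric] Y_def[symmetric] by (simp add: algebra_simps)
qed

text \<open>The four sidebands, the direct cubic terms 4 + 4 (n^2 + 2) \<mu>^2 and
  \<open>mu1\<close> add up to the quantity of \<open>mode_coefficient_pos\<close> divided by 4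
  \<mu>^3.\<close>

lemma mode_total:
 fixes n \<mu> \<rho> :: real and q :: "real \<Rightarrow> real \<Rightarrow> real"
 assumes n: "n \<ge> 2" and \<mu>: "0 < \<mu>" "\<mu> < 1" and \<rho>: "\<rho>^2 = n^2 * ((1 - \<mu>^2) * (n^2 - \<mu>^2))"
  and q: "\<And>s t. s\<^sup>2 = 1 \<Longrightarrow> t\<^sup>2 = 1 \<Longrightarrow> q s t \<ge> 0 \<and> (q s t)\<^sup>2 = n ^ 4 + 1 + 2 * (s * n * \<mu>^2 + t * \<rho>)"
 defines "D \<equiv> \<lambda>s t. s * n * \<mu>^2 + t * \<rho>"
 defines "R \<equiv> \<lambda>s t. (n ^ 4 + D s t + s * n + s * n * D s t) - (n ^ 3 + n + s * (n^2 - D s t))^2 / n^2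
    + 4 * ((n + s)^2 * (n^2 - D s t)^2 / (n^2 * ((n + s)^2 - q s t)))"
 shows "(1 / (16 * \<mu> ^ 3)) * (R 1 1 + R 1 (-1) + R (-1) 1 + R (-1) (-1) + 4 + 4 * (n^2 + 2) * \<mu>^2)
  + (1 / (4 * \<mu> ^ 3) - 1 / (2 * \<mu>^2) - 3 / (4 * \<mu>) + 2 + \<mu> / 2 - 9 / (4 * (2 - \<mu>))) > 0"
proof -
 define M where "M = 1 / (4 * \<mu> ^ 3) - 1 / (2 * \<mu>^2) - 3 / (4 * \<mu>) + 2 + \<mu> / 2 - 9 / (4 * (2 - \<mu>))"
 define T where "T s t = (n + s)^2 * (n^2 - D s t)^2 / (n^2 * ((n + s)^2 - q s t))" for s t
 define X where "X s t = (n ^ 4 + D s t + s * n + s * n * D s t) - (n ^ 3 + n + s * (n^2 - D s t))^2 / n^2" for s t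
 have n0: "n \<noteq> 0" using n by simp
 define r where "r = \<rho> / n"
 have D: "D s t = n * (s * \<mu>^2 + t * r)" for s t using n0 by (simp add: D_def r_def algebra_simps)
 have Y: "(n ^ 3 + n + s * (n^2 - D s t))^2 / n^2 = (n^2 + 1 + s * n)^2 - 2 * s * (n^2 + 1 + s * n) * (s * \<mu>^2 + t * r) + s^2 * (s * \<mu>^2 + t * r)^2" for s t
 proof -
  have "n ^ 3 + n + s * (n^2 - D s t) = n * ((n^2 + 1 + s * n) - s * (s * \<mu>^2 + t * r))"
   unfolding D by (simp add: algebra_simps power2_eq_square power3_eq_cube)
  then show ?thesis using n0 by (simp add: power_mult_distrib) (simp add: power2_eq_square algebra_simps)
 qed
 have rn: "r^2 = (1 - \<mu>^2) * (n^2 - \<mu>^2)" using \<rho> n0 by (simp add: power_divide r_def)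
 \<comment> \<open>Terms odd in s or in t cancel in the sum over the four signs.\<close>
 have "X 1 1 + X 1 (-1) + X (-1) 1 + X (-1) (-1) = 4 * (n ^ 4 + n^2 * \<mu>^2)
   - (4 * ((n^2 + 1)^2 + n^2) - 8 * (n^2 + 1) * \<mu>^2 + 4 * (\<mu> ^ 4 + r^2))"
  unfolding X_def Y unfolding D
  by (simp only: power2_eq_square mult_1_left mult_1_right mult_minus_left mult_minus_right minus_minus) algebra
 then have XS: "X 1 1 + X 1 (-1) + X (-1) 1 + X (-1) (-1) + 4 + 4 * (n^2 + 2) * \<mu>^2 = 4 * (5 * \<mu>^2 * (n^2 + 1) - 4 * n^2 - 2 * \<mu> ^ 4)"
  unfolding rn by (simp add: algebra_simps power2_eq_square eval_nat_numeral)
 have R: "R s t = X s t + 4 * T s t" for s t unfolding R_def X_def T_def by simp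
 have pos: "5 * \<mu>^2 * (n^2 + 1) - 4 * n^2 - 2 * \<mu> ^ 4 + (T 1 1 + T 1 (-1) + T (-1) 1 + T (-1) (-1)) + 4 * \<mu> ^ 3 * M > 0"
  unfolding T_def D_def M_def by (rule mode_coefficient_pos[OF n \<mu> \<rho>]) (rule q)
 have "(1 / (16 * \<mu> ^ 3)) * (R 1 1 + R 1 (-1) + R (-1) 1 + R (-1) (-1) + 4 + 4 * (n^2 + 2) * \<mu>^2) + M
  = (5 * \<mu>^2 * (n^2 + 1) - 4 * n^2 - 2 * \<mu> ^ 4 + (T 1 1 + T 1 (-1) + T (-1) 1 + T (-1) (-1)) + 4 * \<mu> ^ 3 * M) / (4 * \<mu> ^ 3)"
 proof -
  have "R 1 1 + R 1 (-1) + R (-1) 1 + R (-1) (-1) + 4 + 4 * (n^2 + 2) * \<mu>^2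
   = (X 1 1 + X 1 (-1) + X (-1) 1 + X (-1) (-1) + 4 + 4 * (n^2 + 2) * \<mu>^2) + 4 * (T 1 1 + T 1 (-1) + T (-1) 1 + T (-1) (-1))"
   unfolding R by simp
  also have "\<dots> = 4 * (5 * \<mu>^2 * (n^2 + 1) - 4 * n^2 - 2 * \<mu> ^ 4 + (T 1 1 + T 1 (-1) + T (-1) 1 + T (-1) (-1)))"
   unfolding XS by simp
  finally have e: "R 1 1 + R 1 (-1) + R (-1) 1 + R (-1) (-1) + 4 + 4 * (n^2 + 2) * \<mu>^2 = \<dots>" .
  have gen: "(1 / (16 * c)) * (4 * Z) + M = (Z + 4 * c * M) / (4 * c)" if "c > 0" for c Z :: real
   using that by (simp add: field_simps)
  show ?thesis unfolding e by (rule gen) (use \<mu> in simp)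
 qed
 also have "\<dots> > 0" using pos \<mu> by simp
 finally show ?thesis unfolding M_def .
qed

lemma lookup_wcls_big:
 assumes "wcls D s1 s2 p t" "int (D * p) < \<bar>x\<bar> \<or> int (D * p) < \<bar>y\<bar>"
 shows "lk t ((x, y), z) = 0"
 using assms by (force simp: wcls_def in_keys_iff)

text \<open>Feedback of the kernel wave at (n, N) on itself at relative order two. The vanishing of
  \<open>Th1\<close> and \<open>Th2\<close> at order one determines the sidebands in \<alpha> and
  \<beta>. Besides them contribute the direct cubic terms and, through \<mu> \<eta>, the coefficient
  \<open>mu1\<close>; \<open>mode_total\<close> gives the sign of the sum.\<close>

lemma resonant_mode:
 fixes n N :: int
 assumes F: "fsol \<tau> 1 M \<eta> \<phi> m" and M: "M \<ge> 4" and \<tau>: "\<tau> > 0" and n2: "n \<ge> 2" and N6: "N \<ge> 6"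
  and res: "mu_c \<tau> * kn \<tau> (n, N) = (of_int n)^2"
  and fb: "\<And>p. flat (\<beta> $ p)" and ha': "\<And>p. harm \<tau> (\<alpha> $ p)"
  and \<alpha>0: "\<alpha> $ 0 = wv (-1) n N (kn \<tau> (n, N)) (\<i> * of_real (mu_c \<tau>) / of_int n)" and \<beta>0: "\<beta> $ 0 = wv 1 n N 0 1"
  and \<alpha>2: "\<alpha> $ 2 = 0" and \<beta>2: "\<beta> $ 2 = 0"
  and Th: "Th1 \<tau> \<eta> \<phi> \<beta> \<alpha> $ 1 = 0" "Th2 \<tau> (cfm m) \<eta> \<phi> \<beta> \<alpha> $ 1 = 0"
 shows "\<exists>w::real. w > 0 \<and> of_real (mu_c \<tau>) * lk (Th1 \<tau> \<eta> \<phi> \<beta> \<alpha> $ 2) ((n, N), 0)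
   + \<i> * of_int n * lk (Th2 \<tau> (cfm m) \<eta> \<phi> \<beta> \<alpha> $ 2) ((n, N), 0) = \<i> * of_int n * of_real w"
proof -
 let ?l = "lk"
 let ?n = "complex_of_int n" and ?N = "complex_of_int N"
 define \<mu> where "\<mu> = mu_c \<tau>"
 define G where "G = complex_of_real (1 / \<mu>)"
 define T where "T = complex_of_real \<tau>"
 define h where "h = - G / 4"
 define p where "p = - \<i> / 4"
 have mu0: "\<mu> > 0" unfolding \<mu>_def by (rule mu_c_pos)
 have mu1: "\<mu> < 1" unfolding \<mu>_def by (rule mu_c_lt_1[OF \<tau>])
 have k2: "\<tau>^2 = (1 / \<mu>)^2 - 1" using mu_c_sq[of \<tau>] mu0 by (simp add: \<mu>_def[symmetric] field_simps power2_eq_square)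
 have T2: "T^2 = G^2 - 1"
  using arg_cong[OF k2, of complex_of_real] by (simp add: T_def G_def)
 have TT: "T * T = G^2 - 1" using T2 by (simp add: power2_eq_square)
 have G0: "G \<noteq> 0" using mu0 by (simp add: G_def)
 have kn: "kn \<tau> (1,1) = 1 / \<mu>" using kn_1_1[of \<tau>] mu0 by (simp add: \<mu>_def[symmetric] field_simps)
 have G_mu: "complex_of_real \<mu> = 1 / G" by (simp add: G_def)
 have knN: "kn \<tau> (n, N) = (of_int n)^2 / \<mu>" using res mu0 by (simp add: \<mu>_def[symmetric] field_simps)
 define k where "k = ?n^2 * G"
 have knNc: "complex_of_real (kn \<tau> (n, N)) = k" unfolding knN k_def G_def by simp
 define a0 where "a0 = \<i> / (G * ?n)"
 have n0: "?n \<noteq> 0" using n2 by simp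
 from F have cl: "wCl 1 1 1 \<eta>" "wCl 1 (-1) 1 \<phi>" and fl: "\<And>p. flat (\<eta> $ p)" and ha: "\<And>p. harm \<tau> (\<phi> $ p)"
  and z: "\<eta> $ 0 = 0" "\<phi> $ 0 = 0" and one: "\<eta> $ 1 = eta1 \<tau>" "\<phi> $ 1 = phi1 \<tau>"
  and m0: "m $ 0 = mu_c \<tau>" and mo: "\<And>p. odd p \<Longrightarrow> m $ p = 0"
  by (auto simp: fsol_def)
 have m2: "m $ 2 = mu1 \<tau>" and e00: "?l (\<eta> $ 2) ((0,0),0) = 0" using fsol_mu2[OF F M \<tau>] by auto
 have cm1: "cfm m $ 1 = 0" using mo[of 1] by simp
 define P2 where "P2 = z0 (\<phi> $ 2)"
 define H2 where "H2 = \<eta> $ 2"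
 define a1 where "a1 = z0 (\<alpha> $ 1)"
 define b1 where "b1 = \<beta> $ 1"
 have P1: "z0 (phi1 \<tau>) = wv (-1) 1 1 0 p" by (simp add: phi1_def z0_wv p_def)
 have H1: "eta1 \<tau> = wv 1 1 1 0 h" by (simp add: eta1_def h_def G_def \<mu>_def mult.commute)
 have A0: "z0 (\<alpha> $ 0) = wv (-1) n N 0 a0" unfolding \<alpha>0 z0_wv a0_def \<mu>_def[symmetric] G_mu by simp
 have P2c: "wcls 1 (-1) 1 2 P2" using cl(2) by (simp add: wCl_def P2_def wcls_z0)
 have H2c: "wcls 1 1 1 2 H2" using cl(1) by (simp add: wCl_def H2_def)
 have p0: "?l P2 ((0,b),0) = 0" for b
  using wcls_odd[OF P2c, of "((0,b),0)"] by (auto simp: in_keys_iff)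
 \<comment> \<open>Modes of the wave of order two map (n, N) or its reflections to (n, N) only
   through the frequencies (0, 0), (2n, 0), (0, 2N), (2n, 2N). As n \<ge> 2 and N \<ge> 6, only the
   mean is left, and it vanishes for potential and elevation.\<close>
 have big: "?l P2 ((x,y),0) = 0" "?l H2 ((x,y),0) = 0" if "x > 2 \<or> y > 2" for x y
  using that lookup_wcls_big[OF P2c, of x y 0] lookup_wcls_big[OF H2c, of x y 0] by auto
 note Tn = Th_nth[OF z fl fb ha ha' \<alpha>2 \<beta>2 cm1]
 have X1: "kk \<tau> a1 + wv 1 1 1 0 h * wv (-1) n N 0 (k * (k * a0)) + wv 1 n N 0 1 * wv (-1) 1 1 0 (G * (G * p))
   - (wv (-1) 1 1 0 (\<i> * h) * wv 1 n N 0 (\<i> * ?n * a0) + wv (-1) n N 0 (\<i> * ?n) * wv 1 1 1 0 (\<i> * p))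
   - (dwv 1 1 1 (\<i> * T * h) * dwv (-1) n N (\<i> * T * ?N * a0) + dwv 1 n N (\<i> * T * ?N) * dwv (-1) 1 1 (\<i> * T * p)) - d1 b1 = 0"
  using Th(1) unfolding Tn(2) one P1 H1 A0 \<beta>0 a1_def[symmetric] b1_def[symmetric]
  by (simp add: kk_wv d1_wv d2_wv kn knNc G_def[symmetric] T_def[symmetric] of_real_divide[symmetric] del: of_real_divide)
 have Y1: "d1 a1 + wv 1 1 1 0 h * wv 1 n N 0 (\<i> * ?n * (k * a0)) + wv 1 n N 0 1 * wv 1 1 1 0 (\<i> * (G * p))
   + (wv 1 1 1 0 (\<i> * p) * wv 1 n N 0 (\<i> * ?n * a0) + dwv (-1) 1 1 (\<i> * T * p) * dwv (-1) n N (\<i> * T * ?N * a0)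
   + wv (-1) 1 1 0 (G * p) * wv (-1) n N 0 (k * a0)) + cst (1 / G) * b1 = 0"
  using Th(2) unfolding Tn(5) one P1 H1 A0 \<beta>0 a1_def[symmetric] b1_def[symmetric]
  by (simp add: kk_wv d1_wv d2_wv kn knNc G_def[symmetric] T_def[symmetric] m0 \<mu>_def[symmetric] G_mu of_real_divide[symmetric] del: of_real_divide)
 define A where "A s t = ?l a1 ((n + s, N + t), 0)" for s t
 define B where "B s t = ?l b1 ((n + s, N + t), 0)" for s t
 define K where "K s t = complex_of_real (kn \<tau> (n + s, N + t))" for s t
 define d where "d s t = of_int s * ?n + of_int t * T^2 * ?N" for s t :: int
 note L = lookup_add lookup_minus lookup_kk lookup_d1 lookup_d2 lookup_wv_mult lookup_dwv_mult lookup_wv_gen lookup_dwv_gen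
 have e1: "K s t * A s t - \<i> * (?n + of_int s) * B s t + h * a0 * (k^2 + d s t) + of_int s * p * (G^2 + d s t) = 0"
  if "s = 1 \<or> s = -1" "t = 1 \<or> t = -1" for s t
  using that arg_cong[OF X1, of "\<lambda>x. ?l x ((n + s, N + t), 0)"] n2 N6
  by (elim disjE; simp add: L A_def B_def K_def d_def power2_eq_square algebra_simps)
 have e2: "\<i> * (?n + of_int s) * A s t + B s t / G + h * (\<i> * ?n * k * a0) + \<i> * G * p + of_int s * p * ((G * k - d s t) * a0) = 0"
  if "s = 1 \<or> s = -1" "t = 1 \<or> t = -1" for s t
  using that arg_cong[OF Y1, of "\<lambda>x. ?l x ((n + s, N + t), 0)"] n2 N6
  by (elim disjE; simp add: L A_def B_def K_def d_def; simp add: power2_eq_square algebra_simps)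
 have X2: "Th1 \<tau> \<eta> \<phi> \<beta> \<alpha> $ 2 = wv 1 1 1 0 h * kk \<tau> (kk \<tau> a1) + wv (-1) n N 0 (k * (k * a0)) * H2
   + cst (1/2) * (wv 1 1 1 0 h * (wv 1 1 1 0 h * wv (-1) n N 0 (k * (k * (k * a0)))))
   + wv (-1) 1 1 0 (G * (G * p)) * b1 + wv 1 n N 0 1 * kk \<tau> (kk \<tau> P2)
   + wv 1 n N 0 1 * (wv 1 1 1 0 h * wv (-1) 1 1 0 (G * (G * (G * p))))
   - (wv (-1) 1 1 0 (\<i> * h) * d1 a1 + wv (-1) 1 1 0 (\<i> * h) * (wv 1 1 1 0 h * wv 1 n N 0 (\<i> * ?n * (k * a0)))
    + wv (-1) 1 1 0 (\<i> * h) * (wv 1 n N 0 1 * wv 1 1 1 0 (\<i> * (G * p)))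
    + wv 1 n N 0 (\<i> * ?n * a0) * d1 H2 + wv (-1) n N 0 (\<i> * ?n) * d1 P2
    + wv (-1) n N 0 (\<i> * ?n) * (wv 1 1 1 0 h * wv 1 1 1 0 (\<i> * (G * p))) + wv 1 1 1 0 (\<i> * p) * d1 b1)
   - (dwv 1 1 1 (\<i> * T * h) * d2 \<tau> a1 + dwv 1 1 1 (\<i> * T * h) * (wv 1 1 1 0 h * dwv (-1) n N (\<i> * T * ?N * (k * a0)))
    + dwv 1 1 1 (\<i> * T * h) * (wv 1 n N 0 1 * dwv (-1) 1 1 (\<i> * T * (G * p)))
    + dwv (-1) n N (\<i> * T * ?N * a0) * d2 \<tau> H2 + dwv 1 n N (\<i> * T * ?N) * d2 \<tau> P2
    + dwv 1 n N (\<i> * T * ?N) * (wv 1 1 1 0 h * dwv (-1) 1 1 (\<i> * T * (G * p))) + dwv (-1) 1 1 (\<i> * T * p) * d2 \<tau> b1)"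
  unfolding Tn(3) one P1 H1 A0 \<beta>0 a1_def[symmetric] b1_def[symmetric] P2_def[symmetric] H2_def[symmetric]
  by (simp add: kk_wv d1_wv d2_wv kn knNc G_def[symmetric] T_def[symmetric] of_real_divide[symmetric] distrib_left mult.commute[of H2] mult.commute[of b1]
    mult.commute[of "d1 H2"] mult.commute[of "d1 b1"] mult.commute[of "d2 \<tau> H2"] mult.commute[of "d2 \<tau> b1"] add_ac del: of_real_divide)
 have Y2: "Th2 \<tau> (cfm m) \<eta> \<phi> \<beta> \<alpha> $ 2 = wv 1 1 1 0 h * d1 (kk \<tau> a1) + wv 1 n N 0 (\<i> * ?n * (k * a0)) * H2
   + cst (1/2) * (wv 1 1 1 0 h * (wv 1 1 1 0 h * wv 1 n N 0 (\<i> * ?n * (k * (k * a0)))))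
   + wv 1 1 1 0 (\<i> * (G * p)) * b1 + wv 1 n N 0 1 * d1 (kk \<tau> P2) + wv 1 n N 0 1 * (wv 1 1 1 0 h * wv 1 1 1 0 (\<i> * (G * (G * p))))
   + (wv 1 1 1 0 (\<i> * p) * d1 a1 + wv 1 1 1 0 (\<i> * p) * (wv 1 1 1 0 h * wv 1 n N 0 (\<i> * ?n * (k * a0)))
    + wv 1 1 1 0 (\<i> * p) * (wv 1 n N 0 1 * wv 1 1 1 0 (\<i> * (G * p)))
    + wv 1 n N 0 (\<i> * ?n * a0) * d1 P2 + wv 1 n N 0 (\<i> * ?n * a0) * (wv 1 1 1 0 h * wv 1 1 1 0 (\<i> * (G * p))))
   + (dwv (-1) 1 1 (\<i> * T * p) * d2 \<tau> a1 + dwv (-1) 1 1 (\<i> * T * p) * (wv 1 1 1 0 h * dwv (-1) n N (\<i> * T * ?N * (k * a0)))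
    + dwv (-1) 1 1 (\<i> * T * p) * (wv 1 n N 0 1 * dwv (-1) 1 1 (\<i> * T * (G * p)))
    + dwv (-1) n N (\<i> * T * ?N * a0) * d2 \<tau> P2 + dwv (-1) n N (\<i> * T * ?N * a0) * (wv 1 1 1 0 h * dwv (-1) 1 1 (\<i> * T * (G * p))))
   + (wv (-1) 1 1 0 (G * p) * kk \<tau> a1 + wv (-1) 1 1 0 (G * p) * (wv 1 1 1 0 h * wv (-1) n N 0 (k * (k * a0)))
    + wv (-1) 1 1 0 (G * p) * (wv 1 n N 0 1 * wv (-1) 1 1 0 (G * (G * p)))
    + wv (-1) n N 0 (k * a0) * kk \<tau> P2 + wv (-1) n N 0 (k * a0) * (wv 1 1 1 0 h * wv (-1) 1 1 0 (G * (G * p))))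
   + cst (of_real (mu1 \<tau>)) * wv 1 n N 0 1"
  unfolding Tn(6) one P1 H1 A0 \<beta>0 a1_def[symmetric] b1_def[symmetric] P2_def[symmetric] H2_def[symmetric] fm_nth m2
  by (simp add: kk_wv d1_wv d2_wv kn knNc G_def[symmetric] T_def[symmetric] of_real_divide[symmetric] distrib_left distrib_right mult.commute[of H2] mult.commute[of b1]
    mult.commute[of "d1 P2"] mult.commute[of "d2 \<tau> P2"] mult.commute[of "kk \<tau> P2"] mult.commute[of "wv 1 1 1 0 h * _" "wv _ n N _ _"] mult.commute[of "wv 1 1 1 0 h * _" "dwv _ n N _"] add_ac del: of_real_divide)
 have kn_minus: "kn \<tau> (x, y) = kn \<tau> (\<bar>x\<bar>, \<bar>y\<bar>)" for x y by (simp add: kn_def)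
 define e where "e s t = d s t + G^2" for s t :: int
 have TG: "T * T = G * G - 1" and TG2: "T * (T * x) = (G * G - 1) * x" for x
  using TT by (simp_all add: power2_eq_square flip: mult.assoc)
 \<comment> \<open>Four sideband terms; the last bracket collects the cubic terms that involve no
   sideband.\<close>
 have LX: "?l (Th1 \<tau> \<eta> \<phi> \<beta> \<alpha> $ 2) ((n, N), 0) =
   (h * ((K 1 1)^2 - e 1 1) * A 1 1 + p * d 1 1 * B 1 1) + (h * ((K 1 (-1))^2 - e 1 (-1)) * A 1 (-1) + p * d 1 (-1) * B 1 (-1))
  + (h * ((K (-1) 1)^2 - e (-1) 1) * A (-1) 1 - p * d (-1) 1 * B (-1) 1) + (h * ((K (-1) (-1))^2 - e (-1) (-1)) * A (-1) (-1) - p * d (-1) (-1) * B (-1) (-1))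
  + (2 * h^2 * k ^ 3 * a0 + 4 * h * p * G * ?n)"
  unfolding X2 using n2 N6
  by (simp add: L A_def B_def K_def big p0 e00[folded H2_def] T_def[symmetric]; simp add: d_def e_def power2_eq_square power3_eq_cube TG TG2 algebra_simps)
 have LY: "?l (Th2 \<tau> (cfm m) \<eta> \<phi> \<beta> \<alpha> $ 2) ((n, N), 0) =
   (\<i> * (?n + 1) * K 1 1 * h * A 1 1 + \<i> * G * p * B 1 1 - p * (e 1 1 + G * K 1 1) * A 1 1)
  + (\<i> * (?n + 1) * K 1 (-1) * h * A 1 (-1) + \<i> * G * p * B 1 (-1) - p * (e 1 (-1) + G * K 1 (-1)) * A 1 (-1))
  + (\<i> * (?n - 1) * K (-1) 1 * h * A (-1) 1 + \<i> * G * p * B (-1) 1 + p * (e (-1) 1 + G * K (-1) 1) * A (-1) 1)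
  + (\<i> * (?n - 1) * K (-1) (-1) * h * A (-1) (-1) + \<i> * G * p * B (-1) (-1) + p * (e (-1) (-1) + G * K (-1) (-1)) * A (-1) (-1))
  + (2 * h^2 * \<i> * ?n * k^2 * a0 + 4 * \<i> * G^2 * h * p - 8 * G ^ 3 * p^2 - 4 * ?n * p * h * a0 * (k + G)) + of_real (mu1 \<tau>)"
  unfolding Y2 using n2 N6
  by (simp add: L A_def B_def K_def big p0 e00[folded H2_def] T_def[symmetric]; simp add: d_def e_def power2_eq_square power3_eq_cube TG TG2 algebra_simps)
 define nr where "nr = real_of_int n"
 define Nr where "Nr = real_of_int N"
 \<comment> \<open>By \<open>rho2\<close> the square of this quantity is a function of n and \<mu>,
   which is how \<tau> and N disappear from the estimate.\<close>
 define \<rho> where "\<rho> = \<mu>^2 * \<tau>^2 * Nr"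
 define qr where "qr x y = \<mu> * sqrt ((nr + x)^2 + \<tau>^2 * (Nr + y)^2)" for x y
 define Dr where "Dr x y = x * nr * \<mu>^2 + y * \<rho>" for x y
 define R where "R x y = (nr ^ 4 + Dr x y + x * nr + x * nr * Dr x y) - (nr ^ 3 + nr + x * (nr^2 - Dr x y))^2 / nr^2
    + 4 * ((nr + x)^2 * (nr^2 - Dr x y)^2 / (nr^2 * ((nr + x)^2 - qr x y)))" for x y
 have nr2: "nr \<ge> 2" using n2 by (simp add: nr_def)
 have mt: "\<mu>^2 * (1 + \<tau>^2) = 1" unfolding \<mu>_def by (rule mu_c_sq)
 have resr: "\<mu>^2 * (nr^2 + \<tau>^2 * Nr^2) = nr ^ 4"
 proof -
  have "(\<mu> * kn \<tau> (n, N))^2 = (nr^2)^2" using res by (simp add: \<mu>_def nr_def)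
  then show ?thesis by (simp add: power_mult_distrib kn_sq nr_def Nr_def)
 qed
 have rho2: "\<rho>^2 = nr^2 * ((1 - \<mu>^2) * (nr^2 - \<mu>^2))"
  unfolding \<rho>_def using mt resr by algebra
 have qr: "qr x y \<ge> 0 \<and> (qr x y)\<^sup>2 = nr ^ 4 + 1 + 2 * (x * nr * \<mu>^2 + y * \<rho>)" if "x^2 = 1" "y^2 = 1" for x y
 proof
  show "qr x y \<ge> 0" using mu0 by (simp add: qr_def)
  have "(qr x y)^2 = \<mu>^2 * ((nr + x)^2 + \<tau>^2 * (Nr + y)^2)" by (simp add: qr_def power_mult_distrib)
  also have "\<dots> = nr ^ 4 + 1 + 2 * (x * nr * \<mu>^2 + y * \<rho>)"
   unfolding \<rho>_def using mt resr that by algebra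
  finally show "(qr x y)^2 = nr ^ 4 + 1 + 2 * (x * nr * \<mu>^2 + y * \<rho>)" .
 qed
 define w where "w = (1 / (16 * \<mu> ^ 3)) * (R 1 1 + R 1 (-1) + R (-1) 1 + R (-1) (-1) + 4 + 4 * (nr^2 + 2) * \<mu>^2) + mu1 \<tau>"
 have wpos: "w > 0"
  unfolding w_def R_def Dr_def mu1_def Let_def \<mu>_def[symmetric] by (rule mode_total[OF nr2 mu0 mu1 rho2]) (rule qr)
 have nrc: "complex_of_real nr = ?n" by (simp add: nr_def)
 have pih: "p = \<i> * h / G" using G0 by (simp add: p_def h_def)
 have h0: "h \<noteq> 0" using G0 by (simp add: h_def)
 have con: "(1 / G) * (h * ((K s t)^2 - e s t) * A s t + of_int s * p * d s t * B s t)
   + \<i> * ?n * (\<i> * (?n + of_int s) * K s t * h * A s t + \<i> * G * p * B s t - of_int s * p * (e s t + G * K s t) * A s t)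
   = \<i> * ?n * h^2 * G * of_real (R (of_int s) (of_int t))" if s: "s = 1 \<or> s = -1" and t: "t = 1 \<or> t = -1" for s t
 proof -
  let ?s = "real_of_int s" and ?t = "real_of_int t"
  have sq: "?s^2 = 1" "?t^2 = 1" "?s = 1 \<or> ?s = -1" "?t = 1 \<or> ?t = -1" using s t by auto
  have Kq: "K s t = of_real (qr ?s ?t) * G"
   using mu0 by (simp add: K_def kn_def qr_def nr_def Nr_def G_def)
  have dD: "d s t = of_real (Dr ?s ?t) * G^2"
  proof -
   have "of_real (Dr ?s ?t) * G^2 = of_int s * ?n * (of_real \<mu> * G)^2 + of_int t * ((of_real \<mu> * G)^2 * T^2 * ?N)"
    by (simp add: Dr_def \<rho>_def T_def nr_def Nr_def power_mult_distrib algebra_simps)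
   also have "of_real \<mu> * G = 1" using mu0 by (simp add: G_def)
   finally show ?thesis by (simp add: d_def)
  qed
  have det: "complex_of_real (qr ?s ?t) - (?n + of_int s)^2 \<noteq> 0"
  proof -
   have "qr ?s ?t - (nr + ?s)^2 \<noteq> 0"
    using mode_term_bound(1)[OF nr2 mu0 mu1 rho2 sq(3,4)] qr[OF sq(1,2)] by blast
   then have "complex_of_real (qr ?s ?t - (nr + ?s)^2) \<noteq> 0" unfolding of_real_eq_0_iff .
   then show ?thesis by (simp add: nr_def)
  qed
  have qc: "(complex_of_real (qr ?s ?t))^2 = ?n ^ 4 + 1 + 2 * of_real (Dr ?s ?t)"
  proof -
   have "complex_of_real ((qr ?s ?t)^2) = of_real (nr ^ 4 + 1 + 2 * Dr ?s ?t)"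
    using qr[OF sq(1,2)] by (simp add: Dr_def)
   then show ?thesis by (simp add: nr_def)
  qed
  have h1: "of_real (qr ?s ?t) * G * A s t - \<i> * (?n + of_int s) * B s t + h * (\<i> / (G * ?n)) * (?n ^ 4 * G^2 + of_real (Dr ?s ?t) * G^2)
    + of_int s * (\<i> * h / G) * (G^2 + of_real (Dr ?s ?t) * G^2) = 0"
  proof -
   have "k^2 = ?n ^ 4 * G^2" by (simp add: k_def power_mult_distrib flip: power_mult)
   then show ?thesis using e1[OF s t] unfolding dD[symmetric] Kq[symmetric] a0_def[symmetric] pih[symmetric] by simp
  qed
  have h2: "\<i> * (?n + of_int s) * A s t + B s t / G + h * (\<i> * ?n * (?n^2 * G) * (\<i> / (G * ?n))) + \<i> * G * (\<i> * h / G)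
    + of_int s * (\<i> * h / G) * ((G * (?n^2 * G) - of_real (Dr ?s ?t) * G^2) * (\<i> / (G * ?n))) = 0"
   using e2[OF s t] unfolding dD[symmetric] a0_def[symmetric] pih[symmetric] k_def[symmetric] .
  have ss: "complex_of_int s * of_int s = 1" using s by auto
  note mc = mode_contribution[OF ss G0 n0 h0 det qc h1 h2]
  show ?thesis
   using mc unfolding dD[symmetric] Kq[symmetric] pih[symmetric] e_def[symmetric]
   by (simp add: R_def nr_def mult.assoc)
 qed
 have cub: "(1 / G) * (2 * h^2 * k ^ 3 * a0 + 4 * h * p * G * ?n)
   + \<i> * ?n * (2 * h^2 * \<i> * ?n * k^2 * a0 + 4 * \<i> * G^2 * h * p - 8 * G ^ 3 * p^2 - 4 * ?n * p * h * a0 * (k + G))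
   = \<i> * ?n * h^2 * G * (4 + 4 * (?n^2 + 2) / G^2)"
  unfolding pih a0_def k_def using G0 n0 by (simp add: field_simps power2_eq_square power3_eq_cube)
 have "of_real (mu_c \<tau>) * ?l (Th1 \<tau> \<eta> \<phi> \<beta> \<alpha> $ 2) ((n, N), 0)
   + \<i> * ?n * ?l (Th2 \<tau> (cfm m) \<eta> \<phi> \<beta> \<alpha> $ 2) ((n, N), 0)
  = \<i> * ?n * h^2 * G * (of_real (R 1 1) + of_real (R 1 (-1)) + of_real (R (-1) 1) + of_real (R (-1) (-1)) + (4 + 4 * (?n^2 + 2) / G^2))
   + \<i> * ?n * of_real (mu1 \<tau>)"
 proof -
  have lin: "g * (x1 + x2 + x3 + x4 + x5) + u * (y1 + y2 + y3 + y4 + y5 + z) = c * (r1 + r2 + r3 + r4 + r5) + u * z"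
   if "g * x1 + u * y1 = c * r1" "g * x2 + u * y2 = c * r2" "g * x3 + u * y3 = c * r3" "g * x4 + u * y4 = c * r4" "g * x5 + u * y5 = c * r5"
   for g u c x1 x2 x3 x4 x5 y1 y2 y3 y4 y5 z r1 r2 r3 r4 r5 :: complex
   unfolding distrib_left that[symmetric] by simp
  show ?thesis
   unfolding LX LY \<mu>_def[symmetric] G_mu
   by (rule lin) (use con[of 1 1] con[of 1 "-1"] con[of "-1" 1] con[of "-1" "-1"] cub in simp_all)
 qed
 also have "\<dots> = \<i> * ?n * of_real w"
 proof -
  define c where "c = 1 / (16 * \<mu> ^ 3)"
  have hG: "h^2 * G = of_real c" by (simp add: h_def G_def c_def power2_eq_square power3_eq_cube)
  have nG: "4 * (?n^2 + 2) / G^2 = of_real (4 * (nr^2 + 2) * \<mu>^2)" by (simp add: G_def nr_def power_divide)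
  have "of_real w = of_real c * (of_real (R 1 1) + of_real (R 1 (-1)) + of_real (R (-1) 1) + of_real (R (-1) (-1))
    + (4 + of_real (4 * (nr^2 + 2) * \<mu>^2))) + complex_of_real (mu1 \<tau>)"
   unfolding w_def c_def[symmetric] by (simp add: add.assoc)
  then show ?thesis unfolding mult.assoc[of _ "h^2"] hG nG by (simp only: distrib_left mult.assoc)
 qed
 finally show ?thesis using wpos by blast
qed

section \<open>Formal solution up to order N\<close>

lemma resonance_eq:
 assumes "mu_c \<tau> * kn \<tau> (a, b) = (of_int a)^2"
 shows "(real_of_int a)^2 + \<tau>^2 * (real_of_int b)^2 = (1 + \<tau>^2) * (real_of_int a) ^ 4"
proof -
 have "(mu_c \<tau>)^2 * ((real_of_int a)^2 + \<tau>^2 * (real_of_int b)^2) = (real_of_int a) ^ 4"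
  using arg_cong[OF assms, of "\<lambda>x. x\<^sup>2"] by (simp add: power_mult_distrib kn_sq)
 then have "(1 + \<tau>^2) * ((mu_c \<tau>)^2 * ((real_of_int a)^2 + \<tau>^2 * (real_of_int b)^2)) = (1 + \<tau>^2) * (real_of_int a) ^ 4"
  by simp
 then have "((mu_c \<tau>)^2 * (1 + \<tau>^2)) * ((real_of_int a)^2 + \<tau>^2 * (real_of_int b)^2) = (1 + \<tau>^2) * (real_of_int a) ^ 4"
  by (simp only: mult_ac)
 then show ?thesis by (simp add: mu_c_sq)
qed

lemma resonance_1:
 assumes \<tau>: "\<tau> > 0" and r: "mu_c \<tau> * kn \<tau> (a, b) = (of_int a)^2" and a: "\<bar>a\<bar> = 1"
 shows "\<bar>b\<bar> = 1"
proof -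
 have "(real_of_int a)^2 = 1" using a by (metis abs_1 of_int_1 of_int_abs power2_abs power_one)
 moreover then have "(real_of_int a) ^ 4 = 1" by (simp add: power4_eq_xxxx power2_eq_square)
 ultimately have "\<tau>^2 * (real_of_int b)^2 = \<tau>^2" using resonance_eq[OF r] by simp
 then have "(real_of_int b)^2 = 1" using \<tau> by simp
 then have "b^2 = 1" by (metis of_int_1 of_int_eq_iff of_int_power)
 then show ?thesis by (simp add: power2_eq_1_iff abs_if) auto
qed

text \<open>Resonance reads \<tau>^2 (b^2 - a^4) = a^2 (a^2 - 1), and the right-hand side is
  positive for |a| \<ge> 2.\<close>

lemma resonance_b_gt:
 assumes \<tau>: "\<tau> > 0" and r: "mu_c \<tau> * kn \<tau> (a, b) = (of_int a)^2" and a: "\<bar>a\<bar> \<ge> 2"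
 shows "a^2 < \<bar>b\<bar>"
proof -
 have "4 \<le> a\<^sup>2" using power_mono[of 2 "\<bar>a\<bar>" 2] a by simp
 then have a2: "4 \<le> (real_of_int a)\<^sup>2" by (metis of_int_numeral of_int_le_iff of_int_power)
 have "(real_of_int a) ^ 4 = (real_of_int a)^2 * (real_of_int a)^2" by (simp add: power4_eq_xxxx power2_eq_square)
 then have "\<tau>^2 * ((real_of_int b)^2 - (real_of_int a) ^ 4) = (real_of_int a)^2 * ((real_of_int a)^2 - 1)"
  using resonance_eq[OF r] by (simp add: algebra_simps)
 also have "\<dots> > 0" using a2 by (intro mult_pos_pos) auto
 finally have "(real_of_int b)^2 > (real_of_int a) ^ 4" using \<tau> by (simp add: zero_less_mult_iff)
 then have "b^2 > (a^2)\<^sup>2" by (metis (mono_tags) of_int_less_iff of_int_power power_mult mult_2 numeral_Bit0)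
 then have "\<bar>b\<bar>\<^sup>2 > (a^2)\<^sup>2" by simp
 then show ?thesis by (rule power2_less_imp_less) simp
qed

text \<open>Along resonances |b| and |b| / a^2 increase with |a|. Passing from |a| = n to at least n
  + 1 therefore multiplies |b| = N by at least (1 + 1/n)^2, an increase above 2 because N > n^2. So
  the band N \<le> |b| \<le> N + 2 contains no second resonance.\<close>

lemma resonance_gap:
 assumes \<tau>: "\<tau> > 0" and r: "mu_c \<tau> * kn \<tau> (n, N) = (of_int n)^2" and r': "mu_c \<tau> * kn \<tau> (a, b) = (of_int a)^2"
  and n: "n \<ge> 2" and N: "N > 0" and a: "\<bar>a\<bar> \<ge> 2" and b: "\<bar>b\<bar> \<le> N + 2" "\<bar>b\<bar> \<ge> N"
 shows "\<bar>a\<bar> = n \<and> \<bar>b\<bar> = N"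
proof -
 define x where "x = real_of_int \<bar>a\<bar>"
 define y where "y = real_of_int n"
 define B where "B = real_of_int \<bar>b\<bar>"
 define M where "M = real_of_int N"
 have e1: "\<tau>^2 * B^2 = (1 + \<tau>^2) * x ^ 4 - x^2" using resonance_eq[OF r'] by (simp add: x_def B_def)
 have e2: "\<tau>^2 * M^2 = (1 + \<tau>^2) * y ^ 4 - y^2" using resonance_eq[OF r] by (simp add: y_def M_def)
 have x2: "x \<ge> 2" and y2: "y \<ge> 2" using a n by (simp_all add: x_def y_def)
 have "n^2 < \<bar>N\<bar>" by (rule resonance_b_gt[OF \<tau> r]) (use n in simp)
 then have "real_of_int (n^2) < real_of_int N" unfolding of_int_less_iff using N by simp
 then have MN: "y^2 < M" by (simp add: y_def M_def)
 have M0: "M > 0" using N by (simp add: M_def)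
 have t: "\<tau>^2 > 0" using \<tau> by simp
 have f: "(1 + \<tau>^2) * u ^ 4 - u^2 < (1 + \<tau>^2) * v ^ 4 - v^2" if "u < v" "u \<ge> 2" for u v
 proof -
  have p: "u^2 < v\<^sup>2" using that by (simp add: power_strict_mono)
  have "v^2 - u^2 < (v^2 - u^2) * (v^2 + u^2)"
  proof -
   have "v^2 + u^2 > 1" using that power_mono[of 2 u 2] by (smt (verit) power2_eq_square zero_le_power2 one_power2 numeral_le_one_iff power_mono)
   then show ?thesis using p by simp
  qed
  also have "\<dots> \<le> (1 + \<tau>^2) * ((v^2 - u^2) * (v^2 + u^2))" using mult_right_mono[of 1 "1 + \<tau>^2" "(v^2 - u^2) * (v^2 + u^2)"] p t by simp
  also have "\<dots> = (1 + \<tau>^2) * v ^ 4 - (1 + \<tau>^2) * u ^ 4" by (simp add: algebra_simps power4_eq_xxxx power2_eq_square)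
  finally show ?thesis by simp
 qed
 have "\<not> x < y"
 proof
  assume "x < y"
  from f[OF this x2] have "\<tau>^2 * B^2 < \<tau>\<^sup>2 * M^2" unfolding e1 e2 .
  then have "B^2 < M\<^sup>2" using t by simp
  then have "B < M" using M0 by (simp add: power2_less_imp_less)
  then show False using b by (simp add: B_def M_def)
 qed
 moreover have "\<not> y < x"
 proof
  assume yx: "y < x"
  then have "n < \<bar>a\<bar>" by (simp add: x_def y_def)
  then have xy1: "x \<ge> y + 1" unfolding x_def y_def by (metis of_int_1 of_int_add of_int_le_iff zless_imp_add1_zle)
  have xs: "y^2 < x\<^sup>2" using yx y2 by (simp add: power_strict_mono)
  have "\<tau>^2 * M^2 * x ^ 4 = (1 + \<tau>^2) * x ^ 4 * y ^ 4 - y^2 * x ^ 4" unfolding e2 by (simp add: algebra_simps)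
  also have "\<dots> \<le> (1 + \<tau>^2) * x ^ 4 * y ^ 4 - x^2 * y ^ 4"
  proof -
   have "(x^2 * y^2) * y^2 \<le> (x^2 * y^2) * x^2" using xs by (intro mult_left_mono) auto
   then show ?thesis by (simp add: power4_eq_xxxx power2_eq_square algebra_simps)
  qed
  also have "\<dots> = \<tau>^2 * B^2 * y ^ 4" unfolding e1 by (simp add: algebra_simps)
  finally have "M^2 * x ^ 4 \<le> B\<^sup>2 * y ^ 4" using t by (simp add: mult.assoc)
  then have "(M * x^2)^2 \<le> (B * y^2)\<^sup>2" by (simp add: power_mult_distrib flip: power_mult)
  then have "M * x^2 \<le> B * y^2" by (rule power2_le_imp_le) (simp add: B_def)
  also have "\<dots> \<le> (M + 2) * y^2" using b(1) by (intro mult_right_mono) (simp_all add: B_def M_def)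
  finally have 1: "M * x^2 \<le> (M + 2) * y^2" .
  have "M * (y^2 + 2 * y + 1) \<le> M * x^2"
  proof -
   have "(y + 1)^2 \<le> x\<^sup>2" using xy1 y2 by (intro power_mono) auto
   then have "M * (y + 1)^2 \<le> M * x^2" using M0 by (intro mult_left_mono) auto
   then show ?thesis by (simp add: power2_eq_square algebra_simps)
  qed
  with 1 have "M * (2 * y + 1) \<le> 2 * y^2" by (simp add: algebra_simps)
  moreover have "M * 2 \<le> M * (2 * y + 1)" using M0 y2 by (intro mult_left_mono) auto
  ultimately show False using MN by simp
 qed
 ultimately have "x = y" by simp
 then have "\<tau>^2 * B^2 = \<tau>^2 * M^2" unfolding e1 e2 by simp
 then have "B^2 = M^2" using t by simp
 then have "B = M" by (rule power2_eq_imp_eq) (use M0 in \<open>simp_all add: B_def\<close>)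
 then have "real_of_int \<bar>a\<bar> = of_int n" "real_of_int \<bar>b\<bar> = of_int N" using \<open>x = y\<close> by (auto simp: x_def y_def B_def M_def simp del: of_int_abs)
 then show ?thesis by linarith
qed

text \<open>\<open>up\<close> and \<open>lo\<close> bound the frequencies in \<open>x\<^sub>2\<close> from above and from below.\<close>

definition up :: "int \<Rightarrow> wpoly \<Rightarrow> bool" where "up r t \<longleftrightarrow> (\<forall>k\<in>supp t. \<bar>snd (fst k)\<bar> \<le> r)"
definition lo :: "int \<Rightarrow> wpoly \<Rightarrow> bool" where "lo r t \<longleftrightarrow> (\<forall>k\<in>supp t. r \<le> \<bar>snd (fst k)\<bar>)"

lemma up_add: "up r a \<Longrightarrow> up r b \<Longrightarrow> up r (a + b)" and lo_add: "lo r a \<Longrightarrow> lo r b \<Longrightarrow> lo r (a + b)"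
 using Poly_Mapping.keys_add[of a b] by (fastforce simp: up_def lo_def)+
lemma up_diff: "up r a \<Longrightarrow> up r b \<Longrightarrow> up r (a - b)" and lo_diff: "lo r a \<Longrightarrow> lo r b \<Longrightarrow> lo r (a - b)"
 using keys_diff[of a b] by (fastforce simp: up_def lo_def)+
lemma up_mult: "up r a \<Longrightarrow> up q b \<Longrightarrow> r + q \<le> R \<Longrightarrow> up R (a * b)"
 using Poly_Mapping.keys_mult[of a b] by (fastforce simp: up_def)
lemma lo_mult: "lo r a \<Longrightarrow> up q b \<Longrightarrow> R \<le> r - q \<Longrightarrow> lo R (a * b)"
 using Poly_Mapping.keys_mult[of a b] by (fastforce simp: up_def lo_def)
lemma up_mlt: "up r a \<Longrightarrow> up r (mlt w a)" and lo_mlt: "lo r a \<Longrightarrow> lo r (mlt w a)"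
 using keys_mlt[of w a] by (fastforce simp: up_def lo_def)+
lemma up_d: "up r a \<Longrightarrow> up r (d1 a)" "up r a \<Longrightarrow> up r (d2 \<tau> a)" "up r a \<Longrightarrow> up r (kk \<tau> a)"
 by (simp_all add: d1_def d2_def kk_def up_mlt)
lemma lo_d: "lo r a \<Longrightarrow> lo r (d1 a)" "lo r a \<Longrightarrow> lo r (d2 \<tau> a)" "lo r a \<Longrightarrow> lo r (kk \<tau> a)"
 by (simp_all add: d1_def d2_def kk_def lo_mlt)
lemma up_cst: "up r a \<Longrightarrow> up r (cst c * a)" and lo_cst: "lo r a \<Longrightarrow> lo r (cst c * a)"
 by (auto simp: up_def lo_def in_keys_iff)
lemma up_wcls: "wcls 1 s1 s2 p t \<Longrightarrow> up (int p) t" by (auto simp: wcls_def up_def)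
lemma up_wv: "N \<ge> 0 \<Longrightarrow> up N (wv s n N y c)" and lo_wv: "N \<ge> 0 \<Longrightarrow> lo N (wv s n N y c)"
 by (auto simp: up_def lo_def wv_def in_keys_iff lookup_add lookup_single when_def split: if_splits)
lemma up_mono: "up r t \<Longrightarrow> r \<le> R \<Longrightarrow> up R t" by (force simp: up_def)
lemma up_0 [simp]: "up r 0" and lo_0 [simp]: "lo r 0" by (simp_all add: up_def lo_def)
lemma up_lookup: "up r t \<Longrightarrow> \<bar>b\<bar> > r \<Longrightarrow> lk t ((a, b), y) = 0"
 by (force simp: up_def in_keys_iff)
lemma lo_lookup: "lo r t \<Longrightarrow> \<bar>b\<bar> < r \<Longrightarrow> lk t ((a, b), y) = 0"
 by (force simp: lo_def in_keys_iff)

lemma Bf_scale: "(\<And>c t. f (cst c * t) = cst c * f t) \<Longrightarrow> Bf f \<eta> \<phi> (fcst c * \<beta>) (fcst c * \<alpha>) = fcst c * Bf f \<eta> \<phi> \<beta> \<alpha>"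
proof -
 assume f: "\<And>c t. f (cst c * t) = cst c * f t"
 have 1: "fm g (fcst c * a) = fcst c * fm g a" if "\<And>c t. g (cst c * t) = cst c * g t" for g :: "wpoly \<Rightarrow> wpoly" and a
  by (rule fps_ext) (simp add: that)
 have zc: "z0 (cst c * t) = cst c * z0 t" for c t using z0_mult[of "cst c" t] flat_z0_eq[OF flat_cst[of c]] by simp
 have dc: "dyn j (cst c * t) = cst c * dyn j t" for j c t unfolding dyn_def by (rule mlt_cst_mult)
 have "Bf f \<eta> \<phi> (fcst c * \<beta>) (fcst c * \<alpha>) = fm z0 (fcst c * (fm f \<alpha> + \<eta> * fm (dyn 1) (fm f \<alpha>) + fcst (1/2) * \<eta>^2 * fm (dyn 2) (fm f \<alpha>)
    + \<beta> * fm (dyn 1) (fm f \<phi>) + \<beta> * \<eta> * fm (dyn 2) (fm f \<phi>)))"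
  unfolding Bf_def 1[OF f] 1[of "dyn 1", OF dc] 1[of "dyn 2", OF dc] by (simp add: algebra_simps)
 then show ?thesis unfolding 1[of z0, OF zc] Bf_def .
qed

lemma Th_scale: "Th1 \<tau> \<eta> \<phi> (fcst c * \<beta>) (fcst c * \<alpha>) = fcst c * Th1 \<tau> \<eta> \<phi> \<beta> \<alpha>"
 "Th2 \<tau> \<mu> \<eta> \<phi> (fcst c * \<beta>) (fcst c * \<alpha>) = fcst c * Th2 \<tau> \<mu> \<eta> \<phi> \<beta> \<alpha>"
proof -
 have d: "d1 (cst c * t) = cst c * d1 t" "d2 \<tau> (cst c * t) = cst c * d2 \<tau> t" "dy (cst c * t) = cst c * dy t" for c t
  unfolding d1_def d2_def dy_def by (rule mlt_cst_mult)+
 have e: "fm d1 (fcst c * \<beta>) = fcst c * fm d1 \<beta>" "fm (d2 \<tau>) (fcst c * \<beta>) = fcst c * fm (d2 \<tau>) \<beta>"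
  by (rule fps_ext; simp add: d)+
 note B = Bf_scale[of d1, OF d(1)] Bf_scale[of "d2 \<tau>", OF d(2)] Bf_scale[of dy, OF d(3)]
 show "Th1 \<tau> \<eta> \<phi> (fcst c * \<beta>) (fcst c * \<alpha>) = fcst c * Th1 \<tau> \<eta> \<phi> \<beta> \<alpha>"
  "Th2 \<tau> \<mu> \<eta> \<phi> (fcst c * \<beta>) (fcst c * \<alpha>) = fcst c * Th2 \<tau> \<mu> \<eta> \<phi> \<beta> \<alpha>"
  unfolding Th1_def Th2_def B e by (simp_all add: algebra_simps)
qed

text \<open>A resonance at |b| = N matters only if its first component has the parity of N;
  otherwise the step of \<open>fsol_exists\<close> works at order N as well. In the remaining case
  the amplitude c of the inserted wave serves the mode (n, N), and the next coefficient of \<mu>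
  serves (1, 1) as before.\<close>

lemma formal_solution:
 assumes N: "N \<ge> 3" and \<tau>: "\<tau> > 0"
  and disc: "{(n::nat, m::nat). n > 0 \<and> m > 0 \<and> m\<^sup>2 + n^2 \<le> N\<^sup>2 \<and>
     (real n)\<^sup>2 + \<tau>^2 * (real m)^2 = (mu_c \<tau>) powi (-2) * real n ^ 4} = {(1, 1)}"
 shows "\<exists>D \<eta> \<phi> m. fsol \<tau> D (Suc N) \<eta> \<phi> m \<and> m $ 2 = mu1 \<tau>"
proof -
 define res where "res a b \<longleftrightarrow> a \<noteq> 0 \<and> mu_c \<tau> * kn \<tau> (a, b) = (of_int a)^2" for a b :: int
 have res1: "\<bar>a\<bar> = 1 \<and> \<bar>b\<bar> = 1" if r: "res a b" and b: "\<bar>b\<bar> < int N" for a b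
 proof (cases "\<bar>a\<bar> = 1")
  case True
  then show ?thesis using resonance_1[OF \<tau>, of a b] r by (simp add: res_def)
 next
  case False
  then have a2: "\<bar>a\<bar> \<ge> 2" using r by (auto simp: res_def)
  have ab: "a^2 < \<bar>b\<bar>" by (rule resonance_b_gt[OF \<tau> _ a2]) (use r in \<open>simp add: res_def\<close>)
  let ?n = "nat \<bar>a\<bar>" and ?m = "nat \<bar>b\<bar>"
  have pm: "(mu_c \<tau>) powi (-2) = 1 + \<tau>^2"
   using mu_c_sq[of \<tau>] mu_c_pos[of \<tau>] by (simp add: power_int_minus field_simps)
  \<comment> \<open>The pair lies in the disc, because a^2 < |b| \<le> N - 1.\<close>
  have "b^2 + a^2 \<le> (int N)\<^sup>2"
  proof -
   have "\<bar>b\<bar>\<^sup>2 + \<bar>b\<bar> \<le> (int N - 1)\<^sup>2 + (int N - 1)" using b by (intro add_mono power_mono) auto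
   also have "\<dots> \<le> (int N)\<^sup>2" by (simp add: power2_eq_square algebra_simps)
   finally show ?thesis using ab by simp
  qed
  then have "int (?m^2 + ?n^2) \<le> int (N^2)" by simp
  then have "?m^2 + ?n^2 \<le> N\<^sup>2" by (simp only: of_nat_le_iff)
  moreover have "(real ?n)^2 + \<tau>^2 * (real ?m)^2 = (mu_c \<tau>) powi (-2) * real ?n ^ 4"
   using resonance_eq[of \<tau> a b] r unfolding pm by (simp add: res_def)
  moreover have "?n > 0" "?m > 0" using a2 ab zero_le_power2[of a] by auto
  ultimately have "(?n, ?m) \<in> {(1, 1)}" unfolding disc[symmetric] by simp
  then show ?thesis using a2 by auto
 qed
 have N1: "N \<ge> 2" "N \<ge> 1" using N by auto
 obtain \<eta> \<phi> m where F: "fsol \<tau> 1 N \<eta> \<phi> m"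
  using fsol_exists[OF N1(1), of \<tau>] res1 unfolding res_def by blast
 have mu2: "m $ 2 = mu1 \<tau>" if G: "fsol \<tau> D (Suc N) \<eta> \<phi> m" for D \<eta> \<phi> m
  using fsol_mu2(1)[OF G _ \<tau>] N by simp
 from F have cl: "wCl 1 1 1 \<eta>" "wCl 1 (-1) 1 \<phi>" and fl: "\<And>p. flat (\<eta> $ p)" and ha: "\<And>p. harm \<tau> (\<phi> $ p)"
  and z: "\<eta> $ 0 = 0" "\<phi> $ 0 = 0" and one: "\<eta> $ 1 = eta1 \<tau>" "\<phi> $ 1 = phi1 \<tau>"
  and hi: "\<And>p. p \<ge> N \<Longrightarrow> \<eta> $ p = 0 \<and> \<phi> $ p = 0" "\<And>p. p \<ge> N \<Longrightarrow> m $ p = 0"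
  and m0: "m $ 0 = mu_c \<tau>" and mo: "\<And>p. odd p \<Longrightarrow> m $ p = 0"
  and Z: "\<And>q. q < N \<Longrightarrow> E1 \<tau> \<eta> \<phi> $ q = 0" "\<And>q. q < N \<Longrightarrow> E2 \<tau> (cfm m) \<eta> \<phi> $ q = 0"
  by (auto simp: fsol_def)
 note wE1 = wCl_E1[OF cl, of \<tau>] and wE2 = wCl_E2[OF cl wCl_cfm[OF mo], of \<tau>]
 have cE1: "wcls 1 (-1) 1 N (E1 \<tau> \<eta> \<phi> $ N)" and cE2: "wcls 1 1 1 N (E2 \<tau> (cfm m) \<eta> \<phi> $ N)"
  using wE1 wE2 by (auto simp: wCl_def)
 have ce: "wcls 1 1 1 1 (eta1 \<tau>)" using cl(1) unfolding wCl_def one(1)[symmetric] by blast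
 show ?thesis
 proof (cases "\<exists>n. n \<ge> 2 \<and> even (n + int N) \<and> res n (int N)")
  case False
  obtain c where c: "even N \<Longrightarrow> c = 0" and cr:
   "\<And>a b. \<bar>a\<bar> = 1 \<Longrightarrow> \<bar>b\<bar> = 1 \<Longrightarrow> of_real (mu_c \<tau>) * lk (E1 \<tau> \<eta> \<phi> $ N) ((a, b), 0) + \<i> * of_int a *
    (lk (E2 \<tau> (cfm m) \<eta> \<phi> $ N) ((a, b), 0) + of_real c * lk (eta1 \<tau>) ((a, b), 0)) = 0"
   using fsol_mu[OF F] by metis
  obtain a' b' where G: "fsol \<tau> 1 (Suc N) (\<eta> + fps_X ^ N * fps_const b') (\<phi> + fps_X ^ N * fps_const a') (m + fps_X ^ (N - 1) * fps_const c)"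
  proof (rule fsol_step[OF F N1(1), of c])
   fix a b :: int assume a: "a \<noteq> 0" "mu_c \<tau> * kn \<tau> (a, b) = (of_int a)^2"
   then have r: "res a b" by (simp add: res_def)
   show "of_real (mu_c \<tau>) * lk (E1 \<tau> \<eta> \<phi> $ N) ((a, b), 0) + \<i> * of_int a *
    (lk (E2 \<tau> (cfm m) \<eta> \<phi> $ N) ((a, b), 0) + of_real c * lk (eta1 \<tau>) ((a, b), 0)) = 0"
   proof (cases "\<bar>a\<bar> = 1 \<and> \<bar>b\<bar> = 1")
    case True
    then show ?thesis using cr by blast
   next
    case n1: False
    then have bN: "\<bar>b\<bar> \<ge> int N" using res1[OF r] by force
    have "\<bar>a\<bar> \<noteq> 1" using n1 resonance_1[OF \<tau> a(2)] by auto
    then have a2: "\<bar>a\<bar> \<ge> 2" using a(1) by auto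
    have "((a, b), 0) \<notin> supp (E1 \<tau> \<eta> \<phi> $ N) \<and> ((a, b), 0) \<notin> supp (E2 \<tau> (cfm m) \<eta> \<phi> $ N)"
    proof (cases "\<bar>b\<bar> > int N")
     case True
     then show ?thesis using cE1 cE2 by (force simp: wcls_def)
    next
     case False
     then have b: "\<bar>b\<bar> = int N" using bN by simp
     have "res \<bar>a\<bar> (int N)" using r b unfolding res_def kn_def by (simp flip: b)
     then have "odd (\<bar>a\<bar> + int N)" using \<open>\<not> (\<exists>n. n \<ge> 2 \<and> even (n + int N) \<and> res n (int N))\<close> a2 by blast
     then have "odd (a + int N)" by (simp add: abs_if split: if_splits)
     then show ?thesis using cE1 cE2 by (force simp: wcls_def)
    qed
    moreover have "((a, b), 0) \<notin> supp (eta1 \<tau>)" using ce bN N by (force simp: wcls_def)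
    ultimately show ?thesis by (simp add: in_keys_iff)
   qed
  qed (use c in blast)+
  then show ?thesis using mu2[OF G] by blast
 next
  case True
  then obtain n where n2: "n \<ge> 2" and par: "even (n + int N)" and rn: "res n (int N)" by blast
  from rn have rn': "mu_c \<tau> * kn \<tau> (n, int N) = (of_int n)^2" by (simp add: res_def)
  have nN: "n^2 < int N" using resonance_b_gt[OF \<tau> rn'] n2 by simp
  \<comment> \<open>n = 2 forces N to be even and larger than 4; n \<ge> 3 forces N > 9.\<close>
  have N6: "int N \<ge> 6"
  proof (cases "n = 2")
   case True
   then show ?thesis using nN par by simp presburger
  next
   case False
   then have "(3::int)^2 \<le> n\<^sup>2" using n2 by (intro power_mono) auto
   then show ?thesis using nN by simp
  qed
  have nle: "n \<le> int N"
  proof -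
   have "n * 1 \<le> n * n" using n2 by (intro mult_left_mono) auto
   then show ?thesis using nN by (simp add: power2_eq_square)
  qed
  \<comment> \<open>Lowering the order by two preserves the parity required of the frequencies (n,
    N), and two couplings with the wave of order one lead back to order N.\<close>
  define s where "s = N - 2"
  have s: "s \<ge> 3" "s + 2 = N" "s \<ge> 4" using N6 by (auto simp: s_def)
  let ?N = "int N"
  \<comment> \<open>With \<open>\<beta>0\<close> a vector of the kernel of the linear problem at (n,
    N), with coefficient 1 in the elevation.\<close>
  define \<alpha>0 where "\<alpha>0 = wv (-1) n ?N (kn \<tau> (n, ?N)) (\<i> * of_real (mu_c \<tau>) / of_int n)"
  define \<beta>0 where "\<beta>0 = wv 1 n ?N 0 1"
  \<comment> \<open>A frequency N at order s < N violates the bound with D = 1; D = N restores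
    it.\<close>
  have degs: "\<bar>n\<bar> \<le> int (N * s)" "\<bar>?N\<bar> \<le> int (N * s)" "even (n + int s)" "even (?N + int s)"
  proof -
   have "?N * 1 \<le> ?N * int s" using s by (intro mult_left_mono) auto
   then show "\<bar>n\<bar> \<le> int (N * s)" "\<bar>?N\<bar> \<le> int (N * s)" using nle n2 unfolding of_nat_mult by linarith+
   show "even (n + int s)" "even (?N + int s)" using par s(2) by (auto simp flip: s(2))
  qed
  have ca0: "wcls N (-1) 1 s \<alpha>0" unfolding \<alpha>0_def by (rule wcls_wv) (use degs in auto)
  have cb0: "wcls N 1 1 s \<beta>0" unfolding \<beta>0_def by (rule wcls_wv) (use degs in auto)
  have h\<alpha>0: "harm \<tau> \<alpha>0" unfolding \<alpha>0_def by (rule harm_wv)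
  have f\<beta>0: "flat \<beta>0" unfolding \<beta>0_def by (rule flat_wv)
  have cm1: "cfm m $ 1 = 0" using mo[of 1] by simp
  have clN: "wCl N 1 1 \<eta>" "wCl N (-1) 1 \<phi>" using cl wCl_mono N1(2) by blast+
  have fcon: "flat (fps_const t $ p)" if "flat t" for t p using that by (cases p) auto
  have hcon: "harm \<tau> (fps_const t $ p)" if "harm \<tau> t" for t p using that by (cases p) auto
  let ?b0 = "fps_const \<beta>0" and ?a0 = "fps_const \<alpha>0"
  define R1 where "R1 = Th1 \<tau> \<eta> \<phi> ?b0 ?a0 $ 1"
  define R2 where "R2 = Th2 \<tau> (cfm m) \<eta> \<phi> ?b0 ?a0 $ 1"
  have wX: "wCl N 1 1 (\<eta> + fps_X ^ s * ?b0)" "wCl N (-1) 1 (\<phi> + fps_X ^ s * ?a0)"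
   using clN ca0 cb0 by (auto simp: wCl_def fps_X_power_mult_nth intro!: wcls_add)
  have wE: "wCl N (-1) 1 (E1 \<tau> \<eta> \<phi>)" "wCl N 1 1 (E2 \<tau> (cfm m) \<eta> \<phi>)"
   using wE1 wE2 wCl_mono N1(2) by blast+
  have Rdiff: "R1 = E1 \<tau> (\<eta> + fps_X ^ s * ?b0) (\<phi> + fps_X ^ s * ?a0) $ (s + 1) - E1 \<tau> \<eta> \<phi> $ (s + 1)"
   "R2 = E2 \<tau> (cfm m) (\<eta> + fps_X ^ s * ?b0) (\<phi> + fps_X ^ s * ?a0) $ (s + 1) - E2 \<tau> (cfm m) \<eta> \<phi> $ (s + 1)"
   using E_perturb2(1)[OF z s(1), of \<tau> ?b0 ?a0] E_perturb2(2)[OF z s(1), of \<tau> "cfm m" ?b0 ?a0]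
   by (simp_all add: fcong_iff fps_X_power_mult_nth R1_def R2_def)
  have cR: "wcls N (-1) 1 (s + 1) R1" "wcls N 1 1 (s + 1) R2"
   unfolding Rdiff using wCl_E1[OF wX, of \<tau>] wCl_E2[OF wX wCl_cfm[OF mo], of \<tau>] wE
   by (auto simp: wCl_def intro!: wcls_diff)
  have flX: "flat ((\<eta> + fps_X ^ s * ?b0) $ p)" for p
   using fl f\<beta>0 by (auto simp: fps_X_power_mult_nth intro!: flat_add)
  have flm: "flat (cfm m $ p)" for p by simp
  have fR: "flat R1" "flat R2"
   unfolding Rdiff by (intro flat_diff flat_E1 flat_E2 flX fl flm)+
  have wz: "z0 \<alpha>0 = wv (-1) n ?N 0 (\<i> * of_real (mu_c \<tau>) / of_int n)" by (simp add: \<alpha>0_def z0_wv)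
  have ups: "up 1 (\<eta> $ 1)" "up 1 (z0 (\<phi> $ 1))" "up 2 (\<eta> $ 2)" "up 2 (z0 (\<phi> $ 2))"
   using up_wcls[of 1 1 1 "\<eta> $ 1"] up_wcls[of "-1" 1 1 "z0 (\<phi> $ 1)"] up_wcls[of 1 1 2 "\<eta> $ 2"] up_wcls[of "-1" 1 2 "z0 (\<phi> $ 2)"] cl
   by (auto simp: wCl_def wcls_z0)
  have u0: "up ?N (z0 \<alpha>0)" "up ?N \<beta>0" "lo ?N (z0 \<alpha>0)" "lo ?N \<beta>0"
   unfolding wz \<beta>0_def by (rule up_wv lo_wv; simp)+
  note T0 = Th_nth[OF z fl fcon[OF f\<beta>0] ha hcon[OF h\<alpha>0] _ _ cm1, simplified]
  \<comment> \<open>At order s + 1 the kernel wave meets exactly one factor of order one, so |b|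
    stays within 1 of N.\<close>
  have l1: "lo (?N - 1) (a * b)" if "lo ?N b" "up 1 a" for a b using lo_mult[OF that, of "?N - 1"] by (simp add: mult.commute)
  have l2: "lo (?N - 1) (b * a)" if "lo ?N b" "up 1 a" for a b using lo_mult[OF that, of "?N - 1"] by simp
  have u1: "up (?N + 1) (a * b)" if "up ?N b" "up 1 a" for a b using up_mult[OF that, of "?N + 1"] by (simp add: mult.commute)
  have u2: "up (?N + 1) (b * a)" if "up ?N b" "up 1 a" for a b using up_mult[OF that, of "?N + 1"] by simp
  have loR: "lo (?N - 1) R1" "lo (?N - 1) R2"
   unfolding R1_def R2_def T0[unfolded One_nat_def[symmetric]]
   by (intro lo_add lo_diff; fast intro: l1 l2 lo_d up_d u0 ups)+
  have upR: "up (?N + 1) R1" "up (?N + 1) R2"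
   unfolding R1_def R2_def T0[unfolded One_nat_def[symmetric]]
   by (intro up_add up_diff; fast intro: u1 u2 up_d u0 ups)+
  \<comment> \<open>The order s + 1 has the parity opposite to N, which excludes |b| = N.\<close>
  have par1: "lk t ((x, y), 0) = 0" if "wcls D s1 s2 (s + 1) t" "\<bar>y\<bar> = ?N" for t x y D s1 s2
  proof -
   have "odd (y + int (s + 1))" using that(2) s(2) by presburger
   then show ?thesis using that(1) by (force simp: wcls_def in_keys_iff)
  qed
  obtain a b where ab: "wcls N (-1) 1 (s + 1) a" "harm \<tau> a" "wcls N 1 1 (s + 1) b" "flat b"
   "z0 (dy a) - d1 b = - R1" "z0 (d1 a) + cst (of_real (mu_c \<tau>)) * b = - R2"
   and absup: "\<And>K. lk R1 (K, 0) = 0 \<Longrightarrow> lk R2 (K, 0) = 0 \<Longrightarrow>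
     lk (z0 a) (K, 0) = 0 \<and> lk b (K, 0) = 0"
  proof (rule linear_solve_support[where \<tau> = \<tau>, of "mu_c \<tau>", OF _ cR(1) fR(1) cR(2) fR(2)])
   show "mu_c \<tau> \<noteq> 0" using mu_c_pos[of \<tau>] by simp
  next
   fix x y :: int assume xy: "x \<noteq> 0" "mu_c \<tau> * kn \<tau> (x, y) = (of_int x)^2"
   then have r: "res x y" by (simp add: res_def)
   have "lk R1 ((x, y), 0) = 0 \<and> lk R2 ((x, y), 0) = 0"
   \<comment> \<open>There remain |y| = N - 1, where by the disc hypothesis only (\<plusminus>1,
     \<plusminus>1) is resonant, and |y| = N + 1, excluded by \<open>resonance_gap\<close>. Hence
     the order s + 1 can be cancelled by sidebands.\<close>
   proof (cases "\<bar>y\<bar> < ?N - 1 \<or> \<bar>y\<bar> > ?N + 1 \<or> \<bar>y\<bar> = ?N")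
    case True
    then show ?thesis using lo_lookup loR up_lookup upR par1[OF cR(1), of y x] par1[OF cR(2), of y x] by blast
   next
    case False
    then consider "\<bar>y\<bar> = ?N - 1" | "\<bar>y\<bar> = ?N + 1" by linarith
    then show ?thesis
    proof cases
     case 1
     then show ?thesis using res1[OF r] N6 by simp
    next
     case 2
     have "\<bar>x\<bar> \<noteq> 1" using resonance_1[OF \<tau> xy(2)] 2 N6 by auto
     then have "\<bar>x\<bar> \<ge> 2" using xy(1) by auto
     then show ?thesis using resonance_gap[OF \<tau> rn' xy(2) n2] 2 N6 by auto
    qed
   qed
   then show "of_real (mu_c \<tau>) * lk R1 ((x, y), 0) + \<i> * of_int x * lk R2 ((x, y), 0) = 0"
    by simp
  qed (rule that, assumption+)
  define \<alpha> where "\<alpha> = ?a0 + fps_X * fps_const a"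
  define \<beta> where "\<beta> = ?b0 + fps_X * fps_const b"
  let ?T1 = "Th1 \<tau> \<eta> \<phi> \<beta> \<alpha>" and ?T2 = "Th2 \<tau> (cfm m) \<eta> \<phi> \<beta> \<alpha>"
  have an: "\<alpha> $ 0 = \<alpha>0" "\<alpha> $ 1 = a" "\<And>p. p \<ge> 2 \<Longrightarrow> \<alpha> $ p = 0" and bn: "\<beta> $ 0 = \<beta>0" "\<beta> $ 1 = b" "\<And>p. p \<ge> 2 \<Longrightarrow> \<beta> $ p = 0"
   by (simp_all add: \<alpha>_def \<beta>_def)
  have all2: "P p" if "P 0" "P 1" "\<And>p. p \<ge> 2 \<Longrightarrow> P p" for P and p :: nat
   using that by (metis One_nat_def Suc_1 less_2_cases not_le)
  have h\<alpha>: "harm \<tau> (\<alpha> $ p)" for p by (rule all2[of "\<lambda>p. harm \<tau> (\<alpha> $ p)"]) (use an h\<alpha>0 ab in auto)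
  have f\<beta>: "flat (\<beta> $ p)" for p by (rule all2[of "\<lambda>p. flat (\<beta> $ p)"]) (use bn f\<beta>0 ab in auto)
  note T = Th_nth[OF z fl f\<beta> ha h\<alpha> an(3)[OF order_refl] bn(3)[OF order_refl] cm1, unfolded an bn]
  have zda: "z0 (dy a) = kk \<tau> (z0 a)" unfolding dy_harm[OF ab(2)] kk_def by (rule z0_mlt)
  have R1': "R1 = ?T1 $ 1 - (kk \<tau> (z0 a) - d1 b)"
   unfolding R1_def T T0[unfolded One_nat_def[symmetric]] by (simp add: algebra_simps)
  have R2': "R2 = ?T2 $ 1 - (d1 (z0 a) + cst (of_real (mu_c \<tau>)) * b)"
   unfolding R2_def T T0[unfolded One_nat_def[symmetric]] by (simp add: m0 algebra_simps)
  have Th1z: "?T1 $ 1 = 0" using R1' ab(5) unfolding zda by simp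
  have Th2z: "?T2 $ 1 = 0" using R2' ab(6) unfolding z0_d1 by simp
  have n0: "complex_of_int n \<noteq> 0" using n2 by simp
  have knc: "of_real (kn \<tau> (n, ?N)) * of_real (mu_c \<tau>) = (complex_of_int n)^2"
   using arg_cong[OF rn', of complex_of_real] by (simp add: mult.commute)
  have Th1s: "?T1 $ 0 = 0"
  proof -
   have "of_real (kn \<tau> (n, ?N)) * (\<i> * of_real (mu_c \<tau>) / of_int n) = \<i> * (complex_of_int n)"
    using knc n0 by (simp add: field_simps power2_eq_square)
   then show ?thesis unfolding T wz \<beta>0_def by (simp add: kk_wv d1_wv)
  qed
  have Th2s: "?T2 $ 0 = 0"
   unfolding T wz \<beta>0_def using n0 by (simp add: m0 d1_wv cst_wv wv_add)
  obtain w where w: "w > 0" and wK: "of_real (mu_c \<tau>) * lk (?T1 $ 2) ((n, ?N), 0)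
   + \<i> * of_int n * lk (?T2 $ 2) ((n, ?N), 0) = \<i> * of_int n * of_real w"
   using resonant_mode[OF F _ \<tau> n2 N6 rn' f\<beta> h\<alpha> _ _ an(3)[OF order_refl] bn(3)[OF order_refl] Th1z Th2z] N6 an(1) bn(1)
   unfolding \<alpha>0_def \<beta>0_def by auto
  have upab: "up (?N + 1) (z0 a)" "up (?N + 1) b"
  proof -
   have "\<bar>snd (fst k)\<bar> \<le> ?N + 1" if k: "k \<in> supp (z0 a) \<or> k \<in> supp b" for k
   proof (rule ccontr)
    assume c: "\<not> ?thesis"
    obtain x y v where kk: "k = ((x, y), v)" by (metis prod.collapse)
    have v: "v = 0" using k ab(4) flat_z0[of a] by (auto simp: flat_def kk)
    have "lk R1 ((x, y), 0) = 0" "lk R2 ((x, y), 0) = 0"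
     using up_lookup[OF upR(1)] up_lookup[OF upR(2)] c by (auto simp: kk)
    from absup[OF this] show False using k by (auto simp: kk v in_keys_iff)
   qed
   then show "up (?N + 1) (z0 a)" "up (?N + 1) b" by (auto simp: up_def)
  qed
  have v11: "up (?N + 2) (x * y)" if "up 1 x" "up (?N + 1) y" for x y using up_mult[OF that, of "?N + 2"] by simp
  have v11': "up (?N + 2) (y * x)" if "up 1 x" "up (?N + 1) y" for x y using v11[OF that] by (simp add: mult.commute)
  have v2: "up (?N + 2) (x * y)" if "up 2 x" "up ?N y" for x y using up_mult[OF that, of "?N + 2"] by simp
  have v2': "up (?N + 2) (y * x)" if "up 2 x" "up ?N y" for x y using v2[OF that] by (simp add: mult.commute)
  have v22: "up 2 (x * y)" if "up 1 x" "up 1 y" for x y using up_mult[OF that, of 2] by simp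
  have v0: "up (?N + 2) x" if "up ?N x" for x using up_mono[OF that, of "?N + 2"] by simp
  have upT1: "up (?N + 2) (?T1 $ 2)"
   unfolding T distrib_left by (intro up_add up_diff up_cst) (fast intro: v11 v11' v2 v2' v22 u1 u2 up_d up_add u0 upab ups)+
  have upT2: "up (?N + 2) (?T2 $ 2)"
   unfolding T distrib_left distrib_right fm_nth by (intro up_add up_diff up_cst) (fast intro: v0 v11 v11' v2 v2' v22 u1 u2 up_d up_add up_cst u0 upab ups)+
  define r1 where "r1 = lk (E1 \<tau> \<eta> \<phi> $ N) ((n, ?N), 0)"
  define r2 where "r2 = lk (E2 \<tau> (cfm m) \<eta> \<phi> $ N) ((n, ?N), 0)"
  have i1: "r1 = \<i> * of_real (Im r1)"
  proof -
   have "cnj r1 = - r1" unfolding r1_def using wcls_lookup_rho[OF cE1, of n ?N 0] by simp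
   then have "Re r1 = 0" by (simp add: complex_eq_iff)
   then show ?thesis by (simp add: complex_eq_iff)
  qed
  have i2: "r2 = of_real (Re r2)"
  proof -
   have "cnj r2 = r2" unfolding r2_def using wcls_lookup_rho[OF cE2, of n ?N 0] by simp
   then show ?thesis by (simp add: complex_eq_iff)
  qed
  \<comment> \<open>The amplitude solving the resonance condition at (n, N): w > 0 makes it
    solvable, and the symmetry of \<open>r1\<close> and \<open>r2\<close> makes the solution
    real.\<close>
  define c where "c = - (mu_c \<tau> * Im r1 + of_int n * Re r2) / (of_int n * w)"
  have ceq: "of_real (mu_c \<tau>) * r1 + \<i> * of_int n * r2 + of_real c * (\<i> * of_int n * of_real w) = 0"
  proof -
   have "c * (of_int n * w) = - (mu_c \<tau> * Im r1 + of_int n * Re r2)" using n2 w by (simp add: c_def)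
   then have "complex_of_real (c * (of_int n * w)) = of_real (- (mu_c \<tau> * Im r1 + of_int n * Re r2))" by simp
   have "of_real (mu_c \<tau>) * (\<i> * of_real (Im r1)) + \<i> * of_int n * of_real (Re r2) + of_real c * (\<i> * of_int n * of_real w)
    = \<i> * (complex_of_real (c * (of_int n * w)) + of_real (mu_c \<tau> * Im r1 + of_int n * Re r2))" by (simp add: algebra_simps)
   also have "\<dots> = 0" unfolding \<open>complex_of_real (c * (of_int n * w)) = _\<close> by simp
   finally show ?thesis by (subst i1, subst i2)
  qed
  define \<eta>' where "\<eta>' = \<eta> + fps_X ^ s * (fcst (of_real c) * \<beta>)"
  define \<phi>' where "\<phi>' = \<phi> + fps_X ^ s * (fcst (of_real c) * \<alpha>)"
  note P1 = E_perturb2(1)[OF z s(1), of \<tau> "fcst (of_real c) * \<beta>" "fcst (of_real c) * \<alpha>", folded \<eta>'_def \<phi>'_def, unfolded Th_scale]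
  note P2 = E_perturb2(2)[OF z s(1), of \<tau> "cfm m" "fcst (of_real c) * \<beta>" "fcst (of_real c) * \<alpha>", folded \<eta>'_def \<phi>'_def, unfolded Th_scale]
  have Ts: "?T1 $ q = 0 \<and> ?T2 $ q = 0" if "q < 2" for q
   using less_2_cases[OF that] Th1s Th2s Th1z Th2z by auto
  have Z': "E1 \<tau> \<eta>' \<phi>' $ q = 0 \<and> E2 \<tau> (cfm m) \<eta>' \<phi>' $ q = 0" if q: "q < N" for q
  proof -
   have "q < s + 3" "q - s < 2" using q s(2) by auto
   then show ?thesis using P1 P2 Z[OF q] Ts[of "q - s"] by (auto simp: fcong_iff fps_X_power_mult_nth)
  qed
  have EN: "E1 \<tau> \<eta>' \<phi>' $ N = E1 \<tau> \<eta> \<phi> $ N + cst (of_real c) * ?T1 $ 2"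
   "E2 \<tau> (cfm m) \<eta>' \<phi>' $ N = E2 \<tau> (cfm m) \<eta> \<phi> $ N + cst (of_real c) * ?T2 $ 2"
   using P1 P2 s(2) by (auto simp: fcong_iff fps_X_power_mult_nth simp flip: s(2))
  have F': "fsol \<tau> N N \<eta>' \<phi>' m"
   unfolding fsol_def
  proof (intro conjI allI impI)
   have c\<alpha>: "wcls N (-1) 1 (s + q) (\<alpha> $ q)" and c\<beta>: "wcls N 1 1 (s + q) (\<beta> $ q)" for q
    by (rule all2[of "\<lambda>q. wcls N (-1) 1 (s + q) (\<alpha> $ q)"]; use an ca0 ab in simp)
      (rule all2[of "\<lambda>q. wcls N 1 1 (s + q) (\<beta> $ q)"]; use bn cb0 ab in simp)
   have "wcls N (-1) 1 p (cst (of_real c) * \<alpha> $ (p - s))" "wcls N 1 1 p (cst (of_real c) * \<beta> $ (p - s))" if "s \<le> p" for p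
    using wcls_cst_mult[OF c\<alpha>[of "p - s"], of c] wcls_cst_mult[OF c\<beta>[of "p - s"], of c] that by simp_all
   then show "wCl N 1 1 \<eta>'" "wCl N (-1) 1 \<phi>'"
    using clN unfolding \<eta>'_def \<phi>'_def by (auto simp: wCl_def fps_X_power_mult_nth intro!: wcls_add)
   show "flat (\<eta>' $ p)" for p unfolding \<eta>'_def using fl f\<beta> by (auto simp: fps_X_power_mult_nth intro!: flat_add flat_mult)
   show "harm \<tau> (\<phi>' $ p)" for p unfolding \<phi>'_def using ha h\<alpha> by (auto simp: fps_X_power_mult_nth intro!: harm_add harm_cst_mult)
   show "\<eta>' $ 0 = 0" "\<phi>' $ 0 = 0" "\<eta>' $ 1 = eta1 \<tau>" "\<phi>' $ 1 = phi1 \<tau>"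
    using z one s by (auto simp: \<eta>'_def \<phi>'_def fps_X_power_mult_nth)
   show "m $ 0 = mu_c \<tau>" by (rule m0)
   show "\<eta>' $ p = 0" "\<phi>' $ p = 0" "m $ p = 0" if "N \<le> p" for p
    using hi[OF that] an(3)[of "p - s"] bn(3)[of "p - s"] that s(2) by (auto simp: \<eta>'_def \<phi>'_def fps_X_power_mult_nth)
   show "m $ p = 0" if "odd p" for p by (rule mo[OF that])
   show "E1 \<tau> \<eta>' \<phi>' $ q = 0" "E2 \<tau> (cfm m) \<eta>' \<phi>' $ q = 0" if "q < N" for q using Z'[OF that] by auto
  qed
  then have cl': "wCl N 1 1 \<eta>'" "wCl N (-1) 1 \<phi>'" by (auto simp: fsol_def)
  let ?e1 = "E1 \<tau> \<eta>' \<phi>' $ N" and ?e2 = "E2 \<tau> (cfm m) \<eta>' \<phi>' $ N"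
  have c1: "wcls N (-1) 1 N ?e1" using wCl_E1[OF cl'] by (simp add: wCl_def)
  have c2: "wcls N 1 1 N ?e2" using wCl_E2[OF cl' wCl_cfm[OF mo]] by (simp add: wCl_def)
  obtain c' where c': "even N \<Longrightarrow> c' = 0" and cr:
   "\<And>a b. \<bar>a\<bar> = 1 \<Longrightarrow> \<bar>b\<bar> = 1 \<Longrightarrow> of_real (mu_c \<tau>) * lk ?e1 ((a, b), 0) + \<i> * of_int a *
    (lk ?e2 ((a, b), 0) + of_real c' * lk (eta1 \<tau>) ((a, b), 0)) = 0"
   using fsol_mu[OF F'] by metis
  have uE: "up ?N (E1 \<tau> \<eta> \<phi> $ N)" "up ?N (E2 \<tau> (cfm m) \<eta> \<phi> $ N)" using up_wcls[OF cE1] up_wcls[OF cE2] by auto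
  \<comment> \<open>The inserted wave reaches |b| \<le> N + 2 at order N, so the resonances to be
    excluded now are those in the band of \<open>resonance_gap\<close>.\<close>
  have ue: "up (?N + 2) ?e1" "up (?N + 2) ?e2"
   unfolding EN by (intro up_add up_cst upT1 upT2 up_mono[OF uE(1)] up_mono[OF uE(2)]; simp)+
  obtain a' b' where G: "fsol \<tau> N (Suc N) (\<eta>' + fps_X ^ N * fps_const b') (\<phi>' + fps_X ^ N * fps_const a') (m + fps_X ^ (N - 1) * fps_const c')"
  proof (rule fsol_step[OF F' N1(1), of c'])
   fix x y :: int assume xy: "x \<noteq> 0" "mu_c \<tau> * kn \<tau> (x, y) = (of_int x)^2"
   then have r: "res x y" by (simp add: res_def)
   show "of_real (mu_c \<tau>) * lk ?e1 ((x, y), 0) + \<i> * of_int x *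
    (lk ?e2 ((x, y), 0) + of_real c' * lk (eta1 \<tau>) ((x, y), 0)) = 0"
   proof (cases "\<bar>x\<bar> = 1 \<and> \<bar>y\<bar> = 1")
    case True
    then show ?thesis using cr by blast
   next
    case n1: False
    then have yN: "\<bar>y\<bar> \<ge> ?N" using res1[OF r] by force
    have "\<bar>x\<bar> \<noteq> 1" using n1 resonance_1[OF \<tau> xy(2)] by auto
    then have x2: "\<bar>x\<bar> \<ge> 2" using xy(1) by auto
    have e0: "lk (eta1 \<tau>) ((x, y), 0) = 0" using lookup_wcls_big[OF ce, of x y 0] yN N6 by auto
    show ?thesis
    proof (cases "\<bar>y\<bar> > ?N + 2")
     case True
     then show ?thesis using up_lookup[OF ue(1) True] up_lookup[OF ue(2) True] e0 by simp
    next
     case False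
     then have eq: "\<bar>x\<bar> = n" "\<bar>y\<bar> = ?N" using resonance_gap[OF \<tau> rn' xy(2) n2 _ x2] yN N6 by auto
     have K: "of_real (mu_c \<tau>) * lk ?e1 ((n, ?N), 0) + \<i> * of_int n * lk ?e2 ((n, ?N), 0) = 0"
     proof -
      have "of_real (mu_c \<tau>) * lk ?e1 ((n, ?N), 0) + \<i> * of_int n * lk ?e2 ((n, ?N), 0)
       = (of_real (mu_c \<tau>) * r1 + \<i> * of_int n * r2) + of_real c * (of_real (mu_c \<tau>) * lk (?T1 $ 2) ((n, ?N), 0)
   + \<i> * of_int n * lk (?T2 $ 2) ((n, ?N), 0))"
       unfolding EN r1_def r2_def by (simp add: lookup_add algebra_simps)
      then show ?thesis unfolding wK using ceq by simp
     qed
     define \<sigma> :: int where "\<sigma> = (if x = n then 1 else - 1)"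
     have xs: "x = \<sigma> * n" "\<sigma> = 1 \<or> \<sigma> = -1" using eq(1) by (auto simp: \<sigma>_def abs_if split: if_splits)
     have l: "lk ?e1 ((x, y), 0) = of_int \<sigma> * lk ?e1 ((n, ?N), 0)"
      "lk ?e2 ((x, y), 0) = lk ?e2 ((n, ?N), 0)"
     proof -
      have "y = ?N \<or> y = - ?N" using eq(2) by linarith
      moreover have "x = n \<and> \<sigma> = 1 \<or> x = - n \<and> \<sigma> = -1" using xs by auto
      ultimately show "lk ?e1 ((x, y), 0) = of_int \<sigma> * lk ?e1 ((n, ?N), 0)"
       "lk ?e2 ((x, y), 0) = lk ?e2 ((n, ?N), 0)"
       by (elim disjE conjE; simp only: wcls_lookup_sg1[OF c1] wcls_lookup_sg2[OF c1] wcls_lookup_sg1[OF c2] wcls_lookup_sg2[OF c2]; simp)+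
     qed
     have "of_real (mu_c \<tau>) * (of_int \<sigma> * lk ?e1 ((n, ?N), 0)) + \<i> * of_int (\<sigma> * n) * lk ?e2 ((n, ?N), 0)
      = of_int \<sigma> * (of_real (mu_c \<tau>) * lk ?e1 ((n, ?N), 0) + \<i> * of_int n * lk ?e2 ((n, ?N), 0))"
      by (simp add: algebra_simps)
     then show ?thesis unfolding l e0 K unfolding xs(1) by simp
    qed
   qed
  qed (use c' in blast)+
  then show ?thesis using mu2[OF G] by blast
 qed
qed

section \<open>The critical value of the parameter\<close>

text \<open>\<open>mu_c\<close> decreases in \<tau>, and the numerator \<open>g\<close> of
  \<open>mu1\<close> as a function of \<mu> decreases on [0, 1], while the denominator is positive;
  so the sign changes exactly once.\<close>

lemma critical_tau:
 "\<exists>!\<tau>\<^sub>c. \<tau>\<^sub>c > 0 \<and> mu1 \<tau>\<^sub>c = 0 \<and> (\<forall>\<tau>. 0 < \<tau> \<and> \<tau> < \<tau>\<^sub>c \<longrightarrow> mu1 \<tau> < 0) \<and> (\<forall>\<tau>. \<tau> > \<tau>\<^sub>c \<longrightarrow> mu1 \<tau> > 0)"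
proof -
 define g :: "real \<Rightarrow> real" where "g x = 2 - 5 * x - 4 * x ^ 2 + 10 * x ^ 3 - 4 * x ^ 4 - 2 * x ^ 5" for x
 have mu1_g: "mu1 \<tau> = g (mu_c \<tau>) / (4 * mu_c \<tau> ^ 3 * (2 - mu_c \<tau>))" if "\<tau> > 0" for \<tau>
 proof -
  have "mu_c \<tau> > 0" "mu_c \<tau> < 1" using mu_c_pos mu_c_lt_1[OF that] by auto
  then have "2 - mu_c \<tau> \<noteq> 0" "mu_c \<tau> \<noteq> 0" by auto
  then show ?thesis unfolding mu1_def Let_def g_def
   by (simp add: divide_simps) (simp add: algebra_simps power2_eq_square power3_eq_cube power4_eq_xxxx eval_nat_numeral)
 qed
 have den: "4 * mu_c \<tau> ^ 3 * (2 - mu_c \<tau>) > 0" if "\<tau> > 0" for \<tau>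
  using mu_c_pos[of \<tau>] mu_c_lt_1[OF that] by simp
 have g_dec: "g b < g a" if "0 \<le> a" "a < b" "b \<le> 1" for a b
 proof (rule DERIV_neg_imp_decreasing[OF that(2)])
  fix x assume x: "a \<le> x" "x \<le> b"
  have d: "(g has_real_derivative (- 5 - 8 * x + 30 * x^2 - 16 * x ^ 3 - 10 * x ^ 4)) (at x)"
   unfolding g_def by (auto intro!: derivative_eq_intros)
  \<comment> \<open>30 x - 16 x^2 is replaced by its maximum, at 15/16, and x^4 by its tangent at
    1/2; the bound that remains for the derivative is affine in x and negative up to x = 1.\<close>
  have "x * (30 * x - 16 * x^2) \<le> x * (225 / 16)"
  proof (rule mult_left_mono)
   have "0 \<le> (4 * x - 15 / 4)\<^sup>2" by simp
   then show "30 * x - 16 * x^2 \<le> 225 / 16" by (simp add: power2_eq_square algebra_simps)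
  qed (use that x in simp)
  moreover have "x ^ 4 \<ge> x / 2 - 3 / 16"
  proof -
   have "0 \<le> (x - 1 / 2)\<^sup>2 * ((x + 1 / 2)^2 + 1 / 2)" by simp
   also have "\<dots> = x ^ 4 - x / 2 + 3 / 16" by (simp add: power2_eq_square power4_eq_xxxx field_simps)
   finally show ?thesis by simp
  qed
  moreover have "x \<le> 1" using x that by simp
  ultimately have "- 5 - 8 * x + 30 * x^2 - 16 * x ^ 3 - 10 * x ^ 4 < 0"
   by (simp add: power2_eq_square power3_eq_cube algebra_simps)
  with d show "\<exists>y. (g has_real_derivative y) (at x) \<and> y < 0" by blast
 qed
 \<comment> \<open>g is positive at 3/10 and g 1 = -3.\<close>
 have "\<exists>x\<ge>3/10. x \<le> 1 \<and> g x = 0"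
  by (rule IVT2) (auto simp: g_def eval_nat_numeral intro!: continuous_intros)
 then obtain x0 where x0: "3/10 \<le> x0" "x0 \<le> 1" "g x0 = 0" by blast
 have "x0 \<noteq> 1" using x0(3) by (auto simp: g_def)
 then have x01: "0 < x0" "x0 < 1" using x0 by auto
 define t where "t = sqrt (1 / x0^2 - 1)"
 have "x0^2 < 1" using x01 by (simp add: power_less_one_iff)
 then have "1 / x0^2 > 1" using x01 by simp
 then have t: "t > 0" "t^2 = 1 / x0^2 - 1" by (simp_all add: t_def)
 have mono: "mu_c b < mu_c a" if "0 < a" "a < b" for a b
 proof -
  have "a^2 < b\<^sup>2" using that by (intro power_strict_mono) auto
  have "mu_c x = 1 / sqrt (1 + x^2)" for x
   by (simp add: mu_c_def powr_minus_divide powr_half_sqrt add_nonneg_nonneg)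
  then show ?thesis using \<open>a\<^sup>2 < b\<^sup>2\<close> by (simp add: divide_strict_left_mono add_pos_nonneg)
 qed
 have mt: "mu_c t = x0"
 proof -
  have "(mu_c t)^2 = x0^2" using mu_c_sq[of t] x01 t(2) by (simp add: field_simps)
  then show ?thesis using mu_c_pos[of t] x01 by (simp add: power2_eq_iff)
 qed
 have neg: "mu1 a < 0" if "0 < a" "a < t" for a
 proof -
  have "g (mu_c a) < g x0" using g_dec[of x0 "mu_c a"] mono[OF that] mu_c_lt_1[OF that(1)] x01 mt by simp
  then show ?thesis unfolding mu1_g[OF that(1)] using den[OF that(1)] x0(3) by (simp add: divide_neg_pos)
 qed
 have pos: "mu1 a > 0" if "t < a" for a
 proof -
  have a: "a > 0" using that t by simp
  have "g (mu_c a) > g x0" using g_dec[of "mu_c a" x0] mono[OF t(1) that] mu_c_pos[of a] x01 mt by simp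
  then show ?thesis unfolding mu1_g[OF a] using den[OF a] x0(3) by (simp add: divide_pos_pos)
 qed
 have zero: "mu1 t = 0" unfolding mu1_g[OF t(1)] mt x0(3) by simp
 show ?thesis
 proof (rule ex1I[of _ t])
  show "t > 0 \<and> mu1 t = 0 \<and> (\<forall>\<tau>. 0 < \<tau> \<and> \<tau> < t \<longrightarrow> mu1 \<tau> < 0) \<and> (\<forall>\<tau>. \<tau> > t \<longrightarrow> mu1 \<tau> > 0)"
   using t zero neg pos by blast
  show "s = t" if "s > 0 \<and> mu1 s = 0 \<and> (\<forall>\<tau>. 0 < \<tau> \<and> \<tau> < s \<longrightarrow> mu1 \<tau> < 0) \<and> (\<forall>\<tau>. \<tau> > s \<longrightarrow> mu1 \<tau> > 0)" for s
   using that neg[of s] pos[of s] by (metis less_irrefl linorder_neqE_linordered_idom)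
 qed
qed

section \<open>The elliptic estimate\<close>

text \<open>The operator factorises: w = v' - k v satisfies w' + k w = v'' - k^2 v. Integrating
  exp(k y) w upwards from -\<infinity> gives |w| \<le> M / k, and integrating exp(-k y) v downwards
  from v 0 = 0 gives |v| \<le> M / k^2. The derivatives follow from w and from the equation.\<close>

lemma ode_bound:
 fixes v v' v'' :: "real \<Rightarrow> complex"
 assumes k: "k > 0" and d: "\<And>y. (v has_vector_derivative v' y) (at y)" "\<And>y. (v' has_vector_derivative v'' y) (at y)"
  and v0: "v 0 = 0" and B: "\<And>y. y \<le> 0 \<Longrightarrow> norm (v y) \<le> B" "\<And>y. y \<le> 0 \<Longrightarrow> norm (v' y) \<le> B"
  and M: "\<And>y. y \<le> 0 \<Longrightarrow> norm (v'' y - of_real (k^2) * v y) \<le> M" and y: "y \<le> 0"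
 shows "k^2 * norm (v y) \<le> M" "k * norm (v' y) \<le> 2 * M" "norm (v'' y) \<le> 2 * M"
proof -
 define w where "w y = v' y - of_real k * v y" for y
 have M0: "M \<ge> 0" using M[OF order_refl] norm_ge_zero order_trans by blast
 have w: "norm (w y) \<le> M / k" if y: "y \<le> 0" for y
 proof -
  have "norm (of_real (exp (k * y)) * w y) - norm (of_real (exp (k * s)) * w s) \<le> M / k * exp (k * y)" if s: "s < y" for s
  proof -
   have "norm (of_real (exp (k * y)) * w y - of_real (exp (k * s)) * w s) \<le> M / k * exp (k * y) - M / k * exp (k * s)"
   proof (rule differentiable_bound_general[OF s, where f' = "\<lambda>x. of_real (exp (k * x)) * (v'' x - of_real (k^2) * v x)" and \<phi>' = "\<lambda>x. M * exp (k * x)"])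
    have dd: "((\<lambda>x. of_real (exp (k * x)) * w x) has_vector_derivative of_real (exp (k * x)) * (v'' x - of_real (k^2) * v x)) (at x)" for x
    proof -
     have "((\<lambda>x. complex_of_real (exp (k * x))) has_vector_derivative of_real (k * exp (k * x))) (at x)"
      using k by (intro has_vector_derivative_of_real) (auto intro!: derivative_eq_intros simp flip: has_real_derivative_iff_has_vector_derivative)
     moreover have "(w has_vector_derivative v'' x - of_real k * v' x) (at x)"
      unfolding w_def by (intro has_vector_derivative_diff d has_vector_derivative_mult_right)
     ultimately show ?thesis
      by (rule has_vector_derivative_eq_rhs[OF has_vector_derivative_mult]) (simp add: w_def power2_eq_square algebra_simps)
    qed
    show "((\<lambda>x. of_real (exp (k * x)) * w x) has_vector_derivative of_real (exp (k * x)) * (v'' x - of_real (k^2) * v x)) (at x)" for x by (rule dd)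
    show "continuous_on {s..y} (\<lambda>x. of_real (exp (k * x)) * w x)"
     by (intro continuous_at_imp_continuous_on ballI has_vector_derivative_continuous[OF dd])
    show "continuous_on {s..y} (\<lambda>x. M / k * exp (k * x))" by (intro continuous_intros)
    show "((\<lambda>x. M / k * exp (k * x)) has_vector_derivative M * exp (k * x)) (at x)" for x
     using k by (auto intro!: derivative_eq_intros simp flip: has_real_derivative_iff_has_vector_derivative)
    show "norm (of_real (exp (k * x)) * (v'' x - of_real (k^2) * v x)) \<le> M * exp (k * x)" if "x < y" for x
     using M[of x] that y by (auto simp: norm_mult mult.commute intro!: mult_right_mono)
   qed
   moreover have "0 \<le> M / k * exp (k * s)" using M0 k by simp
   ultimately show ?thesis using norm_triangle_ineq2[of "of_real (exp (k * y)) * w y" "of_real (exp (k * s)) * w s"] by linarith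
  qed
  then have ev: "\<forall>\<^sub>F s in at_bot. norm (of_real (exp (k * y)) * w y) - norm (of_real (exp (k * s)) * w s) \<le> M / k * exp (k * y)"
   unfolding eventually_at_bot_dense by blast
  have wB: "norm (w s) \<le> B + k * B" if "s \<le> 0" for s
  proof -
   have "norm (w s) \<le> norm (v' s) + norm (of_real k * v s)" unfolding w_def by (rule norm_triangle_ineq4)
   also have "\<dots> \<le> B + k * B" using B[OF that] k by (intro add_mono) (auto simp: norm_mult)
   finally show ?thesis .
  qed
  \<comment> \<open>Boundedness of v and v' is enough to lose the boundary term at -\<infinity>;
    decay need not be known in advance.\<close>
  have "((\<lambda>s. norm (of_real (exp (k * s)) * w s)) \<longlongrightarrow> 0) at_bot"
  proof (rule Lim_null_comparison)
   show "\<forall>\<^sub>F s in at_bot. norm (norm (of_real (exp (k * s)) * w s)) \<le> exp (k * s) * (B + k * B)"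
    using eventually_le_at_bot[of 0] by eventually_elim (auto simp: norm_mult intro!: mult_left_mono wB)
   have "((\<lambda>s. exp (k * s)) \<longlongrightarrow> 0) at_bot" using k
    by (intro filterlim_compose[OF exp_at_bot] filterlim_tendsto_pos_mult_at_bot[OF tendsto_const _ filterlim_ident]) auto
   from tendsto_mult_left_zero[OF this] show "((\<lambda>s. exp (k * s) * (B + k * B)) \<longlongrightarrow> 0) at_bot" .
  qed
  from tendsto_diff[OF tendsto_const this, of "norm (of_real (exp (k * y)) * w y)"]
  have "((\<lambda>s. norm (of_real (exp (k * y)) * w y) - norm (of_real (exp (k * s)) * w s)) \<longlongrightarrow> norm (of_real (exp (k * y)) * w y)) at_bot" by simp
  then have "norm (of_real (exp (k * y)) * w y) \<le> M / k * exp (k * y)"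
   by (rule tendsto_upperbound[OF _ ev]) simp
  then have "norm (w y) * exp (k * y) \<le> (M / k) * exp (k * y)" by (simp add: norm_mult mult.commute)
  then show ?thesis by (rule mult_right_le_imp_le) simp
 qed
 show v: "k^2 * norm (v y) \<le> M"
 proof (cases "y = 0")
  case True then show ?thesis using v0 M0 by simp
 next
  case False
  then have y0: "y < 0" using y by simp
  have "norm (of_real (exp (- k * 0)) * v 0 - of_real (exp (- k * y)) * v y) \<le> - M / k^2 * exp (- k * 0) - - M / k^2 * exp (- k * y)"
  proof (rule differentiable_bound_general[OF y0, where f' = "\<lambda>x. of_real (exp (- k * x)) * w x" and \<phi>' = "\<lambda>x. M / k * exp (- k * x)"])
   have dd: "((\<lambda>x. of_real (exp (- k * x)) * v x) has_vector_derivative of_real (exp (- k * x)) * w x) (at x)" for x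
   proof -
    have "((\<lambda>x. complex_of_real (exp (- k * x))) has_vector_derivative of_real (- k * exp (- k * x))) (at x)"
     by (intro has_vector_derivative_of_real) (auto intro!: derivative_eq_intros simp flip: has_real_derivative_iff_has_vector_derivative)
    from has_vector_derivative_mult[OF this d(1)] show ?thesis
     by (rule has_vector_derivative_eq_rhs) (simp add: w_def algebra_simps)
   qed
   show "((\<lambda>x. of_real (exp (- k * x)) * v x) has_vector_derivative of_real (exp (- k * x)) * w x) (at x)" for x by (rule dd)
   show "continuous_on {y..0} (\<lambda>x. of_real (exp (- k * x)) * v x)"
    by (intro continuous_at_imp_continuous_on ballI has_vector_derivative_continuous[OF dd])
   show "continuous_on {y..0} (\<lambda>x. - M / k^2 * exp (- k * x))" by (intro continuous_intros)
   show "((\<lambda>x. - M / k^2 * exp (- k * x)) has_vector_derivative M / k * exp (- k * x)) (at x)" for x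
    using k by (auto intro!: derivative_eq_intros simp: power2_eq_square field_simps simp flip: has_real_derivative_iff_has_vector_derivative)
   show "norm (of_real (exp (- k * x)) * w x) \<le> M / k * exp (- k * x)" if "x < 0" for x
    using mult_right_mono[OF w[of x], of "exp (- k * x)"] that by (simp add: norm_mult mult.commute)
  qed
  then have "exp (- k * y) * norm (v y) \<le> M / k^2 * exp (- k * y) - M / k^2" using v0 by (simp add: norm_mult)
  moreover have "M / k^2 \<ge> 0" using M0 by simp
  ultimately have "exp (- k * y) * norm (v y) \<le> exp (- k * y) * (M / k^2)" by (simp add: mult.commute)
  then have "norm (v y) \<le> M / k^2" by (rule mult_left_le_imp_le) simp
  then show ?thesis using k by (simp add: pos_le_divide_eq mult.commute)
 qed
 have "norm (v' y) \<le> norm (w y) + norm (of_real k * v y)" unfolding w_def by (rule order_trans[OF _ norm_triangle_ineq]) simp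
 then have "k * norm (v' y) \<le> k * (norm (w y) + norm (of_real k * v y))" using k by (intro mult_left_mono) auto
 also have "\<dots> \<le> 2 * M" using w[OF y] v k by (simp add: norm_mult distrib_left power2_eq_square field_simps)
 finally show "k * norm (v' y) \<le> 2 * M" .
 have "norm (v'' y) \<le> norm (v'' y - of_real (k^2) * v y) + norm (of_real (k^2) * v y)" by (rule order_trans[OF _ norm_triangle_ineq]) simp
 also have "\<dots> \<le> M + M" using M[OF y] v by (intro add_mono) (simp_all add: norm_mult norm_power)
 finally show "norm (v'' y) \<le> 2 * M" by simp
qed

section \<open>A norm taking suprema in depth and sums in the horizontal frequency\<close>

definition nn :: "wpoly \<Rightarrow> bool" where "nn t \<longleftrightarrow> (\<forall>k\<in>supp t. snd k \<ge> 0)"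
text \<open>The supremum in y is taken after all exponentials with the same horizontal frequency
  have been added, so that cancellation between different rates is retained; the coefficient norm
  \<open>n1\<close> would not see it.\<close>

definition cn :: "int \<times> int \<Rightarrow> wpoly \<Rightarrow> real" where "cn K t = (SUP y\<in>{..0}. norm (cf K y t))"
definition sn :: "wpoly \<Rightarrow> real" where "sn t = (\<Sum>K\<in>fst ` supp t. cn K t)"

lemma nn_0 [simp]: "nn 0" by (simp add: nn_def)
lemma nn_add: "nn a \<Longrightarrow> nn b \<Longrightarrow> nn (a + b)" using Poly_Mapping.keys_add[of a b] by (fastforce simp: nn_def)
lemma nn_uminus: "nn a \<Longrightarrow> nn (- a)" by (simp add: nn_def keys_minus)
lemma nn_mult: "nn a \<Longrightarrow> nn b \<Longrightarrow> nn (a * b)" using Poly_Mapping.keys_mult[of a b] by (fastforce simp: nn_def)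
lemma nn_mlt: "nn a \<Longrightarrow> nn (mlt w a)" using keys_mlt[of w a] by (fastforce simp: nn_def)
lemma nn_flat: "flat a \<Longrightarrow> nn a" by (simp add: nn_def flat_def)
lemma nn_sum: "(\<And>i. i \<in> A \<Longrightarrow> nn (f i)) \<Longrightarrow> nn (sum f A)"
 by (induction A rule: infinite_finite_induct) (auto intro: nn_add)
lemma norm_cf_le_part:
 assumes "nn t" "y \<le> 0"
 shows "norm (cf K y t) \<le> (\<Sum>k\<in>supp t. if fst k = K then norm (lk t k) else 0)"
 unfolding cf_def lsum_def
proof (rule sum_norm_le)
 fix k assume k: "k \<in> supp t"
 then have "snd k * y \<le> 0" using assms by (simp add: nn_def mult_nonneg_nonpos)
 then show "norm (if fst k = K then lk t k * complex_of_real (exp (snd k * y)) else 0)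
   \<le> (if fst k = K then norm (lk t k) else 0)"
  by (auto simp: norm_mult intro!: mult_left_le)
qed

lemma bdd_cf: "nn t \<Longrightarrow> bdd_above ((\<lambda>y. norm (cf K y t)) ` {..0})"
 by (rule bdd_aboveI2[OF norm_cf_le_part]) auto

lemma cn_ge: "nn t \<Longrightarrow> y \<le> 0 \<Longrightarrow> norm (cf K y t) \<le> cn K t"
 unfolding cn_def by (rule cSUP_upper[OF _ bdd_cf]) auto

lemma cn_le: "(\<And>y. y \<le> 0 \<Longrightarrow> norm (cf K y t) \<le> B) \<Longrightarrow> cn K t \<le> B"
 unfolding cn_def by (rule cSUP_least) auto

lemma cn_nonneg: "nn t \<Longrightarrow> 0 \<le> cn K t"
 using cn_ge[of t 0 K] norm_ge_zero order_trans by blast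

lemma cn_eq_0: "K \<notin> fst ` supp t \<Longrightarrow> cn K t = 0"
 by (simp add: cn_def cf_eq_0)

lemma sn_superset: "finite S \<Longrightarrow> fst ` supp t \<subseteq> S \<Longrightarrow> sn t = (\<Sum>K\<in>S. cn K t)"
 unfolding sn_def by (rule sum.mono_neutral_left) (auto simp: cn_eq_0)

lemma sn_nonneg: "nn t \<Longrightarrow> 0 \<le> sn t" by (simp add: sn_def sum_nonneg cn_nonneg)
lemma sn_0 [simp]: "sn 0 = 0" by (simp add: sn_def)

lemma sn_add: assumes "nn a" "nn b" shows "sn (a + b) \<le> sn a + sn b"
proof -
 let ?S = "fst ` (supp a \<union> supp b)"
 have "sn (a + b) = (\<Sum>K\<in>?S. cn K (a + b))" using Poly_Mapping.keys_add[of a b] by (intro sn_superset) auto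
 also have "\<dots> \<le> (\<Sum>K\<in>?S. cn K a + cn K b)"
 proof (intro sum_mono cn_le)
  fix K and y :: real assume "y \<le> 0"
  then show "norm (cf K y (a + b)) \<le> cn K a + cn K b"
   unfolding cf_add using assms by (intro order_trans[OF norm_triangle_ineq] add_mono cn_ge)
 qed
 also have "\<dots> = sn a + sn b" using sn_superset[of ?S a] sn_superset[of ?S b] by (simp add: sum.distrib image_mono[OF Un_upper1] image_mono[OF Un_upper2])
 finally show ?thesis .
qed

lemma sn_uminus [simp]: "sn (- a) = sn a" by (simp add: sn_def cn_def cf_uminus keys_minus)

lemma sn_sum: "(\<And>i. i \<in> A \<Longrightarrow> nn (f i)) \<Longrightarrow> sn (sum f A) \<le> (\<Sum>i\<in>A. sn (f i))"
 by (induction A rule: infinite_finite_induct) (auto intro!: order_trans[OF sn_add] nn_sum)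

text \<open>A flat exponential only translates the horizontal frequencies and leaves the profiles in
  y as they are.\<close>

lemma sn_mult_flat:
 assumes "flat a" "nn t" shows "sn (a * t) \<le> n1 a * sn t"
proof -
 have single: "sn (mon (J, 0) c * t) \<le> norm c * sn t" for J c
 proof -
  let ?S = "(+) J ` fst ` supp t"
  have "sn (mon (J, 0) c * t) = (\<Sum>K\<in>?S. cn K (mon (J, 0) c * t))"
   using Poly_Mapping.keys_mult[of "mon (J, 0 :: real) c" t]
   by (intro sn_superset) (auto simp: image_iff split: if_splits; force)+
  also have "\<dots> \<le> (\<Sum>K\<in>?S. norm c * cn (K - J) t)"
   using assms(2) by (intro sum_mono cn_le) (auto simp: cf_mult_single norm_mult intro!: mult_left_mono cn_ge)
  also have "\<dots> = norm c * sn t" by (subst sum.reindex) (auto simp: sn_def sum_distrib_left)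
  finally show ?thesis .
 qed
 have "a * t = (\<Sum>k\<in>supp a. mon k (lk a k) * t)"
  by (subst poly_mapping_decompose[of a]) (simp add: sum_distrib_right)
 also have "sn \<dots> \<le> (\<Sum>k\<in>supp a. sn (mon k (lk a k) * t))"
  by (rule sn_sum, rule nn_mult) (use assms in \<open>auto simp: nn_def flat_def\<close>)
 also have "\<dots> \<le> (\<Sum>k\<in>supp a. norm (lk a k) * sn t)"
 proof (rule sum_mono)
  fix k assume "k \<in> supp a"
  then have "k = (fst k, 0)" using assms(1) by (auto simp: flat_def prod_eq_iff)
  then show "sn (mon k (lk a k) * t) \<le> norm (lk a k) * sn t"
   using single[of "fst k"] by metis
 qed
 also have "\<dots> = n1 a * sn t" by (simp add: n1_def lsum_def sum_distrib_right)
 finally show ?thesis .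
qed

lemma sn_le_n1: "nn t \<Longrightarrow> sn t \<le> n1 t"
proof -
 assume t: "nn t"
 have "sn t \<le> (\<Sum>K\<in>fst ` supp t. \<Sum>k\<in>supp t. if fst k = K then norm (lk t k) else 0)"
  unfolding sn_def by (intro sum_mono cn_le norm_cf_le_part t)
 also have "\<dots> = n1 t" unfolding n1_def lsum_def by (subst sum.swap) (auto intro!: sum.cong simp: sum.delta')
 finally show ?thesis .
qed

lemma keys_z0: "supp (z0 t) \<subseteq> (\<lambda>k. (fst k, 0)) ` supp t"
 unfolding z0_def by (rule keys_gpush)

lemma n1_z0_le: "nn t \<Longrightarrow> n1 (z0 t) \<le> sn t"
proof -
 assume t: "nn t"
 have "n1 (z0 t) = (\<Sum>k\<in>(\<lambda>k. (fst k, 0)) ` supp t. norm (lk (z0 t) k))"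
  unfolding n1_def by (rule lsum_superset) (use keys_z0 in auto)
 also have "(\<lambda>k. (fst k, 0::real)) ` supp t = (\<lambda>K. (K, 0)) ` fst ` supp t" by auto
 also have "(\<Sum>k\<in>(\<lambda>K. (K, 0)) ` fst ` supp t. norm (lk (z0 t) k)) = (\<Sum>K\<in>fst ` supp t. norm (cf K 0 t))"
  by (subst sum.reindex) (auto simp: inj_on_def lookup_z0)
 also have "\<dots> \<le> sn t" unfolding sn_def by (intro sum_mono cn_ge t order_refl)
 finally show ?thesis .
qed

lemma cf_deriv: "((\<lambda>y. cf K y t) has_vector_derivative cf K y (dy t)) (at y)"
proof (induction t rule: poly_mapping_induct)
 case (single k c)
 have "((\<lambda>y. c * complex_of_real (exp (snd k * y))) has_vector_derivative of_real (snd k) * c * of_real (exp (snd k * y))) (at y)"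
 proof -
  have "((\<lambda>y. complex_of_real (exp (snd k * y))) has_vector_derivative of_real (snd k * exp (snd k * y))) (at y)"
   by (intro has_vector_derivative_of_real) (auto intro!: derivative_eq_intros simp flip: has_real_derivative_iff_has_vector_derivative)
  from has_vector_derivative_mult_right[OF this, of c] show ?thesis by (simp add: algebra_simps)
 qed
 then show ?case by (simp add: cf_single dy_def mlt_single)
next
 case (add a b)
 then show ?case by (auto simp: cf_add dy_add intro!: has_vector_derivative_add)
qed

lemma cf_d: "cf K y (d1 t) = \<i> * of_int (fst K) * cf K y t" "cf K y (d2 \<tau> t) = \<i> * of_real \<tau> * of_int (snd K) * cf K y t"
 unfolding d1_def d2_def by (rule cf_mlt_fst)+

lemma nn_d: "nn t \<Longrightarrow> nn (d1 t)" "nn t \<Longrightarrow> nn (d2 \<tau> t)" "nn t \<Longrightarrow> nn (dy t)" "nn t \<Longrightarrow> nn (dyn j t)"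
 by (simp_all add: d1_def d2_def dy_def dyn_def nn_mlt)

definition lap :: "real \<Rightarrow> wpoly \<Rightarrow> wpoly" where "lap \<tau> t = d1 (d1 t) + d2 \<tau> (d2 \<tau> t) + dy (dy t)"

lemma nn_lap: "nn t \<Longrightarrow> nn (lap \<tau> t)" unfolding lap_def by (intro nn_add nn_d)

text \<open>Vanishing trace and nonnegative rates allow \<open>ode_bound\<close> in every horizontal
  mode. As n \<noteq> 0, its k is at least 1 and dominates |n| and \<tau> |m|, so all derivatives up
  to order two cost at most k^2, with the same constant for every mode.\<close>

lemma elliptic:
 assumes t: "nn t" "z0 t = 0" and odd: "\<And>k. k \<in> supp t \<Longrightarrow> fst (fst k) \<noteq> 0"
  and u: "u \<in> {t, d1 t, d2 \<tau> t, dy t, d1 (d1 t), d1 (d2 \<tau> t), d1 (dy t), d2 \<tau> (d2 \<tau> t), d2 \<tau> (dy t), dy (dy t)}"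
 shows "sn u \<le> 2 * sn (lap \<tau> t)"
proof -
 let ?S = "fst ` supp t"
 have ku: "supp u \<subseteq> supp t"
  using u by (auto simp: d1_def d2_def dy_def in_keys_iff)
 have kl: "supp (lap \<tau> t) \<subseteq> supp t"
 proof -
  have "lap \<tau> t = mlt (\<lambda>k. (\<i> * of_int (fst (fst k)))\<^sup>2 + (\<i> * of_real \<tau> * of_int (snd (fst k)))^2 + (of_real (snd k))^2) t"
   unfolding lap_def d1_def d2_def dy_def mlt_mlt by (rule poly_mapping_eqI) (simp add: lookup_add power2_eq_square algebra_simps)
  then show ?thesis by (simp only: keys_mlt)
 qed
 have "sn u = (\<Sum>K\<in>?S. cn K u)" using ku by (intro sn_superset) auto
 also have "\<dots> \<le> (\<Sum>K\<in>?S. 2 * cn K (lap \<tau> t))"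
 proof (intro sum_mono cn_le)
  fix K and y :: real assume K: "K \<in> ?S" and y: "y \<le> 0"
  define k where "k = kn \<tau> K"
  define M where "M = cn K (lap \<tau> t)"
  have n0: "fst K \<noteq> 0" using odd K by auto
  then have "1 \<le> \<bar>fst K\<bar>" by linarith
  then have n1: "1 \<le> \<bar>real_of_int (fst K)\<bar>" by linarith
  have kn: "\<bar>real_of_int (fst K)\<bar> \<le> k" "\<bar>\<tau> * real_of_int (snd K)\<bar> \<le> k"
   by (rule abs_le_square_iff[THEN iffD2, of _ k, simplified abs_of_nonneg[OF kn_nonneg[of \<tau> K, folded k_def]]];
    simp add: k_def kn_sq power_mult_distrib)+
  have k1: "k \<ge> 1" using kn n1 by linarith
  have fM: "norm (cf K y (dy (dy t)) - of_real (k^2) * cf K y t) \<le> M" if "y \<le> 0" for y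
  proof -
   have "complex_of_real (k^2) = (of_int (fst K))^2 + of_real (\<tau>^2) * (of_int (snd K))^2"
    unfolding k_def kn_sq by simp
   then have "cf K y (dy (dy t)) - of_real (k^2) * cf K y t = cf K y (lap \<tau> t)"
    unfolding lap_def cf_add cf_d by (simp add: power2_eq_square algebra_simps)
   then show ?thesis unfolding M_def using cn_ge[OF nn_lap[OF t(1)] that] by simp
  qed
  have v0: "cf K 0 t = 0" using t(2) lookup_z0[of t K] by simp
  have Bd: "norm (cf K y t) \<le> max (cn K t) (cn K (dy t))" "norm (cf K y (dy t)) \<le> max (cn K t) (cn K (dy t))" if "y \<le> 0" for y
   using cn_ge[OF t(1) that, of K] cn_ge[OF nn_d(3)[OF t(1)] that, of K] by auto
  note ob = ode_bound[where v = "\<lambda>y. cf K y t", OF _ cf_deriv cf_deriv v0 Bd fM y]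
  define a where "a = norm (cf K y t)"
  define b where "b = norm (cf K y (dy t))"
  have ob: "k^2 * a \<le> M" "k * b \<le> 2 * M" "norm (cf K y (dy (dy t))) \<le> 2 * M"
   using ob k1 unfolding a_def b_def by auto
  have a0: "a \<ge> 0" "b \<ge> 0" by (simp_all add: a_def b_def)
  have M0: "M \<ge> 0" using cn_nonneg[OF nn_lap[OF t(1)]] by (simp add: M_def)
  have p: "p * q * a \<le> 2 * M" if "0 \<le> p" "p \<le> k" "0 \<le> q" "q \<le> k" for p q
  proof -
   have "p * q * a \<le> k * k * a" using that a0 k1 by (intro mult_right_mono mult_mono) auto
   then show ?thesis using ob(1) M0 by (simp add: power2_eq_square)
  qed
  have q: "p * b \<le> 2 * M" if "0 \<le> p" "p \<le> k" for p
   using mult_right_mono[OF that(2) a0(2)] ob(2) by simp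
  define n m where "n = \<bar>real_of_int (fst K)\<bar>" and "m = \<bar>\<tau> * real_of_int (snd K)\<bar>"
  have nm: "0 \<le> n" "n \<le> k" "0 \<le> m" "m \<le> k" using kn by (simp_all add: n_def m_def)
  have nd: "norm (cf K y (d1 s)) = n * norm (cf K y s)" "norm (cf K y (d2 \<tau> s)) = m * norm (cf K y s)" for s
   by (simp_all add: cf_d norm_mult abs_mult n_def m_def)
  have ps: "a \<le> 2 * M" "n * a \<le> 2 * M" "m * a \<le> 2 * M" "b \<le> 2 * M" "n * b \<le> 2 * M" "m * b \<le> 2 * M"
   "n * (n * a) \<le> 2 * M" "n * (m * a) \<le> 2 * M" "m * (m * a) \<le> 2 * M"
   using nm p[of 1 1] p[of n 1] p[of m 1] p[of n n] p[of n m] p[of m m] q[of 1] q[of n] q[of m] k1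
   by (simp_all add: mult.assoc)
  have "norm (cf K y u) \<le> 2 * M"
   using u by (elim insertE emptyE; simp only: nd ps ob(3) a_def[symmetric] b_def[symmetric])
  then show "norm (cf K y u) \<le> 2 * cn K (lap \<tau> t)" by (simp add: M_def)
 qed
 also have "\<dots> = 2 * sn (lap \<tau> t)" using sn_superset[of ?S "lap \<tau> t"] kl by (simp add: sum_distrib_left image_mono)
 finally show ?thesis .
qed

text \<open>The recursion has finitely many coefficients h j, of sum H. For r \<le> 1 with r H \<le>
  1/2 the partial sums satisfy S P \<le> S (N + 1) + S P / 2 and hence are bounded. Nothing is asked
  of the initial terms up to N, so the radius depends on H only.\<close>

lemma rec_summable:
 fixes A h :: "nat \<Rightarrow> real"
 assumes A0: "\<And>p. 0 \<le> A p" and h0: "\<And>j. 0 \<le> h j" "\<And>j. j > J \<Longrightarrow> h j = 0"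
  and rec: "\<And>p. p > N \<Longrightarrow> A p \<le> (\<Sum>j=1..p. h j * A (p - j))"
 obtains r0 where "r0 > 0" "r0 \<le> 1" "\<And>r. 0 \<le> r \<Longrightarrow> r \<le> r0 \<Longrightarrow> summable (\<lambda>p. A p * r ^ p)"
proof -
 define H where "H = (\<Sum>j=1..J. h j)"
 have H0: "H \<ge> 0" using h0(1) by (simp add: H_def sum_nonneg)
 define r0 where "r0 = 1 / (2 * H + 1)"
 have r0: "r0 > 0" "r0 \<le> 1" "r0 * H \<le> 1 / 2" using H0 by (simp_all add: r0_def field_simps)
 have "summable (\<lambda>p. A p * r ^ p)" if r: "0 \<le> r" "r \<le> r0" for r
 proof -
  have r1: "r \<le> 1" using r r0 by simp
  define S where "S P = (\<Sum>p<P. A p * r ^ p)" for P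
  have "S P \<le> 2 * S (Suc N)" for P
  proof (cases "P \<le> Suc N")
   case True
   then have "S P \<le> S (Suc N)" unfolding S_def using A0 r by (intro sum_mono2) auto
   moreover have "S (Suc N) \<ge> 0" unfolding S_def using A0 r by (intro sum_nonneg) auto
   ultimately show ?thesis by simp
  next
   case False
   have eq: "{..<P} = {..<Suc N} \<union> {Suc N..<P}" using False by auto
   have "S P = S (Suc N) + (\<Sum>p=Suc N..<P. A p * r ^ p)" unfolding S_def eq by (rule sum.union_disjoint) auto
   also have "(\<Sum>p=Suc N..<P. A p * r ^ p) \<le> (\<Sum>p=Suc N..<P. \<Sum>j=1..p. h j * r ^ j * (A (p - j) * r ^ (p - j)))"
   proof (rule sum_mono)
    fix p assume "p \<in> {Suc N..<P}"
    then have "A p * r ^ p \<le> (\<Sum>j=1..p. h j * A (p - j)) * r ^ p" using rec[of p] r by (intro mult_right_mono) auto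
    also have "\<dots> = (\<Sum>j=1..p. h j * r ^ j * (A (p - j) * r ^ (p - j)))"
     unfolding sum_distrib_right by (intro sum.cong refl) (simp add: mult_ac flip: power_add)
    finally show "A p * r ^ p \<le> \<dots>" .
   qed
   also have "\<dots> \<le> (\<Sum>p<P. \<Sum>j=1..p. h j * r ^ j * (A (p - j) * r ^ (p - j)))"
    using A0 h0 r by (intro sum_mono2 sum_nonneg) auto
   also have "\<dots> = (\<Sum>(p, j)\<in>Sigma {..<P} (\<lambda>p. {1..p}). h j * r ^ j * (A (p - j) * r ^ (p - j)))"
    by (simp add: sum.Sigma)
   also have "\<dots> = (\<Sum>(j, q)\<in>{(j, q). 1 \<le> j \<and> j + q < P}. h j * r ^ j * (A q * r ^ q))"
    by (rule sum.reindex_bij_witness[of _ "\<lambda>(j, q). (j + q, j)" "\<lambda>(p, j). (j, p - j)"]) auto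
   also have "\<dots> \<le> (\<Sum>(j, q)\<in>{1..P} \<times> {..<P}. h j * r ^ j * (A q * r ^ q))"
    using A0 h0 r by (intro sum_mono2) auto
   also have "\<dots> = (\<Sum>j=1..P. h j * r ^ j) * S P"
    by (simp add: S_def sum_product sum.cartesian_product)
   also have "\<dots> \<le> (1 / 2) * S P"
   proof (rule mult_right_mono)
    have "(\<Sum>j=1..P. h j * r ^ j) \<le> (\<Sum>j=1..P. h j * r)"
    proof (intro sum_mono mult_left_mono h0)
     fix j assume "j \<in> {1..P}"
     then show "r ^ j \<le> r" using power_decreasing[of 1 j r] r r1 by simp
    qed
    also have "\<dots> \<le> (\<Sum>j\<in>{1..max P J}. h j * r)" using h0 r by (intro sum_mono2) auto
    also have "\<dots> = (\<Sum>j=1..J. h j * r)" by (rule sum.mono_neutral_right) (use h0 in auto)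
    also have "\<dots> = H * r" by (simp add: H_def sum_distrib_right)
    also have "\<dots> \<le> H * r0" using r H0 by (intro mult_left_mono)
    finally show "(\<Sum>j=1..P. h j * r ^ j) \<le> 1 / 2" using r0(3) by (simp add: mult.commute)
    show "0 \<le> S P" unfolding S_def using A0 r by (intro sum_nonneg) auto
   qed
   finally show ?thesis by simp
  qed
  then show ?thesis using A0 r unfolding S_def
   by (intro summableI_nonneg_bounded[where x = "2 * (\<Sum>p<Suc N. A p * r ^ p)"]) auto
 qed
 with r0 show ?thesis using that by blast
qed

section \<open>Uniqueness of the potential\<close>

lemma gradient_within_inner: "b \<in> Basis \<Longrightarrow> gradient_within f S x \<bullet> b = frechet_derivative f (at x within S) b"
 by (simp add: gradient_within_def inner_sum_left inner_Basis if_distrib[of "\<lambda>c. _ * c"] sum.delta cong: if_cong)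

lemma partial_eq: "b \<in> Basis \<Longrightarrow> partial b f x = frechet_derivative f (at x) b"
 by (simp add: partial_def gradient_within_inner)

lemma line_deriv:
 fixes f :: "'a::euclidean_space \<Rightarrow> real"
 assumes "f differentiable (at (P + t *\<^sub>R b))" "b \<in> Basis"
 shows "((\<lambda>t. f (P + t *\<^sub>R b)) has_real_derivative partial b f (P + t *\<^sub>R b)) (at t)"
proof -
 have f: "(f has_derivative frechet_derivative f (at (P + t *\<^sub>R b))) (at (P + t *\<^sub>R b))"
  using assms(1) frechet_derivative_works by blast
 have "((\<lambda>t. P + t *\<^sub>R b) has_derivative (\<lambda>h. h *\<^sub>R b)) (at t)" by (auto intro!: derivative_eq_intros)
 from has_derivative_compose[OF this f]
 have "((\<lambda>t. f (P + t *\<^sub>R b)) has_derivative (\<lambda>h. frechet_derivative f (at (P + t *\<^sub>R b)) (h *\<^sub>R b))) (at t)" .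
 then show ?thesis unfolding has_field_derivative_def partial_eq[OF assms(2)]
  by (rule has_derivative_eq_rhs) (auto simp: linear_scale[OF has_derivative_linear[OF f]])
qed

lemma second_derivative_at_max:
 fixes h h' :: "real \<Rightarrow> real"
 assumes r: "r > 0" and h: "\<And>t. \<bar>t\<bar> < r \<Longrightarrow> (h has_real_derivative h' t) (at t)" and c: "(h' has_real_derivative c) (at 0)"
  and m: "\<And>t. \<bar>t\<bar> < r \<Longrightarrow> h t \<le> h 0"
 shows "c \<le> 0"
proof (rule ccontr)
 assume "\<not> c \<le> 0"
 have h0: "h' 0 = 0" by (rule DERIV_local_max[OF h r]) (use r m in auto)
 obtain d where d: "d > 0" "\<And>x. x > 0 \<Longrightarrow> x < d \<Longrightarrow> h' 0 < h' x"
  using DERIV_pos_inc_right[OF c] \<open>\<not> c \<le> 0\<close> by auto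
 define t where "t = min d r / 2"
 have t: "0 < t" "t < d" "t < r" using d(1) r by (auto simp: t_def)
 obtain z where z: "0 < z" "z < t" "h t - h 0 = (t - 0) * h' z" using MVT2[OF t(1), of h h'] h t by auto
 have "h' z > 0" using d(2)[of z] z t h0 by simp
 then have "t * h' z > 0" using t by simp
 then have "h t > h 0" using z(3) by simp
 then show False using m[of t] t by simp
qed

lemma open_fluid: "continuous_on UNIV e \<Longrightarrow> open (fluid e)"
proof -
 assume e: "continuous_on UNIV e"
 have "continuous_on UNIV (\<lambda>x :: plane \<times> real. e (fst x))" by (rule continuous_on_compose2[OF e]) (auto intro: continuous_intros)
 then show ?thesis unfolding fluid_def case_prod_beta by (intro open_Collect_less continuous_intros)
qed

text \<open>n and m are sum and difference of the two integer coordinates, hence of equal parity;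
  conversely equal parity allows to recover them.\<close>

lemma wave_lattice_iff: "K \<in> wave_lattice \<tau> \<longleftrightarrow> (\<exists>n m :: int. even (n + m) \<and> K = (of_int n, \<tau> * of_int m))"
proof
 assume "K \<in> wave_lattice \<tau>"
 then obtain a b :: int where "K = of_int a *\<^sub>R (1, \<tau>) + of_int b *\<^sub>R (1, - \<tau>)" by (auto simp: wave_lattice_def)
 then have "even ((a + b) + (a - b)) \<and> K = (of_int (a + b), \<tau> * of_int (a - b))" by (auto simp: algebra_simps)
 then show "\<exists>n m :: int. even (n + m) \<and> K = (of_int n, \<tau> * of_int m)" by blast
next
 assume "\<exists>n m :: int. even (n + m) \<and> K = (of_int n, \<tau> * of_int m)"
 then obtain n m :: int where nm: "even (n + m)" "K = (of_int n, \<tau> * of_int m)" by blast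
 from nm(1) obtain a where a: "n + m = 2 * a" by (rule evenE)
 then have "n = a + (a - m)" "m = a - (a - m)" by simp_all
 then have "K = of_int a *\<^sub>R (1, \<tau>) + of_int (a - m) *\<^sub>R (1, - \<tau>)"
  unfolding nm(2) using a by (auto simp: algebra_simps simp flip: of_int_add)
 then show "K \<in> wave_lattice \<tau>" unfolding wave_lattice_def by blast
qed

text \<open>The multiples of 2\<pi> and of 2\<pi>/\<tau> are a sublattice of the periods with
  rectangular cell, so that suprema over the plane become suprema over a compact box.\<close>

lemma shift_to_box:
 assumes "\<tau> > 0"
 obtains l where "l \<in> period_lattice \<tau>" "X + l \<in> cbox (0, 0) (2 * pi, 2 * pi / \<tau>)"
proof -
 define i where "i = - \<lfloor>fst X / (2 * pi)\<rfloor>"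
 define j where "j = - \<lfloor>snd X / (2 * pi / \<tau>)\<rfloor>"
 define l where "l = (2 * pi * of_int i, 2 * pi / \<tau> * of_int j)"
 have "l \<in> period_lattice \<tau>"
 proof -
  have "\<exists>k::int. l \<bullet> K = 2 * pi * of_int k" if "K \<in> wave_lattice \<tau>" for K
  proof -
   obtain n m where "K = (of_int n, \<tau> * of_int m)" using \<open>K \<in> wave_lattice \<tau>\<close> wave_lattice_iff by blast
   then have "l \<bullet> K = 2 * pi * of_int (i * n + j * m)" using assms by (simp add: l_def field_simps)
   then show ?thesis by blast
  qed
  then show ?thesis by (auto simp: period_lattice_def)
 qed
 moreover have box: "0 \<le> x + w * of_int (- \<lfloor>x / w\<rfloor>) \<and> x + w * of_int (- \<lfloor>x / w\<rfloor>) \<le> w" if "w > 0" for x w :: real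
 proof -
  have "w * of_int \<lfloor>x / w\<rfloor> \<le> w * (x / w)" "w * (x / w) \<le> w * (of_int \<lfloor>x / w\<rfloor> + 1)"
   using that by (intro mult_left_mono; linarith)+
  moreover have "w * (x / w) = x" using that by simp
  ultimately have "w * of_int \<lfloor>x / w\<rfloor> \<le> x" "x \<le> w * (of_int \<lfloor>x / w\<rfloor> + 1)" by argo+
  then show ?thesis by (simp add: algebra_simps)
 qed
 have "X + l \<in> cbox (0, 0) (2 * pi, 2 * pi / \<tau>)"
  using box[of "2 * pi" "fst X"] box[of "2 * pi / \<tau>" "snd X"] assms
  by (auto simp: cbox_Pair_eq l_def i_def j_def mem_Times_iff simp del: of_int_minus)
 ultimately show ?thesis using that by blast
qed

context
 fixes \<tau> :: real and e :: "plane \<Rightarrow> real" and \<psi> :: "plane \<Rightarrow> real"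
 assumes \<tau>: "\<tau> > 0" and e: "continuous_on UNIV e" "periodic \<tau> e"
begin

lemma potential_line_deriv:
 assumes "is_potential \<tau> e \<psi> f" "P + t *\<^sub>R b \<in> fluid e" "b \<in> Basis"
 shows "((\<lambda>t. f (P + t *\<^sub>R b)) has_real_derivative partial b f (P + t *\<^sub>R b)) (at t)"
  "((\<lambda>t. partial b f (P + t *\<^sub>R b)) has_real_derivative partial b (partial b f) (P + t *\<^sub>R b)) (at t)"
proof -
 have dd: "f differentiable (at Q)" "partial b f differentiable (at Q)" if "Q \<in> fluid e" for Q
  using assms(1,3) that at_within_open[OF that open_fluid[OF e(1)]]
  unfolding is_potential_def harmonic_on_def C1_on_def differentiable_on_def by metis+
 show "((\<lambda>t. f (P + t *\<^sub>R b)) has_real_derivative partial b f (P + t *\<^sub>R b)) (at t)"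
  "((\<lambda>t. partial b f (P + t *\<^sub>R b)) has_real_derivative partial b (partial b f) (P + t *\<^sub>R b)) (at t)"
  by (rule line_deriv[OF dd(1)[OF assms(2)] assms(3)] line_deriv[OF dd(2)[OF assms(2)] assms(3)])+
qed

lemma potential_vertical_small:
 assumes "is_potential \<tau> e \<psi> f" "\<delta> > 0"
 shows "\<forall>\<^sub>F z in at_bot. \<forall>X. \<bar>partial (0, 1) f (X, z)\<bar> < \<delta>"
proof -
 have "\<forall>\<^sub>F z in at_bot. \<forall>X. dist (gradient f (X, z)) 0 < \<delta>"
  using assms unfolding is_potential_def uniform_limit_iff by auto
 then show ?thesis
 proof eventually_elim
  case (elim z)
  show ?case
  proof
   fix X
   have "\<bar>gradient f (X, z) \<bullet> (0, 1)\<bar> \<le> norm (gradient f (X, z)) * norm (0 :: plane, 1 :: real)" by (rule Cauchy_Schwarz_ineq2)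
   also have "norm (0 :: plane, 1 :: real) = 1" by (simp add: norm_Pair)
   finally show "\<bar>partial (0, 1) f (X, z)\<bar> < \<delta>" unfolding partial_def using elim by (smt (verit) dist_0_norm dist_commute mult.right_neutral)
  qed
 qed
qed

text \<open>Maximum principle in an unbounded domain. The difference d may attain its maximum inside
  or escape to infinite depth; both are prevented by adding \<delta> (z + exp z). The exponential
  makes the sum strictly subharmonic, and the linear part beats d at depth, where d grows at rate at
  most \<delta>/2 since both gradients tend to 0.\<close>

lemma potential_le:
 assumes f: "is_potential \<tau> e \<psi> f" and g: "is_potential \<tau> e \<psi> g" and h0: "h0 \<le> e Y0"
 shows "f (Y0, h0) \<le> g (Y0, h0)"
proof (rule ccontr)
 assume neg: "\<not> ?thesis"
 define d where "d P = f P - g P" for P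
 have dper: "d (X + l, z) = d (X, z)" if "z \<le> e X" "l \<in> period_lattice \<tau>" for X l z
 proof -
  have c: "(X, z) \<in> closed_fluid e" using that(1) by (simp add: closed_fluid_def)
  show ?thesis
   using bspec[OF bspec[OF conjunct1[OF f[unfolded is_potential_def]] that(2)] c]
    bspec[OF bspec[OF conjunct1[OF g[unfolded is_potential_def]] that(2)] c] by (simp add: d_def)
 qed
 have eper: "e (X + l) = e X" if "l \<in> period_lattice \<tau>" for X l using e(2) that unfolding periodic_def by blast
 have db: "d (X, e X) = 0" for X using f g by (simp add: d_def is_potential_def del: split_paired_All)
 have dc: "continuous_on (closed_fluid e) d"
  unfolding d_def using f g by (intro continuous_on_diff) (auto simp: is_potential_def C1_on_def differentiable_imp_continuous_on)
 let ?box = "cbox (0, 0) (2 * pi, 2 * pi / \<tau>)"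
 obtain E where E: "\<And>X. \<bar>e X\<bar> \<le> E"
 proof -
  have "compact (e ` ?box)" by (intro compact_continuous_image compact_cbox continuous_on_subset[OF e(1)]) auto
  then obtain E where "\<forall>x\<in>e ` ?box. norm x \<le> E" using compact_imp_bounded bounded_iff by metis
  then have E: "\<bar>e X\<bar> \<le> E" if "X \<in> ?box" for X using imageI[OF that, of e] unfolding real_norm_def by blast
  have "\<bar>e X\<bar> \<le> E" for X
  proof -
   obtain l where "l \<in> period_lattice \<tau>" "X + l \<in> ?box" by (rule shift_to_box[OF \<tau>])
   then show ?thesis using E[of "X + l"] eper by simp
  qed
  then show ?thesis using that by blast
 qed
 define a where "a = d (Y0, h0)"
 have a: "a > 0" using neg by (simp add: a_def d_def)
 define q where "q z = z + exp z" for z :: real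
 have qmono: "q x \<le> q y" if "x \<le> y" for x y using that by (simp add: q_def add_mono)
 \<comment> \<open>So small that G at (Y0, h0) still exceeds \<delta> q E, an upper bound for G on
   the surface, where d vanishes.\<close>
 define \<delta> where "\<delta> = a / (1 + \<bar>q E - q h0\<bar>)"
 have \<delta>: "\<delta> > 0" "\<delta> * (q E - q h0) < a"
 proof -
  show "\<delta> > 0" using a by (simp add: \<delta>_def add_pos_nonneg)
  have "\<delta> * (q E - q h0) \<le> \<delta> * \<bar>q E - q h0\<bar>" using \<open>\<delta> > 0\<close> by (intro mult_left_mono) auto
  also have "\<dots> < a" using a by (simp add: \<delta>_def field_simps add_pos_nonneg)
  finally show "\<delta> * (q E - q h0) < a" .
 qed
 define G where "G P = d P + \<delta> * q (snd P)" for P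
 have G0: "G (Y0, h0) > \<delta> * q E" using \<delta>(2) by (simp add: G_def a_def algebra_simps)
 have "\<forall>\<^sub>F z in at_bot. (\<forall>X. \<bar>partial (0, 1) f (X, z)\<bar> < \<delta> / 4) \<and> (\<forall>X. \<bar>partial (0, 1) g (X, z)\<bar> < \<delta> / 4) \<and> z < - E"
  using potential_vertical_small[OF f, of "\<delta> / 4"] potential_vertical_small[OF g, of "\<delta> / 4"] eventually_gt_at_bot[of "- E"] \<delta>(1)
  by (auto simp: eventually_conj_iff)
 then obtain z1 where z1: "\<And>z X. z \<le> z1 \<Longrightarrow> \<bar>partial (0, 1) f (X, z)\<bar> < \<delta> / 4"
  "\<And>z X. z \<le> z1 \<Longrightarrow> \<bar>partial (0, 1) g (X, z)\<bar> < \<delta> / 4" "\<And>z. z \<le> z1 \<Longrightarrow> z < - E"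
  unfolding eventually_at_bot_linorder by blast
 have below: "(X, z) \<in> fluid e" if "z \<le> z1" for X z using z1(3)[OF that] E[of X] by (simp add: fluid_def abs_le_iff)
 obtain D where D: "\<And>X. d (X, z1) \<le> D"
 proof -
  have "(\<lambda>X. (X, z1)) ` ?box \<subseteq> closed_fluid e" using below[OF order_refl] by (auto simp: fluid_def closed_fluid_def less_imp_le)
  then have "compact ((\<lambda>X. d (X, z1)) ` ?box)"
   by (intro compact_continuous_image compact_cbox continuous_on_compose2[OF dc]) (auto intro!: continuous_intros)
  then obtain D where "\<forall>x\<in>(\<lambda>X. d (X, z1)) ` ?box. norm x \<le> D" using compact_imp_bounded bounded_iff by metis
  then have D: "\<bar>d (X, z1)\<bar> \<le> D" if "X \<in> ?box" for X using imageI[OF that, of "\<lambda>X. d (X, z1)"] unfolding real_norm_def by blast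
  have "d (X, z1) \<le> D" for X
  proof -
   obtain l where l: "l \<in> period_lattice \<tau>" "X + l \<in> ?box" by (rule shift_to_box[OF \<tau>])
   have "z1 \<le> e X" using below[of z1 X] by (simp add: fluid_def)
   then show ?thesis using D[OF l(2)] dper[OF _ l(1), of z1 X] by simp
  qed
  then show ?thesis using that by blast
 qed
 have deep: "d (X, z) \<le> D + \<delta> / 2 * (z1 - z)" if z: "z < z1" for X z
 proof -
  have b: "(0 :: plane, 1 :: real) \<in> Basis" by (simp add: Basis_prod_def)
  define p where "p s = partial (0, 1) f (X, s) - partial (0, 1) g (X, s)" for s
  have "((\<lambda>s. d (X, s)) has_real_derivative p s) (at s)" if "s \<le> z1" for s
   using potential_line_deriv(1)[OF f, of "(X, 0)" s "(0, 1)"] potential_line_deriv(1)[OF g, of "(X, 0)" s "(0, 1)"] below[OF that, of X] b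
   unfolding d_def p_def by (auto intro!: DERIV_diff)
  then obtain s where s: "z < s" "s < z1" "d (X, z1) - d (X, z) = (z1 - z) * p s"
   using MVT2[OF z, of "\<lambda>s. d (X, s)" p] by auto
  have "\<bar>p s\<bar> \<le> \<delta> / 2" using z1(1)[of s X] z1(2)[of s X] s(2) unfolding p_def by linarith
  then have "(z1 - z) * (- (\<delta> / 2)) \<le> (z1 - z) * p s" using z by (intro mult_left_mono) auto
  then show ?thesis using s(3) D[of X] by (simp add: algebra_simps)
 qed
 \<comment> \<open>A bottom so deep that G lies below its value at (Y0, h0): downwards d gains at
   most \<delta>/2 per unit while \<delta> z loses \<delta>.\<close>
 define zL where "zL = min (min (z1 - 1) 0) (min (h0 - 1) (2 * (G (Y0, h0) - D - \<delta> / 2 * z1 - \<delta>) / \<delta> - 1))"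
 have zL: "zL < z1" "zL \<le> 0" "zL < h0" by (simp_all add: zL_def)
 have GL: "G (X, zL) < G (Y0, h0)" for X
 proof -
  have "zL < 2 * (G (Y0, h0) - D - \<delta> / 2 * z1 - \<delta>) / \<delta>" unfolding zL_def by linarith
  then have "\<delta> / 2 * zL < G (Y0, h0) - D - \<delta> / 2 * z1 - \<delta>" using \<delta>(1) by (simp add: field_simps)
  moreover have "G (X, zL) \<le> D + \<delta> / 2 * (z1 - zL) + \<delta> * (zL + 1)"
  proof -
   have "q zL \<le> zL + 1" using zL(2) by (simp add: q_def)
   then have "\<delta> * q zL \<le> \<delta> * (zL + 1)" using \<delta>(1) by (intro mult_left_mono) auto
   then show ?thesis using deep[OF zL(1), of X] by (simp add: G_def)
  qed
  ultimately show ?thesis by (simp add: algebra_simps diff_divide_distrib)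
 qed
 define C where "C = {P. fst P \<in> ?box \<and> zL \<le> snd P \<and> snd P \<le> e (fst P)}"
 have Cc: "compact C"
 proof -
  have ec: "continuous_on UNIV (\<lambda>x :: plane \<times> real. e (fst x))" by (rule continuous_on_compose2[OF e(1)]) (auto intro: continuous_intros)
  have "closed {P :: plane \<times> real. zL \<le> snd P \<and> snd P \<le> e (fst P)}"
   by (intro closed_Collect_conj closed_Collect_le continuous_intros ec)
  moreover have "C = (?box \<times> {zL..E}) \<inter> {P. zL \<le> snd P \<and> snd P \<le> e (fst P)}"
   using E by (auto simp: C_def abs_le_iff mem_Times_iff) (meson order_trans)
  ultimately show ?thesis by (simp add: compact_Int_closed compact_Times compact_cbox)
 qed
 obtain l0 where l0: "l0 \<in> period_lattice \<tau>" "Y0 + l0 \<in> ?box" by (rule shift_to_box[OF \<tau>])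
 have P0C: "(Y0 + l0, h0) \<in> C" using l0 h0 zL eper[OF l0(1)] by (simp add: C_def)
 have Gc: "continuous_on C G"
  unfolding G_def q_def by (intro continuous_intros continuous_on_subset[OF dc]) (auto simp: C_def closed_fluid_def)
 obtain Pm where Pm: "Pm \<in> C" "\<And>P. P \<in> C \<Longrightarrow> G P \<le> G Pm"
  using continuous_attains_sup[OF Cc _ Gc] P0C by blast
 have Gm: "G Pm \<ge> G (Y0, h0)" using Pm(2)[OF P0C] dper[OF h0 l0(1)] by (simp add: G_def)
 obtain Xm zm where PmX: "Pm = (Xm, zm)" by (cases Pm)
 have zme: "zm < e Xm"
 proof (rule ccontr)
  assume "\<not> zm < e Xm"
  then have "zm = e Xm" using Pm(1) by (simp add: C_def PmX)
  then have "G Pm = \<delta> * q (e Xm)" by (simp add: G_def PmX db)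
  also have "\<dots> \<le> \<delta> * q E" using \<delta>(1) E[of Xm] by (intro mult_left_mono qmono) auto
  finally show False using Gm G0 by simp
 qed
 have zmL: "zL < zm" using Pm(1) GL[of Xm] Gm by (cases "zm = zL") (auto simp: C_def PmX)
 have Gmax: "G P \<le> G Pm" if "P \<in> fluid e \<inter> {P. zL < snd P}" for P
 proof -
  obtain X z where P: "P = (X, z)" by (cases P)
  obtain l where l: "l \<in> period_lattice \<tau>" "X + l \<in> ?box" by (rule shift_to_box[OF \<tau>])
  have z: "z < e X" "zL < z" using that by (auto simp: P fluid_def)
  have "(X + l, z) \<in> C" using l z eper[OF l(1)] by (simp add: C_def)
  then have "G (X + l, z) \<le> G Pm" by (rule Pm)
  then show ?thesis using dper[OF _ l(1), of z X] z by (simp add: G_def P)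
 qed
 have "open (fluid e \<inter> {P. zL < snd P})" by (intro open_Int open_fluid[OF e(1)] open_Collect_less continuous_intros)
 moreover have "Pm \<in> fluid e \<inter> {P. zL < snd P}" using zme zmL by (simp add: PmX fluid_def)
 ultimately obtain r where r: "r > 0" "ball Pm r \<subseteq> fluid e \<inter> {P. zL < snd P}" by (meson openE)
 \<comment> \<open>G has an interior maximum at Pm, so its pure second derivatives are nonpositive
   there; their sum, however, is the positive contribution of the exponential alone.\<close>
 have second: "partial b (partial b f) Pm - partial b (partial b g) Pm + \<delta> * exp zm * (snd b)^2 \<le> 0" if b: "b \<in> Basis" for b
 proof (rule second_derivative_at_max[OF r(1), where h = "\<lambda>t. G (Pm + t *\<^sub>R b)"
    and h' = "\<lambda>t. partial b f (Pm + t *\<^sub>R b) - partial b g (Pm + t *\<^sub>R b) + \<delta> * (snd b * (1 + exp (zm + t * snd b)))"])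
  have in_ball: "Pm + t *\<^sub>R b \<in> ball Pm r" if "\<bar>t\<bar> < r" for t using that norm_Basis[OF b] by (simp add: dist_norm)
  then have fl: "Pm + t *\<^sub>R b \<in> fluid e" if "\<bar>t\<bar> < r" for t using r(2) that by blast
  show "G (Pm + t *\<^sub>R b) \<le> G (Pm + 0 *\<^sub>R b)" if "\<bar>t\<bar> < r" for t
   using Gmax[OF subsetD[OF r(2) in_ball[OF that]]] by simp
  show "((\<lambda>t. G (Pm + t *\<^sub>R b)) has_real_derivative partial b f (Pm + t *\<^sub>R b) - partial b g (Pm + t *\<^sub>R b) + \<delta> * (snd b * (1 + exp (zm + t * snd b)))) (at t)"
   if "\<bar>t\<bar> < r" for t
  proof -
   have eq: "(\<lambda>t. G (Pm + t *\<^sub>R b)) = (\<lambda>t. f (Pm + t *\<^sub>R b) - g (Pm + t *\<^sub>R b) + \<delta> * ((zm + t * snd b) + exp (zm + t * snd b)))"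
    by (simp add: fun_eq_iff G_def d_def q_def PmX)
   have "((\<lambda>t. \<delta> * ((zm + t * snd b) + exp (zm + t * snd b))) has_real_derivative \<delta> * (snd b * (1 + exp (zm + t * snd b)))) (at t)"
    by (auto intro!: derivative_eq_intros simp: algebra_simps)
   then show ?thesis unfolding eq
    by (intro DERIV_add DERIV_diff potential_line_deriv(1)[OF f fl[OF that] b] potential_line_deriv(1)[OF g fl[OF that] b])
  qed
  have z: "\<bar>0::real\<bar> < r" using r by simp
  show "((\<lambda>t. partial b f (Pm + t *\<^sub>R b) - partial b g (Pm + t *\<^sub>R b) + \<delta> * (snd b * (1 + exp (zm + t * snd b))))
   has_real_derivative partial b (partial b f) Pm - partial b (partial b g) Pm + \<delta> * exp zm * (snd b)^2) (at 0)"
  proof -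
   have "((\<lambda>t. \<delta> * (snd b * (1 + exp (zm + t * snd b)))) has_real_derivative \<delta> * exp zm * (snd b)^2) (at 0)"
    by (auto intro!: derivative_eq_intros simp: power2_eq_square)
   from DERIV_add[OF DERIV_diff[OF potential_line_deriv(2)[OF f fl[OF z] b] potential_line_deriv(2)[OF g fl[OF z] b]] this]
   show ?thesis by simp
  qed
 qed
 have Pmf: "Pm \<in> fluid e" using zme by (simp add: PmX fluid_def)
 have hz: "(\<Sum>b\<in>Basis. partial b (partial b f) Pm) = 0" "(\<Sum>b\<in>Basis. partial b (partial b g) Pm) = 0"
  using f g Pmf unfolding is_potential_def harmonic_on_def by blast+
 have "0 \<ge> (\<Sum>b\<in>Basis. partial b (partial b f) Pm - partial b (partial b g) Pm + \<delta> * exp zm * (snd b)^2)"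
  by (rule sum_nonpos) (rule second)
 also have "(\<Sum>b\<in>Basis. partial b (partial b f) Pm - partial b (partial b g) Pm + \<delta> * exp zm * (snd b)^2)
  = \<delta> * exp zm * (\<Sum>b\<in>(Basis :: (plane \<times> real) set). (snd b)\<^sup>2)"
  by (simp add: sum.distrib sum_subtractf hz sum_distrib_left)
 finally have "\<delta> * exp zm * (\<Sum>b\<in>(Basis :: (plane \<times> real) set). (snd b)\<^sup>2) \<le> 0" .
 moreover have "(\<Sum>b\<in>{(0 :: plane, 1 :: real)}. (snd b)\<^sup>2) \<le> (\<Sum>b\<in>(Basis :: (plane \<times> real) set). (snd b)\<^sup>2)"
  by (rule sum_mono2) (auto simp: Basis_prod_def)
 moreover have "0 < \<delta> * exp zm" using \<delta>(1) by simp
 ultimately show False using \<delta>(1) by (simp add: mult_le_0_iff)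
qed

lemma potential_unique:
 "is_potential \<tau> e \<psi> f \<Longrightarrow> is_potential \<tau> e \<psi> g \<Longrightarrow> P \<in> closed_fluid e \<Longrightarrow> f P = g P"
 using potential_le[of f g] potential_le[of g f] by (cases P) (auto simp: closed_fluid_def intro: antisym)

end

section \<open>One-sided derivatives at the surface\<close>

lemma has_derivative_within_direction:
 fixes f :: "'a::real_normed_vector \<Rightarrow> real"
 assumes f: "(f has_derivative f') (at x within S)" "(f has_derivative f'') (at x within S)"
  and t: "t0 > 0" "\<And>t. 0 \<le> t \<Longrightarrow> t \<le> t0 \<Longrightarrow> x + t *\<^sub>R d \<in> S"
 shows "f' d = f'' d"
proof -
 have sub: "(\<lambda>t. x + t *\<^sub>R d) ` {0..t0} \<subseteq> S" using t by auto
 have "((\<lambda>t. f (x + t *\<^sub>R d)) has_vector_derivative D d) (at 0 within {0..t0})" if D: "(f has_derivative D) (at x within S)" for D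
 proof -
  have l: "((\<lambda>t. x + t *\<^sub>R d) has_derivative (\<lambda>h. h *\<^sub>R d)) (at 0 within {0..t0})" by (auto intro!: derivative_eq_intros)
  have "(f has_derivative D) (at (x + 0 *\<^sub>R d) within (\<lambda>t. x + t *\<^sub>R d) ` {0..t0})"
   using has_derivative_subset[OF D sub] by simp
  from has_derivative_in_compose[OF l this] show ?thesis
   unfolding has_vector_derivative_def by (rule has_derivative_eq_rhs) (auto simp: linear_scale[OF has_derivative_linear[OF D]])
 qed
 from this[OF f(1)] this[OF f(2)] show ?thesis
  by (rule vector_derivative_unique_within_closed_interval[of 0 t0 0, unfolded cbox_interval, rotated 2]) (use t in auto)
qed

text \<open>At a surface point only directions into the fluid are available, but they span the
  space: besides the downward vertical, each horizontal h can be followed along (h, -M) as soon as M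
  exceeds the slope of the surface along h.\<close>

lemma derivative_unique_closed_fluid:
 fixes f :: "plane \<times> real \<Rightarrow> real"
 assumes e: "e differentiable (at X)" and z: "z \<le> e X" and f: "(f has_derivative f') (at (X, z) within closed_fluid e)" "(f has_derivative f'') (at (X, z) within closed_fluid e)"
 shows "f' = f''"
proof
 fix d :: "plane \<times> real"
 obtain h k where d: "d = (h, k)" by (cases d)
 obtain D where D: "(e has_derivative D) (at X)" using e by (auto simp: differentiable_def)
 define M where "M = \<bar>D h\<bar> + 1"
 have line: "((\<lambda>t. e (X + t *\<^sub>R h) + M * t) has_real_derivative D h + M) (at 0)"
 proof -
  have "((\<lambda>t. X + t *\<^sub>R h) has_derivative (\<lambda>s. s *\<^sub>R h)) (at 0)" by (auto intro!: derivative_eq_intros)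
  from has_derivative_compose[OF this, of e D] D
  have "((\<lambda>t. e (X + t *\<^sub>R h)) has_real_derivative D h) (at 0)"
   unfolding has_field_derivative_def
   by (auto simp: linear_scale[OF has_derivative_linear[OF D]] mult.commute elim!: has_derivative_eq_rhs)
  then show ?thesis by (auto intro!: derivative_eq_intros)
 qed
 have "D h + M > 0" unfolding M_def by linarith
 then obtain t1 where t1: "t1 > 0" "\<And>t. t > 0 \<Longrightarrow> t < t1 \<Longrightarrow> e X < e (X + t *\<^sub>R h) + M * t"
  using DERIV_pos_inc_right[OF line] by auto
 have "f' (h, - M) = f'' (h, - M)"
 proof (rule has_derivative_within_direction[OF f, of "t1 / 2"])
  show "(X, z) + t *\<^sub>R (h, - M) \<in> closed_fluid e" if "0 \<le> t" "t \<le> t1 / 2" for t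
   using t1(2)[of t] that t1(1) z by (cases "t = 0") (auto simp: closed_fluid_def mult.commute)
 qed (use t1 in simp)
 moreover have "f' (0, - 1) = f'' (0, - 1)"
  by (rule has_derivative_within_direction[OF f, of 1]) (use z in \<open>auto simp: closed_fluid_def\<close>)
 moreover have "d = (h, - M) + (- (k + M)) *\<^sub>R (0, - 1)" by (simp add: d)
 ultimately show "f' d = f'' d"
  using has_derivative_linear[OF f(1)] has_derivative_linear[OF f(2)] by (simp only: linear_add linear_scale)
qed

text \<open>The choice made by SOME does not matter: the potential is unique on the closed fluid,
  and so is its one-sided derivative at the surface. Any explicit potential V may therefore be
  used.\<close>

lemma dirichlet_neumann_eq:
 assumes \<tau>: "\<tau> > 0" and e: "continuous_on UNIV e" "periodic \<tau> e" "e differentiable (at X)"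
  and V: "is_potential \<tau> e \<psi> V" and D: "(V has_derivative D) (at (X, e X) within closed_fluid e)"
 shows "dirichlet_neumann \<tau> e \<psi> X = D (0, 1) - gradient e X \<bullet> (D ((1, 0), 0), D ((0, 1), 0))"
proof -
 let ?p = "potential \<tau> e \<psi>"
 have p: "is_potential \<tau> e \<psi> ?p" unfolding potential_def by (rule someI[of _ V]) (rule V)
 have eq: "?p P = V P" if "P \<in> closed_fluid e" for P by (rule potential_unique[OF \<tau> e(1,2) p V that])
 have m: "(X, e X) \<in> closed_fluid e" by (simp add: closed_fluid_def)
 have pD: "(?p has_derivative D) (at (X, e X) within closed_fluid e)"
  by (rule has_derivative_transform[OF m eq D])
 have fD: "frechet_derivative ?p (at (X, e X) within closed_fluid e) = D"
  using derivative_unique_closed_fluid[OF e(3) order_refl _ pD] pD frechet_derivative_works differentiable_def by blast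
 define g where "g = gradient_within ?p (closed_fluid e) (X, e X)"
 have b: "((1, 0), 0) \<in> (Basis :: (plane \<times> real) set)" "((0, 1), 0) \<in> (Basis :: (plane \<times> real) set)" "(0, 1) \<in> (Basis :: (plane \<times> real) set)"
  by (auto simp: Basis_prod_def)
 have "g \<bullet> ((1, 0), 0) = D ((1, 0), 0)" "g \<bullet> ((0, 1), 0) = D ((0, 1), 0)" "g \<bullet> (0, 1) = D (0, 1)"
  using b by (simp_all only: g_def gradient_within_inner fD)
 then have "snd g = D (0, 1)" "fst g = (D ((1, 0), 0), D ((0, 1), 0))" by (auto simp: inner_prod_def prod_eq_iff)
 then show ?thesis unfolding dirichlet_neumann_def Let_def g_def[symmetric] by simp
qed

section \<open>Evaluation of the series\<close>

text \<open>\<open>chi\<close> is a character of the additive group of keys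
  (\<open>chi_add\<close>), so products of exponential polynomials evaluate to products of
  functions.\<close>

definition phase :: "real \<Rightarrow> key \<Rightarrow> plane \<times> real \<Rightarrow> complex" where
 "phase \<tau> k P = \<i> * of_real (of_int (fst (fst k)) * fst (fst P) + \<tau> * of_int (snd (fst k)) * snd (fst P)) + of_real (snd k * snd P)"
definition chi :: "real \<Rightarrow> plane \<times> real \<Rightarrow> key \<Rightarrow> complex" where "chi \<tau> P k = exp (phase \<tau> k P)"
definition rt :: "real \<Rightarrow> wpoly \<Rightarrow> plane \<times> real \<Rightarrow> real" where "rt \<tau> t P = Re (ev (chi \<tau> P) t)"

lemma chi_add: "chi \<tau> P (k + l) = chi \<tau> P k * chi \<tau> P l"
 by (simp add: chi_def phase_def flip: exp_add) (simp add: algebra_simps)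

lemma norm_chi: "norm (chi \<tau> P k) = exp (snd k * snd P)"
 by (simp add: chi_def phase_def norm_exp_eq_Re)

lemma ev_rho: "ev (chi \<tau> P) (rho t) = cnj (ev (chi \<tau> P) t)"
proof (induction t rule: poly_mapping_induct)
 case (single k c)
 have "chi \<tau> P ((- fst (fst k), - snd (fst k)), snd k) = cnj (chi \<tau> P k)"
  by (simp add: chi_def phase_def exp_cnj algebra_simps)
 then show ?case by (simp add: rho_def split_beta)
next
 case (add a b)
 then show ?case by (simp add: sg_add ev_add)
qed

lemma ev_real: "rho t = t \<Longrightarrow> ev (chi \<tau> P) t = of_real (rt \<tau> t P)"
 using ev_rho[of \<tau> P t] by (simp add: rt_def complex_eq_iff)

lemma rt_add: "rt \<tau> (a + b) P = rt \<tau> a P + rt \<tau> b P" by (simp add: rt_def ev_add)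
lemma rt_0 [simp]: "rt \<tau> 0 P = 0" by (simp add: rt_def)
lemma rt_uminus: "rt \<tau> (- a) P = - rt \<tau> a P" by (simp add: rt_def ev_uminus)
lemma rt_sum: "rt \<tau> (sum f A) P = (\<Sum>i\<in>A. rt \<tau> (f i) P)" by (simp add: rt_def ev_sum)
lemma rt_mult: "rho a = a \<Longrightarrow> rho b = b \<Longrightarrow> rt \<tau> (a * b) P = rt \<tau> a P * rt \<tau> b P"
 using ev_real[of a \<tau> P] ev_real[of b \<tau> P] ev_mult[of "chi \<tau> P" a b, OF chi_add] by (simp add: rt_def[of \<tau> "a * b"])
lemma rt_cst: "rt \<tau> (cst (of_real c)) P = c"
 by (simp add: rt_def chi_def phase_def)

lemma ev_chi_cf:
 "ev (chi \<tau> P) t = (\<Sum>K\<in>fst ` supp t. chi \<tau> (fst P, 0) (K, 0) * cf K (snd P) t)"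
proof -
 have chi: "chi \<tau> P k = chi \<tau> (fst P, 0) (fst k, 0) * of_real (exp (snd k * snd P))" for k
  by (simp add: chi_def phase_def exp_add flip: exp_of_real)
 have "(\<Sum>K\<in>fst ` supp t. chi \<tau> (fst P, 0) (K, 0) * cf K (snd P) t)
  = (\<Sum>K\<in>fst ` supp t. \<Sum>k\<in>supp t. if fst k = K then lk t k * chi \<tau> P k else 0)"
  unfolding cf_def lsum_def sum_distrib_left by (intro sum.cong refl) (auto simp: chi)
 also have "\<dots> = ev (chi \<tau> P) t" unfolding ev_def lsum_def by (subst sum.swap) (auto intro!: sum.cong simp: sum.delta')
 finally show ?thesis by simp
qed

lemma abs_rt_le: "nn t \<Longrightarrow> snd P \<le> 0 \<Longrightarrow> \<bar>rt \<tau> t P\<bar> \<le> sn t"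
proof -
 assume t: "nn t" "snd P \<le> 0"
 have "\<bar>rt \<tau> t P\<bar> \<le> norm (ev (chi \<tau> P) t)" unfolding rt_def by (rule abs_Re_le_cmod)
 also have "\<dots> \<le> sn t" unfolding ev_chi_cf sn_def
  by (rule sum_norm_le) (use t in \<open>auto simp: norm_mult norm_chi intro!: cn_ge\<close>)
 finally show ?thesis .
qed

lemma abs_rt_le_n1:
 assumes "\<And>k. k \<in> supp t \<Longrightarrow> snd k \<ge> 1" "snd P \<le> 0"
 shows "\<bar>rt \<tau> t P\<bar> \<le> n1 t * exp (snd P)"
proof -
 have "\<bar>rt \<tau> t P\<bar> \<le> norm (ev (chi \<tau> P) t)" unfolding rt_def by (rule abs_Re_le_cmod)
 also have "\<dots> \<le> (\<Sum>k\<in>supp t. norm (lk t k) * exp (snd P))" unfolding ev_def lsum_def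
 proof (rule sum_norm_le)
  fix k assume k: "k \<in> supp t"
  have "snd k * snd P \<le> snd P" using mult_right_mono_neg[OF assms(1)[OF k] assms(2)] by simp
  then show "norm (lk t k * chi \<tau> P k) \<le> norm (lk t k) * exp (snd P)"
   by (simp add: norm_mult norm_chi mult_left_mono)
 qed
 finally show ?thesis by (simp add: n1_def lsum_def sum_distrib_right)
qed

lemma rt_derivative:
 "(rt \<tau> t has_derivative (\<lambda>H. rt \<tau> (d1 t) P * fst (fst H) + rt \<tau> (d2 \<tau> t) P * snd (fst H) + rt \<tau> (dy t) P * snd H)) (at P within S)"
proof -
 have "((\<lambda>P. ev (chi \<tau> P) t) has_derivative (\<lambda>H. ev (chi \<tau> P) (d1 t) * of_real (fst (fst H)) + ev (chi \<tau> P) (d2 \<tau> t) * of_real (snd (fst H))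
   + ev (chi \<tau> P) (dy t) * of_real (snd H))) (at P within S)"
 proof (induction t rule: poly_mapping_induct)
  case (single k c)
  have L: "(phase \<tau> k has_derivative phase \<tau> k) (at P within S)"
   unfolding phase_def by (auto intro!: derivative_eq_intros)
  have "(exp has_derivative (\<lambda>z. exp (phase \<tau> k P) * z)) (at (phase \<tau> k P))"
   using DERIV_exp[of "phase \<tau> k P"] by (simp add: has_field_derivative_def)
  from has_derivative_mult_right[OF has_derivative_compose[OF L this], of c]
  have "((\<lambda>P. c * exp (phase \<tau> k P)) has_derivative (\<lambda>H. c * (exp (phase \<tau> k P) * phase \<tau> k H))) (at P within S)" .
  moreover have "(\<lambda>P. ev (chi \<tau> P) (mon k c)) = (\<lambda>P. c * exp (phase \<tau> k P))"
   by (simp add: chi_def fun_eq_iff)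
  moreover have "(\<lambda>H. c * (exp (phase \<tau> k P) * phase \<tau> k H)) = (\<lambda>H. ev (chi \<tau> P) (d1 (mon k c)) * of_real (fst (fst H))
   + ev (chi \<tau> P) (d2 \<tau> (mon k c)) * of_real (snd (fst H)) + ev (chi \<tau> P) (dy (mon k c)) * of_real (snd H))"
   by (rule ext) (simp add: d1_def d2_def dy_def mlt_single chi_def phase_def[of \<tau> k "_ :: plane \<times> real"] algebra_simps)
  ultimately show ?case by simp
 next
  case (add a b)
  show ?case unfolding ev_add d1_add d2_add dy_add
   by (rule has_derivative_eq_rhs[OF has_derivative_add[OF add]]) (simp add: fun_eq_iff algebra_simps)
 qed
 from bounded_linear.has_derivative[OF bounded_linear_Re this] show ?thesis by (simp add: rt_def[abs_def])
qed

text \<open>Absolute convergence at radius r: in the norm \<open>n1\<close> for series of functions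
  of X, which act as multipliers, and in the weaker \<open>sn\<close> for functions on the
  half-space, which is what the elliptic estimate delivers. The trace at y = 0 leads from the second
  to the first (\<open>goodf_z0\<close>).\<close>

definition goodf :: "real \<Rightarrow> wpoly fps \<Rightarrow> bool" where
 "goodf r a \<longleftrightarrow> (\<forall>p. rho (a $ p) = a $ p \<and> flat (a $ p)) \<and> summable (\<lambda>p. n1 (a $ p) * r ^ p)"
definition good :: "real \<Rightarrow> wpoly fps \<Rightarrow> bool" where
 "good r a \<longleftrightarrow> (\<forall>p. rho (a $ p) = a $ p \<and> nn (a $ p)) \<and> summable (\<lambda>p. sn (a $ p) * r ^ p)"
definition rval :: "real \<Rightarrow> real \<Rightarrow> wpoly fps \<Rightarrow> plane \<times> real \<Rightarrow> real" where
 "rval \<tau> \<epsilon> a P = (suminf (\<lambda>p. \<epsilon> ^ p * rt \<tau> (a $ p) P))"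

section \<open>Calculus of absolutely convergent series\<close>

lemma summable_Cauchy:
 fixes f g h :: "nat \<Rightarrow> real"
 assumes "summable f" "summable g" "\<And>p. 0 \<le> f p" "\<And>p. 0 \<le> g p" "\<And>p. \<bar>h p\<bar> \<le> (\<Sum>i\<le>p. f i * g (p - i))"
 shows "summable h"
proof (rule summable_comparison_test')
 show "summable (\<lambda>p. \<Sum>i\<le>p. f i * g (p - i))" by (rule summable_Cauchy_product) (use assms in auto)
 show "norm (h p) \<le> (\<Sum>i\<le>p. f i * g (p - i))" if "p \<ge> 0" for p using assms(5) by simp
qed

lemma rho_sum: "(\<And>i. i \<in> A \<Longrightarrow> rho (f i) = f i) \<Longrightarrow> rho (sum f A) = sum f A"
 by (induction A rule: infinite_finite_induct) (auto simp: sg_add)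
lemma rho_d: "rho t = t \<Longrightarrow> rho (d1 t) = d1 t" "rho t = t \<Longrightarrow> rho (d2 \<tau> t) = d2 \<tau> t" "rho t = t \<Longrightarrow> rho (dy t) = dy t"
proof -
 have "rho (d1 s) = d1 (rho s) \<and> rho (d2 \<tau> s) = d2 \<tau> (rho s) \<and> rho (dy s) = dy (rho s)" for s
  by (induction s rule: poly_mapping_induct)
    (auto simp: rho_def d1_def d2_def dy_def mlt_single mlt_add gpush_add split_beta)
 then show "rho t = t \<Longrightarrow> rho (d1 t) = d1 t" "rho t = t \<Longrightarrow> rho (d2 \<tau> t) = d2 \<tau> t" "rho t = t \<Longrightarrow> rho (dy t) = dy t" by metis+
qed
lemma rho_fps_mult: "(\<And>p. rho (a $ p) = a $ p) \<Longrightarrow> (\<And>p. rho (b $ p) = b $ p) \<Longrightarrow> rho ((a * b) $ p) = (a * b) $ p"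
 unfolding fps_mult_nth by (intro rho_sum) (simp add: sg_mult)
lemma rho_z0: "rho t = t \<Longrightarrow> rho (z0 t) = z0 t"
proof -
 have "rho (z0 s) = z0 (rho s)" for s
  by (induction s rule: poly_mapping_induct) (auto simp: rho_def z0_add gpush_add split_beta)
 then show "rho t = t \<Longrightarrow> rho (z0 t) = z0 t" by metis
qed

context
 fixes r :: real
 assumes r: "r \<ge> 0"
begin

lemma goodf_imp_good: "goodf r a \<Longrightarrow> good r a"
 unfolding good_def goodf_def using r
 by (auto simp: nn_flat intro!: summable_comparison_test'[where g = "\<lambda>p. n1 (a $ p) * r ^ p"] mult_right_mono sn_le_n1 simp: abs_mult sn_nonneg)

lemma goodf_finite: "(\<And>p. rho (a $ p) = a $ p) \<Longrightarrow> (\<And>p. flat (a $ p)) \<Longrightarrow> (\<And>p. p \<ge> M \<Longrightarrow> a $ p = 0) \<Longrightarrow> goodf r a"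
 unfolding goodf_def by (intro conjI allI summable_finite[of "{..<M}"]) simp_all

lemma good_add: "good r a \<Longrightarrow> good r b \<Longrightarrow> good r (a + b)"
 unfolding good_def using r
 by (auto simp: sg_add nn_add intro!: summable_comparison_test'[where g = "\<lambda>p. sn (a $ p) * r ^ p + sn (b $ p) * r ^ p", OF summable_add])
   (simp add: abs_mult sn_nonneg nn_add mult_right_mono sn_add flip: distrib_right)

lemma good_uminus: "good r a \<Longrightarrow> good r (- a)"
 by (simp add: good_def sg_uminus nn_uminus)

lemma good_diff: "good r a \<Longrightarrow> good r b \<Longrightarrow> good r (a - b)"
 using good_add[of a "- b"] good_uminus by simp

lemma goodf_add: "goodf r a \<Longrightarrow> goodf r b \<Longrightarrow> goodf r (a + b)"
 unfolding goodf_def using r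
 by (auto simp: sg_add flat_add intro!: summable_comparison_test'[where g = "\<lambda>p. n1 (a $ p) * r ^ p + n1 (b $ p) * r ^ p", OF summable_add])
   (simp add: abs_mult mult_right_mono n1_add flip: distrib_right)

lemma goodf_uminus: "goodf r a \<Longrightarrow> goodf r (- a)"
 by (simp add: goodf_def sg_uminus flat_uminus)

lemma goodf_diff: "goodf r a \<Longrightarrow> goodf r b \<Longrightarrow> goodf r (a - b)"
 using goodf_add[of a "- b"] goodf_uminus by simp

lemma good_mult: assumes a: "goodf r a" and b: "good r b" shows "good r (a * b)"
 unfolding good_def
proof (intro conjI allI)
 have n: "nn (a $ i * b $ j)" for i j using a b by (simp add: goodf_def good_def nn_mult nn_flat)
 show "rho ((a * b) $ p) = (a * b) $ p" for p using a b by (intro rho_fps_mult) (auto simp: goodf_def good_def)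
 show nnp: "nn ((a * b) $ p)" for p unfolding fps_mult_nth by (intro nn_sum n)
 show "summable (\<lambda>p. sn ((a * b) $ p) * r ^ p)"
 proof (rule summable_Cauchy[where f = "\<lambda>p. n1 (a $ p) * r ^ p" and g = "\<lambda>p. sn (b $ p) * r ^ p"])
  show "\<bar>sn ((a * b) $ p) * r ^ p\<bar> \<le> (\<Sum>i\<le>p. n1 (a $ i) * r ^ i * (sn (b $ (p - i)) * r ^ (p - i)))" for p
  proof -
   have "sn ((a * b) $ p) \<le> (\<Sum>i=0..p. sn (a $ i * b $ (p - i)))" unfolding fps_mult_nth by (rule sn_sum) (rule n)
   also have "\<dots> \<le> (\<Sum>i=0..p. n1 (a $ i) * sn (b $ (p - i)))"
    using a b by (intro sum_mono sn_mult_flat) (auto simp: goodf_def good_def)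
   finally have "sn ((a * b) $ p) * r ^ p \<le> (\<Sum>i=0..p. n1 (a $ i) * sn (b $ (p - i))) * r ^ p" using r by (intro mult_right_mono) auto
   also have "\<dots> = (\<Sum>i\<le>p. n1 (a $ i) * r ^ i * (sn (b $ (p - i)) * r ^ (p - i)))"
    unfolding sum_distrib_right atLeast0AtMost by (intro sum.cong refl) (simp add: mult_ac flip: power_add)
   finally show ?thesis using nnp r by (simp add: abs_mult sn_nonneg)
  qed
 qed (use a b r in \<open>auto simp: goodf_def good_def sn_nonneg\<close>)
qed

lemma goodf_mult: assumes a: "goodf r a" and b: "goodf r b" shows "goodf r (a * b)"
 unfolding goodf_def
proof (intro conjI allI)
 show "rho ((a * b) $ p) = (a * b) $ p" for p using a b by (intro rho_fps_mult) (auto simp: goodf_def)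
 show "flat ((a * b) $ p)" for p using a b by (intro flat_fm_mult) (auto simp: goodf_def)
 show "summable (\<lambda>p. n1 ((a * b) $ p) * r ^ p)"
 proof (rule summable_Cauchy[where f = "\<lambda>p. n1 (a $ p) * r ^ p" and g = "\<lambda>p. n1 (b $ p) * r ^ p"])
  show "\<bar>n1 ((a * b) $ p) * r ^ p\<bar> \<le> (\<Sum>i\<le>p. n1 (a $ i) * r ^ i * (n1 (b $ (p - i)) * r ^ (p - i)))" for p
  proof -
   have "n1 ((a * b) $ p) \<le> (\<Sum>i=0..p. n1 (a $ i * b $ (p - i)))" unfolding fps_mult_nth by (rule n1_sum)
   also have "\<dots> \<le> (\<Sum>i=0..p. n1 (a $ i) * n1 (b $ (p - i)))" by (intro sum_mono n1_mult)
   finally have "n1 ((a * b) $ p) * r ^ p \<le> (\<Sum>i=0..p. n1 (a $ i) * n1 (b $ (p - i))) * r ^ p" using r by (intro mult_right_mono) auto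
   also have "\<dots> = (\<Sum>i\<le>p. n1 (a $ i) * r ^ i * (n1 (b $ (p - i)) * r ^ (p - i)))"
    unfolding sum_distrib_right atLeast0AtMost by (intro sum.cong refl) (simp add: mult_ac flip: power_add)
   finally show ?thesis using r by (simp add: abs_mult)
  qed
 qed (use a b r in \<open>auto simp: goodf_def\<close>)
qed

lemma goodf_z0: "good r a \<Longrightarrow> goodf r (fm z0 a)"
 unfolding good_def goodf_def using r
 by (auto simp: rho_z0 intro!: summable_comparison_test'[where g = "\<lambda>p. sn (a $ p) * r ^ p"] mult_right_mono n1_z0_le simp: abs_mult)

end

context
 fixes r \<epsilon> \<tau> :: real
 assumes \<epsilon>: "\<bar>\<epsilon>\<bar> \<le> r"
begin

lemma r_nonneg: "0 \<le> r" using \<epsilon> by linarith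

lemma rval_term_le:
 assumes "good r a" "snd P \<le> 0" shows "\<bar>\<epsilon> ^ p * rt \<tau> (a $ p) P\<bar> \<le> sn (a $ p) * r ^ p"
proof -
 have "\<bar>\<epsilon>\<bar> ^ p * \<bar>rt \<tau> (a $ p) P\<bar> \<le> r ^ p * sn (a $ p)"
  using assms \<epsilon> by (intro mult_mono power_mono abs_rt_le) (auto simp: good_def)
 then show ?thesis by (simp add: abs_mult power_abs mult.commute)
qed

lemma rval_abs_summable: "good r a \<Longrightarrow> snd P \<le> 0 \<Longrightarrow> summable (\<lambda>p. \<bar>\<epsilon> ^ p * rt \<tau> (a $ p) P\<bar>)"
 by (rule summable_comparison_test'[where g = "\<lambda>p. sn (a $ p) * r ^ p"]) (use rval_term_le in \<open>auto simp: good_def\<close>)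

lemma rval_summable: "good r a \<Longrightarrow> snd P \<le> 0 \<Longrightarrow> summable (\<lambda>p. \<epsilon> ^ p * rt \<tau> (a $ p) P)"
 by (rule summable_rabs_cancel[OF rval_abs_summable])

lemma rval_add: "good r a \<Longrightarrow> good r b \<Longrightarrow> snd P \<le> 0 \<Longrightarrow> rval \<tau> \<epsilon> (a + b) P = rval \<tau> \<epsilon> a P + rval \<tau> \<epsilon> b P"
 unfolding rval_def by (subst suminf_add) (auto simp: rt_add algebra_simps rval_summable)

lemma rval_uminus: "good r a \<Longrightarrow> snd P \<le> 0 \<Longrightarrow> rval \<tau> \<epsilon> (- a) P = - rval \<tau> \<epsilon> a P"
 unfolding rval_def by (subst suminf_minus[symmetric]) (auto simp: rt_uminus rval_summable)

lemma rval_diff: "good r a \<Longrightarrow> good r b \<Longrightarrow> snd P \<le> 0 \<Longrightarrow> rval \<tau> \<epsilon> (a - b) P = rval \<tau> \<epsilon> a P - rval \<tau> \<epsilon> b P"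
 using rval_add[of a "- b" P] rval_uminus[of b P] good_uminus[OF r_nonneg, of b] by simp

lemma rval_mult:
 assumes a: "good r a" and b: "good r b" and P: "snd P \<le> 0"
 shows "rval \<tau> \<epsilon> (a * b) P = rval \<tau> \<epsilon> a P * rval \<tau> \<epsilon> b P"
proof -
 have "rval \<tau> \<epsilon> a P * rval \<tau> \<epsilon> b P = (suminf (\<lambda>p. \<Sum>i\<le>p. (\<epsilon> ^ i * rt \<tau> (a $ i) P) * (\<epsilon> ^ (p - i) * rt \<tau> (b $ (p - i)) P)))"
  unfolding rval_def by (rule Cauchy_product) (use rval_abs_summable[OF a P] rval_abs_summable[OF b P] in auto)
 also have "\<dots> = rval \<tau> \<epsilon> (a * b) P"
  unfolding rval_def
 proof (rule suminf_cong)
  fix p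
  have "(\<Sum>i\<le>p. (\<epsilon> ^ i * rt \<tau> (a $ i) P) * (\<epsilon> ^ (p - i) * rt \<tau> (b $ (p - i)) P)) = (\<Sum>i\<le>p. \<epsilon> ^ p * rt \<tau> (a $ i * b $ (p - i)) P)"
   using a b by (intro sum.cong refl) (auto simp: rt_mult good_def simp flip: power_add)
  then show "(\<Sum>i\<le>p. (\<epsilon> ^ i * rt \<tau> (a $ i) P) * (\<epsilon> ^ (p - i) * rt \<tau> (b $ (p - i)) P)) = \<epsilon> ^ p * rt \<tau> ((a * b) $ p) P"
   by (simp add: fps_mult_nth rt_sum sum_distrib_left atLeast0AtMost)
 qed
 finally show ?thesis by simp
qed

lemma rval_eps:
 assumes a: "good r a" and e: "e > 0"
 shows "\<exists>n. \<forall>m\<ge>n. \<forall>P\<in>UNIV \<times> {..0}. \<bar>(\<Sum>p<m. \<epsilon> ^ p * rt \<tau> (a $ p) P) - rval \<tau> \<epsilon> a P\<bar> < e"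
proof -
 have sm: "summable (\<lambda>p. sn (a $ p) * r ^ p)" using a by (simp add: good_def)
 obtain n where n: "\<forall>m\<ge>n. norm (suminf (\<lambda>p. sn (a $ (p + m)) * r ^ (p + m))) < e"
  using suminf_exist_split[OF e sm] by (rule exE)
 have "\<bar>(\<Sum>p<m. \<epsilon> ^ p * rt \<tau> (a $ p) P) - rval \<tau> \<epsilon> a P\<bar> < e" if m: "m \<ge> n" and P: "snd P \<le> 0" for m P
 proof -
  have "rval \<tau> \<epsilon> a P = (suminf (\<lambda>p. \<epsilon> ^ (p + m) * rt \<tau> (a $ (p + m)) P)) + (\<Sum>p<m. \<epsilon> ^ p * rt \<tau> (a $ p) P)"
   unfolding rval_def by (rule suminf_split_initial_segment[OF rval_summable[OF a P]])
  moreover have "\<bar>suminf (\<lambda>p. \<epsilon> ^ (p + m) * rt \<tau> (a $ (p + m)) P)\<bar> \<le> (suminf (\<lambda>p. sn (a $ (p + m)) * r ^ (p + m)))"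
   unfolding real_norm_def[symmetric]
   by (rule order_trans[OF summable_norm suminf_le])
     (use rval_term_le[OF a P] rval_abs_summable[OF a P] sm summable_iff_shift[of "\<lambda>p. \<bar>\<epsilon> ^ p * rt \<tau> (a $ p) P\<bar>" m] in
      \<open>auto simp: summable_iff_shift[of "\<lambda>p. sn (a $ p) * r ^ p"]\<close>)
  ultimately show ?thesis using n[rule_format, OF m] by simp
 qed
 then show ?thesis by (intro exI[of _ n] allI impI ballI) (simp add: mem_Times_iff)
qed

lemma rval_uniform_limit:
 assumes "good r a"
 shows "uniform_limit (UNIV \<times> {..0}) (\<lambda>m P. \<Sum>p<m. \<epsilon> ^ p * rt \<tau> (a $ p) P) (rval \<tau> \<epsilon> a) sequentially"
 unfolding uniform_limit_iff eventually_sequentially dist_norm real_norm_def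
proof (intro allI impI)
 fix e :: real assume "e > 0"
 from rval_eps[OF assms this]
 show "\<exists>N. \<forall>m\<ge>N. \<forall>P\<in>UNIV \<times> {..0}. \<bar>(\<Sum>p<m. \<epsilon> ^ p * rt \<tau> (a $ p) P) - rval \<tau> \<epsilon> a P\<bar> < e" .
qed

lemma continuous_on_rt: "continuous_on S (rt \<tau> t)"
 by (rule has_derivative_continuous_on[OF rt_derivative])

lemma continuous_on_rval: "good r a \<Longrightarrow> continuous_on (UNIV \<times> {..0}) (rval \<tau> \<epsilon> a)"
 by (rule uniform_limit_theorem[OF _ rval_uniform_limit]) (auto intro!: always_eventually continuous_intros continuous_on_rt)

text \<open>Termwise differentiation: the three differentiated series converge uniformly on the
  half-space by \<open>rval_eps\<close>. The derivative is taken within the closed half-space, so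
  that the surface is included.\<close>

lemma rval_derivative:
 assumes a: "good r a" and d: "good r (fm d1 a)" "good r (fm (d2 \<tau>) a)" "good r (fm dy a)" and P: "snd P \<le> 0"
 shows "(rval \<tau> \<epsilon> a has_derivative (\<lambda>H. rval \<tau> \<epsilon> (fm d1 a) P * fst (fst H) + rval \<tau> \<epsilon> (fm (d2 \<tau>) a) P * snd (fst H)
  + rval \<tau> \<epsilon> (fm dy a) P * snd H)) (at P within UNIV \<times> {..0})"
proof -
 let ?S = "(UNIV :: plane set) \<times> {..0 :: real}"
 let ?D = "\<lambda>P H. rval \<tau> \<epsilon> (fm d1 a) P * fst (fst H) + rval \<tau> \<epsilon> (fm (d2 \<tau>) a) P * snd (fst H) + rval \<tau> \<epsilon> (fm dy a) P * snd H"
 let ?D' = "\<lambda>p P H. \<epsilon> ^ p * (rt \<tau> (d1 (a $ p)) P * fst (fst H) + rt \<tau> (d2 \<tau> (a $ p)) P * snd (fst H) + rt \<tau> (dy (a $ p)) P * snd H)"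
 have "\<exists>g. \<forall>x\<in>?S. (\<lambda>p. \<epsilon> ^ p * rt \<tau> (a $ p) x) sums g x \<and> (g has_derivative ?D x) (at x within ?S)"
 proof (rule has_derivative_series[where f' = ?D'])
  show "convex ?S" by (intro convex_Times convex_UNIV convex_real_interval)
  show "((\<lambda>P. \<epsilon> ^ p * rt \<tau> (a $ p) P) has_derivative ?D' p P) (at P within ?S)" for p P
   by (rule has_derivative_mult_right[OF rt_derivative])
  show "P \<in> ?S" using P by (simp add: mem_Times_iff)
  show "(\<lambda>p. \<epsilon> ^ p * rt \<tau> (a $ p) P) sums rval \<tau> \<epsilon> a P" unfolding rval_def using rval_summable[OF a P] by (rule summable_sums)
  fix e :: real assume e: "e > 0"
  then have e3: "e / 3 > 0" by simp
  obtain n1' where n1: "\<forall>m\<ge>n1'. \<forall>P\<in>?S. \<bar>(\<Sum>p<m. \<epsilon> ^ p * rt \<tau> (fm d1 a $ p) P) - rval \<tau> \<epsilon> (fm d1 a) P\<bar> < e / 3"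
   using rval_eps[OF d(1) e3] by (rule exE)
  obtain n2' where n2: "\<forall>m\<ge>n2'. \<forall>P\<in>?S. \<bar>(\<Sum>p<m. \<epsilon> ^ p * rt \<tau> (fm (d2 \<tau>) a $ p) P) - rval \<tau> \<epsilon> (fm (d2 \<tau>) a) P\<bar> < e / 3"
   using rval_eps[OF d(2) e3] by (rule exE)
  obtain n3' where n3: "\<forall>m\<ge>n3'. \<forall>P\<in>?S. \<bar>(\<Sum>p<m. \<epsilon> ^ p * rt \<tau> (fm dy a $ p) P) - rval \<tau> \<epsilon> (fm dy a) P\<bar> < e / 3"
   using rval_eps[OF d(3) e3] by (rule exE)
  show "\<forall>\<^sub>F m in sequentially. \<forall>x\<in>?S. \<forall>h. norm ((\<Sum>i<m. ?D' i x h) - ?D x h) \<le> e * norm h"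
   unfolding eventually_sequentially
  proof (intro exI[of _ "max n1' (max n2' n3')"] allI impI ballI)
   fix m x and h :: "plane \<times> real"
   assume m: "max n1' (max n2' n3') \<le> m" and x: "x \<in> ?S"
   define A where "A = (\<Sum>p<m. \<epsilon> ^ p * rt \<tau> (fm d1 a $ p) x) - rval \<tau> \<epsilon> (fm d1 a) x"
   define B where "B = (\<Sum>p<m. \<epsilon> ^ p * rt \<tau> (fm (d2 \<tau>) a $ p) x) - rval \<tau> \<epsilon> (fm (d2 \<tau>) a) x"
   define C where "C = (\<Sum>p<m. \<epsilon> ^ p * rt \<tau> (fm dy a $ p) x) - rval \<tau> \<epsilon> (fm dy a) x"
   have ABC: "\<bar>A\<bar> \<le> e / 3" "\<bar>B\<bar> \<le> e / 3" "\<bar>C\<bar> \<le> e / 3"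
    using n1[rule_format, of m x] n2[rule_format, of m x] n3[rule_format, of m x] m x by (simp_all add: A_def B_def C_def less_imp_le)
   have "(\<Sum>i<m. ?D' i x h) - ?D x h = A * fst (fst h) + B * snd (fst h) + C * snd h"
    unfolding A_def B_def C_def by (simp add: distrib_left sum.distrib sum_distrib_right left_diff_distrib mult.assoc)
   also have "norm \<dots> \<le> \<bar>A\<bar> * \<bar>fst (fst h)\<bar> + \<bar>B\<bar> * \<bar>snd (fst h)\<bar> + \<bar>C\<bar> * \<bar>snd h\<bar>"
    unfolding real_norm_def abs_mult[symmetric] by linarith
   also have "\<dots> \<le> e / 3 * norm h + e / 3 * norm h + e / 3 * norm h"
   proof (intro add_mono mult_mono ABC)
    show "\<bar>fst (fst h)\<bar> \<le> norm h" "\<bar>snd (fst h)\<bar> \<le> norm h" "\<bar>snd h\<bar> \<le> norm h"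
     using order_trans[OF norm_fst_le[of "fst (fst h)" "snd (fst h)"]] order_trans[OF norm_snd_le[of "snd (fst h)" "fst (fst h)"]]
      norm_fst_le[of "fst h" "snd h"] norm_snd_le[of "snd h" "fst h"] by simp_all
   qed (use e in auto)
   finally show "norm ((\<Sum>i<m. ?D' i x h) - ?D x h) \<le> e * norm h" by simp
  qed
 qed
 then obtain g where g: "\<And>x. x \<in> ?S \<Longrightarrow> (\<lambda>p. \<epsilon> ^ p * rt \<tau> (a $ p) x) sums g x" "\<And>x. x \<in> ?S \<Longrightarrow> (g has_derivative ?D x) (at x within ?S)" by blast
 have PS: "P \<in> ?S" using P by (simp add: mem_Times_iff)
 have "rval \<tau> \<epsilon> a x = g x" if "x \<in> ?S" for x using sums_unique[OF g(1)[OF that]] by (simp add: rval_def)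
 from has_derivative_transform[OF PS this g(2)[OF PS]] show ?thesis .
qed

text \<open>The tail is small uniformly on the half-space, and the finitely many remaining terms
  decay like exp y because all rates are at least 1.\<close>

lemma rval_at_bot:
 assumes a: "good r a" and k: "\<And>p k. k \<in> supp (a $ p) \<Longrightarrow> snd k \<ge> 1" and e: "e > 0"
 shows "\<forall>\<^sub>F y in at_bot. \<forall>X. \<bar>rval \<tau> \<epsilon> a (X, y)\<bar> < e"
proof -
 have e2: "e / 2 > 0" using e by simp
 obtain m where m': "\<forall>k\<ge>m. \<forall>P\<in>UNIV \<times> {..0}. \<bar>(\<Sum>p<k. \<epsilon> ^ p * rt \<tau> (a $ p) P) - rval \<tau> \<epsilon> a P\<bar> < e / 2"
  using rval_eps[OF a e2] by (rule exE)
 have m: "\<bar>(\<Sum>p<m. \<epsilon> ^ p * rt \<tau> (a $ p) P) - rval \<tau> \<epsilon> a P\<bar> < e / 2" if "snd P \<le> 0" for P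
  using m'[rule_format, of m P] that by (simp add: mem_Times_iff)
 define B where "B = (\<Sum>p<m. \<bar>\<epsilon>\<bar> ^ p * n1 (a $ p))"
 have "((\<lambda>y. B * exp y) \<longlongrightarrow> B * 0) at_bot" by (intro tendsto_mult tendsto_const exp_at_bot)
 then have "\<forall>\<^sub>F y in at_bot. B * exp y < e / 2" by (rule order_tendstoD(2)) (use e2 in simp)
 then show ?thesis using eventually_le_at_bot[of 0]
 proof eventually_elim
  case (elim y)
  show ?case
  proof
   fix X
   have "\<bar>\<Sum>p<m. \<epsilon> ^ p * rt \<tau> (a $ p) (X, y)\<bar> \<le> (\<Sum>p<m. \<bar>\<epsilon>\<bar> ^ p * n1 (a $ p) * exp y)"
   proof (rule order_trans[OF sum_abs sum_mono])
    show "\<bar>\<epsilon> ^ p * rt \<tau> (a $ p) (X, y)\<bar> \<le> \<bar>\<epsilon>\<bar> ^ p * n1 (a $ p) * exp y" for p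
     using abs_rt_le_n1[of "a $ p" "(X, y)" \<tau>, OF k] elim(2) by (simp add: abs_mult power_abs mult.assoc mult_left_mono)
   qed
   also have "\<dots> < e / 2" using elim(1) by (simp add: B_def sum_distrib_right)
   finally have "\<bar>\<Sum>p<m. \<epsilon> ^ p * rt \<tau> (a $ p) (X, y)\<bar> < e / 2" .
   moreover have "\<bar>(\<Sum>p<m. \<epsilon> ^ p * rt \<tau> (a $ p) (X, y)) - rval \<tau> \<epsilon> a (X, y)\<bar> < e / 2"
    by (rule m) (use elim(2) in simp)
   ultimately show "\<bar>rval \<tau> \<epsilon> a (X, y)\<bar> < e" by linarith
  qed
 qed
qed

end

lemma rt_z0: "rt \<tau> (z0 t) P = rt \<tau> t (fst P, 0)"
proof -
 have "ev (chi \<tau> P) (z0 t) = ev (chi \<tau> (fst P, 0)) t"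
  by (induction t rule: poly_mapping_induct) (auto simp: z0_add ev_add chi_def phase_def)
 then show ?thesis by (simp add: rt_def)
qed

lemma rval_z0: "rval \<tau> \<epsilon> (fm z0 a) P = rval \<tau> \<epsilon> a (fst P, 0)"
 by (simp add: rval_def rt_z0)

lemma rval_flat: "(\<And>p. flat (a $ p)) \<Longrightarrow> rval \<tau> \<epsilon> a P = rval \<tau> \<epsilon> a (fst P, 0)"
proof -
 assume "\<And>p. flat (a $ p)"
 then have "fm z0 a = a" by (intro fps_ext) (simp add: flat_z0_eq)
 then show ?thesis using rval_z0[of \<tau> \<epsilon> a P] by simp
qed

lemma rval_fcst: "rval \<tau> \<epsilon> (fcst (of_real c)) P = c"
proof -
 have "(\<lambda>p. \<epsilon> ^ p * rt \<tau> (fcst (of_real c) $ p) P) = (\<lambda>p. if p = 0 then c else 0)"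
  by (auto simp: rt_cst fun_eq_iff)
 then show ?thesis unfolding rval_def using sums_unique[OF sums_single[of 0 "\<lambda>_. c"]] by simp
qed

section \<open>Convergence\<close>

lemma fcong_Sub_cong: "fcong M \<phi> \<phi>' \<Longrightarrow> fcong M (Sub \<eta> \<phi>) (Sub \<eta> \<phi>')"
proof -
 assume f: "fcong M \<phi> \<phi>'"
 have "fcong M (SubT q \<eta> \<phi>) (SubT q \<eta> \<phi>')" for q
  unfolding SubT_def by (intro fcong_sum fcong_mult fcong_refl fcong_fm f)
 then show ?thesis by (auto simp: fcong_iff Sub_def)
qed

text \<open>Beyond order \<open>N\<close> the coefficients of the potential are chosen such that its trace on the surface is
 a polynomial of degree \<open>N\<close> in \<open>\<epsilon>\<close>.\<close>

lemma trace_extension: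
 assumes \<eta>: "wCl D 1 1 \<eta>" "\<eta> $ 0 = 0" and \<phi>: "wCl D (-1) 1 \<phi>" "\<And>p. harm \<tau> (\<phi> $ p)" "\<phi> $ 0 = 0"
 obtains \<phi>' where "wCl D (-1) 1 \<phi>'" "\<And>p. harm \<tau> (\<phi>' $ p)" "\<phi>' $ 0 = 0" "\<And>p. p \<le> N \<Longrightarrow> \<phi>' $ p = \<phi> $ p"
  "\<And>p. p > N \<Longrightarrow> z0 (Sub \<eta> \<phi>' $ p) = 0"
proof -
 \<comment> \<open>The harmonic function with the unwanted trace. By \<open>Sub_perturb1\<close>
   subtracting it at its order changes the trace there by exactly this amount and leaves the lower
   orders intact.\<close>
 define h where "h n g = hx \<tau> (z0 (Sub \<eta> g $ (N + Suc n)))" for n g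
 define G where "G = rec_nat \<phi> (\<lambda>n g. g + fps_X ^ (N + Suc n) * fps_const (- h n g))"
 have G0: "G 0 = \<phi>" and GS: "G (Suc n) = G n + fps_X ^ (N + Suc n) * fps_const (- h n (G n))" for n
  by (simp_all add: G_def)
 have nth: "G (Suc n) $ p = (if p = N + Suc n then G n $ p - h n (G n) else G n $ p)" for n p
  by (auto simp: GS fps_X_power_mult_nth)
 have G: "wCl D (-1) 1 (G n) \<and> (\<forall>p. harm \<tau> (G n $ p)) \<and> G n $ 0 = 0" for n
 proof (induction n)
  case 0
  then show ?case using \<phi> by (simp add: G0)
 next
  case (Suc n)
  have "wcls D (-1) 1 (N + Suc n) (h n (G n))"
   unfolding h_def using wCl_Sub[OF \<eta>(1), of "-1" 1 "G n"] Suc by (intro wcls_hx wcls_z0) (simp add: wCl_def)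
  moreover have "harm \<tau> (h n (G n))" by (simp add: h_def)
  moreover from this have "harm \<tau> (a - h n (G n))" if "harm \<tau> a" for a
   using harm_add[OF that harm_uminus, of "h n (G n)"] by simp
  ultimately show ?case using Suc by (auto simp: nth wCl_def intro!: wcls_diff)
 qed
 have stab: "G (n + i) $ p = G n $ p" if "p \<le> N + n" for n i p
  by (induction i) (use that in \<open>simp_all add: nth\<close>)
 have P: "fcong (Suc (N + Suc n)) (Sub \<eta> (G (Suc n))) (Sub \<eta> (G n) + fps_X ^ (N + Suc n) * fps_const (- h n (G n)))" for n
  using Sub_perturb1[of \<eta> "G n" "N + Suc n" 0 "fps_const (- h n (G n))"] \<eta>(2) G[of n] by (simp add: GS)
 have Z: "z0 (Sub \<eta> (G n) $ q) = 0" if "N < q" "q \<le> N + n" for n q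
  using that
 proof (induction n arbitrary: q)
  case (Suc n)
  have "Sub \<eta> (G (Suc n)) $ q = (Sub \<eta> (G n) + fps_X ^ (N + Suc n) * fps_const (- h n (G n))) $ q"
   using P[of n] Suc.prems by (auto simp: fcong_iff)
  then show ?case using Suc.IH[of q] Suc.prems
   by (cases "q = N + Suc n") (auto simp: fps_X_power_mult_nth z0_add z0_uminus h_def z0_hx z0_diff flat_z0_eq)
 qed simp
 \<comment> \<open>The coefficient of order p is final from stage p on, so the diagonal is the
   limit.\<close>
 define \<phi>' where "\<phi>' = Abs_fps (\<lambda>p. G p $ p)"
 have eq: "\<phi>' $ p = G n $ p" if "p \<le> n" for p n
  using stab[of p p "n - p"] that by (simp add: \<phi>'_def)
 show ?thesis
 proof (rule that[of \<phi>'])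
  show "wCl D (-1) 1 \<phi>'" "harm \<tau> (\<phi>' $ p)" "\<phi>' $ 0 = 0" for p using G by (auto simp: \<phi>'_def wCl_def)
  show "\<phi>' $ p = \<phi> $ p" if "p \<le> N" for p using stab[of p 0 p] that by (simp add: \<phi>'_def G0)
  show "z0 (Sub \<eta> \<phi>' $ p) = 0" if "p > N" for p
  proof -
   have "fcong (Suc p) \<phi>' (G p)" using eq by (auto simp: fcong_iff)
   from fcong_Sub_cong[OF this, of \<eta>] have "Sub \<eta> \<phi>' $ p = Sub \<eta> (G p) $ p" by (simp add: fcong_iff)
   then show ?thesis using Z[of p p] that by simp
  qed
 qed
qed

text \<open>Decay at least like exp y. It survives the shift to the surface because \<eta> contains
  no exponential in y (\<open>dec_Sub\<close>).\<close>

definition dec :: "wpoly \<Rightarrow> bool" where "dec t \<longleftrightarrow> (\<forall>k\<in>supp t. snd k \<ge> 1)"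

lemma dec_0 [simp]: "dec 0" by (simp add: dec_def)
lemma dec_add: "dec a \<Longrightarrow> dec b \<Longrightarrow> dec (a + b)" using Poly_Mapping.keys_add[of a b] by (fastforce simp: dec_def)
lemma dec_sum: "(\<And>i. i \<in> A \<Longrightarrow> dec (f i)) \<Longrightarrow> dec (sum f A)"
 by (induction A rule: infinite_finite_induct) (auto intro: dec_add)
lemma dec_mult: "flat a \<Longrightarrow> dec b \<Longrightarrow> dec (a * b)" using Poly_Mapping.keys_mult[of a b] by (fastforce simp: dec_def flat_def)
lemma dec_mlt: "dec a \<Longrightarrow> dec (mlt w a)" using keys_mlt[of w a] by (fastforce simp: dec_def)
lemma nn_dec: "dec a \<Longrightarrow> nn a" by (force simp: dec_def nn_def)

lemma flat_fps_power: "(\<And>p. flat (a $ p)) \<Longrightarrow> flat ((a ^ j) $ p)"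
proof (induction j arbitrary: p)
 case 0
 then show ?case using flat_fcst[of 1 p] by (cases p) (auto simp: flat_def)
qed (auto intro: flat_fm_mult)

lemma dec_Sub:
 assumes "\<And>p. flat (\<eta> $ p)" "\<And>p. dec (\<phi> $ p)"
 shows "dec (Sub \<eta> \<phi> $ p)"
proof -
 have "dec ((fcst (1 / fact j) * \<eta> ^ j * fm (dyn j) \<phi>) $ q)" for j q
  unfolding fps_mult_nth[of "fcst (1 / fact j) * \<eta> ^ j"] using assms
  by (intro dec_sum dec_mult flat_fm_mult flat_fcst flat_fps_power) (auto simp: dyn_def dec_mlt)
 then show ?thesis by (simp add: Sub_def SubT_def fps_sum_nth dec_sum)
qed

text \<open>Oddness in x1 gives |n| \<ge> 1, and the rate of a harmonic mode is at least
  |n|.\<close>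

lemma dec_odd_harm: "wcls D (-1) s p t \<Longrightarrow> harm \<tau> t \<Longrightarrow> dec t"
proof -
 assume w: "wcls D (-1) s p t" and h: "harm \<tau> t"
 have "snd k \<ge> 1" if k: "k \<in> supp t" for k
 proof -
  have "fst (fst k) \<noteq> 0" using wcls_odd[OF w] k by auto
  then have "1 \<le> \<bar>real_of_int (fst (fst k))\<bar>" by linarith
  then have "1 \<le> (real_of_int (fst (fst k)))\<^sup>2" by (metis abs_le_square_iff abs_one one_power2)
  also have "\<dots> \<le> (kn \<tau> (fst k))\<^sup>2" by (simp add: kn_sq)
  finally have "1 \<le> kn \<tau> (fst k)" using kn_nonneg by (metis abs_le_square_iff abs_of_nonneg abs_one one_power2)
  then show ?thesis using h k by (auto simp: harm_def)
 qed
 then show ?thesis by (simp add: dec_def)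
qed

text \<open>\<open>Sub_deriv\<close> used twice. The shifted first derivative that arises in between
  is expressed again by derivatives of the shifted function, which produces the minus sign of the
  quadratic term.\<close>

lemma Sub_second_deriv:
 assumes w: "\<And>x y. w (x + y) = w x + w y" and \<eta>: "\<eta> $ 0 = 0" "\<And>p. flat (\<eta> $ p)"
 defines "d \<equiv> fm (mlt w)"
 shows "d (d (Sub \<eta> \<phi>)) = Sub \<eta> (d (d \<phi>)) + 2 * d \<eta> * fm dy (d (Sub \<eta> \<phi>))
  - (d \<eta>)\<^sup>2 * fm dy (fm dy (Sub \<eta> \<phi>)) + d (d \<eta>) * fm dy (Sub \<eta> \<phi>)"
proof -
 have fdy: "fm dy a = 0" if "\<And>p. flat (a $ p)" for a by (rule fps_ext) (simp add: that flat_dy)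
 have y0: "fm dy \<eta> = 0" "fm dy (d \<eta>) = 0" using \<eta>(2) by (auto intro!: fdy simp: d_def flat_mlt)
 have com: "fm dy (d a) = d (fm dy a)" for a by (rule fps_ext) (simp add: d_def dy_def mlt_commute)
 have dm: "d (a * b) = d a * b + a * d b" "d (a + b) = d a + d b" for a b
  unfolding d_def by (rule fm_mult_deriv fm_add; simp add: mlt_add mlt_mult[OF w])+
 have dym: "fm dy (a * b) = fm dy a * b + a * fm dy b" "fm dy (a + b) = fm dy a + fm dy b" for a b
  by (rule fm_mult_deriv fm_add; simp add: dy_add dy_mult)+
 have 1: "d (Sub \<eta> f) = Sub \<eta> (d f) + d \<eta> * fm dy (Sub \<eta> f)" for f
  unfolding d_def Sub_dy[OF \<eta>(1) y0(1)] by (rule Sub_deriv[OF w \<eta>(1)])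
 have 2: "fm dy (Sub \<eta> (d \<phi>)) = fm dy (d (Sub \<eta> \<phi>)) - d \<eta> * fm dy (fm dy (Sub \<eta> \<phi>))"
  unfolding 1[of \<phi>] dym y0(2) by simp
 have "d (d (Sub \<eta> \<phi>)) = d (Sub \<eta> (d \<phi>)) + (d (d \<eta>) * fm dy (Sub \<eta> \<phi>) + d \<eta> * d (fm dy (Sub \<eta> \<phi>)))"
  unfolding 1[of \<phi>] dm ..
 then show ?thesis unfolding 1[of "d \<phi>"] 2 com[symmetric] by (simp add: power2_eq_square algebra_simps)
qed

text \<open>Harmonicity of \<phi> cancels the shifted second derivatives. Every term on the right
  carries a factor with a derivative of \<eta>, which vanishes at \<epsilon> = 0; this makes the
  identity a recursion in the order.\<close>

lemma Sub_laplace: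
 assumes \<eta>: "\<eta> $ 0 = 0" "\<And>p. flat (\<eta> $ p)" and \<phi>: "\<And>p. harm \<tau> (\<phi> $ p)"
 shows "fm (lap \<tau>) (Sub \<eta> \<phi>) = 2 * fm d1 \<eta> * fm d1 (fm dy (Sub \<eta> \<phi>)) + 2 * fm (d2 \<tau>) \<eta> * fm (d2 \<tau>) (fm dy (Sub \<eta> \<phi>))
  - ((fm d1 \<eta>)^2 + (fm (d2 \<tau>) \<eta>)^2) * fm dy (fm dy (Sub \<eta> \<phi>))
  + (fm d1 (fm d1 \<eta>) + fm (d2 \<tau>) (fm (d2 \<tau>) \<eta>)) * fm dy (Sub \<eta> \<phi>)"
proof -
 have y0: "fm dy \<eta> = 0" by (rule fps_ext) (simp add: \<eta>(2) flat_dy)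
 have 1: "fm d1 (fm d1 (Sub \<eta> \<phi>)) = Sub \<eta> (fm d1 (fm d1 \<phi>)) + 2 * fm d1 \<eta> * fm dy (fm d1 (Sub \<eta> \<phi>))
  - (fm d1 \<eta>)\<^sup>2 * fm dy (fm dy (Sub \<eta> \<phi>)) + fm d1 (fm d1 \<eta>) * fm dy (Sub \<eta> \<phi>)"
  unfolding d1_def by (rule Sub_second_deriv[OF _ \<eta>]) (simp add: algebra_simps)
 have 2: "fm (d2 \<tau>) (fm (d2 \<tau>) (Sub \<eta> \<phi>)) = Sub \<eta> (fm (d2 \<tau>) (fm (d2 \<tau>) \<phi>)) + 2 * fm (d2 \<tau>) \<eta> * fm dy (fm (d2 \<tau>) (Sub \<eta> \<phi>))
  - (fm (d2 \<tau>) \<eta>)\<^sup>2 * fm dy (fm dy (Sub \<eta> \<phi>)) + fm (d2 \<tau>) (fm (d2 \<tau>) \<eta>) * fm dy (Sub \<eta> \<phi>)"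
  unfolding d2_def by (rule Sub_second_deriv[OF _ \<eta>]) (simp add: algebra_simps)
 have 3: "fm dy (fm dy (Sub \<eta> \<phi>)) = Sub \<eta> (fm dy (fm dy \<phi>))" by (simp add: Sub_dy[OF \<eta>(1) y0])
 have l0: "fm d1 (fm d1 \<phi>) + fm (d2 \<tau>) (fm (d2 \<tau>) \<phi>) + fm dy (fm dy \<phi>) = 0"
  by (rule fps_ext) (simp add: harm_laplace[OF \<phi>])
 have s0: "Sub \<eta> (fm d1 (fm d1 \<phi>)) + Sub \<eta> (fm (d2 \<tau>) (fm (d2 \<tau>) \<phi>)) + fm dy (fm dy (Sub \<eta> \<phi>)) = 0"
  unfolding 3 Sub_add[symmetric] l0 by simp
 have c: "fm dy (fm d1 a) = fm d1 (fm dy a)" "fm dy (fm (d2 \<tau>) a) = fm (d2 \<tau>) (fm dy a)" for a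
  by (rule fps_ext; simp add: d_commute)+
 have "fm (lap \<tau>) (Sub \<eta> \<phi>) = fm d1 (fm d1 (Sub \<eta> \<phi>)) + fm (d2 \<tau>) (fm (d2 \<tau>) (Sub \<eta> \<phi>)) + fm dy (fm dy (Sub \<eta> \<phi>))"
  by (rule fps_ext) (simp add: lap_def)
 also have "\<dots> = (Sub \<eta> (fm d1 (fm d1 \<phi>)) + Sub \<eta> (fm (d2 \<tau>) (fm (d2 \<tau>) \<phi>)) + fm dy (fm dy (Sub \<eta> \<phi>)))
  + (2 * fm d1 \<eta> * fm d1 (fm dy (Sub \<eta> \<phi>)) + 2 * fm (d2 \<tau>) \<eta> * fm (d2 \<tau>) (fm dy (Sub \<eta> \<phi>))
  - ((fm d1 \<eta>)^2 + (fm (d2 \<tau>) \<eta>)^2) * fm dy (fm dy (Sub \<eta> \<phi>))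
  + (fm d1 (fm d1 \<eta>) + fm (d2 \<tau>) (fm (d2 \<tau>) \<eta>)) * fm dy (Sub \<eta> \<phi>))"
  unfolding 1 2 c by (simp add: algebra_simps)
 finally show ?thesis unfolding s0 by simp
qed

section \<open>Summability of the flattened potential\<close>

definition ops :: "real \<Rightarrow> wpoly \<Rightarrow> wpoly list" where
 "ops \<tau> t = [t, d1 t, d2 \<tau> t, dy t, d1 (d1 t), d1 (d2 \<tau> t), d1 (dy t), d2 \<tau> (d2 \<tau> t), d2 \<tau> (dy t), dy (dy t)]"
definition nops :: "real \<Rightarrow> wpoly \<Rightarrow> real" where "nops \<tau> t = (\<Sum>u\<leftarrow>ops \<tau> t. sn u)"

lemma sn_le_nops: "nn t \<Longrightarrow> u \<in> set (ops \<tau> t) \<Longrightarrow> sn u \<le> nops \<tau> t"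
 unfolding nops_def by (rule member_le_sum_list) (auto simp: ops_def sn_nonneg nn_d)

lemma nn_ops: "nn t \<Longrightarrow> u \<in> set (ops \<tau> t) \<Longrightarrow> nn u" by (auto simp: ops_def nn_d)

lemma nops_nonneg: "nn t \<Longrightarrow> 0 \<le> nops \<tau> t"
 using sn_le_nops[of t t \<tau>] sn_nonneg[of t] by (force simp: ops_def)

text \<open>Ten functions, each with the constant 2 of \<open>elliptic\<close>.\<close>

lemma nops_le_lap:
 assumes "nn t" "z0 t = 0" "\<And>k. k \<in> supp t \<Longrightarrow> fst (fst k) \<noteq> 0"
 shows "nops \<tau> t \<le> 20 * sn (lap \<tau> t)"
proof -
 have "nops \<tau> t \<le> (\<Sum>u\<leftarrow>ops \<tau> t. 2 * sn (lap \<tau> t))"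
  unfolding nops_def
 proof (rule sum_list_mono)
  show "sn u \<le> 2 * sn (lap \<tau> t)" if "u \<in> set (ops \<tau> t)" for u
   by (rule elliptic[OF assms]) (use that in \<open>simp_all add: ops_def\<close>)
 qed
 then show ?thesis by (simp add: ops_def)
qed

lemma sn_mult_nth_le:
 assumes "\<And>p. flat (c $ p)" "c $ 0 = 0" "\<And>p. nn (a $ p)"
 shows "sn ((c * a) $ p) \<le> (\<Sum>j=1..p. n1 (c $ j) * sn (a $ (p - j)))"
proof -
 have "sn ((c * a) $ p) \<le> (\<Sum>j=0..p. sn (c $ j * a $ (p - j)))"
  unfolding fps_mult_nth by (rule sn_sum) (use assms in \<open>auto intro: nn_mult nn_flat\<close>)
 also have "\<dots> \<le> (\<Sum>j=0..p. n1 (c $ j) * sn (a $ (p - j)))" by (intro sum_mono sn_mult_flat assms)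
 also have "\<dots> = (\<Sum>j=1..p. n1 (c $ j) * sn (a $ (p - j)))" by (simp add: sum.atLeast_Suc_atMost assms(2))
 finally show ?thesis .
qed

text \<open>The coefficients in \<open>Sub_laplace\<close> are polynomials in \<epsilon> without
  constant term, so the Laplacian at order p is controlled by boundedly many lower orders. For p > N
  the trace is zero, and \<open>nops_le_lap\<close> turns this into the recursion of
  \<open>rec_summable\<close>.\<close>

lemma Sub_summable:
 assumes \<eta>: "wCl D 1 1 \<eta>" "\<eta> $ 0 = 0" "\<And>p. flat (\<eta> $ p)" "\<And>p. p \<ge> M \<Longrightarrow> \<eta> $ p = 0"
  and \<phi>: "wCl D (-1) 1 \<phi>" "\<And>p. harm \<tau> (\<phi> $ p)" and z: "\<And>p. p > N \<Longrightarrow> z0 (Sub \<eta> \<phi> $ p) = 0"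
 obtains r0 where "r0 > 0" "r0 \<le> 1" "\<And>r. 0 \<le> r \<Longrightarrow> r \<le> r0 \<Longrightarrow> summable (\<lambda>p. nops \<tau> (Sub \<eta> \<phi> $ p) * r ^ p)"
proof -
 let ?v = "Sub \<eta> \<phi>"
 have cv: "wCl D (-1) 1 ?v" by (rule wCl_Sub[OF \<eta>(1) \<phi>(1)])
 have "dec (\<phi> $ p)" for p using \<phi>(1) unfolding wCl_def by (intro dec_odd_harm[OF _ \<phi>(2)]) blast
 then have dv: "dec (?v $ p)" for p by (rule dec_Sub[OF \<eta>(3)])
 then have nv: "nn (?v $ p)" for p by (rule nn_dec)
 define c1 c2 c3 c4 where "c1 = 2 * fm d1 \<eta>" and "c2 = 2 * fm (d2 \<tau>) \<eta>" and "c3 = - ((fm d1 \<eta>)^2 + (fm (d2 \<tau>) \<eta>)^2)"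
  and "c4 = fm d1 (fm d1 \<eta>) + fm (d2 \<tau>) (fm (d2 \<tau>) \<eta>)"
 have two: "(2 * a) $ p = a $ p + a $ p" for a :: "wpoly fps" and p by (simp only: mult_2 fps_add_nth)
 have fl: "flat (c1 $ p)" "flat (c2 $ p)" "flat (c3 $ p)" "flat (c4 $ p)" for p
  unfolding c1_def c2_def c3_def c4_def two power2_eq_square fps_neg_nth fps_add_nth using \<eta>(3)
  by (intro flat_add flat_uminus flat_fm_mult; simp add: flat_d)+
 have c0: "c1 $ 0 = 0" "c2 $ 0 = 0" "c3 $ 0 = 0" "c4 $ 0 = 0"
  unfolding c1_def c2_def c3_def c4_def two using \<eta>(2) by (simp_all add: power2_eq_square)
 have cfin: "c1 $ p = 0" "c2 $ p = 0" "c3 $ p = 0" "c4 $ p = 0" if p: "p > 2 * M" for p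
 proof -
  have sq: "(fm f \<eta> * fm f \<eta>) $ p = 0" if "f 0 = 0" for f :: "wpoly \<Rightarrow> wpoly"
   unfolding fps_mult_nth
  proof (rule sum.neutral, rule ballI)
   fix i assume "i \<in> {0..p}"
   then have "i \<ge> M \<or> p - i \<ge> M" using p by auto
   then show "fm f \<eta> $ i * fm f \<eta> $ (p - i) = 0" using \<eta>(4) that by auto
  qed
  show "c1 $ p = 0" "c2 $ p = 0" "c3 $ p = 0" "c4 $ p = 0"
   unfolding c1_def c2_def c3_def c4_def two power2_eq_square using \<eta>(4)[of p] p sq[of d1] sq[of "d2 \<tau>"] by simp_all
 qed
 define h where "h j = 20 * (n1 (c1 $ j) + n1 (c2 $ j) + n1 (c3 $ j) + n1 (c4 $ j))" for j
 show ?thesis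
 proof (rule rec_summable[of "\<lambda>p. nops \<tau> (?v $ p)" h "2 * M" N])
  show "0 \<le> nops \<tau> (?v $ p)" "0 \<le> h p" for p by (simp_all add: nops_nonneg nv h_def)
  show "h j = 0" if "j > 2 * M" for j using cfin[OF that] by (simp add: h_def)
  show "nops \<tau> (?v $ p) \<le> (\<Sum>j=1..p. h j * nops \<tau> (?v $ (p - j)))" if p: "p > N" for p
  proof -
   have odd: "fst (fst k) \<noteq> 0" if "k \<in> supp (?v $ p)" for k
    using wcls_odd[of D 1 p "?v $ p"] cv that by (auto simp: wCl_def)
   have "lap \<tau> (?v $ p) = fm (lap \<tau>) ?v $ p" by simp
   also have "fm (lap \<tau>) ?v = c1 * fm d1 (fm dy ?v) + c2 * fm (d2 \<tau>) (fm dy ?v) + c3 * fm dy (fm dy ?v) + c4 * fm dy ?v"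
    unfolding Sub_laplace[OF \<eta>(2,3) \<phi>(2)] c1_def c2_def c3_def c4_def by (simp add: algebra_simps)
   finally have lp: "lap \<tau> (?v $ p) = (c1 * fm d1 (fm dy ?v)) $ p + (c2 * fm (d2 \<tau>) (fm dy ?v)) $ p + (c3 * fm dy (fm dy ?v)) $ p + (c4 * fm dy ?v) $ p"
    by (simp only: fps_add_nth)
   have nna: "nn ((c * a) $ p)" if "\<And>p. flat (c $ p)" "\<And>p. nn (a $ p)" for c a
    unfolding fps_mult_nth by (intro nn_sum nn_mult nn_flat that)
   have b: "sn ((c * a) $ p) \<le> (\<Sum>j=1..p. n1 (c $ j) * nops \<tau> (?v $ (p - j)))"
    if "\<And>p. flat (c $ p)" "c $ 0 = 0" "\<And>p. a $ p \<in> set (ops \<tau> (?v $ p))" for c a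
   proof -
    have n: "nn (a $ p)" for p by (rule nn_ops[OF nv that(3)])
    show ?thesis by (rule order_trans[OF sn_mult_nth_le[OF that(1,2) n]])
     (intro sum_mono mult_left_mono sn_le_nops[OF nv that(3)] n1_nonneg)
   qed
   have o: "fm d1 (fm dy ?v) $ p \<in> set (ops \<tau> (?v $ p))" "fm (d2 \<tau>) (fm dy ?v) $ p \<in> set (ops \<tau> (?v $ p))"
    "fm dy (fm dy ?v) $ p \<in> set (ops \<tau> (?v $ p))" "fm dy ?v $ p \<in> set (ops \<tau> (?v $ p))" for p by (simp_all add: ops_def)
   note nno = nn_ops[OF nv o(1)] nn_ops[OF nv o(2)] nn_ops[OF nv o(3)] nn_ops[OF nv o(4)]
   have "sn (lap \<tau> (?v $ p)) \<le> sn ((c1 * fm d1 (fm dy ?v)) $ p) + sn ((c2 * fm (d2 \<tau>) (fm dy ?v)) $ p) + sn ((c3 * fm dy (fm dy ?v)) $ p) + sn ((c4 * fm dy ?v) $ p)"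
    unfolding lp by (intro order_trans[OF sn_add] add_mono order_refl nn_add nna fl nno)
   also have "\<dots> \<le> (\<Sum>j=1..p. n1 (c1 $ j) * nops \<tau> (?v $ (p - j))) + (\<Sum>j=1..p. n1 (c2 $ j) * nops \<tau> (?v $ (p - j)))
     + (\<Sum>j=1..p. n1 (c3 $ j) * nops \<tau> (?v $ (p - j))) + (\<Sum>j=1..p. n1 (c4 $ j) * nops \<tau> (?v $ (p - j)))"
    by (intro add_mono b fl c0 o)
   finally have "20 * sn (lap \<tau> (?v $ p)) \<le> 20 * \<dots>" by (rule mult_left_mono) simp
   also have "\<dots> = (\<Sum>j=1..p. h j * nops \<tau> (?v $ (p - j)))"
    unfolding h_def by (simp add: sum.distrib sum_distrib_left algebra_simps)
   finally have "20 * sn (lap \<tau> (?v $ p)) \<le> (\<Sum>j=1..p. h j * nops \<tau> (?v $ (p - j)))" .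
   then show ?thesis using nops_le_lap[OF nv z[OF p] odd, of \<tau>] by simp
  qed
 qed (rule that)
qed

text \<open>Used for 1 / (1 + |\<nabla>\<eta>|^2): since q is a polynomial in \<epsilon>, the
  coefficients of the inverse obey a recursion of bounded length, and \<open>rec_summable\<close>
  applies once more.\<close>

lemma inverse_summable:
 assumes q: "wCl D 1 1 q" "q $ 0 = 0" "\<And>p. flat (q $ p)" "\<And>p. p > M \<Longrightarrow> q $ p = 0"
 obtains iv r0 where "(1 + q) * iv = 1" "wCl D 1 1 iv" "\<And>p. flat (iv $ p)" "r0 > 0"
  "\<And>r. 0 \<le> r \<Longrightarrow> r \<le> r0 \<Longrightarrow> goodf r iv"
proof -
 define iv where "iv = fps_right_inverse (1 + q) 1"
 have 1: "(1 + q) * iv = 1" unfolding iv_def by (rule fps_right_inverse) (simp add: q)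
 have i0: "iv $ 0 = 1" by (simp add: iv_def)
 have iS: "iv $ p = - (\<Sum>j=1..p. q $ j * iv $ (p - j))" if "p > 0" for p
  unfolding iv_def using that by (cases p) (auto intro!: sum.cong)
 have one: "(1 :: wpoly) = cst (of_real 1)" by (simp flip: single_one add: zero_prod_def)
 have one': "wcls D 1 1 0 (1 :: wpoly)" "flat (1 :: wpoly)" by (subst one, rule wcls_cst flat_cst)+
 have w: "wcls D 1 1 p (iv $ p) \<and> flat (iv $ p)" for p
 proof (induction p rule: less_induct)
  case (less p)
  show ?case
  proof (cases "p = 0")
   case True
   then show ?thesis unfolding True i0 using one' by blast
  next
   case False
   have f1: "wcls D 1 1 p (q $ j * iv $ (p - j))" if "j \<in> {1..p}" for j
    using wcls_mult[of D 1 1 j "q $ j" 1 1 "p - j" "iv $ (p - j)"] q(1) less[of "p - j"] that by (simp add: wCl_def)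
   have f2: "flat (q $ j * iv $ (p - j))" if "j \<in> {1..p}" for j using flat_mult[OF q(3)] less[of "p - j"] that by simp
   have "p > 0" using False by simp
   show ?thesis unfolding iS[OF \<open>p > 0\<close>] by (intro conjI wcls_uminus wcls_sum flat_uminus flat_sum f1 f2)
  qed
 qed
 obtain r0 where r0: "r0 > 0" "r0 \<le> 1" "\<And>r. 0 \<le> r \<Longrightarrow> r \<le> r0 \<Longrightarrow> summable (\<lambda>p. n1 (iv $ p) * r ^ p)"
 proof (rule rec_summable[of "\<lambda>p. n1 (iv $ p)" "\<lambda>j. n1 (q $ j)" M 0])
  show "n1 (iv $ p) \<le> (\<Sum>j=1..p. n1 (q $ j) * n1 (iv $ (p - j)))" if "p > 0" for p
   unfolding iS[OF that] n1_uminus by (rule order_trans[OF n1_sum sum_mono]) (rule n1_mult)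
 qed (use q(4) in auto)
 show ?thesis using that[OF 1 _ _ r0(1)] w r0(3) by (auto simp: wCl_def goodf_def wcls_def)
qed

section \<open>The potential\<close>

lemma Basis_plane_real: "(Basis :: (plane \<times> real) set) = {((1, 0), 0), ((0, 1), 0), (0, 1)}"
 by (auto simp: Basis_prod_def zero_prod_def)

lemma gradient_withinI:
 assumes f: "(f has_derivative (\<lambda>H. g \<bullet> H)) (at x within S)" and u: "\<And>D. (f has_derivative D) (at x within S) \<Longrightarrow> D = (\<lambda>H. g \<bullet> H)"
 shows "gradient_within f S x = g"
proof (rule euclidean_eqI)
 fix b :: 'a assume b: "b \<in> Basis"
 have "frechet_derivative f (at x within S) = (\<lambda>H. g \<bullet> H)"
  using u f frechet_derivative_works differentiable_def by metis
 then show "gradient_within f S x \<bullet> b = g \<bullet> b" using b by (simp add: gradient_within_inner)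
qed

lemma gradient_within_openI:
 assumes "open S" "x \<in> S" "(f has_derivative (\<lambda>H. g \<bullet> H)) (at x within S)"
 shows "gradient_within f S x = g" "gradient f x = g"
proof -
 have at: "at x within S = at x" by (rule at_within_open[OF assms(2,1)])
 have d: "(f has_derivative (\<lambda>H. g \<bullet> H)) (at x)" using assms(3) unfolding at .
 show "gradient_within f S x = g"
  by (rule gradient_withinI[OF assms(3)]) (rule has_derivative_unique[OF _ d], simp only: at)
 show "gradient f x = g"
  by (rule gradient_withinI[OF d]) (rule has_derivative_unique[OF _ d])
qed

lemma C1_onI:
 assumes "\<And>x. x \<in> S \<Longrightarrow> (f has_derivative (\<lambda>H. g x \<bullet> H)) (at x within S)" "\<And>x. x \<in> S \<Longrightarrow> gradient_within f S x = g x" "continuous_on S g"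
 shows "C1_on f S"
 unfolding C1_on_def using assms by (auto simp: differentiable_on_def differentiable_def cong: continuous_on_cong)

lemma cis_period: "cis (2 * pi * of_int k) = 1"
 by (simp add: cis.ctr complex_eq_iff cos_int_2pin sin_int_2pin)

text \<open>At order p both components of a frequency are congruent to p, so their sum is even and
  the wave vector lies in the lattice dual to the periods.\<close>

lemma rt_periodic:
 assumes t: "wcls D s1 s2 p t" and l: "l \<in> period_lattice \<tau>"
 shows "rt \<tau> t (X + l, y) = rt \<tau> t (X, y)"
proof -
 have "chi \<tau> (X + l, y) k = chi \<tau> (X, y) k" if k: "k \<in> supp t" for k
 proof -
  have "even (fst (fst k) + int p)" "even (snd (fst k) + int p)" using t k by (auto simp: wcls_def)
  then have "even (fst (fst k) + snd (fst k))" by presburger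
  then have "(of_int (fst (fst k)), \<tau> * of_int (snd (fst k))) \<in> wave_lattice \<tau>" unfolding wave_lattice_iff by blast
  then obtain j :: int where "l \<bullet> (of_int (fst (fst k)), \<tau> * of_int (snd (fst k))) = 2 * pi * of_int j"
   using l by (auto simp: period_lattice_def)
  then have j: "of_int (fst (fst k)) * fst l + \<tau> * of_int (snd (fst k)) * snd l = 2 * pi * of_int j"
   by (simp add: inner_prod_def algebra_simps)
  have "phase \<tau> k (X + l, y) = phase \<tau> k (X, y) + \<i> * of_real (of_int (fst (fst k)) * fst l + \<tau> * of_int (snd (fst k)) * snd l)"
   by (simp add: phase_def algebra_simps)
  then have "chi \<tau> (X + l, y) k = chi \<tau> (X, y) k * exp (\<i> * of_real (2 * pi * of_int j))" unfolding j chi_def by (simp only: exp_add)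
  then show ?thesis by (simp only: cis_conv_exp[symmetric] cis_period mult_1_right)
 qed
 then have "ev (chi \<tau> (X + l, y)) t = ev (chi \<tau> (X, y)) t" unfolding ev_def lsum_def by (intro sum.cong) auto
 then show ?thesis by (simp add: rt_def)
qed

lemma rval_periodic: "wCl D s1 s2 a \<Longrightarrow> l \<in> period_lattice \<tau> \<Longrightarrow> rval \<tau> \<epsilon> a (X + l, y) = rval \<tau> \<epsilon> a (X, y)"
proof -
 assume w: "wCl D s1 s2 a" and l: "l \<in> period_lattice \<tau>"
 have "rt \<tau> (a $ p) (X + l, y) = rt \<tau> (a $ p) (X, y)" for p using w unfolding wCl_def by (intro rt_periodic[OF _ l]) blast
 then show ?thesis by (simp add: rval_def)
qed

context
 fixes r \<epsilon> \<tau> :: real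
 assumes \<epsilon>: "\<bar>\<epsilon>\<bar> \<le> r"
begin

lemma rval_bounded:
 assumes "good r a" obtains B where "\<And>P. snd P \<le> 0 \<Longrightarrow> \<bar>rval \<tau> \<epsilon> a P\<bar> \<le> B"
proof
 fix P :: "plane \<times> real" assume P: "snd P \<le> 0"
 show "\<bar>rval \<tau> \<epsilon> a P\<bar> \<le> suminf (\<lambda>p. sn (a $ p) * r ^ p)"
  unfolding rval_def real_norm_def[symmetric]
  by (rule order_trans[OF summable_norm suminf_le])
   (use rval_term_le[OF \<epsilon> assms P] rval_abs_summable[OF \<epsilon> assms P] assms in \<open>simp_all add: good_def\<close>)
qed

lemma flat_derivative:
 assumes a: "goodf r a" "goodf r (fm d1 a)" "goodf r (fm (d2 \<tau>) a)"
 shows "((\<lambda>X. rval \<tau> \<epsilon> a (X, 0)) has_derivative (\<lambda>h. (rval \<tau> \<epsilon> (fm d1 a) (X, 0), rval \<tau> \<epsilon> (fm (d2 \<tau>) a) (X, 0)) \<bullet> h)) (at X)"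
proof -
 have r: "0 \<le> r" using \<epsilon> by linarith
 have dy0: "fm dy a = 0" by (rule fps_ext) (use a(1) in \<open>simp add: goodf_def flat_dy\<close>)
 have g0: "good r 0" by (simp add: good_def)
 have D: "(rval \<tau> \<epsilon> a has_derivative (\<lambda>H. rval \<tau> \<epsilon> (fm d1 a) (X, 0) * fst (fst H) + rval \<tau> \<epsilon> (fm (d2 \<tau>) a) (X, 0) * snd (fst H)
  + rval \<tau> \<epsilon> (fm dy a) (X, 0) * snd H)) (at (X, 0) within UNIV \<times> {..0})"
  by (rule rval_derivative[OF \<epsilon>]) (use a goodf_imp_good[OF r] g0 dy0 in auto)
 have i: "((\<lambda>X. (X, 0 :: real)) has_derivative (\<lambda>h. (h, 0))) (at X)" by (auto intro!: derivative_eq_intros)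
 have "(rval \<tau> \<epsilon> a has_derivative (\<lambda>H. rval \<tau> \<epsilon> (fm d1 a) (X, 0) * fst (fst H) + rval \<tau> \<epsilon> (fm (d2 \<tau>) a) (X, 0) * snd (fst H)
  + rval \<tau> \<epsilon> (fm dy a) (X, 0) * snd H)) (at (X, 0) within (\<lambda>X. (X, 0)) ` UNIV)"
  by (rule has_derivative_subset[OF D]) auto
 from has_derivative_in_compose[OF i this] show ?thesis
  by (rule has_derivative_eq_rhs) (simp add: fun_eq_iff inner_prod_def)
qed

lemma flat_gradient:
 assumes a: "goodf r a" "goodf r (fm d1 a)" "goodf r (fm (d2 \<tau>) a)"
 shows "gradient (\<lambda>X. rval \<tau> \<epsilon> a (X, 0)) X = (rval \<tau> \<epsilon> (fm d1 a) (X, 0), rval \<tau> \<epsilon> (fm (d2 \<tau>) a) (X, 0))"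
 by (rule gradient_within_openI(2)[OF open_UNIV UNIV_I]) (rule flat_derivative[OF a])

end

section \<open>Return to the physical domain\<close>

context
 fixes r \<epsilon> \<tau> :: real and D M N :: nat and \<eta> \<phi> :: "wpoly fps"
 assumes \<epsilon>: "\<bar>\<epsilon>\<bar> \<le> r" and \<tau>: "\<tau> > 0"
  and \<eta>: "wCl D 1 1 \<eta>" "\<eta> $ 0 = 0" "\<And>p. flat (\<eta> $ p)" "\<And>p. p \<ge> M \<Longrightarrow> \<eta> $ p = 0"
  and \<phi>: "wCl D (-1) 1 \<phi>" "\<And>p. harm \<tau> (\<phi> $ p)"
  and su: "summable (\<lambda>p. nops \<tau> (Sub \<eta> \<phi> $ p) * r ^ p)"
begin

abbreviation (input) "flatpot \<equiv> Sub \<eta> \<phi>"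
abbreviation (input) "surf \<equiv> \<lambda>X. rval \<tau> \<epsilon> \<eta> (X, 0)"
text \<open>Undoes the flattening: height above the surface becomes the variable y \<le> 0, where
  the series converges. For \<omega> = \<phi> it is the candidate for the potential.\<close>

definition potV :: "wpoly fps \<Rightarrow> plane \<times> real \<Rightarrow> real" where
 "potV \<omega> P = rval \<tau> \<epsilon> (Sub \<eta> \<omega>) (fst P, snd P - rval \<tau> \<epsilon> \<eta> (fst P, 0))"
text \<open>The convergence needed to differentiate \<open>potV\<close> once. It holds for \<phi>
  and for its first derivatives because \<open>nops\<close> covers two derivatives of the flattened
  potential.\<close>

definition tame :: "wpoly fps \<Rightarrow> bool" where
 "tame \<omega> \<longleftrightarrow> good r (Sub \<eta> \<omega>) \<and> good r (fm d1 (Sub \<eta> \<omega>)) \<and> good r (fm (d2 \<tau>) (Sub \<eta> \<omega>)) \<and> good r (fm dy (Sub \<eta> \<omega>))"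

lemma r0: "0 \<le> r" using \<epsilon> by linarith
lemma dec_v: "dec (flatpot $ p)"
proof -
 have "dec (\<phi> $ p)" for p using \<phi>(1) unfolding wCl_def by (intro dec_odd_harm[OF _ \<phi>(2)]) blast
 then show ?thesis by (rule dec_Sub[OF \<eta>(3)])
qed

lemma rho_v: "rho (flatpot $ p) = flatpot $ p"
 using wCl_Sub[OF \<eta>(1) \<phi>(1)] by (simp add: wCl_def wcls_def)

lemma good_ops:
 assumes "\<And>t. f t \<in> set (ops \<tau> t)" shows "good r (fm f flatpot)"
 unfolding good_def
proof (intro conjI allI)
 have n: "nn (flatpot $ p)" for p by (rule nn_dec[OF dec_v])
 show "nn (fm f flatpot $ p)" for p using nn_ops[OF n assms] by simp
 have ru: "rho u = u" if "u \<in> set (ops \<tau> (flatpot $ p))" for u p using that rho_v[of p] by (auto simp: ops_def rho_d)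
 show "rho (fm f flatpot $ p) = fm f flatpot $ p" for p using ru[OF assms] by simp
 show "summable (\<lambda>p. sn (fm f flatpot $ p) * r ^ p)"
 proof (rule summable_comparison_test'[OF su])
  show "norm (sn (fm f flatpot $ p) * r ^ p) \<le> nops \<tau> (flatpot $ p) * r ^ p" for p
   using sn_le_nops[OF n assms, of p] sn_nonneg[OF nn_ops[OF n assms, of p]] r0 by (simp add: abs_mult mult_right_mono)
 qed
qed

lemma good_v: "good r flatpot" "good r (fm d1 flatpot)" "good r (fm (d2 \<tau>) flatpot)" "good r (fm dy flatpot)"
 "good r (fm d1 (fm d1 flatpot))" "good r (fm d1 (fm (d2 \<tau>) flatpot))" "good r (fm d1 (fm dy flatpot))" "good r (fm (d2 \<tau>) (fm (d2 \<tau>) flatpot))"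
 "good r (fm (d2 \<tau>) (fm dy flatpot))" "good r (fm dy (fm dy flatpot))"
proof -
 have i: "fm (\<lambda>t. t) flatpot = flatpot" by (rule fps_ext) simp
 show "good r flatpot" "good r (fm d1 flatpot)" "good r (fm (d2 \<tau>) flatpot)" "good r (fm dy flatpot)"
  "good r (fm d1 (fm d1 flatpot))" "good r (fm d1 (fm (d2 \<tau>) flatpot))" "good r (fm d1 (fm dy flatpot))" "good r (fm (d2 \<tau>) (fm (d2 \<tau>) flatpot))"
  "good r (fm (d2 \<tau>) (fm dy flatpot))" "good r (fm dy (fm dy flatpot))"
  using good_ops[of "\<lambda>t. t"] good_ops[of d1] good_ops[of "d2 \<tau>"] good_ops[of dy] good_ops[of "\<lambda>t. d1 (d1 t)"]
   good_ops[of "\<lambda>t. d1 (d2 \<tau> t)"] good_ops[of "\<lambda>t. d1 (dy t)"] good_ops[of "\<lambda>t. d2 \<tau> (d2 \<tau> t)"] good_ops[of "\<lambda>t. d2 \<tau> (dy t)"] good_ops[of "\<lambda>t. dy (dy t)"]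
  by (simp_all add: ops_def fm_fm i)
qed

lemma goodf_eta: "goodf r \<eta>" "goodf r (fm d1 \<eta>)" "goodf r (fm (d2 \<tau>) \<eta>)" "goodf r (fm d1 (fm d1 \<eta>))" "goodf r (fm d1 (fm (d2 \<tau>) \<eta>))"
 "goodf r (fm (d2 \<tau>) (fm d1 \<eta>))" "goodf r (fm (d2 \<tau>) (fm (d2 \<tau>) \<eta>))"
proof -
 have "rho (\<eta> $ p) = \<eta> $ p" for p using \<eta>(1) by (simp add: wCl_def wcls_def)
 then show "goodf r \<eta>" "goodf r (fm d1 \<eta>)" "goodf r (fm (d2 \<tau>) \<eta>)" "goodf r (fm d1 (fm d1 \<eta>))" "goodf r (fm d1 (fm (d2 \<tau>) \<eta>))"
  "goodf r (fm (d2 \<tau>) (fm d1 \<eta>))" "goodf r (fm (d2 \<tau>) (fm (d2 \<tau>) \<eta>))"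
  by (auto intro!: goodf_finite[OF r0, of _ M] simp: rho_d flat_d \<eta>)
qed

lemma y0: "fm dy \<eta> = 0" by (rule fps_ext) (simp add: \<eta>(3) flat_dy)
lemma com: "fm dy (fm d1 a) = fm d1 (fm dy a)" "fm dy (fm (d2 \<tau>) a) = fm (d2 \<tau>) (fm dy a)" "fm (d2 \<tau>) (fm d1 a) = fm d1 (fm (d2 \<tau>) a)"
 by (rule fps_ext; simp add: d_commute)+
lemma Sdy: "Sub \<eta> (fm dy \<omega>) = fm dy (Sub \<eta> \<omega>)" by (simp add: Sub_dy[OF \<eta>(2) y0])
text \<open>The shift of a derivative is traded for derivatives of the shifted function, the only
  quantities whose summability is at hand.\<close>

lemma Sd1: "Sub \<eta> (fm d1 \<omega>) = fm d1 (Sub \<eta> \<omega>) - fm d1 \<eta> * fm dy (Sub \<eta> \<omega>)"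
 using Sub_d1[OF \<eta>(2), of \<omega>] by (simp add: Sdy)
lemma Sd2: "Sub \<eta> (fm (d2 \<tau>) \<omega>) = fm (d2 \<tau>) (Sub \<eta> \<omega>) - fm (d2 \<tau>) \<eta> * fm dy (Sub \<eta> \<omega>)"
 using Sub_d2[OF \<eta>(2), of \<tau> \<omega>] by (simp add: Sdy)
lemma fmd: "fm d1 (a - b * c) = fm d1 a - (fm d1 b * c + b * fm d1 c)" "fm (d2 \<tau>) (a - b * c) = fm (d2 \<tau>) a - (fm (d2 \<tau>) b * c + b * fm (d2 \<tau>) c)"
 "fm dy (a - b * c) = fm dy a - (fm dy b * c + b * fm dy c)"
proof -
 have m: "fm (mlt w) (a - x) = fm (mlt w) a - fm (mlt w) x" for w x by (rule fps_ext) (simp add: mlt_diff)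
 have "fm d1 (b * c) = fm d1 b * c + b * fm d1 c" "fm (d2 \<tau>) (b * c) = fm (d2 \<tau>) b * c + b * fm (d2 \<tau>) c" "fm dy (b * c) = fm dy b * c + b * fm dy c"
  by (rule fm_mult_deriv; simp add: d1_add d1_mult d2_add d2_mult dy_add dy_mult)+
 then show "fm d1 (a - b * c) = fm d1 a - (fm d1 b * c + b * fm d1 c)" "fm (d2 \<tau>) (a - b * c) = fm (d2 \<tau>) a - (fm (d2 \<tau>) b * c + b * fm (d2 \<tau>) c)"
  "fm dy (a - b * c) = fm dy a - (fm dy b * c + b * fm dy c)"
  using m[unfolded] unfolding d1_def d2_def dy_def by simp_all
qed

lemma yy0: "fm dy (fm d1 \<eta>) = 0" "fm dy (fm (d2 \<tau>) \<eta>) = 0"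
 unfolding com y0 by (rule fps_ext; simp)+

lemma tame: "tame \<phi>" "tame (fm d1 \<phi>)" "tame (fm (d2 \<tau>) \<phi>)" "tame (fm dy \<phi>)"
proof -
 have gv: "good r (fm dy (fm d1 flatpot))" "good r (fm dy (fm (d2 \<tau>) flatpot))" "good r (fm (d2 \<tau>) (fm d1 flatpot))" using good_v by (simp_all add: com)
 have ge: "goodf r (fm dy (fm d1 \<eta>))" "goodf r (fm dy (fm (d2 \<tau>) \<eta>))" unfolding yy0 by (simp_all add: goodf_def)
 note i = conjI good_v gv goodf_eta ge good_diff[OF r0] good_add[OF r0] good_mult[OF r0]
 show "tame \<phi>" unfolding tame_def by (intro i)
 show "tame (fm d1 \<phi>)" unfolding tame_def Sd1 fmd by (intro i)
 show "tame (fm (d2 \<tau>) \<phi>)" unfolding tame_def Sd2 fmd by (intro i)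
 show "tame (fm dy \<phi>)" unfolding tame_def Sdy by (intro i)
qed

lemma tame_good: "tame \<omega> \<Longrightarrow> good r (Sub \<eta> (fm d1 \<omega>))" "tame \<omega> \<Longrightarrow> good r (Sub \<eta> (fm (d2 \<tau>) \<omega>))" "tame \<omega> \<Longrightarrow> good r (Sub \<eta> (fm dy \<omega>))"
 unfolding Sdy Sd1 Sd2 tame_def by (auto intro!: good_diff[OF r0] good_mult[OF r0] goodf_eta)

lemma e_deriv: "(surf has_derivative (\<lambda>h. (rval \<tau> \<epsilon> (fm d1 \<eta>) (X, 0), rval \<tau> \<epsilon> (fm (d2 \<tau>) \<eta>) (X, 0)) \<bullet> h)) (at X)"
 by (rule flat_derivative[OF \<epsilon> goodf_eta(1-3)])

lemma e_cont: "continuous_on UNIV surf"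
 using e_deriv by (intro continuous_at_imp_continuous_on ballI) (rule has_derivative_continuous)

lemma e_per: "periodic \<tau> surf" unfolding periodic_def using rval_periodic[OF \<eta>(1)] by simp

text \<open>The slope terms of the change of variables match those in \<open>Sd1\<close> and
  \<open>Sd2\<close>. Hence genuine differentiation of \<open>potV\<close> corresponds to formal
  differentiation of its argument.\<close>

lemma potV_deriv:
 assumes t: "tame \<omega>" and P: "P \<in> closed_fluid surf"
 shows "(potV \<omega> has_derivative (\<lambda>H. ((potV (fm d1 \<omega>) P, potV (fm (d2 \<tau>) \<omega>) P), potV (fm dy \<omega>) P) \<bullet> H)) (at P within closed_fluid surf)"
proof -
 define F where "F P = (fst P, snd P - surf (fst P))" for P :: "plane \<times> real"
 define e1 where "e1 = rval \<tau> \<epsilon> (fm d1 \<eta>) (fst P, 0)"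
 define e2 where "e2 = rval \<tau> \<epsilon> (fm (d2 \<tau>) \<eta>) (fst P, 0)"
 let ?S = "Sub \<eta> \<omega>"
 have FP: "snd (F P) \<le> 0" using P by (auto simp: F_def closed_fluid_def)
 have surf': "rval \<tau> \<epsilon> (fm d1 \<eta>) (F P) = e1" "rval \<tau> \<epsilon> (fm (d2 \<tau>) \<eta>) (F P) = e2"
  unfolding e1_def e2_def by (subst rval_flat; simp add: F_def flat_d \<eta>(3))+
 have "((\<lambda>P. surf (fst P)) has_derivative (\<lambda>H. (e1, e2) \<bullet> fst H)) (at P within closed_fluid surf)"
  unfolding e1_def e2_def
  by (rule has_derivative_compose[OF has_derivative_fst[OF has_derivative_ident] e_deriv])
 then have "(F has_derivative (\<lambda>H. (fst H, snd H - (e1, e2) \<bullet> fst H))) (at P within closed_fluid surf)"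
  unfolding F_def by (intro has_derivative_Pair has_derivative_diff has_derivative_fst has_derivative_snd has_derivative_ident)
 moreover have "(rval \<tau> \<epsilon> ?S has_derivative (\<lambda>H. rval \<tau> \<epsilon> (fm d1 ?S) (F P) * fst (fst H) + rval \<tau> \<epsilon> (fm (d2 \<tau>) ?S) (F P) * snd (fst H)
  + rval \<tau> \<epsilon> (fm dy ?S) (F P) * snd H)) (at (F P) within F ` closed_fluid surf)"
  by (rule has_derivative_subset[OF rval_derivative[OF \<epsilon>]]) (use t FP in \<open>auto simp: tame_def F_def closed_fluid_def\<close>)
 ultimately have d: "((\<lambda>P. rval \<tau> \<epsilon> ?S (F P)) has_derivative (\<lambda>H. rval \<tau> \<epsilon> (fm d1 ?S) (F P) * fst (fst H) + rval \<tau> \<epsilon> (fm (d2 \<tau>) ?S) (F P) * snd (fst H)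
  + rval \<tau> \<epsilon> (fm dy ?S) (F P) * (snd H - (e1, e2) \<bullet> fst H))) (at P within closed_fluid surf)"
  by (rule has_derivative_eq_rhs[OF has_derivative_in_compose]) simp
 have pe: "potV \<omega> = (\<lambda>P. rval \<tau> \<epsilon> ?S (F P))" by (simp add: potV_def F_def fun_eq_iff)
 have ps: "potV (fm d1 \<omega>) P = rval \<tau> \<epsilon> (fm d1 ?S) (F P) - e1 * rval \<tau> \<epsilon> (fm dy ?S) (F P)"
  "potV (fm (d2 \<tau>) \<omega>) P = rval \<tau> \<epsilon> (fm (d2 \<tau>) ?S) (F P) - e2 * rval \<tau> \<epsilon> (fm dy ?S) (F P)" "potV (fm dy \<omega>) P = rval \<tau> \<epsilon> (fm dy ?S) (F P)"
  using t FP surf' unfolding potV_def F_def[symmetric] Sd1 Sd2 Sdy tame_def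
  by (simp_all add: rval_diff[OF \<epsilon>] rval_mult[OF \<epsilon>] good_mult[OF r0] goodf_eta goodf_imp_good[OF r0])
 show ?thesis unfolding pe by (rule has_derivative_eq_rhs[OF d]) (simp add: ps fun_eq_iff inner_prod_def algebra_simps)
qed

lemma potV_cont: "good r (Sub \<eta> \<omega>) \<Longrightarrow> continuous_on (closed_fluid surf) (potV \<omega>)"
 unfolding potV_def
 by (rule continuous_on_compose2[OF continuous_on_rval[OF \<epsilon>]])
   (auto intro!: continuous_intros continuous_on_compose2[OF e_cont] simp: closed_fluid_def)

lemma potV_gradient:
 assumes t: "tame \<omega>" and P: "P \<in> closed_fluid surf"
 shows "gradient_within (potV \<omega>) (closed_fluid surf) P = ((potV (fm d1 \<omega>) P, potV (fm (d2 \<tau>) \<omega>) P), potV (fm dy \<omega>) P)"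
proof (rule gradient_withinI[OF potV_deriv[OF assms]])
 obtain X z where Xz: "P = (X, z)" "z \<le> surf X" using P by (auto simp: closed_fluid_def)
 have ed: "surf differentiable (at X)" using e_deriv unfolding differentiable_def by blast
 show "L = (\<lambda>H. ((potV (fm d1 \<omega>) P, potV (fm (d2 \<tau>) \<omega>) P), potV (fm dy \<omega>) P) \<bullet> H)"
  if "(potV \<omega> has_derivative L) (at P within closed_fluid surf)" for L
  unfolding Xz(1)
  by (rule derivative_unique_closed_fluid[where e = "\<lambda>X. rval \<tau> \<epsilon> \<eta> (X, 0)" and X = X and z = z, OF ed Xz(2) that[unfolded Xz(1)] potV_deriv[OF assms, unfolded Xz(1)]])
qed

lemma fluid_sub: "fluid surf \<subseteq> closed_fluid surf" by (auto simp: fluid_def closed_fluid_def)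

text \<open>Formulated for any f that agrees with \<open>potV\<close> in the fluid, so that it also
  applies to the partial derivatives of \<open>potV \<phi>\<close>, which are identified only
  there.\<close>

lemma potV_fluid:
 assumes t: "tame \<omega>" and f: "\<And>P. P \<in> fluid surf \<Longrightarrow> f P = potV \<omega> P"
 shows "C1_on f (fluid surf)"
  "P \<in> fluid surf \<Longrightarrow> gradient f P = ((potV (fm d1 \<omega>) P, potV (fm (d2 \<tau>) \<omega>) P), potV (fm dy \<omega>) P)"
proof -
 have d: "(f has_derivative (\<lambda>H. ((potV (fm d1 \<omega>) P, potV (fm (d2 \<tau>) \<omega>) P), potV (fm dy \<omega>) P) \<bullet> H)) (at P within fluid surf)" if "P \<in> fluid surf" for P
  by (rule has_derivative_transform[OF that f has_derivative_subset[OF potV_deriv[OF t] fluid_sub]]) (use that fluid_sub in auto)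
 note g = gradient_within_openI[OF open_fluid[OF e_cont] _ d]
 show "C1_on f (fluid surf)"
  by (rule C1_onI[OF d g(1)])
    (auto intro!: continuous_on_Pair continuous_on_subset[OF potV_cont fluid_sub] tame_good t)
 show "gradient f P = ((potV (fm d1 \<omega>) P, potV (fm (d2 \<tau>) \<omega>) P), potV (fm dy \<omega>) P)" if "P \<in> fluid surf" using g(2)[OF that that] .
qed

lemma potV_harmonic: "harmonic_on (potV \<phi>) (fluid surf)"
proof -
 note g = potV_fluid[OF tame(1) refl]
 have p1: "partial ((1, 0), 0) (potV \<phi>) P = potV (fm d1 \<phi>) P" and p2: "partial ((0, 1), 0) (potV \<phi>) P = potV (fm (d2 \<tau>) \<phi>) P"
  and p3: "partial (0, 1) (potV \<phi>) P = potV (fm dy \<phi>) P" if "P \<in> fluid surf" for P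
  using g(2)[OF that] by (simp_all add: partial_def inner_prod_def)
 have c: "C1_on (partial ((1, 0), 0) (potV \<phi>)) (fluid surf)" "C1_on (partial ((0, 1), 0) (potV \<phi>)) (fluid surf)" "C1_on (partial (0, 1) (potV \<phi>)) (fluid surf)"
  by (rule potV_fluid(1)[OF tame(2)], rule p1, assumption) (rule potV_fluid(1)[OF tame(3)], rule p2, assumption,
   rule potV_fluid(1)[OF tame(4)], rule p3, assumption)
 have g1: "gradient (partial ((1, 0), 0) (potV \<phi>)) P = ((potV (fm d1 (fm d1 \<phi>)) P, potV (fm (d2 \<tau>) (fm d1 \<phi>)) P), potV (fm dy (fm d1 \<phi>)) P)"
  if "P \<in> fluid surf" for P by (rule potV_fluid(2)[OF tame(2) _ that]) (rule p1)
 have g2: "gradient (partial ((0, 1), 0) (potV \<phi>)) P = ((potV (fm d1 (fm (d2 \<tau>) \<phi>)) P, potV (fm (d2 \<tau>) (fm (d2 \<tau>) \<phi>)) P), potV (fm dy (fm (d2 \<tau>) \<phi>)) P)"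
  if "P \<in> fluid surf" for P by (rule potV_fluid(2)[OF tame(3) _ that]) (rule p2)
 have g3: "gradient (partial (0, 1) (potV \<phi>)) P = ((potV (fm d1 (fm dy \<phi>)) P, potV (fm (d2 \<tau>) (fm dy \<phi>)) P), potV (fm dy (fm dy \<phi>)) P)"
  if "P \<in> fluid surf" for P by (rule potV_fluid(2)[OF tame(4) _ that]) (rule p3)
 have "(\<Sum>b\<in>Basis. partial b (partial b (potV \<phi>)) P) = 0" if P: "P \<in> fluid surf" for P
 proof -
  have y: "snd P - surf (fst P) \<le> 0" using P by (auto simp: fluid_def)
  have "fm d1 (fm d1 \<phi>) + fm (d2 \<tau>) (fm (d2 \<tau>) \<phi>) + fm dy (fm dy \<phi>) = 0"
   by (rule fps_ext) (simp add: harm_laplace[OF \<phi>(2)])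
  then have "Sub \<eta> (fm d1 (fm d1 \<phi>)) + Sub \<eta> (fm (d2 \<tau>) (fm (d2 \<tau>) \<phi>)) + Sub \<eta> (fm dy (fm dy \<phi>)) = 0"
   unfolding Sub_add[symmetric] by simp
  moreover have "potV (fm d1 (fm d1 \<phi>)) P + potV (fm (d2 \<tau>) (fm (d2 \<tau>) \<phi>)) P + potV (fm dy (fm dy \<phi>)) P
   = rval \<tau> \<epsilon> (Sub \<eta> (fm d1 (fm d1 \<phi>)) + Sub \<eta> (fm (d2 \<tau>) (fm (d2 \<tau>) \<phi>)) + Sub \<eta> (fm dy (fm dy \<phi>))) (fst P, snd P - surf (fst P))"
   unfolding potV_def using y tame_good[OF tame(2)] tame_good[OF tame(3)] tame_good[OF tame(4)]
   by (simp add: rval_add[OF \<epsilon>] good_add[OF r0])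
  moreover have "rval \<tau> \<epsilon> 0 Q = 0" for Q by (simp add: rval_def)
  ultimately have "potV (fm d1 (fm d1 \<phi>)) P + potV (fm (d2 \<tau>) (fm (d2 \<tau>) \<phi>)) P + potV (fm dy (fm dy \<phi>)) P = 0" by simp
  then show ?thesis unfolding Basis_plane_real
   using g1[OF P] g2[OF P] g3[OF P] by (simp add: partial_def[of _ "partial _ _"] inner_prod_def zero_prod_def)
 qed
 then show ?thesis unfolding harmonic_on_def using g(1) c by (auto simp: Basis_plane_real)
qed

text \<open>Both oddness and boundedness of \<eta> matter for the last condition: the former gives
  uniform decay in the flattened variable, the latter carries it over to z.\<close>

lemma potV_potential: "is_potential \<tau> surf (\<lambda>X. rval \<tau> \<epsilon> (fm z0 flatpot) (X, 0)) (potV \<phi>)"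
 unfolding is_potential_def
proof (intro conjI ballI allI)
 show "case P of (X, z) \<Rightarrow> potV \<phi> (X + l, z) = potV \<phi> (X, z)" if "l \<in> period_lattice \<tau>" for l P
  using rval_periodic[OF wCl_Sub[OF \<eta>(1) \<phi>(1)] that] rval_periodic[OF \<eta>(1) that] by (auto simp: potV_def)
 show "C1_on (potV \<phi>) (closed_fluid surf)"
  by (rule C1_onI[OF potV_deriv[OF tame(1)] potV_gradient[OF tame(1)]])
    (auto intro!: continuous_on_Pair potV_cont tame_good tame)
 show "harmonic_on (potV \<phi>) (fluid surf)" by (rule potV_harmonic)
 show "potV \<phi> (X, surf X) = rval \<tau> \<epsilon> (fm z0 flatpot) (X, 0)" for X by (simp add: potV_def rval_z0)
 show "uniform_limit UNIV (\<lambda>z X. gradient (potV \<phi>) (X, z)) (\<lambda>_. 0) at_bot"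
  unfolding uniform_limit_iff
 proof (intro allI impI)
  fix c :: real assume c: "c > 0"
  obtain B where B: "\<And>X. \<bar>surf X\<bar> \<le> B" using rval_bounded[OF \<epsilon> goodf_imp_good[OF r0 goodf_eta(1)]] by (metis snd_conv order_refl)
  have de: "snd k \<ge> 1" if "k \<in> supp (Sub \<eta> (fm (mlt w) \<phi>) $ p)" for w p k
  proof -
   have "dec (\<phi> $ p)" for p using \<phi>(1) unfolding wCl_def by (intro dec_odd_harm[OF _ \<phi>(2)]) blast
   then have "dec (fm (mlt w) \<phi> $ p)" for p by (simp add: dec_mlt)
   then have "dec (Sub \<eta> (fm (mlt w) \<phi>) $ p)" by (rule dec_Sub[OF \<eta>(3)])
   then show ?thesis using that by (simp add: dec_def)
  qed
  note de1 = de[of _ "\<lambda>k. \<i> * of_int (fst (fst k))", folded d1_def] and de2 = de[of _ "\<lambda>k. \<i> * of_real \<tau> * of_int (snd (fst k))", folded d2_def]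
   and de3 = de[of _ "\<lambda>k. of_real (snd k)", folded dy_def]
  have c3: "c / 3 > 0" using c by simp
  have "\<forall>\<^sub>F y in at_bot. (\<forall>X. \<bar>rval \<tau> \<epsilon> (Sub \<eta> (fm d1 \<phi>)) (X, y)\<bar> < c / 3) \<and> (\<forall>X. \<bar>rval \<tau> \<epsilon> (Sub \<eta> (fm (d2 \<tau>) \<phi>)) (X, y)\<bar> < c / 3)
    \<and> (\<forall>X. \<bar>rval \<tau> \<epsilon> (Sub \<eta> (fm dy \<phi>)) (X, y)\<bar> < c / 3)"
   by (intro eventually_conj rval_at_bot[OF \<epsilon> tame_good(1)[OF tame(1)] de1 c3] rval_at_bot[OF \<epsilon> tame_good(2)[OF tame(1)] de2 c3]
    rval_at_bot[OF \<epsilon> tame_good(3)[OF tame(1)] de3 c3])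
  then obtain y0 where y0: "\<And>y X. y \<le> y0 \<Longrightarrow> \<bar>rval \<tau> \<epsilon> (Sub \<eta> (fm d1 \<phi>)) (X, y)\<bar> < c / 3" "\<And>y X. y \<le> y0 \<Longrightarrow> \<bar>rval \<tau> \<epsilon> (Sub \<eta> (fm (d2 \<tau>) \<phi>)) (X, y)\<bar> < c / 3"
   "\<And>y X. y \<le> y0 \<Longrightarrow> \<bar>rval \<tau> \<epsilon> (Sub \<eta> (fm dy \<phi>)) (X, y)\<bar> < c / 3"
   unfolding eventually_at_bot_linorder by blast
  have "dist (gradient (potV \<phi>) (X, z)) 0 < c" if z: "z \<le> min (y0 - B) (- B - 1)" for z X
  proof -
   have eB: "- B \<le> surf X" using B[of X] by (simp add: abs_le_iff)
   have f: "(X, z) \<in> fluid surf" using z eB by (simp add: fluid_def)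
   have y: "z - surf X \<le> y0" using z eB by linarith
   have "norm (gradient (potV \<phi>) (X, z)) \<le> norm (fst (gradient (potV \<phi>) (X, z))) + norm (snd (gradient (potV \<phi>) (X, z)))"
    by (metis norm_Pair_le prod.collapse)
   also have "norm (fst (gradient (potV \<phi>) (X, z))) \<le> norm (potV (fm d1 \<phi>) (X, z)) + norm (potV (fm (d2 \<tau>) \<phi>) (X, z))"
    unfolding potV_fluid(2)[OF tame(1) refl f] fst_conv by (rule norm_Pair_le)
   finally have "norm (gradient (potV \<phi>) (X, z)) \<le> \<bar>potV (fm d1 \<phi>) (X, z)\<bar> + \<bar>potV (fm (d2 \<tau>) \<phi>) (X, z)\<bar> + \<bar>potV (fm dy \<phi>) (X, z)\<bar>"
    unfolding potV_fluid(2)[OF tame(1) refl f] snd_conv real_norm_def by simp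
   also have "\<dots> < c / 3 + c / 3 + c / 3" unfolding potV_def fst_conv snd_conv by (intro add_strict_mono y0 y)
   finally show ?thesis by simp
  qed
  then show "\<forall>\<^sub>F z in at_bot. \<forall>X\<in>UNIV. dist (gradient (potV \<phi>) (X, z)) 0 < c"
   unfolding eventually_at_bot_linorder by blast
 qed
qed

lemma A_goodf: "goodf r (A1 \<eta> \<phi>)" "goodf r (A2 \<tau> \<eta> \<phi>)" "goodf r (A3 \<eta> \<phi>)"
 unfolding A1_def A2_def A3_def by (rule goodf_z0[OF r0 tame_good(1)[OF tame(1)]] goodf_z0[OF r0 tame_good(2)[OF tame(1)]] goodf_z0[OF r0 tame_good(3)[OF tame(1)]])+

lemma E1_goodf: "goodf r (E1 \<tau> \<eta> \<phi>)"
 unfolding E1_def by (intro goodf_diff[OF r0] goodf_mult[OF r0] A_goodf goodf_eta)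

lemma F1_eq: "F1 \<tau> (\<lambda>X. rval \<tau> \<epsilon> (fm z0 flatpot) (X, 0), surf) \<mu> u0 X = rval \<tau> \<epsilon> (E1 \<tau> \<eta> \<phi>) (X, 0)"
proof -
 let ?P = "(X, surf X)"
 have m: "?P \<in> closed_fluid surf" by (simp add: closed_fluid_def)
 have ed: "surf differentiable (at X)" using e_deriv unfolding differentiable_def by blast
 have dn: "dirichlet_neumann \<tau> surf (\<lambda>X. rval \<tau> \<epsilon> (fm z0 flatpot) (X, 0)) X
  = potV (fm dy \<phi>) ?P - gradient surf X \<bullet> (potV (fm d1 \<phi>) ?P, potV (fm (d2 \<tau>) \<phi>) ?P)"
  unfolding dirichlet_neumann_eq[OF \<tau> e_cont e_per ed potV_potential potV_deriv[OF tame(1) m]]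
  by (simp add: inner_prod_def)
 have A: "potV (fm d1 \<phi>) ?P = rval \<tau> \<epsilon> (A1 \<eta> \<phi>) (X, 0)" "potV (fm (d2 \<tau>) \<phi>) ?P = rval \<tau> \<epsilon> (A2 \<tau> \<eta> \<phi>) (X, 0)"
  "potV (fm dy \<phi>) ?P = rval \<tau> \<epsilon> (A3 \<eta> \<phi>) (X, 0)"
  by (simp_all add: potV_def A1_def A2_def A3_def rval_z0)
 note gi = goodf_imp_good[OF r0]
 show ?thesis unfolding F1_def Let_def prod.case dn A flat_gradient[OF \<epsilon> goodf_eta(1-3)] E1_def u0_def
  by (simp add: rval_diff[OF \<epsilon>] rval_mult[OF \<epsilon>] gi A_goodf goodf_eta goodf_mult[OF r0] goodf_diff[OF r0])
qed

text \<open>By the chain rule the gradient of the trace is a + c \<nabla>\<eta>, with a the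
  horizontal and c the vertical velocity. Rewriting the numerator of the quotient in
  \<open>F2\<close> through the kinematic defect leaves \<open>E2\<close> and the square of that
  defect.\<close>

lemma F2_eq:
 assumes m: "goodf r m" and iv: "(1 + ((fm d1 \<eta>)^2 + (fm (d2 \<tau>) \<eta>)^2)) * iv = 1" "goodf r iv"
 shows "F2 (\<lambda>X. rval \<tau> \<epsilon> (fm z0 flatpot) (X, 0), surf) (rval \<tau> \<epsilon> m (X, 0)) u0 X
  = rval \<tau> \<epsilon> (E2 \<tau> m \<eta> \<phi> - fcst (1/2) * ((E1 \<tau> \<eta> \<phi>)^2 * iv)) (X, 0)"
  "goodf r (E2 \<tau> m \<eta> \<phi> - fcst (1/2) * ((E1 \<tau> \<eta> \<phi>)^2 * iv))"
proof -
 note gi = goodf_imp_good[OF r0]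
 have half: "goodf r (fcst (1/2))" by (rule goodf_finite[OF r0, of _ 1]) (auto simp: sg_cst flat_fcst split: nat.split if_splits)
 have eq1: "(1 :: wpoly fps) = fcst (of_real 1)" by (simp flip: single_one add: zero_prod_def)
 have eqw: "(1 :: wpoly) = cst (of_real 1)" by (simp flip: single_one add: zero_prod_def)
 have l1: "rho (1 :: wpoly) = 1" "flat (1 :: wpoly)"
  by (subst (1 2) eqw, simp only: sg_cst complex_cnj_complex_of_real) (subst eqw, rule flat_cst)
 have one: "goodf r 1" by (rule goodf_finite[OF r0, of _ 1]) (auto simp: l1 fps_one_nth)
 have E2g: "goodf r (E2 \<tau> m \<eta> \<phi>)" unfolding E2_def power2_eq_square
  by (intro goodf_add[OF r0] goodf_mult[OF r0] A_goodf half m goodf_eta)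
 show gq: "goodf r (E2 \<tau> m \<eta> \<phi> - fcst (1/2) * ((E1 \<tau> \<eta> \<phi>)^2 * iv))"
  unfolding power2_eq_square by (intro goodf_diff[OF r0] goodf_mult[OF r0] E2g half E1_goodf iv)
 define a1 a2 c x1 x2 w where "a1 = rval \<tau> \<epsilon> (A1 \<eta> \<phi>) (X, 0)" and "a2 = rval \<tau> \<epsilon> (A2 \<tau> \<eta> \<phi>) (X, 0)" and "c = rval \<tau> \<epsilon> (A3 \<eta> \<phi>) (X, 0)"
  and "x1 = rval \<tau> \<epsilon> (fm d1 \<eta>) (X, 0)" and "x2 = rval \<tau> \<epsilon> (fm (d2 \<tau>) \<eta>) (X, 0)" and "w = rval \<tau> \<epsilon> iv (X, 0)"
 define \<mu> where "\<mu> = rval \<tau> \<epsilon> m (X, 0)"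
 have half': "rval \<tau> \<epsilon> (fcst (1/2)) (X, 0) = 1/2" using rval_fcst[of \<tau> \<epsilon> "1/2"] by simp
 have one': "rval \<tau> \<epsilon> 1 (X, 0) = 1" unfolding eq1 by (rule rval_fcst)
 have gz: "goodf r (fm z0 flatpot)" by (rule goodf_z0[OF r0 good_v(1)])
 have dz: "fm d1 (fm z0 flatpot) = fm z0 (fm d1 flatpot)" "fm (d2 \<tau>) (fm z0 flatpot) = fm z0 (fm (d2 \<tau>) flatpot)"
  by (rule fps_ext; simp add: z0_d1 z0_d2)+
 have gd: "goodf r (fm d1 (fm z0 flatpot))" "goodf r (fm (d2 \<tau>) (fm z0 flatpot))" unfolding dz by (rule goodf_z0[OF r0] good_v)+
 have v1: "rval \<tau> \<epsilon> (fm d1 (fm z0 flatpot)) (X, 0) = a1 + x1 * c" "rval \<tau> \<epsilon> (fm (d2 \<tau>) (fm z0 flatpot)) (X, 0) = a2 + x2 * c"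
  unfolding dz a1_def a2_def x1_def x2_def c_def A1_def A2_def A3_def rval_z0 fst_conv Sd1 Sd2 Sdy
  by (simp_all add: rval_diff[OF \<epsilon>] rval_mult[OF \<epsilon>] good_mult[OF r0] goodf_eta gi good_v)
 have w: "(1 + (x1^2 + x2^2)) * w = 1"
 proof -
  have "rval \<tau> \<epsilon> ((1 + ((fm d1 \<eta>)^2 + (fm (d2 \<tau>) \<eta>)^2)) * iv) (X, 0) = 1" unfolding iv one' ..
  then show ?thesis unfolding power2_eq_square x1_def x2_def w_def
   by (simp add: rval_mult[OF \<epsilon>] rval_add[OF \<epsilon>] gi one iv goodf_eta goodf_mult[OF r0] goodf_add[OF r0] one')
 qed
 have E1v: "rval \<tau> \<epsilon> (E1 \<tau> \<eta> \<phi>) (X, 0) = c - x1 * a1 - x2 * a2 - x1"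
  unfolding E1_def a1_def a2_def c_def x1_def x2_def
  by (simp add: rval_diff[OF \<epsilon>] rval_mult[OF \<epsilon>] gi A_goodf goodf_eta goodf_mult[OF r0] goodf_diff[OF r0])
 have E2v: "rval \<tau> \<epsilon> (E2 \<tau> m \<eta> \<phi>) (X, 0) = a1 + (1/2) * (a1^2 + a2^2 + c^2) + \<mu> * surf X"
  unfolding E2_def power2_eq_square a1_def a2_def c_def \<mu>_def
  by (simp add: rval_add[OF \<epsilon>] rval_mult[OF \<epsilon>] gi A_goodf goodf_eta goodf_mult[OF r0] goodf_add[OF r0] half half' m)
 have R: "rval \<tau> \<epsilon> (E2 \<tau> m \<eta> \<phi> - fcst (1/2) * ((E1 \<tau> \<eta> \<phi>)^2 * iv)) (X, 0)
  = a1 + (1/2) * (a1^2 + a2^2 + c^2) + \<mu> * surf X - (1/2) * ((c - x1 * a1 - x2 * a2 - x1)^2 * w)"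
 proof -
  have "rval \<tau> \<epsilon> (E2 \<tau> m \<eta> \<phi> - fcst (1/2) * ((E1 \<tau> \<eta> \<phi>)^2 * iv)) (X, 0)
   = rval \<tau> \<epsilon> (E2 \<tau> m \<eta> \<phi>) (X, 0) - (1/2) * ((rval \<tau> \<epsilon> (E1 \<tau> \<eta> \<phi>) (X, 0))^2 * w)"
   unfolding power2_eq_square w_def
   by (simp add: rval_diff[OF \<epsilon>] rval_mult[OF \<epsilon>] gi E2g E1_goodf goodf_mult[OF r0] half half' iv)
  then show ?thesis unfolding E1v E2v .
 qed
 have q: "1 + (x1^2 + x2^2) > 0" by (simp add: add_pos_nonneg)
 then have w': "w = 1 / (1 + (x1^2 + x2^2))" using w by (simp add: field_simps)
 have n: "(norm (a, b))^2 = a^2 + b^2" for a b :: real by (simp add: norm_Pair)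
 define s where "s = 1 + (x1^2 + x2^2)"
 have s0: "s > 0" using q by (simp add: s_def)
 \<comment> \<open>The value of \<open>E1\<close>. By \<open>L\<close> the quantity squared in the
   quotient of \<open>F2\<close> is c s - d; once its square is expanded, the terms without d^2 turn
   the trace gradient into the velocities (\<open>id\<close>).\<close>
 define d where "d = c - x1 * a1 - x2 * a2 - x1"
 have L: "x1 * (a1 + x1 * c + 1) + x2 * (a2 + x2 * c) = c * s - d" by (simp add: s_def d_def power2_eq_square algebra_simps)
 have sq: "(c * s - d)^2 / (2 * s) = c^2 * s / 2 - c * d + d^2 / (2 * s)" using s0 by (simp add: power2_eq_square field_simps)
 have id: "(a1 + x1 * c) + ((a1 + x1 * c)^2 + (a2 + x2 * c)^2) / 2 - (c^2 * s / 2 - c * d) = a1 + (1/2) * (a1^2 + a2^2 + c^2)"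
  by (simp add: s_def d_def power2_eq_square field_simps)
 have gp: "gradient (\<lambda>X. rval \<tau> \<epsilon> (fm z0 flatpot) (X, 0)) X = (a1 + x1 * c, a2 + x2 * c)"
  unfolding flat_gradient[OF \<epsilon> gz gd] v1 ..
 have ge: "gradient surf X = (x1, x2)" unfolding flat_gradient[OF \<epsilon> goodf_eta(1-3)] x1_def x2_def ..
 have "F2 (\<lambda>X. rval \<tau> \<epsilon> (fm z0 flatpot) (X, 0), surf) \<mu> u0 X
  = (a1 + x1 * c) + \<mu> * surf X + ((a1 + x1 * c)^2 + (a2 + x2 * c)^2) / 2 - (x1 * (a1 + x1 * c + 1) + x2 * (a2 + x2 * c))^2 / (2 * s)"
  unfolding F2_def Let_def prod.case gp ge n u0_def by (simp add: s_def)
 also have "\<dots> = a1 + (1/2) * (a1^2 + a2^2 + c^2) + \<mu> * surf X - (1/2) * (d^2 * (1 / s))"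
 proof -
  have "d^2 / (2 * s) = (1/2) * (d^2 * (1 / s))" by simp
  then show ?thesis unfolding L sq using id by linarith
 qed
 finally show "F2 (\<lambda>X. rval \<tau> \<epsilon> (fm z0 flatpot) (X, 0), surf) (rval \<tau> \<epsilon> m (X, 0)) u0 X
  = rval \<tau> \<epsilon> (E2 \<tau> m \<eta> \<phi> - fcst (1/2) * ((E1 \<tau> \<eta> \<phi>)^2 * iv)) (X, 0)"
  unfolding R \<mu>_def[symmetric] w' d_def s_def .
qed

end

section \<open>Sobolev norms\<close>

lemma integral_cis:
 assumes L: "L \<ge> 0" and w: "w \<noteq> 0" "cis (w * L) = 1"
 shows "integral {0..L} (\<lambda>y. cis (w * y)) = 0"
proof -
 have "((\<lambda>y. cis (w * y)) has_integral (cis (w * L) / (\<i> * of_real w) - cis (w * 0) / (\<i> * of_real w))) {0..L}"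
 proof (rule fundamental_theorem_of_calculus[OF L])
  fix y assume "y \<in> {0..L}"
  have "((\<lambda>y. exp (\<i> * of_real w * of_real y) / (\<i> * of_real w)) has_vector_derivative exp (\<i> * of_real w * of_real y)) (at y within {0..L})"
  proof -
   have "((\<lambda>z. exp (\<i> * of_real w * z) / (\<i> * of_real w)) has_field_derivative exp (\<i> * of_real w * of_real y)) (at (of_real y))"
    using w(1) by (auto intro!: derivative_eq_intros simp: field_simps)
   then show ?thesis using has_vector_derivative_real_field by (fastforce simp: o_def)
  qed
  then show "((\<lambda>y. cis (w * y) / (\<i> * of_real w)) has_vector_derivative cis (w * y)) (at y within {0..L})"
   by (simp add: cis_conv_exp mult.assoc)
 qed
 then have "((\<lambda>y. cis (w * y)) has_integral 0) {0..L}" using w(2) by simp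
 then show ?thesis by (rule integral_unique)
qed

lemma period_cell_cbox: "period_cell \<tau> = cbox (0, 0) (2 * pi, pi / \<tau>)"
 by (simp add: period_cell_def cbox_Pair_eq)

text \<open>The cell is a full period in x1 but only half of 2\<pi>/\<tau> in x2. That suffices: the
  x1-integral vanishes unless n = 0, and then m is even, so \<pi>/\<tau> is a period.\<close>

lemma integral_lattice_cis:
 assumes \<tau>: "\<tau> > 0" and e: "even (n + m)"
 shows "integral (period_cell \<tau>) (\<lambda>X. cis (of_int n * fst X + \<tau> * of_int m * snd X)) = (if n = 0 \<and> m = 0 then of_real (2 * pi^2 / \<tau>) else 0)"
proof -
 have "integral (period_cell \<tau>) (\<lambda>X. cis (of_int n * fst X + \<tau> * of_int m * snd X))
  = integral (cbox 0 (2 * pi)) (\<lambda>x. integral (cbox 0 (pi / \<tau>)) (\<lambda>y. cis (of_int n * x) * cis (\<tau> * of_int m * y)))"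
  unfolding period_cell_cbox by (subst integral_prod_continuous) (auto intro!: continuous_intros simp: cis_mult)
 also have "\<dots> = integral {0..2 * pi} (\<lambda>x. cis (of_int n * x)) * integral {0..pi / \<tau>} (\<lambda>y. cis (\<tau> * of_int m * y))"
  by simp
 also have "\<dots> = (if n = 0 \<and> m = 0 then of_real (2 * pi^2 / \<tau>) else 0)"
 proof (cases "n = 0")
  case False
  have "integral {0..2 * pi} (\<lambda>x. cis (of_int n * x)) = 0"
   using False cis_period[of n] by (intro integral_cis) (auto simp: mult.commute mult.left_commute)
  then show ?thesis using False by simp
 next
  case True
  show ?thesis
  proof (cases "m = 0")
   case True
   then show ?thesis using \<open>n = 0\<close> \<tau> by (simp add: power2_eq_square field_simps scaleR_conv_of_real)
  next
   case False
   obtain j where j: "m = 2 * j" using e \<open>n = 0\<close> by (auto elim: evenE)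
   have "integral {0..pi / \<tau>} (\<lambda>y. cis (\<tau> * of_int m * y)) = 0"
   proof (rule integral_cis)
    have "\<tau> * of_int m * (pi / \<tau>) = 2 * pi * of_int j" using \<tau> by (simp add: j)
    then show "cis (\<tau> * of_int m * (pi / \<tau>)) = 1" using cis_period[of j] by simp
   qed (use \<tau> False in auto)
   then show ?thesis using False by simp
  qed
 qed
 finally show ?thesis .
qed

lemma fourier_term:
 assumes \<tau>: "\<tau> > 0" and t: "rho t = t" "flat t" "\<And>k. k \<in> supp t \<Longrightarrow> even (fst (fst k) + snd (fst k))" and e: "even (n + m)"
 shows "((\<lambda>X. of_real (rt \<tau> t (X, 0)) * cis (- ((of_int n, \<tau> * of_int m) \<bullet> X))) has_integral
  (lk t ((n, m), 0) * of_real (2 * pi^2 / \<tau>))) (period_cell \<tau>)"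
proof -
 let ?g = "\<lambda>k X. lk t k * cis (of_int (fst (fst k) - n) * fst X + \<tau> * of_int (snd (fst k) - m) * snd X)"
 let ?c = "\<lambda>k. if fst k = (n, m) then lk t k * of_real (2 * pi^2 / \<tau>) else 0"
 have "of_real (rt \<tau> t (X, 0)) * cis (- ((of_int n, \<tau> * of_int m) \<bullet> X)) = (\<Sum>k\<in>supp t. ?g k X)" for X
 proof -
  have "chi \<tau> (X, 0) k * cis (- ((of_int n, \<tau> * of_int m) \<bullet> X))
   = cis (of_int (fst (fst k) - n) * fst X + \<tau> * of_int (snd (fst k) - m) * snd X)" for k
  proof -
   have "chi \<tau> (X, 0) k = cis (of_int (fst (fst k)) * fst X + \<tau> * of_int (snd (fst k)) * snd X)"
    by (simp add: chi_def phase_def cis_conv_exp)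
   then show ?thesis by (simp add: cis_mult inner_prod_def algebra_simps)
  qed
  then show ?thesis unfolding ev_real[OF t(1), symmetric] ev_def lsum_def sum_distrib_right by (simp add: mult.assoc)
 qed
 moreover have "((\<lambda>X. \<Sum>k\<in>supp t. ?g k X) has_integral (\<Sum>k\<in>supp t. ?c k)) (period_cell \<tau>)"
 proof (rule has_integral_sum[OF finite_keys])
  fix k assume k: "k \<in> supp t"
  have ev: "even ((fst (fst k) - n) + (snd (fst k) - m))" using t(3)[OF k] e by presburger
  have "(\<lambda>X :: plane. cis (of_int (fst (fst k) - n) * fst X + \<tau> * of_int (snd (fst k) - m) * snd X)) integrable_on period_cell \<tau>"
   unfolding period_cell_cbox by (intro integrable_continuous continuous_intros)
  from has_integral_mult_right[OF integrable_integral[OF this], of "lk t k"]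
  show "(?g k has_integral ?c k) (period_cell \<tau>)"
   unfolding integral_lattice_cis[OF \<tau> ev] by (rule has_integral_eq_rhs) (auto simp: prod_eq_iff)
 qed
 moreover have "(\<Sum>k\<in>supp t. ?c k) = lk t ((n, m), 0) * of_real (2 * pi^2 / \<tau>)"
 proof -
  have "(\<Sum>k\<in>supp t. ?c k) = (\<Sum>k\<in>supp t. if k = ((n, m), 0) then lk t k * of_real (2 * pi^2 / \<tau>) else 0)"
   using t(2) by (intro sum.cong refl) (auto simp: flat_def prod_eq_iff)
  then show ?thesis by (simp add: in_keys_iff)
 qed
 ultimately show ?thesis by simp
qed

lemma measure_period_cell: "\<tau> > 0 \<Longrightarrow> measure lebesgue (period_cell \<tau>) = 2 * pi^2 / \<tau>"
 unfolding period_cell_cbox by (simp add: content_Pair power2_eq_square)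

lemma sum_square_le: "(\<And>x. x \<in> A \<Longrightarrow> 0 \<le> f x) \<Longrightarrow> finite A \<Longrightarrow> (\<Sum>x\<in>A. (f x)\<^sup>2) \<le> (\<Sum>x\<in>A. f x :: real)\<^sup>2"
proof -
 assume f: "\<And>x. x \<in> A \<Longrightarrow> 0 \<le> f x" "finite A"
 have "(\<Sum>x\<in>A. (f x)\<^sup>2) \<le> (\<Sum>x\<in>A. f x * (\<Sum>y\<in>A. f y))"
  unfolding power2_eq_square using f by (intro sum_mono mult_left_mono member_le_sum) auto
 then show ?thesis by (simp add: power2_eq_square sum_distrib_right)
qed

text \<open>With q = k + 1 and y^q = 1/2, the expression is at most twice the q-th power of (p + 1)
  y^(p + 1), and j y^j tends to 0.\<close>

lemma poly_geometric_bounded: "\<exists>C. \<forall>p::nat. real (Suc p) ^ k * (1 / 2) ^ p \<le> C"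
proof -
 define q where "q = Suc k"
 define y where "y = root q (1 / 2)"
 have y: "y \<ge> 0" "y < 1" unfolding y_def q_def by simp_all
 have yq: "y ^ q = 1 / 2" unfolding y_def by (rule real_root_pow_pos2) (simp_all add: q_def)
 have "(\<lambda>n. real n * y ^ n) \<longlonglongrightarrow> 0" using powser_times_n_limit_0[of y] y by simp
 then obtain B where B: "\<And>n. norm (real n * y ^ n) \<le> B" using convergent_imp_Bseq convergentI BseqE by metis
 have "real (Suc p) ^ k * (1 / 2) ^ p \<le> 2 * B ^ q" for p
 proof -
  have "real (Suc p) ^ k * (1 / 2) ^ p \<le> real (Suc p) ^ q * (1 / 2) ^ p"
   unfolding q_def by (intro mult_right_mono power_increasing) auto
  also have "\<dots> = 2 * (real (Suc p) * y ^ Suc p) ^ q"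
  proof -
   have "(y ^ Suc p) ^ q = (1 / 2) ^ Suc p" by (metis power_mult mult.commute yq)
   then show ?thesis by (simp add: power_mult_distrib del: power_Suc) simp
  qed
  also have "\<dots> \<le> 2 * B ^ q" using B[of "Suc p"] y by (intro mult_left_mono power_mono) auto
  finally show ?thesis .
 qed
 then show ?thesis by blast
qed

lemma continuous_on_flat_rval:
 assumes "\<bar>\<epsilon>\<bar> \<le> r" "goodf r a" shows "continuous_on S (\<lambda>X. rval \<tau> \<epsilon> a (X, 0))"
 by (rule continuous_on_compose2[OF continuous_on_rval[OF assms(1) goodf_imp_good[OF _ assms(2)]]])
   (use assms(1) in \<open>auto intro!: continuous_intros\<close>)

text \<open>Uniform convergence on the cell permits termwise integration. The offset s makes the
  result applicable to series divided by a power of \<epsilon>, whose coefficients keep the grading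
  of the original order.\<close>

lemma rval_fourier:
 assumes \<tau>: "\<tau> > 0" and \<epsilon>: "\<bar>\<epsilon>\<bar> \<le> r" and a: "goodf r a" and w: "\<And>p. wcls D s1 s2 (p + s) (a $ p)" and e: "even (n + m)"
 shows "(\<lambda>M. \<Sum>p<M. \<epsilon> ^ p * lk (a $ p) ((n, m), 0)) \<longlonglongrightarrow> fourier_coeff \<tau> (\<lambda>X. rval \<tau> \<epsilon> a (X, 0)) (of_int n, \<tau> * of_int m)"
proof -
 have r: "0 \<le> r" using \<epsilon> by linarith
 let ?K = "(of_int n, \<tau> * of_int m)"
 let ?f = "\<lambda>M X. of_real (\<Sum>p<M. \<epsilon> ^ p * rt \<tau> (a $ p) (X, 0)) * cis (- (?K \<bullet> X))"
 let ?g = "\<lambda>X. of_real (rval \<tau> \<epsilon> a (X, 0)) * cis (- (?K \<bullet> X))"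
 let ?A = "complex_of_real (2 * pi^2 / \<tau>)"
 have cis: "continuous_on S (\<lambda>X :: plane. cis (- (?K \<bullet> X)))" for S by (intro continuous_intros)
 have u: "uniform_limit (cbox (0, 0) (2 * pi, pi / \<tau>)) ?f ?g sequentially"
  unfolding uniform_limit_iff eventually_sequentially
 proof (intro allI impI)
  fix c :: real assume c: "c > 0"
  obtain N where N: "\<forall>M\<ge>N. \<forall>P\<in>UNIV \<times> {..0}. \<bar>(\<Sum>p<M. \<epsilon> ^ p * rt \<tau> (a $ p) P) - rval \<tau> \<epsilon> a P\<bar> < c"
   using rval_eps[OF \<epsilon> goodf_imp_good[OF r a] c] by (rule exE)
  have "dist (?f M X) (?g X) < c" if M: "M \<ge> N" for M X
  proof -
   have "dist (?f M X) (?g X) = norm ((complex_of_real (\<Sum>p<M. \<epsilon> ^ p * rt \<tau> (a $ p) (X, 0)) - of_real (rval \<tau> \<epsilon> a (X, 0))) * cis (- (?K \<bullet> X)))"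
    unfolding dist_norm left_diff_distrib ..
   also have "\<dots> = \<bar>(\<Sum>p<M. \<epsilon> ^ p * rt \<tau> (a $ p) (X, 0)) - rval \<tau> \<epsilon> a (X, 0)\<bar>"
    unfolding norm_mult norm_cis of_real_diff[symmetric] norm_of_real by simp
   also have "\<dots> < c" by (rule N[rule_format, OF M]) simp
   finally show ?thesis .
  qed
  then show "\<exists>N. \<forall>M\<ge>N. \<forall>X\<in>cbox (0, 0) (2 * pi, pi / \<tau>). dist (?f M X) (?g X) < c" by blast
 qed
 have cf: "continuous_on (cbox (0, 0) (2 * pi, pi / \<tau>)) (?f M)" for M
  by (intro continuous_intros cis continuous_on_of_real continuous_on_sum continuous_on_compose2[OF continuous_on_rt[of \<epsilon> r UNIV]]) (use \<epsilon> in auto)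
 obtain I J where I: "\<And>M. (?f M has_integral I M) (cbox (0, 0) (2 * pi, pi / \<tau>))" and J: "(?g has_integral J) (cbox (0, 0) (2 * pi, pi / \<tau>))"
  and IJ: "I \<longlonglongrightarrow> J"
  by (rule uniform_limit_integral_cbox[OF u cf]) auto
 have trm: "((\<lambda>X. of_real (rt \<tau> (a $ p) (X, 0)) * cis (- (?K \<bullet> X))) has_integral (lk (a $ p) ((n, m), 0) * ?A)) (period_cell \<tau>)" for p
 proof (rule fourier_term[OF \<tau> _ _ _ e])
  show "even (fst (fst k) + snd (fst k))" if "k \<in> supp (a $ p)" for k
  proof -
   have "even (fst (fst k) + int (p + s))" "even (snd (fst k) + int (p + s))" using w[of p] that unfolding wcls_def by blast+
   then show ?thesis by presburger
  qed
 qed (use a in \<open>auto simp: goodf_def\<close>)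
 have "I M = (\<Sum>p<M. \<epsilon> ^ p * lk (a $ p) ((n, m), 0)) * ?A" for M
 proof (rule has_integral_unique[OF I])
  have "((\<lambda>X. \<Sum>p<M. of_real (\<epsilon> ^ p) * (of_real (rt \<tau> (a $ p) (X, 0)) * cis (- (?K \<bullet> X)))) has_integral
   (\<Sum>p<M. of_real (\<epsilon> ^ p) * (lk (a $ p) ((n, m), 0) * ?A))) (period_cell \<tau>)"
   by (intro has_integral_sum has_integral_mult_right trm) auto
  then show "(?f M has_integral (\<Sum>p<M. \<epsilon> ^ p * lk (a $ p) ((n, m), 0)) * ?A) (cbox (0, 0) (2 * pi, pi / \<tau>))"
   unfolding period_cell_cbox by (simp add: sum_distrib_right sum_divide_distrib mult.assoc)
 qed
 then have "I = (\<lambda>M. (\<Sum>p<M. \<epsilon> ^ p * lk (a $ p) ((n, m), 0)) * ?A)" by (rule ext)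
 then have lim: "(\<lambda>M. (\<Sum>p<M. \<epsilon> ^ p * lk (a $ p) ((n, m), 0)) * ?A) \<longlonglongrightarrow> J" using IJ by (simp only:)
 have A0: "?A \<noteq> 0" using \<tau> by simp
 have "fourier_coeff \<tau> (\<lambda>X. rval \<tau> \<epsilon> a (X, 0)) ?K = J / ?A"
 proof -
  have "continuous_on (cbox (0, 0) (2 * pi, pi / \<tau>)) ?g"
   by (intro continuous_intros cis continuous_on_of_real continuous_on_flat_rval[OF \<epsilon> a])
  then have "set_integrable lebesgue (cbox (0, 0) (2 * pi, pi / \<tau>)) ?g" by (rule absolutely_integrable_continuous)
  then have "(LINT X : period_cell \<tau> | lebesgue. ?g X) = J"
   unfolding period_cell_cbox by (subst set_lebesgue_integral_eq_integral) (auto intro: integral_unique J)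
  then show ?thesis unfolding fourier_coeff_def measure_period_cell[OF \<tau>] by simp
 qed
 moreover have "(\<lambda>M. (\<Sum>p<M. \<epsilon> ^ p * lk (a $ p) ((n, m), 0)) * ?A / ?A) \<longlonglongrightarrow> J / ?A"
  by (intro tendsto_divide lim tendsto_const A0)
 ultimately show ?thesis using A0 by simp
qed

text \<open>Frequencies at index p are at most D (p + s), so the Sobolev weight is at most G^k (p +
  1)^(2k); halving the radius of convergence gains 2^(-p), which absorbs it. As the weights are at
  least 1, the weighted sum of squares is bounded by the square of the weighted sum of
  moduli.\<close>

lemma sobolev_rval:
 assumes \<tau>: "\<tau> > 0" and r: "r > 0" and a: "goodf r a" and w: "\<And>p. wcls D s1 s2 (p + s) (a $ p)"
 shows "\<exists>B. \<forall>\<epsilon>. \<bar>\<epsilon>\<bar> \<le> r / 2 \<longrightarrow> (\<lambda>X. rval \<tau> \<epsilon> a (X, 0)) \<in> sobolev \<tau> k \<and> sobolev_norm \<tau> k (\<lambda>X. rval \<tau> \<epsilon> a (X, 0)) \<le> B"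
proof -
 define W where "W K = (1 + (norm (K :: plane))^2) ^ k" for K
 define G where "G = 1 + (1 + \<tau>^2) * (real D * real (Suc s))^2"
 have G1: "G \<ge> 1" by (simp add: G_def)
 obtain C where C: "\<And>p::nat. real (Suc p) ^ (2 * k) * (1 / 2) ^ p \<le> C" using poly_geometric_bounded[of "2 * k"] by blast
 have sm: "summable (\<lambda>p. n1 (a $ p) * r ^ p)" using a by (simp add: goodf_def)
 define B where "B = G ^ k * C * suminf (\<lambda>p. n1 (a $ p) * r ^ p)"
 have W1: "W K \<ge> 1" for K by (simp add: W_def)
 have W0: "W K \<ge> 0" for K by (simp add: W_def)
 have Wk: "W (of_int n, \<tau> * of_int m) \<le> G ^ k * real (Suc p) ^ (2 * k)" if "((n, m), y) \<in> supp (a $ p)" for n m y p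
 proof -
  have "\<bar>n\<bar> \<le> int (D * (p + s))" "\<bar>m\<bar> \<le> int (D * (p + s))" using w[of p] that by (auto simp: wcls_def)
  then have b: "\<bar>real_of_int n\<bar> \<le> real D * real (p + s)" "\<bar>real_of_int m\<bar> \<le> real D * real (p + s)"
   by (metis of_int_abs of_int_le_iff of_int_of_nat_eq of_nat_mult)+
  have ps: "real (p + s) \<le> real (Suc s) * real (Suc p)" unfolding of_nat_mult[symmetric] of_nat_le_iff by simp
  have c: "real D * real (p + s) \<le> real D * real (Suc s) * real (Suc p)" using mult_left_mono[OF ps, of "real D"] by (simp add: mult.assoc)
  have n2: "(real_of_int n)^2 \<le> (real D * real (Suc s) * real (Suc p))\<^sup>2" "(real_of_int m)^2 \<le> (real D * real (Suc s) * real (Suc p))\<^sup>2"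
   using b c by (metis abs_le_square_iff abs_of_nonneg mult_nonneg_nonneg of_nat_0_le_iff order_trans)+
  have gen: "1 + ((x * y)^2 + \<tau>^2 * (x * y)^2) = 1 + (1 + \<tau>^2) * x^2 * y^2" for x y :: real by (simp add: power_mult_distrib algebra_simps)
  have "1 + (norm (real_of_int n, \<tau> * of_int m))^2 = 1 + ((real_of_int n)^2 + \<tau>^2 * (real_of_int m)^2)" by (simp add: norm_Pair power_mult_distrib)
  also have "\<dots> \<le> 1 + ((real D * real (Suc s) * real (Suc p))^2 + \<tau>^2 * (real D * real (Suc s) * real (Suc p))^2)"
   using n2 by (intro add_mono mult_left_mono) auto
  also have "\<dots> = 1 + (1 + \<tau>^2) * (real D * real (Suc s))^2 * (real (Suc p))^2" by (rule gen)
  also have "\<dots> \<le> (real (Suc p))\<^sup>2 + (1 + \<tau>^2) * (real D * real (Suc s))^2 * (real (Suc p))^2"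
   by (intro add_right_mono) (simp add: one_le_power)
  also have "\<dots> = G * (real (Suc p))^2" by (simp add: G_def algebra_simps)
  finally have "W (of_int n, \<tau> * of_int m) \<le> (G * (real (Suc p))^2) ^ k" unfolding W_def by (intro power_mono) auto
  then show ?thesis by (simp only: power_mult_distrib power_mult)
 qed
 have main: "(\<lambda>X. rval \<tau> \<epsilon> a (X, 0)) \<in> sobolev \<tau> k \<and> sobolev_norm \<tau> k (\<lambda>X. rval \<tau> \<epsilon> a (X, 0)) \<le> B" if e2: "\<bar>\<epsilon>\<bar> \<le> r / 2" for \<epsilon>
 proof -
  define u where "u = (\<lambda>X. rval \<tau> \<epsilon> a (X, 0))"
  have \<epsilon>: "\<bar>\<epsilon>\<bar> \<le> r" using e2 r by linarith
  have uc: "continuous_on S u" for S unfolding u_def by (rule continuous_on_flat_rval[OF \<epsilon> a])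
  define idx where "idx K = (\<lfloor>fst K\<rfloor>, \<lfloor>snd K / \<tau>\<rfloor>)" for K :: plane
  have idx: "K = (of_int (fst (idx K)), \<tau> * of_int (snd (idx K)))" "even (fst (idx K) + snd (idx K))" if K: "K \<in> wave_lattice \<tau>" for K
  proof -
   obtain n m where nm: "even (n + m)" "K = (of_int n, \<tau> * of_int m)" using K unfolding wave_lattice_iff by (elim exE conjE)
   have "idx K = (n, m)" using \<tau> by (simp add: idx_def nm(2))
   then show "K = (of_int (fst (idx K)), \<tau> * of_int (snd (idx K)))" "even (fst (idx K) + snd (idx K))" using nm by simp_all
  qed
  have partial_le: "(\<Sum>K\<in>F. W K * norm (\<Sum>p<M. \<epsilon> ^ p * lk (a $ p) (idx K, 0))) \<le> B" if F: "finite F" "F \<subseteq> wave_lattice \<tau>" for F M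
  proof -
   have inj: "inj_on (\<lambda>K. (idx K, 0 :: real)) F" using idx(1) F(2) by (auto simp: inj_on_def) (metis subsetD)+
   have lk: "(\<Sum>K\<in>F. W K * norm (lk (a $ p) (idx K, 0))) \<le> G ^ k * real (Suc p) ^ (2 * k) * n1 (a $ p)" for p
   proof -
    have "(\<Sum>K\<in>F. W K * norm (lk (a $ p) (idx K, 0))) \<le> (\<Sum>K\<in>F. G ^ k * real (Suc p) ^ (2 * k) * norm (lk (a $ p) (idx K, 0)))"
    proof (rule sum_mono)
     fix K assume K: "K \<in> F"
     show "W K * norm (lk (a $ p) (idx K, 0)) \<le> G ^ k * real (Suc p) ^ (2 * k) * norm (lk (a $ p) (idx K, 0))"
     proof (cases "(idx K, 0) \<in> supp (a $ p)")
      case True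
      have "K \<in> wave_lattice \<tau>" using K F(2) by blast
      then have "W K = W (of_int (fst (idx K)), \<tau> * of_int (snd (idx K)))" by (rule arg_cong[OF idx(1)])
      also have "\<dots> \<le> G ^ k * real (Suc p) ^ (2 * k)" by (rule Wk[of _ _ 0]) (use True in simp)
      finally show ?thesis by (rule mult_right_mono) simp
     qed (simp add: in_keys_iff)
    qed
    also have "\<dots> = G ^ k * real (Suc p) ^ (2 * k) * (\<Sum>l\<in>(\<lambda>K. (idx K, 0)) ` F. norm (lk (a $ p) l))"
     by (simp add: sum.reindex[OF inj] sum_distrib_left)
    also have "(\<Sum>l\<in>(\<lambda>K. (idx K, 0)) ` F. norm (lk (a $ p) l)) \<le> n1 (a $ p)"
    proof -
     have "n1 (a $ p) = (\<Sum>l\<in>supp (a $ p) \<union> (\<lambda>K. (idx K, 0)) ` F. norm (lk (a $ p) l))"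
      unfolding n1_def by (rule lsum_superset) (use F in auto)
     then show ?thesis using F by (simp add: sum_mono2)
    qed
    finally show ?thesis using G1 by (simp add: mult_left_mono)
   qed
   have "(\<Sum>K\<in>F. W K * norm (\<Sum>p<M. \<epsilon> ^ p * lk (a $ p) (idx K, 0)))
    \<le> (\<Sum>K\<in>F. \<Sum>p<M. \<bar>\<epsilon>\<bar> ^ p * (W K * norm (lk (a $ p) (idx K, 0))))"
   proof (rule sum_mono)
    fix K
    have "W K * norm (\<Sum>p<M. \<epsilon> ^ p * lk (a $ p) (idx K, 0)) \<le> W K * (\<Sum>p<M. norm (\<epsilon> ^ p * lk (a $ p) (idx K, 0)))"
     using W1[of K] by (intro mult_left_mono norm_sum) auto
    then show "W K * norm (\<Sum>p<M. \<epsilon> ^ p * lk (a $ p) (idx K, 0)) \<le> (\<Sum>p<M. \<bar>\<epsilon>\<bar> ^ p * (W K * norm (lk (a $ p) (idx K, 0))))"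
     by (simp add: sum_distrib_left norm_mult norm_power mult.left_commute)
   qed
   also have "\<dots> = (\<Sum>p<M. \<bar>\<epsilon>\<bar> ^ p * (\<Sum>K\<in>F. W K * norm (lk (a $ p) (idx K, 0))))"
    by (subst sum.swap) (simp add: sum_distrib_left)
   also have "\<dots> \<le> (\<Sum>p<M. G ^ k * C * (n1 (a $ p) * r ^ p))"
   proof (rule sum_mono)
    fix p
    have "\<bar>\<epsilon>\<bar> ^ p * (\<Sum>K\<in>F. W K * norm (lk (a $ p) (idx K, 0))) \<le> (r / 2) ^ p * (G ^ k * real (Suc p) ^ (2 * k) * n1 (a $ p))"
     using e2 lk[of p] W1 by (intro mult_mono power_mono) (auto intro!: sum_nonneg mult_nonneg_nonneg W0)
    also have "\<dots> = G ^ k * (real (Suc p) ^ (2 * k) * (1 / 2) ^ p) * (n1 (a $ p) * r ^ p)" by (simp add: power_divide)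
    also have "\<dots> \<le> G ^ k * C * (n1 (a $ p) * r ^ p)" using C[of p] G1 r by (intro mult_right_mono mult_left_mono) auto
    finally show "\<bar>\<epsilon>\<bar> ^ p * (\<Sum>K\<in>F. W K * norm (lk (a $ p) (idx K, 0))) \<le> G ^ k * C * (n1 (a $ p) * r ^ p)" .
   qed
   also have "\<dots> \<le> B"
   proof -
    have "C \<ge> 0" using order_trans[OF _ C[of 0]] by simp
    then show ?thesis unfolding B_def sum_distrib_left[symmetric] using G1 r
     by (intro mult_left_mono sum_le_suminf[OF sm]) auto
   qed
   finally show ?thesis .
  qed
  have fc: "(\<lambda>M. \<Sum>p<M. \<epsilon> ^ p * lk (a $ p) (idx K, 0)) \<longlonglongrightarrow> fourier_coeff \<tau> u K" if "K \<in> wave_lattice \<tau>" for K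
   using rval_fourier[OF \<tau> \<epsilon> a w idx(2)[OF that]] idx(1)[OF that] unfolding u_def by simp
  have fin: "(\<Sum>K\<in>F. W K * (norm (fourier_coeff \<tau> u K))^2) \<le> B\<^sup>2" if F: "finite F" "F \<subseteq> wave_lattice \<tau>" for F
  proof -
   have "(\<lambda>M. \<Sum>K\<in>F. W K * norm (\<Sum>p<M. \<epsilon> ^ p * lk (a $ p) (idx K, 0))) \<longlonglongrightarrow> (\<Sum>K\<in>F. W K * norm (fourier_coeff \<tau> u K))"
    using F by (intro tendsto_sum tendsto_mult tendsto_const tendsto_norm fc) auto
   then have le: "(\<Sum>K\<in>F. W K * norm (fourier_coeff \<tau> u K)) \<le> B"
    by (rule Lim_bounded) (use partial_le[OF F] in auto)
   have "(\<Sum>K\<in>F. W K * (norm (fourier_coeff \<tau> u K))^2) \<le> (\<Sum>K\<in>F. (W K * norm (fourier_coeff \<tau> u K))\<^sup>2)"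
   proof (rule sum_mono)
    fix K
    have "W K * 1 \<le> W K * W K" using W1[of K] by (intro mult_left_mono) auto
    then show "W K * (norm (fourier_coeff \<tau> u K))^2 \<le> (W K * norm (fourier_coeff \<tau> u K))\<^sup>2"
     unfolding power_mult_distrib by (intro mult_right_mono) (auto simp: power2_eq_square)
   qed
   also have "\<dots> \<le> (\<Sum>K\<in>F. W K * norm (fourier_coeff \<tau> u K))\<^sup>2"
    by (rule sum_square_le[OF _ F(1)]) (use W1 in \<open>auto intro!: mult_nonneg_nonneg W0\<close>)
   also have "\<dots> \<le> B\<^sup>2" using le W1 by (intro power_mono sum_nonneg) (auto intro!: mult_nonneg_nonneg W0)
   finally show ?thesis .
  qed
  have summ: "(\<lambda>K. W K * (norm (fourier_coeff \<tau> u K))^2) summable_on wave_lattice \<tau>"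
   using W1 fin by (intro nonneg_bdd_above_summable_on bdd_aboveI2[where M = "B^2"]) (auto intro!: mult_nonneg_nonneg W0)
  have "B \<ge> 0" using partial_le[of "{}" 0] by simp
  moreover have il: "infsum (\<lambda>K. W K * (norm (fourier_coeff \<tau> u K))^2) (wave_lattice \<tau>) \<le> B\<^sup>2"
   by (rule infsum_le_finite_sums[OF summ fin])
  moreover have "sobolev_norm \<tau> k u \<le> sqrt (B^2)" unfolding sobolev_norm_def W_def[symmetric] by (rule real_sqrt_le_mono[OF il])
  ultimately have "sobolev_norm \<tau> k u \<le> B" by simp
  moreover have "u \<in> sobolev \<tau> k"
   unfolding sobolev_def
  proof (intro CollectI conjI)
   show "periodic \<tau> u" unfolding periodic_def u_def rval_def using rt_periodic[OF w] by simp
   have "u \<in> borel_measurable lborel" using borel_measurable_continuous_onI[OF uc[of UNIV]] by simp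
   then show "u \<in> borel_measurable lebesgue" by (rule measurable_completion)
   show "set_integrable lebesgue (period_cell \<tau>) (\<lambda>X. (u X)\<^sup>2)"
    unfolding period_cell_cbox by (intro absolutely_integrable_continuous continuous_intros uc)
   show "(\<lambda>K. (1 + (norm K)^2) ^ k * (norm (fourier_coeff \<tau> u K))^2) summable_on wave_lattice \<tau>" using summ by (simp add: W_def)
  qed
  ultimately show ?thesis by (simp add: u_def)
 qed
 then show ?thesis by blast
qed

section \<open>Symmetry of the values and membership in the symmetric space\<close>

lemma rt_reflect:
 "wcls D s1 s2 p t \<Longrightarrow> rt \<tau> t ((- x, y), z) = of_int s1 * rt \<tau> t ((x, y), z)"
 "wcls D s1 s2 p t \<Longrightarrow> rt \<tau> t ((x, - y), z) = of_int s2 * rt \<tau> t ((x, y), z)"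
proof -
 have 1: "ev (chi \<tau> ((- x, y), z)) t = ev (chi \<tau> ((x, y), z)) (sg1 t)" for t
  by (induction t rule: poly_mapping_induct) (auto simp: sg1_def gpush_add ev_add chi_def phase_def)
 have 2: "ev (chi \<tau> ((x, - y), z)) t = ev (chi \<tau> ((x, y), z)) (sg2 t)" for t
  by (induction t rule: poly_mapping_induct) (auto simp: sg2_def gpush_add ev_add chi_def phase_def)
 have c: "ev (chi \<tau> P) (of_int j * t) = of_int j * ev (chi \<tau> P) t" for j :: int and P t
 proof -
  have cj: "(of_int j :: wpoly) = cst (of_int j)"
   by (induction j rule: int_induct[where k = 0]) (simp_all add: single_add single_diff zero_prod_def flip: single_one)
  show ?thesis unfolding ev_mult[of "chi \<tau> P", OF chi_add] cj by (simp add: chi_def phase_def del: single_of_int)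
 qed
 show "rt \<tau> t ((- x, y), z) = of_int s1 * rt \<tau> t ((x, y), z)" if "wcls D s1 s2 p t"
  using that unfolding wcls_def rt_def 1 by (simp add: c)
 show "rt \<tau> t ((x, - y), z) = of_int s2 * rt \<tau> t ((x, y), z)" if "wcls D s1 s2 p t"
  using that unfolding wcls_def rt_def 2 by (simp add: c)
qed

text \<open>The mean is the Fourier coefficient at frequency 0, which oddness in x1 removes at every
  order.\<close>

lemma rval_mean_zero:
 assumes \<tau>: "\<tau> > 0" and \<epsilon>: "\<bar>\<epsilon>\<bar> \<le> r" and a: "goodf r a" and w: "\<And>p. wcls D (-1) s2 (p + s) (a $ p)"
 shows "(LINT X : period_cell \<tau> | lebesgue. rval \<tau> \<epsilon> a (X, 0)) = 0"
proof -
 let ?u = "\<lambda>X. rval \<tau> \<epsilon> a (X, 0)"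
 have l0: "lk (a $ p) ((0, 0), 0) = 0" for p
 proof (rule ccontr)
  assume "\<not> ?thesis"
  then have "((0, 0), 0) \<in> supp (a $ p)" by (simp add: in_keys_iff)
  from wcls_odd[OF w this] show False by simp
 qed
 have "fourier_coeff \<tau> ?u (of_int 0, \<tau> * of_int 0) = 0"
  by (rule LIMSEQ_unique[OF rval_fourier[OF \<tau> \<epsilon> a w]]) (simp_all add: l0)
 then have f0: "(LINT X : period_cell \<tau> | lebesgue. complex_of_real (?u X)) = 0"
  unfolding fourier_coeff_def measure_period_cell[OF \<tau>] using \<tau> by (simp add: zero_prod_def[symmetric])
 have c: "continuous_on (cbox (0, 0) (2 * pi, pi / \<tau>)) ?u" by (rule continuous_on_flat_rval[OF \<epsilon> a])
 then have i: "(?u has_integral integral (period_cell \<tau>) ?u) (period_cell \<tau>)" unfolding period_cell_cbox by (intro integrable_integral integrable_continuous)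
 have "((\<lambda>X. complex_of_real (?u X)) has_integral of_real (integral (period_cell \<tau>) ?u)) (period_cell \<tau>)"
  using has_integral_linear[OF i bounded_linear_of_real] by (simp add: o_def)
 then have "integral (period_cell \<tau>) (\<lambda>X. complex_of_real (?u X)) = of_real (integral (period_cell \<tau>) ?u)" by (rule integral_unique)
 moreover have "(LINT X : period_cell \<tau> | lebesgue. complex_of_real (?u X)) = integral (period_cell \<tau>) (\<lambda>X. complex_of_real (?u X))"
  unfolding period_cell_cbox by (intro set_lebesgue_integral_eq_integral absolutely_integrable_continuous continuous_on_of_real c)
 moreover have "(LINT X : period_cell \<tau> | lebesgue. ?u X) = integral (period_cell \<tau>) ?u"
  unfolding period_cell_cbox by (intro set_lebesgue_integral_eq_integral absolutely_integrable_continuous c)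
 ultimately show ?thesis using f0 by simp
qed

lemma HH_S_rval:
 assumes \<tau>: "\<tau> > 0" and r: "r > 0" and a: "goodf r a" "\<And>p. wcls D (-1) 1 (p + s) (a $ p)" and b: "goodf r b" "\<And>p. wcls D 1 1 (p + s) (b $ p)"
 shows "\<exists>B. \<forall>\<epsilon>. \<bar>\<epsilon>\<bar> \<le> r / 2 \<longrightarrow> (\<lambda>X. rval \<tau> \<epsilon> a (X, 0), \<lambda>X. rval \<tau> \<epsilon> b (X, 0)) \<in> HH_S \<tau> k
  \<and> HH_norm \<tau> k (\<lambda>X. rval \<tau> \<epsilon> a (X, 0), \<lambda>X. rval \<tau> \<epsilon> b (X, 0)) \<le> B"
proof -
 obtain A where A: "\<And>\<epsilon>. \<bar>\<epsilon>\<bar> \<le> r / 2 \<Longrightarrow> (\<lambda>X. rval \<tau> \<epsilon> a (X, 0)) \<in> sobolev \<tau> k \<and> sobolev_norm \<tau> k (\<lambda>X. rval \<tau> \<epsilon> a (X, 0)) \<le> A"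
  using sobolev_rval[OF \<tau> r a] by blast
 obtain B where B: "\<And>\<epsilon>. \<bar>\<epsilon>\<bar> \<le> r / 2 \<Longrightarrow> (\<lambda>X. rval \<tau> \<epsilon> b (X, 0)) \<in> sobolev \<tau> k \<and> sobolev_norm \<tau> k (\<lambda>X. rval \<tau> \<epsilon> b (X, 0)) \<le> B"
  using sobolev_rval[OF \<tau> r b] by blast
 have nn0: "0 \<le> sobolev_norm \<tau> k u" for u unfolding sobolev_norm_def by (simp add: infsum_nonneg)
 have "(\<lambda>X. rval \<tau> \<epsilon> a (X, 0), \<lambda>X. rval \<tau> \<epsilon> b (X, 0)) \<in> HH_S \<tau> k
  \<and> HH_norm \<tau> k (\<lambda>X. rval \<tau> \<epsilon> a (X, 0), \<lambda>X. rval \<tau> \<epsilon> b (X, 0)) \<le> sqrt (A^2 + B^2)" if e: "\<bar>\<epsilon>\<bar> \<le> r / 2" for \<epsilon>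
 proof
  have e': "\<bar>\<epsilon>\<bar> \<le> r" using e r by linarith
  have mz: "(LINT X : period_cell \<tau> | lebesgue. rval \<tau> \<epsilon> a (X, 0)) = 0" by (rule rval_mean_zero[OF \<tau> e' a])
  have sa: "rval \<tau> \<epsilon> a ((- x, y), 0) = - rval \<tau> \<epsilon> a ((x, y), 0)" "rval \<tau> \<epsilon> a ((x, - y), 0) = rval \<tau> \<epsilon> a ((x, y), 0)" for x y
   using rval_summable[OF e' goodf_imp_good[OF less_imp_le[OF r] a(1)], of "((x, y), 0)"] unfolding rval_def rt_reflect[OF a(2)] by (simp_all add: suminf_minus)
  have sb: "rval \<tau> \<epsilon> b ((- x, y), 0) = rval \<tau> \<epsilon> b ((x, y), 0)" "rval \<tau> \<epsilon> b ((x, - y), 0) = rval \<tau> \<epsilon> b ((x, y), 0)" for x y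
   unfolding rval_def rt_reflect[OF b(2)] by simp_all
  show "(\<lambda>X. rval \<tau> \<epsilon> a (X, 0), \<lambda>X. rval \<tau> \<epsilon> b (X, 0)) \<in> HH_S \<tau> k"
   unfolding HH_S_def HH_def sobolev0_def using A[OF e] B[OF e] mz sa sb by simp
  show "HH_norm \<tau> k (\<lambda>X. rval \<tau> \<epsilon> a (X, 0), \<lambda>X. rval \<tau> \<epsilon> b (X, 0)) \<le> sqrt (A^2 + B^2)"
   unfolding HH_norm_def fst_conv snd_conv using A[OF e] B[OF e] nn0 by (intro real_sqrt_le_mono add_mono power_mono) auto
 qed
 then show ?thesis by blast
qed

section \<open>Approximate waves\<close>

lemma fcong_E:
 assumes "fcong M \<phi> \<phi>'"
 shows "fcong M (E1 \<tau> \<eta> \<phi>) (E1 \<tau> \<eta> \<phi>')" "fcong M (E2 \<tau> m \<eta> \<phi>) (E2 \<tau> m \<eta> \<phi>')"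
proof -
 have A: "fcong M (A1 \<eta> \<phi>) (A1 \<eta> \<phi>')" "fcong M (A2 \<tau> \<eta> \<phi>) (A2 \<tau> \<eta> \<phi>')" "fcong M (A3 \<eta> \<phi>) (A3 \<eta> \<phi>')"
  unfolding A1_def A2_def A3_def by (intro fcong_fm fcong_Sub_cong assms)+
 show "fcong M (E1 \<tau> \<eta> \<phi>) (E1 \<tau> \<eta> \<phi>')" unfolding E1_def by (intro fcong_diff fcong_mult fcong_refl A)
 show "fcong M (E2 \<tau> m \<eta> \<phi>) (E2 \<tau> m \<eta> \<phi>')" unfolding E2_def by (intro fcong_add fcong_mult fcong_power fcong_refl A)
qed

lemma Sub_nth_lt_2:
 assumes "\<eta> $ 0 = 0" "\<phi> $ 0 = 0" "q < 2" shows "Sub \<eta> \<phi> $ q = \<phi> $ q"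
proof -
 have "\<phi> = fps_X ^ 1 * fps_shift 1 \<phi>" by (rule fps_ext) (use assms(2) in \<open>auto simp: fps_X_power_mult_nth\<close>)
 then have "fcong 2 (Sub \<eta> \<phi>) \<phi>" using Sub_perturb1[of \<eta> 0 1 0 "fps_shift 1 \<phi>"] assms(1) by (simp add: numeral_2_eq_2)
 then show ?thesis using assms(3) by (simp add: fcong_iff)
qed

lemma rt_single: "rt \<tau> (mon ((n, m), 0) c) (X, 0)
 = Re c * cos (of_int n * fst X + \<tau> * of_int m * snd X) - Im c * sin (of_int n * fst X + \<tau> * of_int m * snd X)"
proof -
 have "chi \<tau> (X, 0) ((n, m), 0) = cis (of_int n * fst X + \<tau> * of_int m * snd X)" by (simp add: chi_def phase_def cis_conv_exp)
 then show ?thesis by (simp add: rt_def)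
qed

lemma rt_leading:
 "rt \<tau> (z0 (phi1 \<tau>)) ((x, y), 0) = sin x * cos (\<tau> * y)"
 "rt \<tau> (eta1 \<tau>) ((x, y), 0) = - (1 / mu_c \<tau>) * (cos x * cos (\<tau> * y))"
proof -
 show "rt \<tau> (z0 (phi1 \<tau>)) ((x, y), 0) = sin x * cos (\<tau> * y)"
  unfolding phi1_def z0_wv unfolding wv_def rt_add rt_single by (simp add: sin_add sin_diff field_simps)
 define c where "c = - 1 / (4 * mu_c \<tau>)"
 have "rt \<tau> (eta1 \<tau>) ((x, y), 0) = 4 * c * (cos x * cos (\<tau> * y))"
  unfolding eta1_def c_def[symmetric] wv_def rt_add rt_single by (simp add: cos_add cos_diff algebra_simps)
 then show "rt \<tau> (eta1 \<tau>) ((x, y), 0) = - (1 / mu_c \<tau>) * (cos x * cos (\<tau> * y))" by (simp add: c_def)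
qed

lemma rval_finite:
 assumes "\<And>p. p \<notin> {1..N} \<Longrightarrow> a $ p = 0"
 shows "rval \<tau> \<epsilon> a P = (\<Sum>p=1..N. \<epsilon> ^ p * rt \<tau> (a $ p) P)"
 unfolding rval_def by (rule suminf_finite) (use assms in auto)

lemma goodf_shift:
 assumes "r > 0" "goodf r a" shows "goodf r (fps_shift s a)"
proof -
 have "summable (\<lambda>p. n1 (a $ (p + s)) * r ^ (p + s) / r ^ s)"
  using assms(2) by (intro summable_divide) (simp add: goodf_def summable_iff_shift[of "\<lambda>p. n1 (a $ p) * r ^ p"])
 then have "summable (\<lambda>p. n1 (fps_shift s a $ p) * r ^ p)" using assms(1) by (simp add: power_add)
 then show ?thesis using assms(2) by (simp add: goodf_def)
qed

lemma rval_shift: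
 assumes r: "r > 0" "\<bar>\<epsilon>\<bar> \<le> r" and a: "goodf r a" "\<And>q. q < s \<Longrightarrow> a $ q = 0"
 shows "rval \<tau> \<epsilon> a (X, 0) = \<epsilon> ^ s * rval \<tau> \<epsilon> (fps_shift s a) (X, 0)"
proof -
 have g: "good r a" "good r (fps_shift s a)" using goodf_imp_good[OF less_imp_le[OF r(1)]] a(1) goodf_shift[OF r(1) a(1)] by auto
 have "rval \<tau> \<epsilon> a (X, 0) = suminf (\<lambda>p. \<epsilon> ^ (p + s) * rt \<tau> (a $ (p + s)) (X, 0)) + (\<Sum>p<s. \<epsilon> ^ p * rt \<tau> (a $ p) (X, 0))"
  unfolding rval_def by (rule suminf_split_initial_segment[OF rval_summable[OF r(2) g(1)]]) simp
 also have "(\<Sum>p<s. \<epsilon> ^ p * rt \<tau> (a $ p) (X, 0)) = 0" using a(2) by simp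
 also have "suminf (\<lambda>p. \<epsilon> ^ (p + s) * rt \<tau> (a $ (p + s)) (X, 0)) = suminf (\<lambda>p. \<epsilon> ^ s * (\<epsilon> ^ p * rt \<tau> (fps_shift s a $ p) (X, 0)))"
  by (simp add: power_add mult_ac)
 also have "\<dots> = \<epsilon> ^ s * rval \<tau> \<epsilon> (fps_shift s a) (X, 0)"
  unfolding rval_def by (rule suminf_mult[OF rval_summable[OF r(2) g(2)]]) simp
 finally show ?thesis by simp
qed

text \<open>The wave consists of \<open>Psi\<close>, the trace of \<phi> on the surface, and \<eta>;
  both are polynomials of degree at most N in \<epsilon>. The potential and the defects
  \<open>G1\<close>, \<open>G2\<close> are genuine series, and Q is the pair of defects divided by
  \<epsilon>^(N + 1).\<close>

lemma approximate_waves: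
 assumes N: "N \<ge> 3" and \<tau>: "\<tau> > 0"
  and disc: "{(n::nat, m::nat). n > 0 \<and> m > 0 \<and> m\<^sup>2 + n^2 \<le> N\<^sup>2 \<and>
     (real n)\<^sup>2 + \<tau>^2 * (real m)^2 = (mu_c \<tau>) powi (-2) * real n ^ 4} = {(1, 1)}"
 shows "\<exists>(U :: nat \<Rightarrow> wave) (\<mu> :: real \<Rightarrow> real) (Q :: real \<Rightarrow> wave) (\<epsilon>\<^sub>0 :: real).
     \<epsilon>\<^sub>0 > 0 \<and>
     U 1 = leading_wave \<tau> \<and>
     (\<forall>\<epsilon> k. \<bar>\<epsilon>\<bar> < \<epsilon>\<^sub>0 \<longrightarrow> expansion N U \<epsilon> \<in> HH_S \<tau> k) \<and>
     (\<lambda>\<epsilon>. \<mu> \<epsilon> - mu_c \<tau> - mu1 \<tau> * \<epsilon>^2) \<in> O[nhds 0](\<lambda>\<epsilon>. \<epsilon> ^ 4) \<and>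
     (\<forall>\<epsilon>. \<bar>\<epsilon>\<bar> < \<epsilon>\<^sub>0 \<longrightarrow>
      FF \<tau> (expansion N U \<epsilon>) (\<mu> \<epsilon>) u0 = scale_wave (\<epsilon> ^ (N + 1)) (Q \<epsilon>)) \<and>
     (\<forall>k. \<exists>C. \<forall>\<epsilon>. \<bar>\<epsilon>\<bar> < \<epsilon>\<^sub>0 \<longrightarrow> Q \<epsilon> \<in> HH_S \<tau> k \<and> HH_norm \<tau> k (Q \<epsilon>) \<le> C)"
proof -
 obtain D \<eta> \<phi>0 m where F: "fsol \<tau> D (Suc N) \<eta> \<phi>0 m" and m2: "m $ 2 = mu1 \<tau>"
  using formal_solution[OF assms] by (elim exE conjE)
 from F have c\<eta>: "wCl D 1 1 \<eta>" and c\<phi>0: "wCl D (-1) 1 \<phi>0" and fl: "\<And>p. flat (\<eta> $ p)" and ha0: "\<And>p. harm \<tau> (\<phi>0 $ p)"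
  and z: "\<eta> $ 0 = 0" "\<phi>0 $ 0 = 0" and one: "\<eta> $ 1 = eta1 \<tau>" "\<phi>0 $ 1 = phi1 \<tau>" and hi: "\<And>p. p \<ge> Suc N \<Longrightarrow> \<eta> $ p = 0"
  and m: "m $ 0 = mu_c \<tau>" "\<And>p. odd p \<Longrightarrow> m $ p = 0" "\<And>p. p \<ge> Suc N \<Longrightarrow> m $ p = 0"
  and Z: "\<And>q. q < Suc N \<Longrightarrow> E1 \<tau> \<eta> \<phi>0 $ q = 0" "\<And>q. q < Suc N \<Longrightarrow> E2 \<tau> (cfm m) \<eta> \<phi>0 $ q = 0"
  unfolding fsol_def by blast+
 obtain \<phi> where c\<phi>: "wCl D (-1) 1 \<phi>" and ha: "\<And>p. harm \<tau> (\<phi> $ p)" and z\<phi>: "\<phi> $ 0 = 0" and eq: "\<And>p. p \<le> N \<Longrightarrow> \<phi> $ p = \<phi>0 $ p"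
  and tr: "\<And>p. p > N \<Longrightarrow> z0 (Sub \<eta> \<phi> $ p) = 0"
  by (rule trace_extension[OF c\<eta> z(1) c\<phi>0 ha0 z(2), of N]) (rule that, assumption+)
 obtain ra where ra: "ra > 0" "\<And>r. 0 \<le> r \<Longrightarrow> r \<le> ra \<Longrightarrow> summable (\<lambda>p. nops \<tau> (Sub \<eta> \<phi> $ p) * r ^ p)"
  by (rule Sub_summable[where M = "Suc N" and N = N, OF c\<eta> z(1) fl _ c\<phi> ha], rule hi, assumption, rule tr, assumption, rule that, assumption+)
 \<comment> \<open>The series of |\<nabla>\<eta>|^2, for the denominator in the Bernoulli
   condition.\<close>
 define q where "q = (fm d1 \<eta>)^2 + (fm (d2 \<tau>) \<eta>)^2"
 have cq: "wCl D 1 1 q" unfolding q_def power2_eq_square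
  using wCl_mult[OF wCl_d1[OF c\<eta>] wCl_d1[OF c\<eta>]] wCl_mult[OF wCl_d2[OF c\<eta>, of \<tau>] wCl_d2[OF c\<eta>, of \<tau>]] by (intro wCl_add) simp_all
 have flq: "flat (q $ p)" for p unfolding q_def power2_eq_square fps_add_nth
  by (intro flat_add flat_fm_mult; simp add: flat_d fl)
 have q0: "q $ 0 = 0" by (simp add: q_def power2_eq_square z)
 have hiq: "q $ p = 0" if p: "p > 2 * Suc N" for p
 proof -
  have "(fm f \<eta> * fm f \<eta>) $ p = 0" if "f 0 = 0" for f :: "wpoly \<Rightarrow> wpoly"
   unfolding fps_mult_nth
  proof (rule sum.neutral, rule ballI)
   fix i assume "i \<in> {0..p}"
   then have "i \<ge> Suc N \<or> p - i \<ge> Suc N" using p by auto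
   then show "fm f \<eta> $ i * fm f \<eta> $ (p - i) = 0" using hi that by auto
  qed
  from this[of d1] this[of "d2 \<tau>"] show ?thesis by (simp add: q_def power2_eq_square)
 qed
 obtain iv rb where iv: "(1 + q) * iv = 1" "wCl D 1 1 iv" "\<And>p. flat (iv $ p)" and rb: "rb > 0" "\<And>r. 0 \<le> r \<Longrightarrow> r \<le> rb \<Longrightarrow> goodf r iv"
  by (rule inverse_summable[where M = "2 * Suc N", OF cq q0 flq], rule hiq, assumption, rule that, assumption+)
 define r where "r = min ra rb"
 have r: "r > 0" "r \<ge> 0" "r \<le> ra" "r \<le> rb" using ra(1) rb(1) by (auto simp: r_def)
 note su = ra(2)[OF r(2,3)] and giv = rb(2)[OF r(2,4)]
 define Psi where "Psi = fm z0 (Sub \<eta> \<phi>)"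
 define G1 where "G1 = E1 \<tau> \<eta> \<phi>"
 define G2 where "G2 = E2 \<tau> (cfm m) \<eta> \<phi> - fcst (1/2) * (G1^2 * iv)"
 have cPsi: "wCl D (-1) 1 Psi" unfolding Psi_def by (rule wCl_z0[OF wCl_Sub[OF c\<eta> c\<phi>]])
 have Psi0: "Psi $ p = 0" if "p \<notin> {1..N}" for p
 proof (cases "p = 0")
  case True
  then show ?thesis using Sub_nth_lt_2[OF z(1) z\<phi>, of 0] z\<phi> by (simp add: Psi_def)
 next
  case False
  then show ?thesis using that tr[of p] by (simp add: Psi_def)
 qed
 have eta0: "\<eta> $ p = 0" if "p \<notin> {1..N}" for p using that z(1) hi[of p] by (cases "p = 0") auto
 have rho: "rho (a $ p) = a $ p" if "wCl D s1 s2 a" for a p s1 s2 using that by (simp add: wCl_def wcls_def)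
 have gPsi: "goodf r Psi" by (rule goodf_finite[OF r(2) rho[OF cPsi], of "Suc N"]) (use Psi0 in \<open>auto simp: Psi_def\<close>)
 have g\<eta>: "goodf r \<eta>" by (rule goodf_finite[OF r(2) rho[OF c\<eta>] fl hi])
 have ccm: "wCl D 1 1 (cfm m)" by (rule wCl_cfm[OF m(2)])
 have gm: "goodf r (cfm m)" by (rule goodf_finite[OF r(2) rho[OF ccm], of "Suc N"]) (use m(3) in auto)
 \<comment> \<open>The extension of \<phi>0 starts beyond order N, so the surface conditions still
   hold below order N + 1.\<close>
 have E: "fcong (Suc N) \<phi> \<phi>0" using eq by (simp add: fcong_iff)
 have ZG1: "G1 $ p = 0" if "p < Suc N" for p
  using fcong_E(1)[OF E, of \<tau> \<eta>] Z(1)[OF that] that by (simp add: fcong_iff G1_def)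
 have ZG2: "G2 $ p = 0" if p: "p < Suc N" for p
 proof -
  have "fcong (Suc N) G1 0" using ZG1 by (simp add: fcong_iff)
  then have "fcong (Suc N) (fcst (1/2) * (G1^2 * iv)) (fcst (1/2) * (0\<^sup>2 * iv))" by (intro fcong_mult fcong_power fcong_refl)
  then have "(fcst (1/2) * (G1^2 * iv)) $ p = 0" using p by (simp add: fcong_iff)
  moreover have "E2 \<tau> (cfm m) \<eta> \<phi> $ p = 0" using fcong_E(2)[OF E, of \<tau> "cfm m" \<eta>] Z(2)[OF p] p by (simp add: fcong_iff)
  ultimately show ?thesis by (simp add: G2_def)
 qed
 have cG1: "wCl D (-1) 1 G1" unfolding G1_def by (rule wCl_E1[OF c\<eta> c\<phi>])
 have cG2: "wCl D 1 1 G2"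
 proof -
  have "wCl D 1 1 (G1^2)" unfolding power2_eq_square using wCl_mult[OF cG1 cG1] by simp
  from wCl_mult[OF this iv(2)] have "wCl D 1 1 (G1^2 * iv)" by simp
  from wCl_fcst_mult[OF this, of "1/2"] have "wCl D 1 1 (fcst (1/2) * (G1^2 * iv))" by simp
  then show ?thesis unfolding G2_def by (intro wCl_diff wCl_E2[OF c\<eta> c\<phi> ccm])
 qed
 have r0: "\<bar>0::real\<bar> \<le> r" using r by simp
 have iv': "(1 + ((fm d1 \<eta>)^2 + (fm (d2 \<tau>) \<eta>)^2)) * iv = 1" using iv(1) by (simp add: q_def)
 note hyps = \<tau> c\<eta> z(1) fl hi c\<phi> ha su
 have gG1: "goodf r G1" unfolding G1_def by (rule E1_goodf) (rule r0 hyps, assumption?)+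
 have gG2: "goodf r G2" unfolding G2_def G1_def by (rule F2_eq(2)) (rule r0 hyps gm iv' giv, assumption?)+
 define U :: "nat \<Rightarrow> wave" where "U p = (\<lambda>X. rt \<tau> (Psi $ p) (X, 0), \<lambda>X. rt \<tau> (\<eta> $ p) (X, 0))" for p
 define \<mu> where "\<mu> \<epsilon> = (\<Sum>p\<le>N. m $ p * \<epsilon> ^ p)" for \<epsilon> :: real
 define Q :: "real \<Rightarrow> wave" where "Q \<epsilon> = (\<lambda>X. rval \<tau> \<epsilon> (fps_shift (N + 1) G1) (X, 0), \<lambda>X. rval \<tau> \<epsilon> (fps_shift (N + 1) G2) (X, 0))" for \<epsilon>
 have expn: "expansion N U \<epsilon> = (\<lambda>X. rval \<tau> \<epsilon> Psi (X, 0), \<lambda>X. rval \<tau> \<epsilon> \<eta> (X, 0))" for \<epsilon>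
 proof -
  have "rval \<tau> \<epsilon> Psi P = (\<Sum>p=1..N. \<epsilon> ^ p * rt \<tau> (Psi $ p) P)" "rval \<tau> \<epsilon> \<eta> P = (\<Sum>p=1..N. \<epsilon> ^ p * rt \<tau> (\<eta> $ p) P)" for P
   by (rule rval_finite, rule Psi0, assumption) (rule rval_finite, rule eta0, assumption)
  then show ?thesis unfolding expansion_def U_def by simp
 qed
 have mu: "rval \<tau> \<epsilon> (cfm m) (X, 0) = \<mu> \<epsilon>" for \<epsilon> X
  unfolding rval_def \<mu>_def by (subst suminf_finite[of "{..N}"]) (use m(3) in \<open>auto simp: rt_cst mult.commute\<close>)
 have "U 1 = leading_wave \<tau>"
 proof -
  have "Psi $ 1 = z0 (phi1 \<tau>)" using Sub_nth_lt_2[OF z(1) z\<phi>, of 1] eq[of 1] one N by (simp add: Psi_def del: One_nat_def)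
  then show ?thesis unfolding U_def leading_wave_def one(1) by (auto simp: fun_eq_iff rt_leading simp del: One_nat_def)
 qed
 moreover have "\<forall>\<epsilon> k. \<bar>\<epsilon>\<bar> < r / 2 \<longrightarrow> expansion N U \<epsilon> \<in> HH_S \<tau> k"
 proof (intro allI impI)
  fix \<epsilon> k assume e: "\<bar>\<epsilon>\<bar> < r / 2"
  have w: "wcls D (-1) 1 (p + 0) (Psi $ p)" "wcls D 1 1 (p + 0) (\<eta> $ p)" for p using cPsi c\<eta> by (simp_all add: wCl_def)
  obtain B where "\<forall>\<epsilon>. \<bar>\<epsilon>\<bar> \<le> r / 2 \<longrightarrow> (\<lambda>X. rval \<tau> \<epsilon> Psi (X, 0), \<lambda>X. rval \<tau> \<epsilon> \<eta> (X, 0)) \<in> HH_S \<tau> k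
   \<and> HH_norm \<tau> k (\<lambda>X. rval \<tau> \<epsilon> Psi (X, 0), \<lambda>X. rval \<tau> \<epsilon> \<eta> (X, 0)) \<le> B"
   using HH_S_rval[OF \<tau> r(1) gPsi w(1) g\<eta> w(2), of k] by (rule exE)
  from this[rule_format, OF less_imp_le[OF e]] show "expansion N U \<epsilon> \<in> HH_S \<tau> k" unfolding expn by (rule conjunct1)
 qed
 moreover have "(\<lambda>\<epsilon>. \<mu> \<epsilon> - mu_c \<tau> - mu1 \<tau> * \<epsilon>^2) \<in> O[nhds 0](\<lambda>\<epsilon>. \<epsilon> ^ 4)"
 \<comment> \<open>The odd coefficients of \<mu> vanish, so after order two the next one is of order
   four.\<close>
 proof (rule bigoI[of _ "\<Sum>p=4..N. \<bar>m $ p\<bar>"])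
  have "norm (\<mu> \<epsilon> - mu_c \<tau> - mu1 \<tau> * \<epsilon>^2) \<le> (\<Sum>p=4..N. \<bar>m $ p\<bar>) * norm (\<epsilon> ^ 4)" if e: "dist \<epsilon> 0 < 1" for \<epsilon> :: real
  proof -
   have "{..N} = {0, 1, 2, 3} \<union> {4..N}" using N by auto
   then have "\<mu> \<epsilon> = (\<Sum>p\<in>{0, 1, 2, 3} \<union> {4..N}. m $ p * \<epsilon> ^ p)" by (simp add: \<mu>_def)
   also have "\<dots> = (\<Sum>p\<in>{0, 1, 2, 3}. m $ p * \<epsilon> ^ p) + (\<Sum>p=4..N. m $ p * \<epsilon> ^ p)" by (rule sum.union_disjoint) auto
   also have "(\<Sum>p\<in>{0, 1, 2, 3}. m $ p * \<epsilon> ^ p) = mu_c \<tau> + mu1 \<tau> * \<epsilon>^2"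
    using m(1) m(2)[of 1] m(2)[of 3] m2 by simp
   finally have "norm (\<mu> \<epsilon> - mu_c \<tau> - mu1 \<tau> * \<epsilon>^2) = \<bar>\<Sum>p=4..N. m $ p * \<epsilon> ^ p\<bar>" by simp
   also have "\<dots> \<le> (\<Sum>p=4..N. \<bar>m $ p\<bar> * \<bar>\<epsilon>\<bar> ^ 4)"
   proof (rule order_trans[OF sum_abs sum_mono])
    fix p assume "p \<in> {4..N}"
    then have "\<bar>\<epsilon>\<bar> ^ p \<le> \<bar>\<epsilon>\<bar> ^ 4" using e by (intro power_decreasing) auto
    then show "\<bar>m $ p * \<epsilon> ^ p\<bar> \<le> \<bar>m $ p\<bar> * \<bar>\<epsilon>\<bar> ^ 4" by (simp add: abs_mult power_abs mult_left_mono)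
   qed
   finally show ?thesis by (simp add: sum_distrib_right norm_power)
  qed
  then show "\<forall>\<^sub>F \<epsilon> in nhds 0. norm (\<mu> \<epsilon> - mu_c \<tau> - mu1 \<tau> * \<epsilon>^2) \<le> (\<Sum>p=4..N. \<bar>m $ p\<bar>) * norm (\<epsilon> ^ 4)"
   unfolding eventually_nhds_metric by (intro exI[of _ 1]) simp
 qed
 moreover have "\<forall>\<epsilon>. \<bar>\<epsilon>\<bar> < r / 2 \<longrightarrow> FF \<tau> (expansion N U \<epsilon>) (\<mu> \<epsilon>) u0 = scale_wave (\<epsilon> ^ (N + 1)) (Q \<epsilon>)"
 proof (intro allI impI)
  fix \<epsilon> :: real assume "\<bar>\<epsilon>\<bar> < r / 2"
  then have er: "\<bar>\<epsilon>\<bar> \<le> r" using r by linarith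
  have 1: "F1 \<tau> (expansion N U \<epsilon>) (\<mu> \<epsilon>) u0 X = rval \<tau> \<epsilon> G1 (X, 0)" for X
   unfolding expn Psi_def G1_def by (rule F1_eq) (rule er hyps, assumption?)+
  have 2: "F2 (expansion N U \<epsilon>) (\<mu> \<epsilon>) u0 X = rval \<tau> \<epsilon> G2 (X, 0)" for X
   unfolding expn Psi_def G1_def G2_def mu[of \<epsilon> X, symmetric] by (rule F2_eq(1)) (rule er hyps gm iv' giv, assumption?)+
  show "FF \<tau> (expansion N U \<epsilon>) (\<mu> \<epsilon>) u0 = scale_wave (\<epsilon> ^ (N + 1)) (Q \<epsilon>)"
   unfolding FF_def scale_wave_def Q_def prod.inject fun_eq_iff fst_conv snd_conv 1 2
   by (intro conjI allI rval_shift[OF r(1) er gG1] rval_shift[OF r(1) er gG2]) (use ZG1 ZG2 in auto)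
 qed
 moreover have "\<forall>k. \<exists>C. \<forall>\<epsilon>. \<bar>\<epsilon>\<bar> < r / 2 \<longrightarrow> Q \<epsilon> \<in> HH_S \<tau> k \<and> HH_norm \<tau> k (Q \<epsilon>) \<le> C"
 proof
  fix k
  have w: "wcls D (-1) 1 (p + (N + 1)) (fps_shift (N + 1) G1 $ p)" "wcls D 1 1 (p + (N + 1)) (fps_shift (N + 1) G2 $ p)" for p
   using cG1 cG2 by (simp_all add: wCl_def)
  obtain B where "\<forall>\<epsilon>. \<bar>\<epsilon>\<bar> \<le> r / 2 \<longrightarrow> Q \<epsilon> \<in> HH_S \<tau> k \<and> HH_norm \<tau> k (Q \<epsilon>) \<le> B"
   using HH_S_rval[OF \<tau> r(1) goodf_shift[OF r(1) gG1] w(1) goodf_shift[OF r(1) gG2] w(2), of k] unfolding Q_def by (rule exE)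
  then show "\<exists>C. \<forall>\<epsilon>. \<bar>\<epsilon>\<bar> < r / 2 \<longrightarrow> Q \<epsilon> \<in> HH_S \<tau> k \<and> HH_norm \<tau> k (Q \<epsilon>) \<le> C" by (intro exI[of _ B]) (simp add: less_imp_le)
 qed
 moreover have "r / 2 > 0" using r by simp
 ultimately show ?thesis by (intro exI[of _ U] exI[of _ \<mu>] exI[of _ Q] exI[of _ "r / 2"] conjI)
qed

theorem lemma1p2:
  shows "(\<forall>(N::nat) (\<tau>::real). N \<ge> 3 \<and> \<tau> > 0 \<and>
      {(n::nat, m::nat). n > 0 \<and> m > 0 \<and> m\<^sup>2 + n\<^sup>2 \<le> N\<^sup>2 \<and>
         (real n)\<^sup>2 + \<tau>\<^sup>2 * (real m)\<^sup>2 = (mu_c \<tau>) powi (-2) * real n ^ 4} = {(1, 1)} \<longrightarrow>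
      (\<exists>(U :: nat \<Rightarrow> wave) (\<mu> :: real \<Rightarrow> real) (Q :: real \<Rightarrow> wave) (\<epsilon>\<^sub>0 :: real).
         \<epsilon>\<^sub>0 > 0 \<and>
         U 1 = leading_wave \<tau> \<and>
         (\<forall>\<epsilon> k. \<bar>\<epsilon>\<bar> < \<epsilon>\<^sub>0 \<longrightarrow> expansion N U \<epsilon> \<in> HH_S \<tau> k) \<and>
         (\<lambda>\<epsilon>. \<mu> \<epsilon> - mu_c \<tau> - mu1 \<tau> * \<epsilon>\<^sup>2) \<in> O[nhds 0](\<lambda>\<epsilon>. \<epsilon> ^ 4) \<and>
         (\<forall>\<epsilon>. \<bar>\<epsilon>\<bar> < \<epsilon>\<^sub>0 \<longrightarrow>
            FF \<tau> (expansion N U \<epsilon>) (\<mu> \<epsilon>) u0 = scale_wave (\<epsilon> ^ (N + 1)) (Q \<epsilon>)) \<and>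
         (\<forall>k. \<exists>C. \<forall>\<epsilon>. \<bar>\<epsilon>\<bar> < \<epsilon>\<^sub>0 \<longrightarrow> Q \<epsilon> \<in> HH_S \<tau> k \<and> HH_norm \<tau> k (Q \<epsilon>) \<le> C))) \<and>
    (\<exists>!\<tau>\<^sub>c. \<tau>\<^sub>c > 0 \<and> mu1 \<tau>\<^sub>c = 0 \<and>
       (\<forall>\<tau>. 0 < \<tau> \<and> \<tau> < \<tau>\<^sub>c \<longrightarrow> mu1 \<tau> < 0) \<and> (\<forall>\<tau>. \<tau> > \<tau>\<^sub>c \<longrightarrow> mu1 \<tau> > 0))"
  by (rule conjI[OF _ critical_tau], intro allI impI, elim conjE, rule approximate_waves, assumption+)

end
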